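(* Let $n\in\mathbb N\setminus\{1,3\}$ (with $\mathbb N$ the positive integers). The quantum automorphism group $\mathrm{Aut}^+\bigl(\tfrac12 Q_{n+1}\bigr)$ of the halved hypercube graph $\tfrac12Q_{n+1}$ is isomorphic to the anticommutative special orthogonal quantum group $SO_{n+1}^{-1}$. It acts through the fundamental representation $u$ with $\hat u^{(i)}=v^{\breve\wedge i}$ for $i=0,\dots,\lfloor\frac{n+1}{2}\rfloor$, where $v$ is the fundamental representation of $SO_{n+1}^{-1}$ and $\hat u^{(i)}$ is the block of the Fourier transform $\hat u$ of $u$ corresponding to the invariant subspace $\tilde V_i$.
   Context: **Compact matrix quantum groups.** A compact matrix quantum group is a pair $G=(A,u)$ where $A$ is a unital $*$-algebra over $\mathbb C$ and $u=(u^i_j)\in M_N(A)$ is such that the $u^i_j$ generate $A$, the matrices $u$ and $u^t$ are similar to unitary matrices, and $\Delta(u^i_j)=\sum_k u^i_k\otimes u^k_j$ extends to a $*$-homomorphism $\Delta\colon A\to A\otimes A$. We write $\mathcal O(G)=A$; $u$ is the fundamental representation. $G$ and $H$ are isomorphic if there is a $*$-isomorphism $\phi\colon\mathcal O(G)\to\mathcal O(H)$ with $(\phi\otimes\phi)\circ\Delta_G=\Delta_H\circ\phi$. **Quantum automorphism group of a graph.** For a finite graph $X$ on $N$ vertices with adjacency matrix $A_X$, $\mathrm{Aut}^+X$ is the compact matrix quantum group with $\mathcal O(\mathrm{Aut}^+X)$ the universal unital $*$-algebra generated by $u^i_j$ ($i,j$ vertices) with relations $(u^i_j)^2=u^i_j=u^{i*}_j$,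 $\sum_k u^i_k=1$ and $\sum_k u^k_j=1$ (the relations of the free symmetric quantum group $S_N^+$), and $A_Xu=uA_X$. It acts on the algebra of functions on the vertex set by $\delta_j\mapsto\sum_i\delta_i\otimes u^i_j$. **The graph.** $\tfrac12Q_{n+1}$ has as vertices the vertices of the hypercube $Q_{n+1}$ (vertex set $\mathbb Z_2^{n+1}$) with an even number of ones, two being adjacent iff they are at distance two in $Q_{n+1}$. Equivalently (and this is the description used for the Fourier transform), it is the Cayley graph of $\mathbb Z_2^n$ with respect to $\{\epsilon_i\}_{i=1}^n\cup\{\epsilon_i+\epsilon_j\}_{i<j}$, with $\epsilon_i$ the canonical generators. It has $N=2^n$ vertices. **Fourier transform and blocks.** For $\mu\in\mathbb Z_2^n$ let $\tau_\mu(\alpha)=(-1)^{\alpha\cdot\mu}$, $\alpha\in\mathbb Z_2^n$; let $\mathcal F^\alpha_\mu=(-1)^{\alpha\cdot\mu}$ and $\hat u=\mathcal F^{-1}u\mathcal F$, so the action reads $\tau_\nu\mapsto\sum_\mu\tau_\mu\otimes\hat u^\mu_\nu$. Let $\deg\mu$ be the number of nonzero entries of $\mu$, $V_i=\mathrm{span}\{\tau_\mu\mid\deg\mu=i\}$ for $0\le i\le n$, $V_{n+1}=\{0\}$, and $\tilde V_i=V_i+V_{n+1-i}$ for $i=0,\dots,\lfloor\frac{n+1}2\rfloor$. These are the eigenspaces of the adjacency matrix, hence invariant subspaces, and $\hat u^{(i)}$ is the block of $\hat u$ corresponding to $\tilde V_i$. Put $\tau_i=\tau_{\epsilon_i}$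 for $1\le i\le n$ and $\tau_{n+1}=\tau_1\cdots\tau_n$, and for $\alpha\in\mathbb Z_2^{n+1}$ put $\tau_\alpha=\tau_1^{\alpha_1}\cdots\tau_{n+1}^{\alpha_{n+1}}$. The space $\tilde V_i$ is described by the elements $\tau_\alpha$ with $\alpha\in\mathbb Z_2^{n+1}$, $\deg\alpha=i$; in particular $\tau_1,\dots,\tau_{n+1}$ are the elements used for $\tilde V_1$, on which the action reads $\tau_j\mapsto\sum_{i=1}^{n+1}\tau_i\otimes v^i_j$. **$SO_M^{-1}$.** A matrix $v$ has anticommutative entries if for $i\ne j$, $k\neq l$: $v^i_kv^j_k=-v^j_kv^i_k$, $v^k_iv^k_j=-v^k_jv^k_i$, $v^i_kv^j_l=v^j_lv^i_k$. $\mathcal O(SO_M^{-1})$ is the universal $*$-algebra generated by $v^i_j$, $1\le i,j\le M$, such that $v^i_j=v^{i*}_j$, $v$ is orthogonal ($vv^t=v^tv=1$), $v$ has anticommutative entries, and $\sum_{\sigma\in S_M}v^1_{\sigma(1)}\cdots v^M_{\sigma(M)}=1$. **Anticommutative exterior powers.** $(\mathbb C^M)^{\breve\wedge k}\subseteq(\mathbb C^M)^{\otimes k}$ is the subspace with basis $e_I=\frac1{k!}\sum_{\sigma\in S_k}e_{i_{\sigma(1)}}\otimes\cdots\otimes e_{i_{\sigma(k)}}$ for $I=\{i_1<\dots<i_k\}\subseteq\{1,\dots,M\}$. It is invariant under $v^{\otimes k}$, and $v^{\breve\wedge k}$ denotes the corresponding subrepresentation, i.e. the matrix with entries $(v^{\breve\wedge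 k})^I_J=\sum_{\sigma\in S_k}v^{i_{\sigma(1)}}_{j_1}\cdots v^{i_{\sigma(k)}}_{j_k}$, $I=\{i_1<\dots<i_k\}$, $J=\{j_1<\dots<j_k\}$ (with $v^{\breve\wedge0}=1$). The index $I$ corresponds to the element $\tau_\alpha$ whose $\alpha\in\mathbb Z_2^{n+1}$ has its nonzero entries exactly at the positions in $I$ (here $M=n+1$).
   Formalization: The relations u^i_j u^i_k = 0 = u^j_i u^k_i (j≠k) are added to O(Aut^+X): in a plain *-algebra they do not follow, and n=2 fails without them. For i=(n+1)/2, û^(i)=v^{∧i} is read as τ_J ↦ Σ_I τ_I⊗(v^{∧i})^I_J, since τ_I equals τ of the complement. *)

theory Defs
  imports Complex_Main "HOL-Combinatorics.Permutations" "HOL-Algebra.QuotRing" "HOL-Algebra.Module"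
begin

section \<open>Unital *-algebras over the complex numbers\<close>

record 'a star_alg = "(complex, 'a) module" +
  adj :: "'a \<Rightarrow> 'a"

locale star_algebra = ring A for A :: "('a, 'x) star_alg_scheme" (structure) +
  assumes smult_closed: "x \<in> carrier A \<Longrightarrow> c \<odot> x \<in> carrier A"
    and smult_l_distr: "x \<in> carrier A \<Longrightarrow> (c + d) \<odot> x = c \<odot> x \<oplus> d \<odot> x"
    and smult_r_distr: "x \<in> carrier A \<Longrightarrow> y \<in> carrier A \<Longrightarrow> c \<odot> (x \<oplus> y) = c \<odot> x \<oplus> c \<odot> y"
    and smult_smult: "x \<in> carrier A \<Longrightarrow> (c * d) \<odot> x = c \<odot> (d \<odot> x)"
    and smult_one: "x \<in> carrier A \<Longrightarrow> 1 \<odot> x = x"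
    and smult_mult_left: "x \<in> carrier A \<Longrightarrow> y \<in> carrier A \<Longrightarrow> (c \<odot> x) \<otimes> y = c \<odot> (x \<otimes> y)"
    and smult_mult_right: "x \<in> carrier A \<Longrightarrow> y \<in> carrier A \<Longrightarrow> x \<otimes> (c \<odot> y) = c \<odot> (x \<otimes> y)"
    and adj_closed: "x \<in> carrier A \<Longrightarrow> adj A x \<in> carrier A"
    and adj_adj: "x \<in> carrier A \<Longrightarrow> adj A (adj A x) = x"
    and adj_add: "x \<in> carrier A \<Longrightarrow> y \<in> carrier A \<Longrightarrow> adj A (x \<oplus> y) = adj A x \<oplus> adj A y"
    and adj_mult: "x \<in> carrier A \<Longrightarrow> y \<in> carrier A \<Longrightarrow> adj A (x \<otimes> y) = adj A y \<otimes> adj A x"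
    and adj_smult: "x \<in> carrier A \<Longrightarrow> adj A (c \<odot> x) = cnj c \<odot> adj A x"

definition star_hom ::
    "('a, 'x) star_alg_scheme \<Rightarrow> ('b, 'y) star_alg_scheme \<Rightarrow> ('a \<Rightarrow> 'b) set" where
  "star_hom A B = {\<phi> \<in> ring_hom A B. \<forall>x\<in>carrier A.
     (\<forall>c. \<phi> (c \<odot>\<^bsub>A\<^esub> x) = c \<odot>\<^bsub>B\<^esub> \<phi> x) \<and> \<phi> (adj A x) = adj B (\<phi> x)}"

definition star_iso ::
    "('a, 'x) star_alg_scheme \<Rightarrow> ('b, 'y) star_alg_scheme \<Rightarrow> ('a \<Rightarrow> 'b) set" where
  "star_iso A B = {\<phi> \<in> star_hom A B. bij_betw \<phi> (carrier A) (carrier B)}"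

inductive_set star_generated :: "('a, 'x) star_alg_scheme \<Rightarrow> 'a set \<Rightarrow> 'a set"
  for A (structure) and S where
  base: "x \<in> S \<Longrightarrow> x \<in> star_generated A S"
| one: "\<one> \<in> star_generated A S"
| add: "x \<in> star_generated A S \<Longrightarrow> y \<in> star_generated A S \<Longrightarrow> x \<oplus> y \<in> star_generated A S"
| mult: "x \<in> star_generated A S \<Longrightarrow> y \<in> star_generated A S \<Longrightarrow> x \<otimes> y \<in> star_generated A S"
| smult: "x \<in> star_generated A S \<Longrightarrow> c \<odot> x \<in> star_generated A S"
| adj: "x \<in> star_generated A S \<Longrightarrow> adj A x \<in> star_generated A S"

definition ordered_prod :: "('a, 'x) monoid_scheme \<Rightarrow> 'a list \<Rightarrow> 'a" where
  "ordered_prod A xs = foldr (\<otimes>\<^bsub>A\<^esub>) xs \<one>\<^bsub>A\<^esub>"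

text \<open>To be used for a two-sided ideal \<open>I\<close> that is closed under the involution.\<close>

definition quot_star_alg :: "('a, 'x) star_alg_scheme \<Rightarrow> 'a set \<Rightarrow> 'a set star_alg" where
  "quot_star_alg A I =
     \<lparr>carrier = carrier (A Quot I), mult = (\<otimes>\<^bsub>A Quot I\<^esub>), one = \<one>\<^bsub>A Quot I\<^esub>,
      zero = \<zero>\<^bsub>A Quot I\<^esub>, add = (\<oplus>\<^bsub>A Quot I\<^esub>),
      smult = (\<lambda>c X. I <+>\<^bsub>A\<^esub> ((\<odot>\<^bsub>A\<^esub>) c ` X)),
      adj = (\<lambda>X. adj A ` X)\<rparr>"


section \<open>Monoid algebras, universal *-algebras, tensor products\<close>

text \<open>Finitely supported functions \<open>f\<close> stand for formal linear combinations
  \<open>\<Sum>x. f x \<cdot> x\<close>; \<open>lin_ext h\<close> is the linear extension of \<open>h\<close> on basis elements.\<close>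

definition delta :: "'m \<Rightarrow> 'm \<Rightarrow> complex" where
  "delta x = (\<lambda>z. if z = x then 1 else 0)"

definition lin_ext :: "('m \<Rightarrow> 'k) \<Rightarrow> ('m \<Rightarrow> complex) \<Rightarrow> 'k \<Rightarrow> complex" where
  "lin_ext h f = (\<lambda>z. \<Sum>x | f x \<noteq> 0 \<and> h x = z. f x)"

text \<open>The complex monoid algebra of \<open>M\<close>, with the antilinear involution extending the
  anti-multiplicative involution \<open>s\<close> of \<open>M\<close>.\<close>

definition monoid_algebra ::
    "('m, 'x) monoid_scheme \<Rightarrow> ('m \<Rightarrow> 'm) \<Rightarrow> ('m \<Rightarrow> complex) star_alg" where
  "monoid_algebra M s =
     \<lparr>carrier = {f. finite {x. f x \<noteq> 0} \<and> {x. f x \<noteq> 0} \<subseteq> carrier M},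
      mult = (\<lambda>f g z. \<Sum>(x, y) | f x \<noteq> 0 \<and> g y \<noteq> 0 \<and> x \<otimes>\<^bsub>M\<^esub> y = z. f x * g y),
      one = delta \<one>\<^bsub>M\<^esub>,
      zero = (\<lambda>z. 0),
      add = (\<lambda>f g z. f z + g z),
      smult = (\<lambda>c f z. c * f z),
      adj = (\<lambda>f. lin_ext s (\<lambda>x. cnj (f x)))\<rparr>"

text \<open>The free *-algebra on \<open>X\<close> is the algebra of words in the letters \<open>(x, False)\<close>,
  standing for \<open>x\<close>, and \<open>(x, True)\<close>, standing for \<open>x*\<close>.\<close>

definition free_star_alg :: "'g set \<Rightarrow> (('g \<times> bool) list \<Rightarrow> complex) star_alg" where
  "free_star_alg X = monoid_algebra
     \<lparr>carrier = lists (X \<times> UNIV), mult = (@), one = []\<rparr> (\<lambda>w. rev (map (apsnd Not) w))"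

definition free_gen :: "'g \<Rightarrow> ('g \<times> bool) list \<Rightarrow> complex" where
  "free_gen x = delta [(x, False)]"

text \<open>The universal *-algebra on generators \<open>X\<close> subject to the equations \<open>p = q\<close>
  for \<open>(p, q) \<in> E\<close>.\<close>

definition relation_ideal ::
    "'g set \<Rightarrow> ((('g \<times> bool) list \<Rightarrow> complex) \<times> (('g \<times> bool) list \<Rightarrow> complex)) set
      \<Rightarrow> (('g \<times> bool) list \<Rightarrow> complex) set" where
  "relation_ideal X E =
     (let F = free_star_alg X; R = {p \<ominus>\<^bsub>F\<^esub> q | p q. (p, q) \<in> E}
      in Idl\<^bsub>F\<^esub> (R \<union> adj F ` R))"

definition universal_star_alg ::
    "'g set \<Rightarrow> ((('g \<times> bool) list \<Rightarrow> complex) \<times> (('g \<times> bool) list \<Rightarrow> complex)) set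
      \<Rightarrow> (('g \<times> bool) list \<Rightarrow> complex) set star_alg" where
  "universal_star_alg X E = quot_star_alg (free_star_alg X) (relation_ideal X E)"

definition universal_gen ::
    "'g set \<Rightarrow> ((('g \<times> bool) list \<Rightarrow> complex) \<times> (('g \<times> bool) list \<Rightarrow> complex)) set
      \<Rightarrow> 'g \<Rightarrow> (('g \<times> bool) list \<Rightarrow> complex) set" where
  "universal_gen X E x = relation_ideal X E +>\<^bsub>free_star_alg X\<^esub> free_gen x"

text \<open>The algebraic tensor product is the free vector space on \<open>carrier A \<times> carrier B\<close>
  modulo the bilinearity relators.  The free vector space carries the product
  \<open>(a, b)(c, d) = (ac, bd)\<close>; multiplying a relator by a basis element gives a relator, so
  the linear span of the relators coincides with the ideal they generate.\<close>

definition tensor_pre ::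
    "('a, 'x) star_alg_scheme \<Rightarrow> ('b, 'y) star_alg_scheme \<Rightarrow> ('a \<times> 'b \<Rightarrow> complex) star_alg" where
  "tensor_pre A B = monoid_algebra (A \<times>\<times> B) (map_prod (adj A) (adj B))"

definition tensor_ideal ::
    "('a, 'x) star_alg_scheme \<Rightarrow> ('b, 'y) star_alg_scheme \<Rightarrow> ('a \<times> 'b \<Rightarrow> complex) set" where
  "tensor_ideal A B = (let T = tensor_pre A B in Idl\<^bsub>T\<^esub>
     ({delta (a \<oplus>\<^bsub>A\<^esub> a', b) \<ominus>\<^bsub>T\<^esub> (delta (a, b) \<oplus>\<^bsub>T\<^esub> delta (a', b)) | a a' b.
         a \<in> carrier A \<and> a' \<in> carrier A \<and> b \<in> carrier B}
    \<union> {delta (a, b \<oplus>\<^bsub>B\<^esub> b') \<ominus>\<^bsub>T\<^esub> (delta (a, b) \<oplus>\<^bsub>T\<^esub> delta (a, b')) | a b b'.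
         a \<in> carrier A \<and> b \<in> carrier B \<and> b' \<in> carrier B}
    \<union> {delta (c \<odot>\<^bsub>A\<^esub> a, b) \<ominus>\<^bsub>T\<^esub> c \<odot>\<^bsub>T\<^esub> delta (a, b) | c a b.
         a \<in> carrier A \<and> b \<in> carrier B}
    \<union> {delta (a, c \<odot>\<^bsub>B\<^esub> b) \<ominus>\<^bsub>T\<^esub> c \<odot>\<^bsub>T\<^esub> delta (a, b) | c a b.
         a \<in> carrier A \<and> b \<in> carrier B}))"

definition tensor_alg ::
    "('a, 'x) star_alg_scheme \<Rightarrow> ('b, 'y) star_alg_scheme \<Rightarrow> ('a \<times> 'b \<Rightarrow> complex) set star_alg" where
  "tensor_alg A B = quot_star_alg (tensor_pre A B) (tensor_ideal A B)"

definition elem_tensor ::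
    "('a, 'x) star_alg_scheme \<Rightarrow> ('b, 'y) star_alg_scheme \<Rightarrow> 'a \<Rightarrow> 'b
      \<Rightarrow> ('a \<times> 'b \<Rightarrow> complex) set" where
  "elem_tensor A B a b = tensor_ideal A B +>\<^bsub>tensor_pre A B\<^esub> delta (a, b)"

text \<open>\<open>tensor_map A B \<phi> \<psi>\<close> is \<open>\<phi> \<otimes> \<psi>\<close> with values in \<open>A \<otimes> B\<close>, computed on any representative
  of a class.\<close>

definition tensor_map ::
    "('a, 'x) star_alg_scheme \<Rightarrow> ('b, 'y) star_alg_scheme \<Rightarrow> ('c \<Rightarrow> 'a) \<Rightarrow> ('d \<Rightarrow> 'b)
      \<Rightarrow> ('c \<times> 'd \<Rightarrow> complex) set \<Rightarrow> ('a \<times> 'b \<Rightarrow> complex) set" where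
  "tensor_map A B \<phi> \<psi> T =
     the_elem ((\<lambda>f. tensor_ideal A B +>\<^bsub>tensor_pre A B\<^esub> lin_ext (map_prod \<phi> \<psi>) f) ` T)"


section \<open>Compact matrix quantum groups\<close>

text \<open>The rows and columns of the fundamental representation are indexed by an arbitrary finite
  set \<open>index G\<close> instead of \<open>{1..N}\<close>, so that a vertex set can be used directly;
  \<open>fund G i j\<close> is the entry in row \<open>i\<close> (upper index) and column \<open>j\<close> (lower index).\<close>

record ('i, 'a) quantum_group =
  func_alg :: "'a star_alg"
  index :: "'i set"
  fund :: "'i \<Rightarrow> 'i \<Rightarrow> 'a"

definition unitary_matrix ::
    "('a, 'x) star_alg_scheme \<Rightarrow> 'i set \<Rightarrow> ('i \<Rightarrow> 'i \<Rightarrow> 'a) \<Rightarrow> bool" where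
  "unitary_matrix A N w \<longleftrightarrow> (\<forall>i\<in>N. \<forall>j\<in>N.
     (\<Oplus>\<^bsub>A\<^esub>k\<in>N. w i k \<otimes>\<^bsub>A\<^esub> adj A (w j k)) = (if i = j then \<one>\<^bsub>A\<^esub> else \<zero>\<^bsub>A\<^esub>) \<and>
     (\<Oplus>\<^bsub>A\<^esub>k\<in>N. adj A (w k i) \<otimes>\<^bsub>A\<^esub> w k j) = (if i = j then \<one>\<^bsub>A\<^esub> else \<zero>\<^bsub>A\<^esub>))"

definition similar_to_unitary ::
    "('a, 'x) star_alg_scheme \<Rightarrow> 'i set \<Rightarrow> ('i \<Rightarrow> 'i \<Rightarrow> 'a) \<Rightarrow> bool" where
  "similar_to_unitary A N w \<longleftrightarrow> (\<exists>(T :: 'i \<Rightarrow> 'i \<Rightarrow> complex) T'.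
     (\<forall>i\<in>N. \<forall>j\<in>N. (\<Sum>k\<in>N. T i k * T' k j) = (if i = j then 1 else 0)) \<and>
     (\<forall>i\<in>N. \<forall>j\<in>N. (\<Sum>k\<in>N. T' i k * T k j) = (if i = j then 1 else 0)) \<and>
     unitary_matrix A N (\<lambda>i j. \<Oplus>\<^bsub>A\<^esub>k\<in>N. \<Oplus>\<^bsub>A\<^esub>l\<in>N. (T i k * T' l j) \<odot>\<^bsub>A\<^esub> w k l))"

definition is_comult ::
    "('i, 'a) quantum_group \<Rightarrow> ('a \<Rightarrow> ('a \<times> 'a \<Rightarrow> complex) set) \<Rightarrow> bool" where
  "is_comult G \<Delta> \<longleftrightarrow>
     (let A = func_alg G; u = fund G in
      \<Delta> \<in> star_hom A (tensor_alg A A) \<and>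
      (\<forall>i\<in>index G. \<forall>j\<in>index G.
         \<Delta> (u i j) = (\<Oplus>\<^bsub>tensor_alg A A\<^esub>k\<in>index G. elem_tensor A A (u i k) (u k j))))"

locale compact_matrix_quantum_group =
  fixes G :: "('i, 'a) quantum_group"
  assumes star_algebra: "star_algebra (func_alg G)"
    and finite_index: "finite (index G)"
    and fund_closed: "i \<in> index G \<Longrightarrow> j \<in> index G \<Longrightarrow> fund G i j \<in> carrier (func_alg G)"
    and fund_generates:
      "carrier (func_alg G) = star_generated (func_alg G) {fund G i j | i j. i \<in> index G \<and> j \<in> index G}"
    and similar_unitary: "similar_to_unitary (func_alg G) (index G) (fund G)"
    and similar_unitary_transpose:
      "similar_to_unitary (func_alg G) (index G) (\<lambda>i j. fund G j i)"
    and comult_exists: "\<exists>\<Delta>. is_comult G \<Delta>"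

text \<open>For a compact matrix quantum group, the comultiplication is unique on the carrier since the
  entries of the fundamental representation generate the algebra.\<close>

definition comult :: "('i, 'a) quantum_group \<Rightarrow> 'a \<Rightarrow> ('a \<times> 'a \<Rightarrow> complex) set" where
  "comult G = (SOME \<Delta>. is_comult G \<Delta>)"

definition quantum_group_iso ::
    "('i, 'a) quantum_group \<Rightarrow> ('j, 'b) quantum_group \<Rightarrow> ('a \<Rightarrow> 'b) \<Rightarrow> bool" where
  "quantum_group_iso G H \<phi> \<longleftrightarrow>
     compact_matrix_quantum_group G \<and> compact_matrix_quantum_group H \<and>
     \<phi> \<in> star_iso (func_alg G) (func_alg H) \<and>
     (\<forall>x\<in>carrier (func_alg G).
        tensor_map (func_alg H) (func_alg H) \<phi> \<phi> (comult G x) = comult H (\<phi> x))"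


section \<open>Quantum automorphism groups of graphs\<close>

text \<open>The relations of the free symmetric quantum group (entries are projections, rows and columns
  sum to 1) together with \<open>A u = u A\<close>.  Projections on a Hilbert space that sum to 1 are
  pairwise orthogonal, so C*-algebraic definitions usually leave the orthogonality of the entries
  of each row and column implicit.  In an abstract *-algebra it does not follow (already for four self-adjoint
  idempotents), and without it \<open>u\<close> need not be unitary and
  \<open>\<delta>\<^sub>j \<mapsto> \<Sum>i. \<delta>\<^sub>i \<otimes> u i j\<close> need not be multiplicative; hence it is listed
  explicitly.\<close>

definition qaut_relations :: "'v set \<Rightarrow> ('v \<Rightarrow> 'v \<Rightarrow> bool) \<Rightarrow>
    (((('v \<times> 'v) \<times> bool) list \<Rightarrow> complex) \<times> ((('v \<times> 'v) \<times> bool) list \<Rightarrow> complex)) set" where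
  "qaut_relations V E =
     (let F = free_star_alg (V \<times> V);
          u = (\<lambda>i j. free_gen (i, j));
          A = (\<lambda>i j. if E i j then 1 else 0 :: complex)
      in {(u i j \<otimes>\<^bsub>F\<^esub> u i j, u i j) | i j. i \<in> V \<and> j \<in> V}
       \<union> {(adj F (u i j), u i j) | i j. i \<in> V \<and> j \<in> V}
       \<union> {(u i j \<otimes>\<^bsub>F\<^esub> u i k, \<zero>\<^bsub>F\<^esub>) | i j k. i \<in> V \<and> j \<in> V \<and> k \<in> V \<and> j \<noteq> k}
       \<union> {(u j i \<otimes>\<^bsub>F\<^esub> u k i, \<zero>\<^bsub>F\<^esub>) | i j k. i \<in> V \<and> j \<in> V \<and> k \<in> V \<and> j \<noteq> k}
       \<union> {(\<Oplus>\<^bsub>F\<^esub>k\<in>V. u i k, \<one>\<^bsub>F\<^esub>) | i. i \<in> V}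
       \<union> {(\<Oplus>\<^bsub>F\<^esub>k\<in>V. u k j, \<one>\<^bsub>F\<^esub>) | j. j \<in> V}
       \<union> {(\<Oplus>\<^bsub>F\<^esub>k\<in>V. A i k \<odot>\<^bsub>F\<^esub> u k j, \<Oplus>\<^bsub>F\<^esub>k\<in>V. A k j \<odot>\<^bsub>F\<^esub> u i k) | i j. i \<in> V \<and> j \<in> V})"

definition qaut :: "'v set \<Rightarrow> ('v \<Rightarrow> 'v \<Rightarrow> bool) \<Rightarrow>
    ('v, ((('v \<times> 'v) \<times> bool) list \<Rightarrow> complex) set) quantum_group" where
  "qaut V E =
     \<lparr>func_alg = universal_star_alg (V \<times> V) (qaut_relations V E),
      index = V,
      fund = (\<lambda>i j. universal_gen (V \<times> V) (qaut_relations V E) (i, j))\<rparr>"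


section \<open>The halved hypercube\<close>

text \<open>A vector of \<open>\<int>\<^sub>2\<^sup>n\<close> is represented by its support, a subset of \<open>{1..n}\<close>.
  Addition is then symmetric difference, \<open>deg\<close> is cardinality and
  \<open>\<alpha> \<cdot> \<mu> = card (\<alpha> \<inter> \<mu>)\<close> modulo 2.\<close>

definition Z2_vectors :: "nat \<Rightarrow> nat set set" where
  "Z2_vectors n = Pow {1..n}"

text \<open>Adjacency in the halved \<open>(n+1)\<close>-cube, as Cayley graph of \<open>\<int>\<^sub>2\<^sup>n\<close>.\<close>

definition halved_cube_adj :: "nat \<Rightarrow> nat set \<Rightarrow> nat set \<Rightarrow> bool" where
  "halved_cube_adj n \<alpha> \<beta> \<longleftrightarrow>
     sym_diff \<alpha> \<beta> \<in> {{i} | i. i \<in> {1..n}} \<union> {{i, j} | i j. i \<in> {1..n} \<and> j \<in> {1..n} \<and> i < j}"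

definition qaut_halved_cube ::
    "nat \<Rightarrow> (nat set, (((nat set \<times> nat set) \<times> bool) list \<Rightarrow> complex) set) quantum_group" where
  "qaut_halved_cube n = qaut (Z2_vectors n) (halved_cube_adj n)"

text \<open>The Cayley graph is the distance-two graph on the vectors of \<open>\<int>\<^sub>2\<^sup>n\<^sup>+\<^sup>1\<close> of even degree;
  the isomorphism forgets the last coordinate.\<close>

lemma halved_cube_bij:
  "bij_betw (\<lambda>\<alpha>. \<alpha> - {n+1}) {\<alpha> \<in> Z2_vectors (n+1). even (card \<alpha>)} (Z2_vectors n)"
proof (rule bij_betw_byWitness[where f' = "\<lambda>\<beta>. if even (card \<beta>) then \<beta> else insert (n+1) \<beta>"])
  have fin: "finite \<alpha>" if "\<alpha> \<in> Z2_vectors m" for \<alpha> m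
    using that by (auto simp: Z2_vectors_def intro: finite_subset)
  have notin: "n+1 \<notin> \<beta>" if "\<beta> \<in> Z2_vectors n" for \<beta>
    using that by (auto simp: Z2_vectors_def)
  show "\<forall>\<alpha>\<in>{\<alpha> \<in> Z2_vectors (n+1). even (card \<alpha>)}.
      (if even (card (\<alpha> - {n+1})) then \<alpha> - {n+1} else insert (n+1) (\<alpha> - {n+1})) = \<alpha>"
  proof
    fix \<alpha> assume a: "\<alpha> \<in> {\<alpha> \<in> Z2_vectors (n+1). even (card \<alpha>)}"
    have "Suc (card (\<alpha> - {n+1})) = card \<alpha>" if "n+1 \<in> \<alpha>"
      using a fin[of \<alpha> "n+1"] that by (intro card_Suc_Diff1) auto
    then have "odd (card (\<alpha> - {n+1}))" if "n+1 \<in> \<alpha>"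
      using a that by (metis (mono_tags, lifting) even_Suc mem_Collect_eq)
    then show "(if even (card (\<alpha> - {n+1})) then \<alpha> - {n+1} else insert (n+1) (\<alpha> - {n+1})) = \<alpha>"
      using a by (cases "n+1 \<in> \<alpha>") (simp_all add: insert_absorb)
  qed
  show "\<forall>\<beta>\<in>Z2_vectors n. (if even (card \<beta>) then \<beta> else insert (n+1) \<beta>) - {n+1} = \<beta>"
    using notin by auto
  show "(\<lambda>\<alpha>. \<alpha> - {n+1}) ` {\<alpha> \<in> Z2_vectors (n+1). even (card \<alpha>)} \<subseteq> Z2_vectors n"
    by (force simp: Z2_vectors_def le_Suc_eq)
  show "(\<lambda>\<beta>. if even (card \<beta>) then \<beta> else insert (n+1) \<beta>) ` Z2_vectors n
      \<subseteq> {\<alpha> \<in> Z2_vectors (n+1). even (card \<alpha>)}"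
  proof (intro image_subsetI CollectI conjI)
    fix \<beta> assume b: "\<beta> \<in> Z2_vectors n"
    then show "(if even (card \<beta>) then \<beta> else insert (n+1) \<beta>) \<in> Z2_vectors (n+1)"
      by (auto simp: Z2_vectors_def)
    show "even (card (if even (card \<beta>) then \<beta> else insert (n+1) \<beta>))"
      using notin[OF b] fin[OF b] by simp
  qed
qed

lemma halved_cube_adj_iff:
  assumes "\<alpha> \<in> Z2_vectors (n+1)" "even (card \<alpha>)" "\<beta> \<in> Z2_vectors (n+1)" "even (card \<beta>)"
  shows "halved_cube_adj n (\<alpha> - {n+1}) (\<beta> - {n+1}) \<longleftrightarrow> card (sym_diff \<alpha> \<beta>) = 2"
proof -
  define D where "D = sym_diff \<alpha> \<beta>"
  have fin: "finite \<alpha>" "finite \<beta>" "finite D"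
    using assms by (auto simp: Z2_vectors_def D_def intro: finite_subset)
  have D: "D \<subseteq> {1..n+1}" using assms by (auto simp: Z2_vectors_def D_def)
  have "card \<alpha> = card (\<alpha> \<inter> \<beta>) + card (\<alpha> - \<beta>)" "card \<beta> = card (\<alpha> \<inter> \<beta>) + card (\<beta> - \<alpha>)"
    using fin by (simp_all add: card_Int_Diff) (metis Int_commute card_Int_Diff)
  moreover have "card D = card (\<alpha> - \<beta>) + card (\<beta> - \<alpha>)"
    unfolding D_def using fin by (intro card_Un_disjoint) auto
  ultimately have ev: "even (card D)" using assms(2,4) by presburger
  have sd: "sym_diff (\<alpha> - {n+1}) (\<beta> - {n+1}) = D - {n+1}" by (auto simp: D_def)
  let ?R = "{{i} | i. i \<in> {1..n}} \<union> {{i, j} | i j. i \<in> {1..n} \<and> j \<in> {1..n} \<and> i < j}"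
  have "D - {n+1} \<in> ?R \<longleftrightarrow> card (D - {n+1}) \<in> {1, 2}"
  proof
    assume "D - {n+1} \<in> ?R"
    then obtain i j where "D - {n+1} = {i} \<or> D - {n+1} = {i, j} \<and> i < j" by blast
    then show "card (D - {n+1}) \<in> {1, 2}"
      by (elim disjE conjE) (simp_all del: Diff_insert0 insert_Diff1)
  next
    have sub: "D - {n+1} \<subseteq> {1..n}" using D by fastforce
    assume "card (D - {n+1}) \<in> {1, 2}"
    then consider "card (D - {n+1}) = 1" | "card (D - {n+1}) = 2" by blast
    then show "D - {n+1} \<in> ?R"
    proof cases
      case 1
      then obtain i where i: "D - {n+1} = {i}" by (rule card_1_singletonE)
      then have "i \<in> {1..n}" using sub by blast
      then show ?thesis unfolding i by blast
    next
      case 2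
      then obtain i j where ij: "D - {n+1} = {i, j}" "i \<noteq> j" unfolding card_2_iff by blast
      have "{i, j} = {min i j, max i j}" "min i j < max i j"
        using ij(2) by (auto simp: min_def max_def)
      moreover have "min i j \<in> {1..n}" "max i j \<in> {1..n}"
        using sub unfolding ij(1) by (simp_all add: min_def max_def)
      ultimately show ?thesis unfolding ij(1) by blast
    qed
  qed
  also have "\<dots> \<longleftrightarrow> card D = 2"
  proof (cases "n+1 \<in> D")
    case True
    then have "card D = Suc (card (D - {n+1}))" using fin by (metis card_Suc_Diff1)
    with ev show ?thesis by auto
  next
    case False
    with ev show ?thesis by auto
  qed
  finally show ?thesis unfolding halved_cube_adj_def sd D_def .
qed


section \<open>Fourier transform and its blocks\<close>

definition tau :: "nat set \<Rightarrow> nat set \<Rightarrow> complex" where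
  "tau \<mu> \<alpha> = (-1) ^ card (\<alpha> \<inter> \<mu>)"

definition fourier :: "nat set \<Rightarrow> nat set \<Rightarrow> complex" where
  "fourier \<alpha> \<mu> = tau \<mu> \<alpha>"

definition fourier_inv :: "nat \<Rightarrow> nat set \<Rightarrow> nat set \<Rightarrow> complex" where
  "fourier_inv n \<mu> \<alpha> = tau \<mu> \<alpha> / 2 ^ n"

lemma tau_eq_prod: "finite \<alpha> \<Longrightarrow> tau \<mu> \<alpha> = (\<Prod>i\<in>\<alpha>. if i \<in> \<mu> then -1 else 1)"
  by (simp add: tau_def prod.If_cases)

lemma tau_mult:
  assumes "finite \<alpha>" shows "tau \<mu> \<alpha> * tau \<nu> \<alpha> = tau (sym_diff \<mu> \<nu>) \<alpha>"
  using assms by (simp add: tau_eq_prod flip: prod.distrib) (rule prod.cong, auto)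

lemma tau_commute: "tau \<mu> \<alpha> = tau \<alpha> \<mu>"
  by (simp add: tau_def Int_commute)

lemma sum_tau:
  assumes "\<mu> \<in> Z2_vectors n"
  shows "(\<Sum>\<alpha>\<in>Z2_vectors n. tau \<mu> \<alpha>) = (if \<mu> = {} then 2 ^ n else 0)"
proof (cases "\<mu> = {}")
  case True
  then show ?thesis by (simp add: tau_def Z2_vectors_def card_Pow)
next
  case False
  then obtain m where m: "m \<in> \<mu>" by auto
  let ?s = "\<lambda>\<alpha>. sym_diff \<alpha> {m}"
  have bij: "bij_betw ?s (Z2_vectors n) (Z2_vectors n)"
    by (rule bij_betw_byWitness[where f' = ?s]) (use m assms in \<open>auto simp: Z2_vectors_def\<close>)
  have "(\<Sum>\<alpha>\<in>Z2_vectors n. tau \<mu> \<alpha>) = (\<Sum>\<alpha>\<in>Z2_vectors n. tau \<mu> (?s \<alpha>))"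
    by (rule sum.reindex_bij_betw[OF bij, symmetric])
  also have "\<dots> = (\<Sum>\<alpha>\<in>Z2_vectors n. - tau \<mu> \<alpha>)"
  proof (rule sum.cong[OF refl])
    fix \<alpha> assume "\<alpha> \<in> Z2_vectors n"
    have "finite \<mu>" using assms by (auto simp: Z2_vectors_def intro: finite_subset)
    then have "tau \<mu> (?s \<alpha>) = tau \<alpha> \<mu> * tau {m} \<mu>"
      by (subst tau_mult) (simp_all add: tau_commute)
    then show "tau \<mu> (?s \<alpha>) = - tau \<mu> \<alpha>"
      using m by (simp add: tau_def Int_commute)
  qed
  finally show ?thesis using False by (simp add: sum_negf)
qed

lemma fourier_inv:
  assumes "\<mu> \<in> Z2_vectors n" "\<nu> \<in> Z2_vectors n"
  shows "(\<Sum>\<alpha>\<in>Z2_vectors n. fourier_inv n \<mu> \<alpha> * fourier \<alpha> \<nu>) = (if \<mu> = \<nu> then 1 else 0)"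
proof -
  have "(\<Sum>\<alpha>\<in>Z2_vectors n. fourier_inv n \<mu> \<alpha> * fourier \<alpha> \<nu>)
      = (\<Sum>\<alpha>\<in>Z2_vectors n. tau (sym_diff \<mu> \<nu>) \<alpha>) / 2 ^ n"
    unfolding sum_divide_distrib
  proof (rule sum.cong[OF refl])
    fix \<alpha> assume "\<alpha> \<in> Z2_vectors n"
    then have "finite \<alpha>" by (auto simp: Z2_vectors_def intro: finite_subset)
    then show "fourier_inv n \<mu> \<alpha> * fourier \<alpha> \<nu> = tau (sym_diff \<mu> \<nu>) \<alpha> / 2 ^ n"
      by (simp add: fourier_inv_def fourier_def flip: tau_mult)
  qed
  also have "sym_diff \<mu> \<nu> \<in> Z2_vectors n" using assms by (auto simp: Z2_vectors_def)
  then have "(\<Sum>\<alpha>\<in>Z2_vectors n. tau (sym_diff \<mu> \<nu>) \<alpha>) / 2 ^ n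
      = (if sym_diff \<mu> \<nu> = {} then 1 else 0)"
    by (subst sum_tau) auto
  finally show ?thesis by auto
qed

definition fourier_transform ::
    "nat \<Rightarrow> ('a, 'x) star_alg_scheme \<Rightarrow> (nat set \<Rightarrow> nat set \<Rightarrow> 'a) \<Rightarrow> nat set \<Rightarrow> nat set \<Rightarrow> 'a" where
  "fourier_transform n A u \<mu> \<nu> =
     (\<Oplus>\<^bsub>A\<^esub>\<alpha>\<in>Z2_vectors n. \<Oplus>\<^bsub>A\<^esub>\<beta>\<in>Z2_vectors n.
        (fourier_inv n \<mu> \<alpha> * fourier \<beta> \<nu>) \<odot>\<^bsub>A\<^esub> u \<alpha> \<beta>)"

text \<open>\<open>tau_ext n I\<close> is the product of the \<open>\<tau>\<^sub>i\<close> for \<open>i \<in> I \<subseteq> {1..n+1}\<close>, where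
  \<open>\<tau>\<^sub>n\<^sub>+\<^sub>1 = \<tau>\<^sub>1 \<cdots> \<tau>\<^sub>n\<close>.  It is one of the characters \<open>tau \<mu>\<close>, \<open>\<mu> \<in> \<int>\<^sub>2\<^sup>n\<close>,
  namely that for \<open>\<mu> = tau_exponent n I\<close>.\<close>

definition tau_ext :: "nat \<Rightarrow> nat set \<Rightarrow> nat set \<Rightarrow> complex" where
  "tau_ext n I \<alpha> = (\<Prod>i\<in>I. if i = n+1 then \<Prod>j\<in>{1..n}. tau {j} \<alpha> else tau {i} \<alpha>)"

definition tau_exponent :: "nat \<Rightarrow> nat set \<Rightarrow> nat set" where
  "tau_exponent n I = (if n+1 \<in> I then {1..n} - I else I)"

lemma prod_tau: "finite I \<Longrightarrow> (\<Prod>i\<in>I. tau {i} \<alpha>) = tau I \<alpha>"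
  by (subst tau_commute[of I], simp add: tau_eq_prod) (rule prod.cong, auto simp: tau_def)

lemma tau_ext_eq:
  assumes "I \<subseteq> {1..n+1}" "\<alpha> \<in> Z2_vectors n"
  shows "tau_ext n I \<alpha> = tau (tau_exponent n I) \<alpha>"
proof -
  have fin: "finite I" "finite \<alpha>"
    using assms by (auto simp: Z2_vectors_def intro: finite_subset)
  show ?thesis
  proof (cases "n+1 \<in> I")
    case True
    have "tau_ext n I \<alpha> = (\<Prod>j\<in>{1..n}. tau {j} \<alpha>) * (\<Prod>i\<in>I - {n+1}. tau {i} \<alpha>)"
      unfolding tau_ext_def using True fin by (subst prod.remove[of _ "n+1"]) auto
    also have "\<dots> = tau (sym_diff {1..n} (I - {n+1})) \<alpha>"
      using fin by (simp add: prod_tau tau_mult)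
    also have "sym_diff {1..n} (I - {n+1}) = {1..n} - I"
      using assms(1) by fastforce
    finally show ?thesis using True by (simp add: tau_exponent_def)
  next
    case False
    then have "tau_ext n I \<alpha> = (\<Prod>i\<in>I. tau {i} \<alpha>)"
      unfolding tau_ext_def by (intro prod.cong) auto
    then show ?thesis using False fin by (simp add: tau_exponent_def prod_tau)
  qed
qed

definition k_subsets :: "nat \<Rightarrow> nat \<Rightarrow> nat set set" where
  "k_subsets M k = {I. I \<subseteq> {1..M} \<and> card I = k}"

text \<open>The characters \<open>\<tau>\<^sub>I\<close>, \<open>card I = i\<close>, are the \<open>\<tau>\<^sub>\<mu>\<close> spanning \<open>V\<^sub>i + V\<^sub>n\<^sub>+\<^sub>1\<^sub>-\<^sub>i\<close>.  They
  are pairwise distinct if \<open>2 * i < n + 1\<close>.  If \<open>2 * i = n + 1\<close>, then \<open>\<tau>\<^sub>I = \<tau>\<^sub>J\<close>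
  exactly for \<open>J = I\<close> or \<open>J\<close> the complement of \<open>I\<close>.\<close>

lemma tau_exponent_image:
  assumes "2 * i \<le> n + 1"
  shows "tau_exponent n ` k_subsets (n+1) i = {\<mu> \<in> Z2_vectors n. card \<mu> = i \<or> card \<mu> = n + 1 - i}"
proof (intro equalityI subsetI)
  fix \<mu> assume "\<mu> \<in> tau_exponent n ` k_subsets (n+1) i"
  then obtain I where I: "I \<subseteq> {1..n+1}" "card I = i" "\<mu> = tau_exponent n I"
    by (auto simp: k_subsets_def)
  show "\<mu> \<in> {\<mu> \<in> Z2_vectors n. card \<mu> = i \<or> card \<mu> = n + 1 - i}"
  proof (cases "n+1 \<in> I")
    case True
    then have "\<mu> = {1..n+1} - I" using I by (auto simp: tau_exponent_def le_Suc_eq)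
    moreover have "card ({1..n+1} - I) = n + 1 - i"
      using I by (subst card_Diff_subset) (auto intro: finite_subset)
    moreover have "\<mu> \<subseteq> {1..n}" using True I by (auto simp: tau_exponent_def)
    ultimately show ?thesis by (simp add: Z2_vectors_def)
  next
    case False
    then have "I \<subseteq> {1..n}" using I(1) by (auto simp: subset_iff le_Suc_eq)
    then show ?thesis using False I by (auto simp: Z2_vectors_def tau_exponent_def)
  qed
next
  fix \<mu> assume m: "\<mu> \<in> {\<mu> \<in> Z2_vectors n. card \<mu> = i \<or> card \<mu> = n + 1 - i}"
  then have sub: "\<mu> \<subseteq> {1..n}" by (auto simp: Z2_vectors_def)
  then have notin: "n+1 \<notin> \<mu>" by auto
  consider "card \<mu> = i" | "card \<mu> = n + 1 - i" using m by auto
  then show "\<mu> \<in> tau_exponent n ` k_subsets (n+1) i"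
  proof cases
    case 1
    then show ?thesis using sub notin
      by (intro image_eqI[of _ _ \<mu>]) (auto simp: tau_exponent_def k_subsets_def)
  next
    case 2
    have "card ({1..n+1} - \<mu>) = n + 1 - card \<mu>"
      using sub by (subst card_Diff_subset) (auto intro: finite_subset)
    then have "card ({1..n+1} - \<mu>) = i" using 2 assms by simp
    moreover have "\<mu> = tau_exponent n ({1..n+1} - \<mu>)"
      using sub notin by (auto simp: tau_exponent_def)
    ultimately show ?thesis
      by (intro image_eqI[of _ _ "{1..n+1} - \<mu>"]) (auto simp: k_subsets_def)
  qed
qed

lemma tau_exponent_eq_iff:
  assumes "I \<subseteq> {1..n+1}" "J \<subseteq> {1..n+1}"
  shows "tau_exponent n I = tau_exponent n J \<longleftrightarrow> J = I \<or> J = {1..n+1} - I"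
proof -
  have *: "{1..n+1} = insert (n+1) {1..n}" by auto
  have "n+1 \<notin> {1..n}" by auto
  with assms show ?thesis
    unfolding tau_exponent_def * by (cases "n+1 \<in> I"; cases "n+1 \<in> J") (simp_all only: if_True if_False, blast+)
qed

text \<open>\<open>block_eq n A i U w\<close>: the block of \<open>U\<close> on \<open>V\<^sub>i + V\<^sub>n\<^sub>+\<^sub>1\<^sub>-\<^sub>i\<close>, described by means of
  the elements \<open>\<tau>\<^sub>I\<close> with \<open>card I = i\<close>, is \<open>w\<close>.  That is, the action
  \<open>\<tau>\<^sub>\<nu> \<mapsto> \<Sum>\<mu>. \<tau>\<^sub>\<mu> \<otimes> U \<mu> \<nu>\<close> reads \<open>\<tau>\<^sub>J \<mapsto> \<Sum>I. \<tau>\<^sub>I \<otimes> w I J\<close>; below, the coefficients of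
  each \<open>\<tau>\<^sub>\<mu>\<close> in the two expressions are compared.  The condition for \<open>\<mu>\<close> not of the form
  \<open>tau_exponent n I\<close> says that the span of the \<open>\<tau>\<^sub>I\<close> is invariant.  For \<open>2 * i < n + 1\<close> the
  sum has at most one term and this is an equality of matrices (see \<open>block_eqD\<close>), while for
  \<open>2 * i = n + 1\<close> the \<open>\<tau>\<^sub>I\<close> span without being independent, and the terms for \<open>I\<close> and its
  complement are added.\<close>

definition block_eq ::
    "nat \<Rightarrow> ('a, 'x) star_alg_scheme \<Rightarrow> nat \<Rightarrow> (nat set \<Rightarrow> nat set \<Rightarrow> 'a)
      \<Rightarrow> (nat set \<Rightarrow> nat set \<Rightarrow> 'a) \<Rightarrow> bool" where
  "block_eq n A i U w \<longleftrightarrow>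
     (\<forall>J\<in>k_subsets (n+1) i. \<forall>\<mu>\<in>Z2_vectors n.
        U \<mu> (tau_exponent n J) =
          (\<Oplus>\<^bsub>A\<^esub>I\<in>{I \<in> k_subsets (n+1) i. tau_exponent n I = \<mu>}. w I J))"

lemma block_eqD:
  assumes "block_eq n A i U w" "2 * i < n + 1" "I \<in> k_subsets (n+1) i" "J \<in> k_subsets (n+1) i"
    and "abelian_monoid A" "w I J \<in> carrier A"
  shows "U (tau_exponent n I) (tau_exponent n J) = w I J"
proof -
  interpret abelian_monoid A by fact
  have "K = I" if "K \<in> k_subsets (n+1) i" "tau_exponent n K = tau_exponent n I" for K
  proof (rule ccontr)
    assume "K \<noteq> I"
    then have "I = {1..n+1} - K"
      using that assms(3) tau_exponent_eq_iff[of K n I] by (auto simp: k_subsets_def)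
    moreover have "card ({1..n+1} - K) = n + 1 - card K"
      using that by (subst card_Diff_subset) (auto simp: k_subsets_def intro: finite_subset)
    ultimately show False using that assms(2,3) by (auto simp: k_subsets_def)
  qed
  then have "{K \<in> k_subsets (n+1) i. tau_exponent n K = tau_exponent n I} = {I}"
    using assms(3) by auto
  moreover have "tau_exponent n I \<in> Z2_vectors n"
    using tau_exponent_image[of i n] assms(2,3) by auto
  ultimately have "U (tau_exponent n I) (tau_exponent n J) = (\<Oplus>\<^bsub>A\<^esub>K\<in>{I}. w K J)"
    using assms(1,4) by (simp add: block_eq_def)
  then show ?thesis using assms(6) by simp
qed


section \<open>Anticommutative special orthogonal quantum groups\<close>

definition so_minus_relations :: "nat \<Rightarrow>
    ((((nat \<times> nat) \<times> bool) list \<Rightarrow> complex) \<times> (((nat \<times> nat) \<times> bool) list \<Rightarrow> complex)) set" where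
  "so_minus_relations M =
     (let N = {1..M};
          F = free_star_alg (N \<times> N);
          v = (\<lambda>i j. free_gen (i, j))
      in {(v i j, adj F (v i j)) | i j. i \<in> N \<and> j \<in> N}
       \<union> {(\<Oplus>\<^bsub>F\<^esub>k\<in>N. v i k \<otimes>\<^bsub>F\<^esub> v j k, if i = j then \<one>\<^bsub>F\<^esub> else \<zero>\<^bsub>F\<^esub>) | i j. i \<in> N \<and> j \<in> N}
       \<union> {(\<Oplus>\<^bsub>F\<^esub>k\<in>N. v k i \<otimes>\<^bsub>F\<^esub> v k j, if i = j then \<one>\<^bsub>F\<^esub> else \<zero>\<^bsub>F\<^esub>) | i j. i \<in> N \<and> j \<in> N}
       \<union> {(v i k \<otimes>\<^bsub>F\<^esub> v j k, \<ominus>\<^bsub>F\<^esub> (v j k \<otimes>\<^bsub>F\<^esub> v i k)) | i j k.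
            i \<in> N \<and> j \<in> N \<and> k \<in> N \<and> i \<noteq> j}
       \<union> {(v k i \<otimes>\<^bsub>F\<^esub> v k j, \<ominus>\<^bsub>F\<^esub> (v k j \<otimes>\<^bsub>F\<^esub> v k i)) | i j k.
            i \<in> N \<and> j \<in> N \<and> k \<in> N \<and> i \<noteq> j}
       \<union> {(v i k \<otimes>\<^bsub>F\<^esub> v j l, v j l \<otimes>\<^bsub>F\<^esub> v i k) | i j k l.
            i \<in> N \<and> j \<in> N \<and> k \<in> N \<and> l \<in> N \<and> i \<noteq> j \<and> k \<noteq> l}
       \<union> {(\<Oplus>\<^bsub>F\<^esub>\<sigma>\<in>{\<sigma>. \<sigma> permutes N}. ordered_prod F (map (\<lambda>i. v i (\<sigma> i)) [1..<M+1]), \<one>\<^bsub>F\<^esub>)})"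

definition so_minus ::
    "nat \<Rightarrow> (nat, (((nat \<times> nat) \<times> bool) list \<Rightarrow> complex) set) quantum_group" where
  "so_minus M =
     \<lparr>func_alg = universal_star_alg ({1..M} \<times> {1..M}) (so_minus_relations M),
      index = {1..M},
      fund = (\<lambda>i j. universal_gen ({1..M} \<times> {1..M}) (so_minus_relations M) (i, j))\<rparr>"

text \<open>The \<open>k\<close>-th anticommutative exterior power of \<open>v\<close>, with rows and columns indexed by
  \<open>k\<close>-element sets; list positions, and hence the permuted set, start at 0.\<close>

definition anticomm_ext_power ::
    "('a, 'x) star_alg_scheme \<Rightarrow> (nat \<Rightarrow> nat \<Rightarrow> 'a) \<Rightarrow> nat \<Rightarrow> nat set \<Rightarrow> nat set \<Rightarrow> 'a" where
  "anticomm_ext_power A v k I J =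
     (\<Oplus>\<^bsub>A\<^esub>\<sigma>\<in>{\<sigma>. \<sigma> permutes {..<k}}.
        ordered_prod A
          (map (\<lambda>a. v (sorted_list_of_set I ! \<sigma> a) (sorted_list_of_set J ! a)) [0..<k]))"

end

theory Submission
  imports Defs "HOL-Combinatorics.Multiset_Permutations"
begin

text \<open>Write \<open>M = n + 1\<close>.  The functions on the vertices are generated by the commuting involutions
\<open>\<tau>\<^sub>1, \<dots>, \<tau>\<^sub>M\<close> with \<open>\<tau>\<^sub>1 \<cdots> \<tau>\<^sub>M = 1\<close>, and \<open>\<tau>\<^sub>1, \<dots>, \<tau>\<^sub>M\<close> span an eigenspace of the adjacency
matrix.  A quantum automorphism therefore acts by \<open>\<tau>\<^sub>j \<mapsto> \<Sum>i. \<tau>\<^sub>i \<otimes> v i j\<close>, and the theorem says that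
the relations between the \<open>\<tau>\<^sub>j\<close> amount exactly to the relations of \<open>SO\<^sub>M\<^sup>-\<^sup>1\<close> for \<open>v\<close>.
The value \<open>x\<^sub>j(\<alpha>) = \<Sum>i. \<tau>\<^sub>i(\<alpha>) v i j\<close> of the image of \<open>\<tau>\<^sub>j\<close> at a vertex \<open>\<alpha>\<close> is called \<open>tau_image\<close> below.

\<^item> From \<open>u\<close> to \<open>v\<close>.  The action is multiplicative, so \<open>x\<^sub>j(\<alpha>)\<^sup>2 = 1\<close> and \<open>x\<^sub>j(\<alpha>) x\<^sub>l(\<alpha>) = x\<^sub>l(\<alpha>) x\<^sub>j(\<alpha>)\<close>
  for all \<open>\<alpha>\<close>.  Comparing the coefficients of the functions \<open>\<tau>\<^sub>p \<tau>\<^sub>q\<close>, which together with 1 are linearly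
  independent unless \<open>M\<close> is 2 or 4, gives the anticommutation in a column and half of the commutation
  relations; the transpose of \<open>u\<close> satisfies the same hypotheses and gives the rest
  (\<open>block_col_relations\<close>, \<open>block_anticommutative\<close>).

\<^item> From \<open>v\<close> to \<open>u\<close>.  For anticommutative \<open>v\<close> with orthonormal columns the \<open>x\<^sub>j(\<alpha>)\<close> are commuting involutions,
  and \<open>u \<alpha> \<beta>\<close> is defined as the projection onto the joint eigenspace with eigenvalues \<open>\<tau>\<^sub>j(\<beta>)\<close>
  (\<open>cube_matrix\<close>).  The relations in a row of \<open>u\<close> are then clear.  Since the rows of \<open>v\<close> are orthonormal
  too, \<open>u \<alpha> \<beta>\<close> is also the joint eigenprojection built from the transpose of \<open>v\<close>
  (\<open>cube_matrix_transpose\<close>), which gives the relations in a column.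

\<^item> The expansion into minors (\<open>prod_column_comb_minor\<close>): the product of the \<open>x\<^sub>j\<close>, \<open>j \<in> J\<close>, is the sum of
  \<open>\<tau>\<^sub>I\<close> times the entry with index \<open>(I, J)\<close> of the anticommutative exterior power of \<open>v\<close>, over all \<open>I\<close> with
  as many elements as \<open>J\<close>.  It turns \<open>\<tau>\<^sub>1 \<cdots> \<tau>\<^sub>M = 1\<close> into the determinant condition, shows that the action
  respects the eigenspaces, so that \<open>u\<close> commutes with the adjacency matrix, and describes
  the blocks of the Fourier transform of \<open>u\<close>.

The two constructions are inverse to each other (\<open>cube_matrix_block\<close>, \<open>block_cube_matrix\<close>), and the passage
from \<open>u\<close> to \<open>v\<close> turns matrix products into matrix products (\<open>block_mult\<close>), so it respects the
comultiplications.  The universal properties of the two algebras turn these facts about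
matrices into the isomorphism of quantum groups.\<close>

section \<open>A type class of *-algebras\<close>

text \<open>All computations with matrices take place in this class, in which finite sums and products need no
membership conditions.  The type \<open>star_prod\<close> below transfers the results to algebras with a
carrier set.\<close>

class complex_star_algebra = ring + monoid_mult +
  fixes scaleC :: "complex \<Rightarrow> 'a \<Rightarrow> 'a"  (infixr "*\<^sub>C" 75)
    and star :: "'a \<Rightarrow> 'a"
  assumes scaleC_add_right: "c *\<^sub>C (x + y) = c *\<^sub>C x + c *\<^sub>C y"
    and scaleC_add_left: "(c + d) *\<^sub>C x = c *\<^sub>C x + d *\<^sub>C x"
    and scaleC_scaleC [simp]: "c *\<^sub>C d *\<^sub>C x = (c * d) *\<^sub>C x"
    and scaleC_one [simp]: "1 *\<^sub>C x = x"
    and mult_scaleC_left [simp]: "(c *\<^sub>C x) * y = c *\<^sub>C (x * y)"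
    and mult_scaleC_right [simp]: "x * (c *\<^sub>C y) = c *\<^sub>C (x * y)"
    and star_add: "star (x + y) = star x + star y"
    and star_mult: "star (x * y) = star y * star x"
    and star_star [simp]: "star (star x) = x"
    and star_scaleC: "star (c *\<^sub>C x) = cnj c *\<^sub>C star x"

interpretation complex_vec: vector_space "scaleC :: complex \<Rightarrow> 'a \<Rightarrow> 'a::complex_star_algebra"
  by unfold_locales (simp_all add: scaleC_add_right scaleC_add_left)

lemmas scaleC_simps [simp] = complex_vec.scale_zero_left complex_vec.scale_zero_right
  complex_vec.scale_minus_left complex_vec.scale_minus_right
lemmas scaleC_sum_right = complex_vec.scale_sum_right
lemmas scaleC_sum_left = complex_vec.scale_sum_left

lemma star_one [simp]: "star (1::'a::complex_star_algebra) = 1"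
  by (metis mult_1_left mult_1_right star_mult star_star)

lemma star_zero [simp]: "star (0::'a::complex_star_algebra) = 0"
  by (metis add_cancel_right_right star_add)

lemma star_sum: "star (sum f S) = (\<Sum>i\<in>S. star (f i :: 'a::complex_star_algebra))"
  by (induct S rule: infinite_finite_induct) (simp_all add: star_add)

lemma star_prod_list: "star (prod_list xs) = prod_list (rev (map star (xs::'a::complex_star_algebra list)))"
  by (induct xs) (simp_all add: star_mult)

lemma antisymmetric_eq_zero:
  assumes "x = - (x::'a::complex_star_algebra)" shows "x = 0"
proof -
  have "x + x = 0" using assms by (simp add: eq_neg_iff_add_eq_0)
  then have "(1 + 1) *\<^sub>C x = 0" by (simp only: scaleC_add_left scaleC_one)
  then show ?thesis by simp
qed

lemma prod_list_commute_one:
  fixes x :: "'a::monoid_mult"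
  assumes "\<And>y. y \<in> set xs \<Longrightarrow> x * y = y * x"
  shows "x * prod_list xs = prod_list xs * x"
  using assms
proof (induct xs)
  case (Cons a xs)
  have "x * (a * prod_list xs) = a * (x * prod_list xs)"
    using Cons.prems[of a] by (simp add: mult.assoc flip: mult.assoc[of x a])
  also have "\<dots> = a * prod_list xs * x" using Cons by (simp add: mult.assoc)
  finally show ?case by simp
qed simp

lemma prod_list_mset_cong:
  fixes xs :: "'a::monoid_mult list"
  assumes "mset xs = mset ys" "\<And>x y. x \<in> set xs \<Longrightarrow> y \<in> set xs \<Longrightarrow> x * y = y * x"
  shows "prod_list xs = prod_list ys"
  using assms
proof (induct xs arbitrary: ys)
  case (Cons a xs)
  then have "a \<in> set ys" by (metis list.set_intros(1) mset_eq_setD)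
  then obtain ys1 ys2 where ys: "ys = ys1 @ a # ys2" by (metis split_list)
  have m: "mset xs = mset (ys1 @ ys2)" using Cons.prems(1) ys by simp
  have "prod_list ys = (prod_list ys1 * a) * prod_list ys2" by (simp add: ys mult.assoc)
  also have "prod_list ys1 * a = a * prod_list ys1"
  proof (rule prod_list_commute_one[symmetric])
    fix y assume "y \<in> set ys1"
    then have "y \<in> set (a # xs)" using mset_eq_setD[OF m] by simp
    then show "a * y = y * a" by (intro Cons.prems(2)) simp_all
  qed
  also have "a * prod_list ys1 * prod_list ys2 = a * prod_list (ys1 @ ys2)" by (simp add: mult.assoc)
  also have "prod_list (ys1 @ ys2) = prod_list xs"
    using Cons.hyps[OF m] Cons.prems(2) by simp
  finally show ?case by simp
qed simp

section \<open>Anticommutative matrices\<close>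

text \<open>Orthonormality is imposed on the columns only: this is what the multiplicativity of an action
yields, and the transpose is treated separately.\<close>

locale anticommutative_matrix =
  fixes N :: "'i::linorder set" and v :: "'i \<Rightarrow> 'i \<Rightarrow> 'a::complex_star_algebra"
  assumes finite_index: "finite N"
    and col_orth: "j \<in> N \<Longrightarrow> l \<in> N \<Longrightarrow> (\<Sum>i\<in>N. v i j * v i l) = (if j = l then 1 else 0)"
    and anti_col: "i \<in> N \<Longrightarrow> k \<in> N \<Longrightarrow> j \<in> N \<Longrightarrow> i \<noteq> k \<Longrightarrow> v i j * v k j = - (v k j * v i j)"
    and anti_row: "i \<in> N \<Longrightarrow> j \<in> N \<Longrightarrow> l \<in> N \<Longrightarrow> j \<noteq> l \<Longrightarrow> v i j * v i l = - (v i l * v i j)"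
    and comm: "i \<in> N \<Longrightarrow> k \<in> N \<Longrightarrow> j \<in> N \<Longrightarrow> l \<in> N \<Longrightarrow> i \<noteq> k \<Longrightarrow> j \<noteq> l \<Longrightarrow>
      v i j * v k l = v k l * v i j"
begin

text \<open>If \<open>s i\<close> is the value of \<open>\<tau>\<^sub>i\<close> at a vertex, this is the value at that vertex of the image of \<open>\<tau>\<^sub>j\<close>
under \<open>\<tau>\<^sub>j \<mapsto> \<Sum>i. \<tau>\<^sub>i \<otimes> v i j\<close>.\<close>

definition column_comb :: "('i \<Rightarrow> complex) \<Rightarrow> 'i \<Rightarrow> 'a" where
  "column_comb s j = (\<Sum>i\<in>N. s i *\<^sub>C v i j)"

lemma column_comb_mult:
  "column_comb s j * column_comb s l = (\<Sum>i\<in>N. \<Sum>k\<in>N. (s i * s k) *\<^sub>C (v i j * v k l))"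
  by (simp only: column_comb_def sum_product mult_scaleC_left mult_scaleC_right scaleC_scaleC)
    (intro sum.cong refl, simp add: mult.commute)

lemma double_sum_split:
  fixes g :: "'i \<Rightarrow> 'i \<Rightarrow> 'b::comm_monoid_add"
  shows "(\<Sum>i\<in>N. \<Sum>k\<in>N. g i k)
    = (\<Sum>i\<in>N. g i i) + (\<Sum>i\<in>N. \<Sum>k\<in>N. if i = k then 0 else g i k)"
proof -
  have "(\<Sum>k\<in>N. g i k) = g i i + (\<Sum>k\<in>N. if i = k then 0 else g i k)" if "i \<in> N" for i
  proof -
    have "(\<Sum>k\<in>N. g i k) = (\<Sum>k\<in>N. (if i = k then g i k else 0) + (if i = k then 0 else g i k))"
      by (rule sum.cong) auto
    also have "\<dots> = g i i + (\<Sum>k\<in>N. if i = k then 0 else g i k)"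
      using that finite_index by (simp add: sum.distrib)
    finally show ?thesis .
  qed
  then show ?thesis by (simp add: sum.distrib[symmetric])
qed

context
  fixes s :: "'i \<Rightarrow> complex"
  assumes sign: "i \<in> N \<Longrightarrow> s i * s i = 1"
begin

lemma column_comb_mult_offdiag:
  assumes "j \<in> N" "l \<in> N"
  shows "column_comb s j * column_comb s l = (if j = l then 1 else 0) +
    (\<Sum>i\<in>N. \<Sum>k\<in>N. if i = k then 0 else (s i * s k) *\<^sub>C (v i j * v k l))"
proof -
  have "(\<Sum>i\<in>N. (s i * s i) *\<^sub>C (v i j * v i l)) = (\<Sum>i\<in>N. v i j * v i l)"
    by (rule sum.cong) (simp_all add: sign)
  then show ?thesis unfolding column_comb_mult by (subst double_sum_split) (simp only: col_orth assms)
qed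

text \<open>The diagonal terms of the square add up to the squared length of the column; the others cancel
in pairs because the entries of a column anticommute.\<close>

lemma column_comb_square:
  assumes "j \<in> N"
  shows "column_comb s j * column_comb s j = 1"
proof -
  let ?S = "\<Sum>i\<in>N. \<Sum>k\<in>N. if i = k then 0 else (s i * s k) *\<^sub>C (v i j * v k j)"
  have "?S = (\<Sum>k\<in>N. \<Sum>i\<in>N. if i = k then 0 else (s i * s k) *\<^sub>C (v i j * v k j))"
    by (rule sum.swap)
  also have "\<dots> = (\<Sum>k\<in>N. \<Sum>i\<in>N. - (if k = i then 0 else (s k * s i) *\<^sub>C (v k j * v i j)))"
  proof (intro sum.cong refl)
    fix k i assume ki: "k \<in> N" "i \<in> N"
    show "(if i = k then 0 else (s i * s k) *\<^sub>C (v i j * v k j))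
        = - (if k = i then 0 else (s k * s i) *\<^sub>C (v k j * v i j))"
    proof (cases "i = k")
      case False
      then show ?thesis by (simp only: anti_col[OF ki(2,1) assms False]) (simp add: mult.commute)
    qed simp
  qed
  also have "\<dots> = - ?S" by (simp add: sum_negf)
  finally have "?S = 0" by (rule antisymmetric_eq_zero)
  then show ?thesis using column_comb_mult_offdiag[OF assms assms] by simp
qed

text \<open>For distinct columns the diagonal terms add up to the inner product 0, and in the remaining terms
both the rows and the columns differ, so the entries commute.\<close>

lemma column_comb_commute:
  assumes "j \<in> N" "l \<in> N"
  shows "column_comb s j * column_comb s l = column_comb s l * column_comb s j"
proof (cases "j = l")
  case False
  have "column_comb s l * column_comb s j
      = (\<Sum>i\<in>N. \<Sum>k\<in>N. if i = k then 0 else (s i * s k) *\<^sub>C (v i l * v k j))"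
    using column_comb_mult_offdiag[of l j] assms False by simp
  also have "\<dots> = (\<Sum>k\<in>N. \<Sum>i\<in>N. if i = k then 0 else (s i * s k) *\<^sub>C (v i l * v k j))"
    by (rule sum.swap)
  also have "\<dots> = (\<Sum>k\<in>N. \<Sum>i\<in>N. if k = i then 0 else (s k * s i) *\<^sub>C (v k j * v i l))"
  proof (intro sum.cong refl)
    fix k i assume ki: "k \<in> N" "i \<in> N"
    show "(if i = k then 0 else (s i * s k) *\<^sub>C (v i l * v k j))
        = (if k = i then 0 else (s k * s i) *\<^sub>C (v k j * v i l))"
      using comm[OF ki assms] False by (auto simp: mult.commute)
  qed
  also have "\<dots> = column_comb s j * column_comb s l"
    using column_comb_mult_offdiag[of j l] assms False by simp
  finally show ?thesis by simp
qed simp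

end

end

lemma bij_betw_permute_list:
  assumes "distinct xs"
  shows "bij_betw (\<lambda>\<sigma>. permute_list \<sigma> xs) {\<sigma>. \<sigma> permutes {..<length xs}} (permutations_of_set (set xs))"
  unfolding bij_betw_def
proof (intro conjI equalityI subsetI inj_onI)
  fix \<sigma> \<tau> assume st: "\<sigma> \<in> {\<sigma>. \<sigma> permutes {..<length xs}}" "\<tau> \<in> {\<sigma>. \<sigma> permutes {..<length xs}}"
    and eq: "permute_list \<sigma> xs = permute_list \<tau> xs"
  show "\<sigma> = \<tau>"
  proof
    fix i
    show "\<sigma> i = \<tau> i"
    proof (cases "i < length xs")
      case True
      then have "xs ! \<sigma> i = xs ! \<tau> i" using st eq by (metis mem_Collect_eq permute_list_nth)
      moreover have "\<sigma> i < length xs" "\<tau> i < length xs"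
        using st True permutes_in_image[of _ "{..<length xs}" i] by auto
      ultimately show ?thesis using assms by (simp add: nth_eq_iff_index_eq)
    next
      case False
      then show ?thesis using st by (auto simp: permutes_def)
    qed
  qed
next
  fix ys assume "ys \<in> (\<lambda>\<sigma>. permute_list \<sigma> xs) ` {\<sigma>. \<sigma> permutes {..<length xs}}"
  then show "ys \<in> permutations_of_set (set xs)" using assms by auto
next
  fix ys assume "ys \<in> permutations_of_set (set xs)"
  then have "mset xs = mset ys"
    using assms set_eq_iff_mset_eq_distinct[of xs ys] by (simp add: permutations_of_set_def)
  then obtain \<sigma> where "\<sigma> permutes {..<length xs}" "permute_list \<sigma> xs = ys"
    by (metis mset_eq_permutation)
  then show "ys \<in> (\<lambda>\<sigma>. permute_list \<sigma> xs) ` {\<sigma>. \<sigma> permutes {..<length xs}}" by blast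
qed

lemma inj_on_list_swap: 
  assumes "b < k" "c < k" and "\<And>xs. xs \<in> S \<Longrightarrow> length xs = k"
  shows "inj_on (\<lambda>xs. xs[b := xs ! c, c := xs ! b]) S"
proof (rule inj_on_inverseI)
  fix xs assume "xs \<in> S"
  then have "length xs = k" by (rule assms)
  then show "(\<lambda>xs. xs[b := xs ! c, c := xs ! b]) (xs[b := xs ! c, c := xs ! b]) = xs"
    using assms by (auto intro!: nth_equalityI simp: nth_list_update)
qed

lemma list_split_at_two:
  assumes "length xs = Suc (a + Suc (b + c))"
  obtains us p ms q ws where "xs = us @ p # ms @ q # ws" "length us = a" "length ms = b" "length ws = c"
proof -
  define ys where "ys = drop (Suc a) xs"
  have 1: "xs = take a xs @ xs ! a # ys"
    unfolding ys_def using assms by (intro id_take_nth_drop) simp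
  have 2: "ys = take b ys @ ys ! b # drop (Suc b) ys"
    unfolding ys_def using assms by (intro id_take_nth_drop) simp
  show thesis
    by (rule that[of "take a xs" "xs ! a" "take b ys" "ys ! b" "drop (Suc b) ys"])
      (use 1 2 assms in \<open>simp_all add: ys_def\<close>)
qed

lemma bij_betw_permute_list_set:
  assumes \<sigma>: "\<sigma> permutes {..<k}"
    and S: "\<And>xs. xs \<in> S \<Longrightarrow> length xs = k" "\<And>xs ys. xs \<in> S \<Longrightarrow> mset ys = mset xs \<Longrightarrow> ys \<in> S"
  shows "bij_betw (permute_list \<sigma>) S S"
proof (rule bij_betw_byWitness[where f' = "permute_list (inv_into UNIV \<sigma>)"])
  have i: "inv_into UNIV \<sigma> permutes {..<k}" using \<sigma> by (rule permutes_inv)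
  show "\<forall>xs\<in>S. permute_list (inv_into UNIV \<sigma>) (permute_list \<sigma> xs) = xs"
    using S(1) i by (auto simp flip: permute_list_compose simp: permutes_inv_o[OF \<sigma>])
  show "\<forall>xs\<in>S. permute_list \<sigma> (permute_list (inv_into UNIV \<sigma>) xs) = xs"
    using S(1) \<sigma> by (auto simp flip: permute_list_compose simp: permutes_inv_o[OF \<sigma>])
  have "permute_list \<tau> xs \<in> S" if "xs \<in> S" "\<tau> permutes {..<k}" for \<tau> xs
    using S(2)[OF that(1) mset_permute_list] S(1)[OF that(1)] that(2) by simp
  then show "permute_list \<sigma> ` S \<subseteq> S" "permute_list (inv_into UNIV \<sigma>) ` S \<subseteq> S"
    using \<sigma> i by blast+
qed

context anticommutative_matrix
begin

abbreviation row_prod :: "'i list \<Rightarrow> 'i list \<Rightarrow> 'a" where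
  "row_prod is js \<equiv> prod_list (map2 v is js)"

lemma prod_column_comb_expand:
  "prod_list (map (column_comb s) js)
    = (\<Sum>is | set is \<subseteq> N \<and> length is = length js. prod_list (map s is) *\<^sub>C row_prod is js)"
proof (induct js)
  case Nil
  have "{is. set is \<subseteq> N \<and> length is = length ([]::'i list)} = {[]}" by auto
  then show ?case by simp
next
  case (Cons j js)
  let ?L = "\<lambda>js. {is. set is \<subseteq> N \<and> length is = length (js::'i list)}"
  have img: "?L (j # js) = (\<lambda>(i, is). i # is) ` (N \<times> ?L js)"
    by (auto simp: length_Suc_conv image_iff)
  have fin: "finite (?L js)" using finite_lists_length_eq[OF finite_index] by simp
  have "prod_list (map (column_comb s) (j # js))
      = (\<Sum>i\<in>N. \<Sum>is\<in>?L js. (s i *\<^sub>C v i j) * (prod_list (map s is) *\<^sub>C row_prod is js))"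
    by (simp only: list.map prod_list.Cons Cons column_comb_def sum_product)
  also have "\<dots> = (\<Sum>(i, is)\<in>N \<times> ?L js. prod_list (map s (i # is)) *\<^sub>C row_prod (i # is) (j # js))"
    by (simp add: sum.cartesian_product mult.commute mult.left_commute)
  also have "\<dots> = (\<Sum>is\<in>?L (j # js). prod_list (map s is) *\<^sub>C row_prod is (j # js))"
    unfolding img by (subst sum.reindex) (auto simp: inj_on_def case_prod_unfold)
  finally show ?case .
qed

text \<open>Moving an entry of row \<open>i\<close> past another entry changes the sign exactly if the latter also lies in
row \<open>i\<close>.  Hence the sign \<open>e\<close> is the same for both columns \<open>p\<close> and \<open>q\<close>.\<close>

lemma row_prod_move:
  assumes "i \<in> N" "p \<in> N" "q \<in> N" "set is \<subseteq> N" "set ks \<subseteq> N" "p \<notin> set ks" "q \<notin> set ks"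
  shows "\<exists>e. v i p * row_prod is ks = e *\<^sub>C (row_prod is ks * v i p) \<and>
             v i q * row_prod is ks = e *\<^sub>C (row_prod is ks * v i q)"
  using assms(4-7)
proof (induct "is" ks rule: list_induct2')
  case (4 r rs t ts)
  then obtain e where e: "v i p * row_prod rs ts = e *\<^sub>C (row_prod rs ts * v i p)"
      "v i q * row_prod rs ts = e *\<^sub>C (row_prod rs ts * v i q)" by auto
  have step: "v i c * (v r t * row_prod rs ts)
        = ((if r = i then -1 else 1) * e) *\<^sub>C (v r t * row_prod rs ts * v i c)"
    if c: "v i c * row_prod rs ts = e *\<^sub>C (row_prod rs ts * v i c)" "c \<in> N" "c \<noteq> t" for c
  proof -
    have "v i c * v r t = (if r = i then -1 else 1) *\<^sub>C (v r t * v i c)"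
      using anti_row[of i c t] comm[of i r c t] 4 assms that by auto
    then have "v i c * (v r t * row_prod rs ts)
        = (if r = i then -1 else 1) *\<^sub>C (v r t * (v i c * row_prod rs ts))"
      by (simp add: mult.assoc flip: mult.assoc[of "v i c"])
    then show ?thesis by (simp add: c mult.assoc)
  qed
  show ?case using 4 assms
    by (intro exI[of _ "(if r = i then -1 else 1) * e"]) (simp add: step e)
qed (auto intro: exI[of _ 1])

text \<open>By \<open>row_prod_move\<close> the factors between the two entries of row \<open>i\<close> contribute the same sign in both
products, and \<open>v i q * v i p = - (v i p * v i q)\<close>.\<close>

lemma row_prod_swap:
  assumes "set (is1 @ i # is2 @ i # is3) \<subseteq> N" "set (ks1 @ p # ks2 @ q # ks3) \<subseteq> N"
    and "distinct (ks1 @ p # ks2 @ q # ks3)" "length is1 = length ks1" "length is2 = length ks2"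
  shows "row_prod (is1 @ i # is2 @ i # is3) (ks1 @ q # ks2 @ p # ks3)
    = - row_prod (is1 @ i # is2 @ i # is3) (ks1 @ p # ks2 @ q # ks3)"
proof -
  obtain e where e: "v i p * row_prod is2 ks2 = e *\<^sub>C (row_prod is2 ks2 * v i p)"
      "v i q * row_prod is2 ks2 = e *\<^sub>C (row_prod is2 ks2 * v i q)"
    using row_prod_move[of i p q is2 ks2] assms by auto
  have split: "row_prod (is1 @ i # is2 @ i # is3) (ks1 @ a # ks2 @ b # ks3)
      = row_prod is1 ks1 * (v i a * row_prod is2 ks2 * v i b) * row_prod is3 ks3" for a b
    using assms by (simp add: mult.assoc)
  have "v i q * row_prod is2 ks2 * v i p = e *\<^sub>C (row_prod is2 ks2 * (v i q * v i p))"
    by (simp add: e mult.assoc)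
  also have "v i q * v i p = - (v i p * v i q)" using assms by (intro anti_row) auto
  also have "e *\<^sub>C (row_prod is2 ks2 * - (v i p * v i q)) = - (v i p * row_prod is2 ks2 * v i q)"
    by (simp add: e mult.assoc)
  finally show ?thesis by (simp add: split)
qed

text \<open>Exchanging the two columns that are paired with the repeated row is a sign-reversing bijection on the
orderings of the columns.\<close>

lemma row_prod_repeated_row:
  assumes "\<not> distinct is" "set is \<subseteq> N" "J \<subseteq> N" "length is = card J"
  shows "(\<Sum>ks\<in>permutations_of_set J. row_prod is ks) = 0"
proof -
  obtain is1 is2 is3 i where "is": "is = is1 @ i # is2 @ i # is3"
    using not_distinct_decomp[OF assms(1)] by auto
  define b c where "b = length is1" and "c = Suc (b + length is2)"
  let ?P = "permutations_of_set J" and ?f = "\<lambda>ks. ks[b := ks ! c, c := ks ! b]"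
  have fin: "finite J" using assms finite_index by (auto intro: finite_subset)
  have len: "length ks = length is" if "ks \<in> ?P" for ks
    using that assms length_finite_permutations_of_set by metis
  have bc: "b < length is" "c < length is" by (auto simp: "is" b_def c_def)
  have sub: "?f ` ?P \<subseteq> ?P"
  proof
    fix ys assume "ys \<in> ?f ` ?P"
    then obtain ks where ks: "ks \<in> ?P" "ys = ?f ks" by auto
    have "mset ys = mset ks" unfolding ks(2) using bc len[OF ks(1)] by (intro mset_swap) auto
    then show "ys \<in> ?P" using ks(1) by (metis mset_eq_imp_distinct_iff mset_eq_setD permutations_of_setD permutations_of_setI)
  qed
  have inj: "inj_on ?f ?P" by (rule inj_on_list_swap[OF bc len])
  have "bij_betw ?f ?P ?P" using inj sub by (simp add: bij_betw_def endo_inj_surj)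
  then have "(\<Sum>ks\<in>?P. row_prod is ks) = (\<Sum>ks\<in>?P. row_prod is (?f ks))"
    by (rule sum.reindex_bij_betw[symmetric])
  also have "\<dots> = (\<Sum>ks\<in>?P. - row_prod is ks)"
  proof (rule sum.cong[OF refl])
    fix ks assume ks: "ks \<in> ?P"
    obtain ks1 p ks2 q ks3 where s: "ks = ks1 @ p # ks2 @ q # ks3" "length ks1 = length is1"
        "length ks2 = length is2"
      by (rule list_split_at_two[of ks "length is1" "length is2" "length is3"]) (use len[OF ks] "is" in auto)
    have f: "?f ks = ks1 @ q # ks2 @ p # ks3"
      unfolding s b_def c_def using s by (simp add: nth_append list_update_append)
    show "row_prod is (?f ks) = - row_prod is ks"
      unfolding f unfolding s(1) "is" 
      by (rule row_prod_swap) (use assms permutations_of_setD[OF ks] s "is" in \<open>auto\<close>)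
  qed
  also have "\<dots> = - (\<Sum>ks\<in>?P. row_prod is ks)" by (simp add: sum_negf)
  finally show ?thesis by (rule antisymmetric_eq_zero)
qed

lemma row_prod_permute:
  assumes "distinct is" "set is \<subseteq> N" "distinct ks" "set ks \<subseteq> N" "length is = length ks"
    and \<sigma>: "\<sigma> permutes {..<length ks}"
  shows "row_prod (permute_list \<sigma> is) (permute_list \<sigma> ks) = row_prod is ks"
proof (rule prod_list_mset_cong)
  show "mset (map2 v (permute_list \<sigma> is) (permute_list \<sigma> ks)) = mset (map2 v is ks)"
    using assms by (simp flip: permute_list_zip)
  fix x y
  assume "x \<in> set (map2 v (permute_list \<sigma> is) (permute_list \<sigma> ks))"
    "y \<in> set (map2 v (permute_list \<sigma> is) (permute_list \<sigma> ks))"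
  then have "x \<in> set (map2 v is ks)" "y \<in> set (map2 v is ks)"
    using assms by (simp_all flip: permute_list_zip)
  then obtain a b where ab: "a < length ks" "b < length ks" "x = v (is ! a) (ks ! a)" "y = v (is ! b) (ks ! b)"
    using assms(5) by (auto simp: set_zip)
  show "x * y = y * x"
  proof (cases "a = b")
    case False
    then show ?thesis unfolding ab using assms ab
      by (intro comm) (auto simp: nth_eq_iff_index_eq)
  qed (simp add: ab)
qed

text \<open>The factors commute, so the product equals its average over all orderings of the columns.  In the
expansion of this average the row sequences with a repetition cancel by
\<open>row_prod_repeated_row\<close>.  For distinct rows all entries that occur commute, and a rearrangement of
the columns may be replaced by the inverse rearrangement of the rows.\<close>

theorem prod_column_comb_distinct:
  assumes s: "\<And>i. i \<in> N \<Longrightarrow> s i * s i = 1" and js: "distinct js" "set js \<subseteq> N"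
  shows "prod_list (map (column_comb s) js)
    = (\<Sum>is | set is \<subseteq> N \<and> length is = length js \<and> distinct is. prod_list (map s is) *\<^sub>C row_prod is js)"
proof -
  define k where "k = length js"
  define P where "P = {\<sigma>. \<sigma> permutes {..<k}}"
  define L where "L = {is. set is \<subseteq> N \<and> length is = k}"
  define D where "D = {is. set is \<subseteq> N \<and> length is = k \<and> distinct is}"
  define c where "c = (\<lambda>is. prod_list (map s is))"
  have finP: "finite P" "card P = fact k"
    by (simp_all add: P_def finite_permutations card_permutations)
  have finL: "finite L" unfolding L_def using finite_lists_length_eq[OF finite_index] by simp
  have c_perm: "c (permute_list \<sigma> is) = c is" if "\<sigma> \<in> P" "is \<in> L" for \<sigma> "is"
    unfolding c_def by (rule prod_list_mset_cong) (use that in \<open>auto simp: P_def L_def\<close>)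
  have "fact k *\<^sub>C prod_list (map (column_comb s) js) = (\<Sum>\<sigma>\<in>P. prod_list (map (column_comb s) js))"
    using finP by (simp add: sum_constant_scale complex_vec.sum_constant_scale)
  also have "\<dots> = (\<Sum>\<sigma>\<in>P. prod_list (map (column_comb s) (permute_list \<sigma> js)))"
  proof (rule sum.cong[OF refl])
    fix \<sigma> assume "\<sigma> \<in> P"
    then show "prod_list (map (column_comb s) js) = prod_list (map (column_comb s) (permute_list \<sigma> js))"
      using js column_comb_commute[of s, OF s] by (intro prod_list_mset_cong) (auto simp: P_def k_def)
  qed
  also have "\<dots> = (\<Sum>\<sigma>\<in>P. \<Sum>is\<in>L. c is *\<^sub>C row_prod is (permute_list \<sigma> js))"
    unfolding prod_column_comb_expand by (simp add: L_def k_def c_def)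
  also have "\<dots> = (\<Sum>is\<in>L. \<Sum>\<sigma>\<in>P. c is *\<^sub>C row_prod is (permute_list \<sigma> js))"
    by (rule sum.swap)
  also have "\<dots> = (\<Sum>is\<in>D. \<Sum>\<sigma>\<in>P. c is *\<^sub>C row_prod is (permute_list \<sigma> js))"
  proof (rule sum.mono_neutral_right[OF finL])
    show "\<forall>is\<in>L - D. (\<Sum>\<sigma>\<in>P. c is *\<^sub>C row_prod is (permute_list \<sigma> js)) = 0"
    proof
      fix "is" assume "is": "is \<in> L - D"
      have "(\<Sum>\<sigma>\<in>P. row_prod is (permute_list \<sigma> js)) = (\<Sum>ks\<in>permutations_of_set (set js). row_prod is ks)"
        unfolding P_def k_def by (rule sum.reindex_bij_betw[OF bij_betw_permute_list[OF js(1)]])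
      also have "\<dots> = 0"
        using "is" js by (intro row_prod_repeated_row) (auto simp: L_def D_def k_def distinct_card)
      finally show "(\<Sum>\<sigma>\<in>P. c is *\<^sub>C row_prod is (permute_list \<sigma> js)) = 0"
        by (simp flip: scaleC_sum_right)
    qed
  qed (auto simp: L_def D_def)
  also have "\<dots> = (\<Sum>\<sigma>\<in>P. \<Sum>is\<in>D. c is *\<^sub>C row_prod is (permute_list \<sigma> js))"
    by (rule sum.swap)
  also have "\<dots> = (\<Sum>\<sigma>\<in>P. \<Sum>is\<in>D. c is *\<^sub>C row_prod is js)"
  proof (rule sum.cong[OF refl])
    fix \<sigma> assume \<sigma>: "\<sigma> \<in> P"
    have "bij_betw (permute_list \<sigma>) D D"
      by (rule bij_betw_permute_list_set[of _ k])
        (use \<sigma> in \<open>auto simp: P_def D_def dest: mset_eq_setD mset_eq_length mset_eq_imp_distinct_iff\<close>)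
    then have "(\<Sum>is\<in>D. c is *\<^sub>C row_prod is (permute_list \<sigma> js))
        = (\<Sum>is\<in>D. c (permute_list \<sigma> is) *\<^sub>C row_prod (permute_list \<sigma> is) (permute_list \<sigma> js))"
      by (rule sum.reindex_bij_betw[symmetric])
    also have "\<dots> = (\<Sum>is\<in>D. c is *\<^sub>C row_prod is js)"
    proof (rule sum.cong[OF refl])
      fix "is" assume "is": "is \<in> D"
      then have "row_prod (permute_list \<sigma> is) (permute_list \<sigma> js) = row_prod is js"
        using \<sigma> js by (intro row_prod_permute) (auto simp: D_def P_def k_def)
      moreover have "c (permute_list \<sigma> is) = c is" using \<sigma> "is" by (intro c_perm) (auto simp: D_def L_def)
      ultimately show "c (permute_list \<sigma> is) *\<^sub>C row_prod (permute_list \<sigma> is) (permute_list \<sigma> js)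
        = c is *\<^sub>C row_prod is js" by simp
    qed
    finally show "(\<Sum>is\<in>D. c is *\<^sub>C row_prod is (permute_list \<sigma> js)) = (\<Sum>is\<in>D. c is *\<^sub>C row_prod is js)" .
  qed
  also have "\<dots> = fact k *\<^sub>C (\<Sum>is\<in>D. c is *\<^sub>C row_prod is js)"
    using finP by (simp add: complex_vec.sum_constant_scale)
  finally have "fact k *\<^sub>C prod_list (map (column_comb s) js) = fact k *\<^sub>C (\<Sum>is\<in>D. c is *\<^sub>C row_prod is js)" .
  then have "prod_list (map (column_comb s) js) = (\<Sum>is\<in>D. c is *\<^sub>C row_prod is js)" by simp
  then show ?thesis by (simp add: D_def c_def k_def)
qed

text \<open>A minor without signs: entries in distinct rows and columns commute, and these sums are the entries of
the anticommutative exterior powers.\<close>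

definition minor :: "'i set \<Rightarrow> 'i list \<Rightarrow> 'a" where
  "minor I js = (\<Sum>is\<in>permutations_of_set I. row_prod is js)"

theorem prod_column_comb_minor:
  assumes s: "\<And>i. i \<in> N \<Longrightarrow> s i * s i = 1" and js: "distinct js" "set js \<subseteq> N"
  shows "prod_list (map (column_comb s) js)
    = (\<Sum>I | I \<subseteq> N \<and> card I = length js. prod s I *\<^sub>C minor I js)"
proof -
  let ?K = "{I. I \<subseteq> N \<and> card I = length js}"
  have fin: "finite I" if "I \<in> ?K" for I using that finite_index by (auto intro: finite_subset)
  have "{is. set is \<subseteq> N \<and> length is = length js \<and> distinct is} = (\<Union>I\<in>?K. permutations_of_set I)"
    by (auto simp: permutations_of_set_def distinct_card)
  note UN = this
  have "prod_list (map (column_comb s) js) = (\<Sum>is | set is \<subseteq> N \<and> length is = length js \<and> distinct is.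
      prod_list (map s is) *\<^sub>C row_prod is js)"
    by (rule prod_column_comb_distinct) (use s js in auto)
  also have "\<dots> = (\<Sum>I\<in>?K. \<Sum>is\<in>permutations_of_set I. prod_list (map s is) *\<^sub>C row_prod is js)"
    unfolding UN
  proof (rule sum.UNION_disjoint)
    show "finite ?K" by (rule finite_subset[of _ "Pow N"]) (use finite_index in auto)
    show "\<forall>I\<in>?K. finite (permutations_of_set I)" by simp
    show "\<forall>I\<in>?K. \<forall>J\<in>?K. I \<noteq> J \<longrightarrow> permutations_of_set I \<inter> permutations_of_set J = {}"
      by (auto simp: permutations_of_set_def)
  qed
  also have "\<dots> = (\<Sum>I\<in>?K. prod s I *\<^sub>C minor I js)"
  proof (rule sum.cong[OF refl])
    fix I
    have "prod_list (map s is) = prod s I" if "is \<in> permutations_of_set I" for "is"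
      using that by (auto simp: permutations_of_set_def prod.distinct_set_conv_list)
    then show "(\<Sum>is\<in>permutations_of_set I. prod_list (map s is) *\<^sub>C row_prod is js) = prod s I *\<^sub>C minor I js"
      unfolding minor_def scaleC_sum_right by simp
  qed
  finally show ?thesis .
qed

end

section \<open>Joint spectral projections of commuting involutions\<close>

text \<open>For commuting involutions \<open>x j\<close> and signs \<open>t j\<close> this is the projection onto the joint eigenspace with
eigenvalues \<open>t j\<close>.\<close>

definition joint_proj :: "('j \<Rightarrow> complex) \<Rightarrow> ('j \<Rightarrow> 'a) \<Rightarrow> 'j list \<Rightarrow> 'a::complex_star_algebra" where
  "joint_proj t x js = prod_list (map (\<lambda>j. (1/2) *\<^sub>C (1 + t j *\<^sub>C x j)) js)"

lemma joint_proj_scalar: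
  assumes "\<And>j. j \<in> set js \<Longrightarrow> x j * z = t' j *\<^sub>C z"
  shows "joint_proj t x js * z = (\<Prod>j\<leftarrow>js. (1 + t j * t' j) / 2) *\<^sub>C z"
  using assms
proof (induct js)
  case (Cons j js)
  have "(1 + t j *\<^sub>C x j) * z = (1 + t j * t' j) *\<^sub>C z"
    using Cons.prems[of j] by (simp add: distrib_right scaleC_add_left)
  then show ?case using Cons
    by (simp add: joint_proj_def mult.assoc mult.commute)
qed (simp add: joint_proj_def)

lemma joint_proj_absorb:
  assumes "\<And>j. j \<in> set js \<Longrightarrow> t j * t j = 1" "\<And>j. j \<in> set js \<Longrightarrow> x j * z = t j *\<^sub>C z"
  shows "joint_proj t x js * z = z"
proof -
  have "(\<Prod>j\<leftarrow>js. (1 + t j * t j) / 2) = 1"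
    using assms(1) by (induct js) auto
  then show ?thesis using joint_proj_scalar[where t = t and x = x and t' = t, OF assms(2)] by simp
qed

lemma joint_proj_annihilate:
  assumes "j \<in> set js" "\<And>k. k \<in> set js \<Longrightarrow> x k * z = t' k *\<^sub>C z" "t j * t' j = -1"
  shows "joint_proj t x js * z = 0"
proof -
  have "(\<Prod>j\<leftarrow>js. (1 + t j * t' j) / 2) = 0"
    using assms(1,3) by (force simp: prod_list_zero_iff)
  then show ?thesis using joint_proj_scalar[where t = t and x = x and t' = t', OF assms(2)] by simp
qed

lemma joint_proj_eigen:
  assumes "j \<in> set js" "\<And>j. j \<in> set js \<Longrightarrow> t j * t j = 1" "\<And>j. j \<in> set js \<Longrightarrow> x j * x j = 1"
    and "\<And>j k. j \<in> set js \<Longrightarrow> k \<in> set js \<Longrightarrow> x j * x k = x k * x j"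
  shows "x j * joint_proj t x js = t j *\<^sub>C joint_proj t x js"
  using assms
proof (induct js)
  case (Cons k js)
  have c: "x j * ((1/2) *\<^sub>C (1 + t k *\<^sub>C x k)) = (1/2) *\<^sub>C (1 + t k *\<^sub>C x k) * x j"
    using Cons.prems(4)[of j k] Cons.prems(1) by (simp add: distrib_left distrib_right)
  have split: "joint_proj t x (k # js) = (1/2) *\<^sub>C (1 + t k *\<^sub>C x k) * joint_proj t x js"
    by (simp add: joint_proj_def)
  show ?case
  proof (cases "j = k")
    case True
    have "x k * ((1/2) *\<^sub>C (1 + t k *\<^sub>C x k)) = t k *\<^sub>C ((1/2) *\<^sub>C (1 + t k *\<^sub>C x k))"
      using Cons.prems(2,3)[of k] by (simp add: distrib_left scaleC_add_right add.commute)
    then have "x k * ((1/2) *\<^sub>C (1 + t k *\<^sub>C x k)) * joint_proj t x js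
        = t k *\<^sub>C ((1/2) *\<^sub>C (1 + t k *\<^sub>C x k)) * joint_proj t x js" by (rule arg_cong)
    then show ?thesis unfolding split True by (simp only: mult.assoc mult_scaleC_left)
  next
    case False
    then have "x j * joint_proj t x js = t j *\<^sub>C joint_proj t x js"
      using Cons by simp
    then show ?thesis unfolding split
      by (simp only: c flip: mult.assoc) (simp only: mult.assoc mult_scaleC_right)
  qed
qed simp

lemma star_joint_proj:
  assumes "\<And>j. j \<in> set js \<Longrightarrow> cnj (t j) = t j" "\<And>j. j \<in> set js \<Longrightarrow> star (x j) = x j"
    and "\<And>j k. j \<in> set js \<Longrightarrow> k \<in> set js \<Longrightarrow> x j * x k = x k * x j"
  shows "star (joint_proj t x js) = joint_proj t x js"
proof -
  let ?p = "\<lambda>j. (1/2) *\<^sub>C (1 + t j *\<^sub>C x j)"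
  have "map (\<lambda>j. star (?p j)) js = map ?p js"
    using assms(1,2) by (simp add: star_scaleC star_add)
  then have "star (joint_proj t x js) = prod_list (rev (map ?p js))"
    unfolding joint_proj_def star_prod_list by (simp only: map_map o_def)
  also have "\<dots> = joint_proj t x js"
    unfolding joint_proj_def using assms(3)
    by (intro prod_list_mset_cong) (auto simp: distrib_left distrib_right scaleC_add_right algebra_simps)
  finally show ?thesis .
qed

section \<open>Characters of the cube\<close>

lemma finite_Z2 [simp]: "finite (Z2_vectors n)"
  by (simp add: Z2_vectors_def)

lemma finite_Z2_vector: "\<alpha> \<in> Z2_vectors n \<Longrightarrow> finite \<alpha>"
  by (auto simp: Z2_vectors_def intro: finite_subset)

lemma tau_square: "tau \<mu> \<alpha> * tau \<mu> \<alpha> = 1"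
  by (simp add: tau_def flip: power_mult_distrib)

lemma cnj_tau [simp]: "cnj (tau \<mu> \<alpha>) = tau \<mu> \<alpha>"
  by (simp add: tau_def)

text \<open>The value of \<open>\<tau>\<^sub>i\<close> at \<open>\<alpha>\<close>, with \<open>\<tau>\<^sub>n\<^sub>+\<^sub>1 = \<tau>\<^sub>1 \<cdots> \<tau>\<^sub>n\<close> included.\<close>

definition tau_gen :: "nat \<Rightarrow> nat set \<Rightarrow> nat \<Rightarrow> complex" where
  "tau_gen n \<alpha> i = tau (tau_exponent n {i}) \<alpha>"

lemma tau_gen_square: "tau_gen n \<alpha> i * tau_gen n \<alpha> i = 1"
  by (simp add: tau_gen_def tau_square)

lemma cnj_tau_gen [simp]: "cnj (tau_gen n \<alpha> i) = tau_gen n \<alpha> i"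
  by (simp add: tau_gen_def)

lemma prod_tau_gen:
  assumes "I \<subseteq> {1..n+1}" "\<alpha> \<in> Z2_vectors n"
  shows "prod (tau_gen n \<alpha>) I = tau (tau_exponent n I) \<alpha>"
proof -
  have "prod (tau_gen n \<alpha>) I = tau_ext n I \<alpha>"
    unfolding tau_ext_def
  proof (rule prod.cong[OF refl])
    fix i assume "i \<in> I"
    then have "tau_gen n \<alpha> i = tau_ext n {i} \<alpha>"
      using assms by (subst tau_ext_eq) (auto simp: tau_gen_def)
    then show "tau_gen n \<alpha> i = (if i = n + 1 then \<Prod>j\<in>{1..n}. tau {j} \<alpha> else tau {i} \<alpha>)"
      by (simp add: tau_ext_def)
  qed
  then show ?thesis using tau_ext_eq[OF assms] by simp
qed

lemma tau_exponent_Z2: "I \<subseteq> {1..n+1} \<Longrightarrow> tau_exponent n I \<in> Z2_vectors n"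
  by (auto simp: tau_exponent_def Z2_vectors_def subset_iff le_Suc_eq)

lemma tau_gen_le: "j \<in> {1..n} \<Longrightarrow> tau_gen n \<alpha> j = tau {j} \<alpha>"
  by (simp add: tau_gen_def tau_exponent_def)

lemma tau_orth:
  assumes "\<mu> \<in> Z2_vectors n" "\<nu> \<in> Z2_vectors n"
  shows "(\<Sum>\<alpha>\<in>Z2_vectors n. tau \<mu> \<alpha> * tau \<nu> \<alpha>) = (if \<mu> = \<nu> then 2 ^ n else 0)"
proof -
  have "(\<Sum>\<alpha>\<in>Z2_vectors n. tau \<mu> \<alpha> * tau \<nu> \<alpha>) = (\<Sum>\<alpha>\<in>Z2_vectors n. tau (sym_diff \<mu> \<nu>) \<alpha>)"
    by (rule sum.cong) (simp_all add: tau_mult finite_Z2_vector)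
  moreover have "sym_diff \<mu> \<nu> \<in> Z2_vectors n" using assms by (auto simp: Z2_vectors_def)
  moreover have "sym_diff \<mu> \<nu> = {} \<longleftrightarrow> \<mu> = \<nu>" by auto
  ultimately show ?thesis by (simp add: sum_tau)
qed

lemma tau_separates:
  assumes "\<alpha> \<in> Z2_vectors n" "\<beta> \<in> Z2_vectors n" "\<alpha> \<noteq> \<beta>"
  shows "\<exists>j\<in>{1..n}. tau {j} \<alpha> * tau {j} \<beta> = -1"
proof -
  obtain j where j: "j \<in> sym_diff \<alpha> \<beta>" using assms(3) by auto
  then have "j \<in> {1..n}" using assms by (auto simp: Z2_vectors_def)
  moreover have "tau {j} \<alpha> * tau {j} \<beta> = -1" using j by (auto simp: tau_def)
  ultimately show ?thesis by blast
qed

lemma fourier_injective: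
  fixes f :: "nat set \<Rightarrow> 'a::complex_star_algebra"
  assumes "\<And>\<mu>. \<mu> \<in> Z2_vectors n \<Longrightarrow> (\<Sum>\<beta>\<in>Z2_vectors n. tau \<mu> \<beta> *\<^sub>C f \<beta>) = (\<Sum>\<beta>\<in>Z2_vectors n. tau \<mu> \<beta> *\<^sub>C g \<beta>)"
    and "\<alpha> \<in> Z2_vectors n"
  shows "f \<alpha> = g \<alpha>"
proof -
  have *: "2 ^ n *\<^sub>C h \<alpha> = (\<Sum>\<mu>\<in>Z2_vectors n. tau \<mu> \<alpha> *\<^sub>C (\<Sum>\<beta>\<in>Z2_vectors n. tau \<mu> \<beta> *\<^sub>C h \<beta>))"
    for h :: "nat set \<Rightarrow> 'a"
  proof -
    have tt: "tau \<mu> \<alpha> * tau \<mu> \<beta> = tau \<alpha> \<mu> * tau \<beta> \<mu>" for \<mu> \<beta>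
      by (simp add: tau_def Int_commute)
    have "(\<Sum>\<mu>\<in>Z2_vectors n. tau \<mu> \<alpha> *\<^sub>C (\<Sum>\<beta>\<in>Z2_vectors n. tau \<mu> \<beta> *\<^sub>C h \<beta>))
        = (\<Sum>\<mu>\<in>Z2_vectors n. \<Sum>\<beta>\<in>Z2_vectors n. (tau \<alpha> \<mu> * tau \<beta> \<mu>) *\<^sub>C h \<beta>)"
      by (simp only: scaleC_sum_right scaleC_scaleC tt)
    also have "\<dots> = (\<Sum>\<beta>\<in>Z2_vectors n. \<Sum>\<mu>\<in>Z2_vectors n. (tau \<alpha> \<mu> * tau \<beta> \<mu>) *\<^sub>C h \<beta>)"
      by (rule sum.swap)
    also have "\<dots> = (\<Sum>\<beta>\<in>Z2_vectors n. (if \<alpha> = \<beta> then 2 ^ n else 0) *\<^sub>C h \<beta>)"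
      by (rule sum.cong[OF refl]) (simp only: tau_orth[OF assms(2)] flip: scaleC_sum_left)
    also have "\<dots> = (\<Sum>\<beta>\<in>Z2_vectors n. if \<beta> = \<alpha> then 2 ^ n *\<^sub>C h \<beta> else 0)"
      by (rule sum.cong) auto
    also have "\<dots> = 2 ^ n *\<^sub>C h \<alpha>" using assms(2) by simp
    finally show ?thesis by simp
  qed
  have "2 ^ n *\<^sub>C f \<alpha> = 2 ^ n *\<^sub>C g \<alpha>" unfolding * using assms(1) by simp
  then show ?thesis by simp
qed

section \<open>The spectrum of the halved cube\<close>

lemma halved_cube_adj_card:
  assumes "\<alpha> \<in> Z2_vectors n" "\<beta> \<in> Z2_vectors n"
  shows "halved_cube_adj n \<alpha> \<beta> \<longleftrightarrow> card (sym_diff \<alpha> \<beta>) \<in> {1, 2}"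
proof -
  let ?D = "sym_diff \<alpha> \<beta>"
  have D: "?D \<subseteq> {1..n}" using assms by (auto simp: Z2_vectors_def)
  show ?thesis
  proof
    assume "halved_cube_adj n \<alpha> \<beta>"
    then obtain i j where "?D = {i} \<or> ?D = {i, j} \<and> i < j"
      unfolding halved_cube_adj_def by blast
    then show "card ?D \<in> {1, 2}" by (elim disjE conjE) (simp_all del: Un_iff)
  next
    assume "card ?D \<in> {1, 2}"
    then consider i where "?D = {i}" | i j where "?D = {i, j}" "i \<noteq> j"
      by (metis One_nat_def card_1_singletonE card_2_iff insert_iff singletonD)
    then show "halved_cube_adj n \<alpha> \<beta>"
    proof cases
      case (1 i)
      then show ?thesis using D unfolding halved_cube_adj_def 1 by auto
    next
      case (2 i j)
      then have "i < j \<or> j < i" "{i, j} = {j, i}" by auto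
      then show ?thesis using D unfolding halved_cube_adj_def 2(1) by auto
    qed
  qed
qed

definition adj_coeff :: "nat \<Rightarrow> nat set \<Rightarrow> nat set \<Rightarrow> complex" where
  "adj_coeff n \<alpha> \<beta> = (if halved_cube_adj n \<alpha> \<beta> then 1 else 0)"

lemma adj_coeff_commute: "adj_coeff n \<alpha> \<beta> = adj_coeff n \<beta> \<alpha>"
  by (simp add: adj_coeff_def halved_cube_adj_def Un_commute)

text \<open>The eigenvalue of the adjacency matrix at \<open>\<tau>\<^sub>\<mu>\<close> with \<open>card \<mu> = k\<close>.  It takes the same value at \<open>k\<close> and \<open>n + 1 - k\<close>
and no other coincidences occur, which is why \<open>V\<^sub>k\<close> and \<open>V\<^sub>n\<^sub>+\<^sub>1\<^sub>-\<^sub>k\<close> are joined in one block.\<close>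

definition eigval :: "nat \<Rightarrow> nat \<Rightarrow> complex" where
  "eigval n k = ((of_nat (n + 1) - 2 * of_nat k)\<^sup>2 - of_nat (n + 1)) / 2"

text \<open>The first two elementary symmetric polynomials \<open>e\<^sub>1\<close> and \<open>e\<^sub>2\<close> of signs: from \<open>e\<^sub>1\<^sup>2 = card S + 2 e\<^sub>2\<close> it follows that
\<open>e\<^sub>1 + e\<^sub>2 = ((e\<^sub>1 + 1)\<^sup>2 - (card S + 1)) / 2\<close>.\<close>

lemma sum_card_le_2:
  fixes t :: "nat \<Rightarrow> complex"
  assumes t: "\<And>i. i \<in> S \<Longrightarrow> t i * t i = 1" and fin: "finite S"
  shows "(\<Sum>D | D \<subseteq> S \<and> card D \<in> {1, 2}. prod t D)
    = ((sum t S + 1)\<^sup>2 - of_nat (card S + 1)) / 2"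
  using fin t
proof (induct S)
  case empty
  have "{D. D \<subseteq> {} \<and> card D \<in> {1::nat, 2}} = {}" by auto
  then show ?case by simp
next
  case (insert a S)
  let ?P = "\<lambda>S. {D. D \<subseteq> S \<and> card D \<in> {1::nat, 2}}"
  have f: "finite D" if "D \<subseteq> S" for D using that insert(1) by (rule finite_subset)
  have eq: "?P (insert a S) = ?P S \<union> insert a ` (insert {} ((\<lambda>i. {i}) ` S))"
  proof (intro equalityI subsetI)
    fix D assume D: "D \<in> ?P (insert a S)"
    show "D \<in> ?P S \<union> insert a ` (insert {} ((\<lambda>i. {i}) ` S))"
    proof (cases "a \<in> D")
      case True
      then obtain D' where D': "D = insert a D'" "a \<notin> D'" by (metis mk_disjoint_insert)
      then have sub: "D' \<subseteq> S" using D by auto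
      then have "card D' \<in> {0, 1}" using D D' f[OF sub] by auto
      then have "D' = {} \<or> (\<exists>i. D' = {i})" using f[OF sub] by (auto simp: card_1_singleton_iff)
      then show ?thesis using D' sub by auto
    qed (use D in auto)
  next
    fix D assume "D \<in> ?P S \<union> insert a ` (insert {} ((\<lambda>i. {i}) ` S))"
    then consider "D \<in> ?P S" | "D = {a}" | i where "D = {a, i}" "i \<in> S" by auto
    then show "D \<in> ?P (insert a S)"
      by cases (use insert(2) in \<open>auto simp: card_2_iff\<close>)
  qed
  have "sum (prod t) (?P (insert a S))
      = sum (prod t) (?P S) + sum (prod t) (insert a ` (insert {} ((\<lambda>i. {i}) ` S)))"
    unfolding eq by (rule sum.union_disjoint) (use insert in auto)
  also have "sum (prod t) (insert a ` (insert {} ((\<lambda>i. {i}) ` S))) = t a + (\<Sum>i\<in>S. t a * t i)"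
  proof -
    have "inj_on (insert a) (insert {} ((\<lambda>i. {i}) ` S))"
      by (rule inj_onI) (use insert(2) in \<open>auto simp: doubleton_eq_iff\<close>)
    then have "sum (prod t) (insert a ` (insert {} ((\<lambda>i. {i}) ` S)))
        = sum (prod t \<circ> insert a) (insert {} ((\<lambda>i. {i}) ` S))"
      by (rule sum.reindex)
    also have "\<dots> = t a + sum (prod t \<circ> insert a) ((\<lambda>i. {i}) ` S)"
      using insert by (subst sum.insert) auto
    also have "sum (prod t \<circ> insert a) ((\<lambda>i. {i}) ` S) = (\<Sum>i\<in>S. t a * t i)"
    proof -
      have "prod t {a, i} = t a * t i" if "i \<in> S" for i
        using that insert(2) by (subst prod.insert) auto
      then show ?thesis by (subst sum.reindex) auto
    qed
    finally show ?thesis .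
  qed
  also have "sum (prod t) (?P S) = ((sum t S + 1)\<^sup>2 - of_nat (card S + 1)) / 2"
    using insert by simp
  also have "((sum t S + 1)\<^sup>2 - of_nat (card S + 1)) / 2 + (t a + (\<Sum>i\<in>S. t a * t i))
      = ((t a + sum t S + 1)\<^sup>2 - (t a * t a + of_nat (card S + 1))) / 2"
    unfolding sum_distrib_left[symmetric] by (simp add: power2_eq_square field_simps)
  also have "t a * t a = 1" using insert.prems by simp
  finally show ?case using insert by simp
qed

lemma sum_tau_singletons:
  assumes "\<mu> \<subseteq> {1..n}"
  shows "(\<Sum>i\<in>{1..n}. tau \<mu> {i}) = of_nat n - 2 * of_nat (card \<mu>)"
proof -
  have "(\<Sum>i\<in>{1..n}. tau \<mu> {i}) = (\<Sum>i\<in>{1..n}. 1 - 2 * (if i \<in> \<mu> then 1 else 0))"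
    by (rule sum.cong) (auto simp: tau_def)
  also have "\<dots> = of_nat n - 2 * (\<Sum>i\<in>{1..n}. if i \<in> \<mu> then 1 else 0)"
    by (simp add: sum_subtractf sum_distrib_left)
  also have "(\<Sum>i\<in>{1..n}. if i \<in> \<mu> then 1 else 0) = (of_nat (card \<mu>) :: complex)"
    using assms by (simp add: sum.If_cases Int_absorb1)
  finally show ?thesis .
qed

text \<open>The sum over the neighbours of \<open>\<alpha>\<close> is the sum over the differences \<open>D\<close> with one or two elements, and \<open>\<tau>\<^sub>\<mu>\<close> is
multiplicative.\<close>

lemma adj_tau:
  assumes \<alpha>: "\<alpha> \<in> Z2_vectors n" and \<mu>: "\<mu> \<in> Z2_vectors n"
  shows "(\<Sum>\<gamma>\<in>Z2_vectors n. adj_coeff n \<alpha> \<gamma> * tau \<mu> \<gamma>) = eigval n (card \<mu>) * tau \<mu> \<alpha>"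
proof -
  have bij: "bij_betw (sym_diff \<alpha>) (Z2_vectors n) (Z2_vectors n)"
    by (rule bij_betw_byWitness[where f' = "sym_diff \<alpha>"]) (use \<alpha> in \<open>auto simp: Z2_vectors_def\<close>)
  have "(\<Sum>\<gamma>\<in>Z2_vectors n. adj_coeff n \<alpha> \<gamma> * tau \<mu> \<gamma>)
      = (\<Sum>D\<in>Z2_vectors n. adj_coeff n \<alpha> (sym_diff \<alpha> D) * tau \<mu> (sym_diff \<alpha> D))"
    by (rule sum.reindex_bij_betw[OF bij, symmetric])
  also have "\<dots> = (\<Sum>D\<in>Z2_vectors n. if card D \<in> {1, 2} then tau \<mu> \<alpha> * tau \<mu> D else 0)"
  proof (rule sum.cong[OF refl])
    fix D assume D: "D \<in> Z2_vectors n"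
    have 1: "sym_diff \<alpha> (sym_diff \<alpha> D) = D" by auto
    have 2: "sym_diff \<alpha> D \<in> Z2_vectors n" using \<alpha> D by (auto simp: Z2_vectors_def)
    have 3: "tau \<mu> (sym_diff \<alpha> D) = tau \<mu> \<alpha> * tau \<mu> D"
      using tau_mult[OF finite_Z2_vector[OF \<mu>], of \<alpha> D] by (simp only: tau_commute[of _ \<mu>])
    show "adj_coeff n \<alpha> (sym_diff \<alpha> D) * tau \<mu> (sym_diff \<alpha> D)
        = (if card D \<in> {1, 2} then tau \<mu> \<alpha> * tau \<mu> D else 0)"
      unfolding adj_coeff_def halved_cube_adj_card[OF \<alpha> 2] 1 3 by simp
  qed
  also have "\<dots> = (\<Sum>D | D \<subseteq> {1..n} \<and> card D \<in> {1, 2}. tau \<mu> \<alpha> * tau \<mu> D)"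
  proof -
    have "{D. D \<subseteq> {1..n} \<and> card D \<in> {1::nat, 2}} = {D \<in> Z2_vectors n. card D \<in> {1, 2}}"
      by (auto simp: Z2_vectors_def)
    then show ?thesis by (simp only: sum.inter_filter finite_Z2)
  qed
  also have "\<dots> = tau \<mu> \<alpha> * (\<Sum>D | D \<subseteq> {1..n} \<and> card D \<in> {1, 2}. prod (\<lambda>i. tau \<mu> {i}) D)"
    unfolding sum_distrib_left
  proof (rule sum.cong[OF refl])
    fix D assume "D \<in> {D. D \<subseteq> {1..n} \<and> card D \<in> {1, 2}}"
    then have "finite D" by (auto intro: finite_subset)
    then show "tau \<mu> \<alpha> * tau \<mu> D = tau \<mu> \<alpha> * prod (\<lambda>i. tau \<mu> {i}) D"
      unfolding tau_eq_prod[OF \<open>finite D\<close>] by (auto simp: tau_def intro!: prod.cong)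
  qed
  also have "(\<Sum>D | D \<subseteq> {1..n} \<and> card D \<in> {1, 2}. prod (\<lambda>i. tau \<mu> {i}) D)
      = (((of_nat n - 2 * of_nat (card \<mu>)) + 1)\<^sup>2 - of_nat (n + 1)) / 2"
    using \<mu> by (subst sum_card_le_2) (simp_all only: tau_square sum_tau_singletons Z2_vectors_def Pow_iff
        card_atLeastAtMost finite_atLeastAtMost diff_Suc_1 add_diff_cancel_right')
  also have "\<dots> = eigval n (card \<mu>)" by (simp add: eigval_def algebra_simps)
  finally show ?thesis by (simp add: mult.commute)
qed

lemma eigval_complement: "k \<le> n + 1 \<Longrightarrow> eigval n (n + 1 - k) = eigval n k"
  by (simp add: eigval_def of_nat_diff power2_eq_square algebra_simps)

lemma eigval_eq_iff:
  assumes "k \<le> n + 1" "l \<le> n + 1"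
  shows "eigval n k = eigval n l \<longleftrightarrow> k = l \<or> k + l = n + 1"
proof -
  have "eigval n k = eigval n l \<longleftrightarrow>
      (of_nat (n + 1) - 2 * of_nat k :: complex)\<^sup>2 = (of_nat (n + 1) - 2 * of_nat l)\<^sup>2"
    by (simp add: eigval_def)
  also have "\<dots> \<longleftrightarrow> (of_nat k :: complex) = of_nat l \<or> of_nat k + of_nat l = (of_nat (n + 1) :: complex)"
  proof -
    have "N - 2 * a = N - 2 * b \<or> N - 2 * a = - (N - 2 * b) \<longleftrightarrow> a = b \<or> a + b = N" for N a b :: complex
    proof -
      have "N - 2 * a + (N - 2 * b) = 2 * (N - (a + b))" by (simp add: algebra_simps)
      then have "N - 2 * a = - (N - 2 * b) \<longleftrightarrow> 2 * (N - (a + b)) = 0"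
        by (simp only: eq_neg_iff_add_eq_0)
      also have "\<dots> \<longleftrightarrow> a + b = N"
        by (simp only: mult_eq_0_iff right_minus_eq zero_neq_numeral[symmetric] simp_thms) (rule eq_commute)
      finally show ?thesis by simp
    qed
    then show ?thesis by (simp only: power2_eq_iff)
  qed
  also have "\<dots> \<longleftrightarrow> k = l \<or> k + l = n + 1"
    by (simp only: of_nat_eq_iff flip: of_nat_add)
  finally show ?thesis .
qed

lemma card_tau_exponent:
  assumes "I \<subseteq> {1..n+1}"
  shows "card (tau_exponent n I) = (if n + 1 \<in> I then n + 1 - card I else card I)"
proof (cases "n + 1 \<in> I")
  case True
  have "{1..n} - I = {1..n+1} - I" using True by (auto simp: le_Suc_eq)
  moreover have "card ({1..n+1} - I) = n + 1 - card I"
    using assms by (subst card_Diff_subset) (auto intro: finite_subset)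
  ultimately show ?thesis using True by (simp add: tau_exponent_def)
qed (simp add: tau_exponent_def)

lemma eigval_tau_exponent:
  assumes "I \<subseteq> {1..n+1}"
  shows "eigval n (card (tau_exponent n I)) = eigval n (card I)"
proof -
  have "card I \<le> card {1..n+1}" using assms by (intro card_mono) auto
  then have "card I \<le> n + 1" by simp
  then show ?thesis using eigval_complement[of "card I" n] card_tau_exponent[OF assms] by simp
qed

section \<open>Quantum automorphisms and special orthogonal matrices\<close>

locale quantum_permutation =
  fixes V :: "'v set" and u :: "'v \<Rightarrow> 'v \<Rightarrow> 'a::complex_star_algebra"
  assumes finite_V: "finite V"
    and idem: "i \<in> V \<Longrightarrow> j \<in> V \<Longrightarrow> u i j * u i j = u i j"
    and selfadj: "i \<in> V \<Longrightarrow> j \<in> V \<Longrightarrow> star (u i j) = u i j"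
    and row_disj: "i \<in> V \<Longrightarrow> j \<in> V \<Longrightarrow> k \<in> V \<Longrightarrow> j \<noteq> k \<Longrightarrow> u i j * u i k = 0"
    and col_disj: "i \<in> V \<Longrightarrow> j \<in> V \<Longrightarrow> k \<in> V \<Longrightarrow> j \<noteq> k \<Longrightarrow> u j i * u k i = 0"
    and row_sum: "i \<in> V \<Longrightarrow> (\<Sum>k\<in>V. u i k) = 1"
    and col_sum: "j \<in> V \<Longrightarrow> (\<Sum>k\<in>V. u k j) = 1"

locale cube_quantum_automorphism = quantum_permutation "Z2_vectors n" u for n and u :: "nat set \<Rightarrow> nat set \<Rightarrow> 'a::complex_star_algebra" +
  assumes intertwine: "\<alpha> \<in> Z2_vectors n \<Longrightarrow> \<beta> \<in> Z2_vectors n \<Longrightarrow>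
    (\<Sum>\<gamma>\<in>Z2_vectors n. adj_coeff n \<alpha> \<gamma> *\<^sub>C u \<gamma> \<beta>) = (\<Sum>\<gamma>\<in>Z2_vectors n. adj_coeff n \<gamma> \<beta> *\<^sub>C u \<alpha> \<gamma>)"

locale anticommutative_SO = anticommutative_matrix "{1..M}" v for M and v :: "nat \<Rightarrow> nat \<Rightarrow> 'a::complex_star_algebra" +
  assumes row_orth: "i \<in> {1..M} \<Longrightarrow> k \<in> {1..M} \<Longrightarrow> (\<Sum>j\<in>{1..M}. v i j * v k j) = (if i = k then 1 else 0)"
    and det_row: "(\<Sum>\<sigma> | \<sigma> permutes {1..M}. prod_list (map (\<lambda>i. v i (\<sigma> i)) [1..<M+1])) = 1"
    and selfadj: "i \<in> {1..M} \<Longrightarrow> j \<in> {1..M} \<Longrightarrow> star (v i j) = v i j"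

lemma bij_betw_map_permutes:
  assumes "distinct js"
  shows "bij_betw (\<lambda>\<sigma>. map \<sigma> js) {\<sigma>. \<sigma> permutes set js} (permutations_of_set (set js))"
proof -
  have inj: "inj_on (\<lambda>\<sigma>. map \<sigma> js) {\<sigma>. \<sigma> permutes set js}"
  proof (rule inj_onI, rule ext)
    fix \<sigma> \<tau> i assume "\<sigma> \<in> {\<sigma>. \<sigma> permutes set js}" "\<tau> \<in> {\<sigma>. \<sigma> permutes set js}" "map \<sigma> js = map \<tau> js"
    then show "\<sigma> i = \<tau> i" by (cases "i \<in> set js") (auto simp: permutes_def)
  qed
  have sub: "(\<lambda>\<sigma>. map \<sigma> js) ` {\<sigma>. \<sigma> permutes set js} \<subseteq> permutations_of_set (set js)"
    using assms by (auto simp: permutations_of_set_def distinct_map permutes_inj_on permutes_image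
        simp del: image_iff)
  have "card ((\<lambda>\<sigma>. map \<sigma> js) ` {\<sigma>. \<sigma> permutes set js}) = card (permutations_of_set (set js))"
    using inj by (simp add: card_image card_permutations)
  then show ?thesis unfolding bij_betw_def using inj sub
    by (simp add: card_subset_eq)
qed

context anticommutative_matrix
begin

text \<open>Entries in distinct rows and columns commute, so every product may be ordered by columns instead of
rows.\<close>

lemma det_rows_eq_cols:
  assumes "distinct js" "set js \<subseteq> N"
  shows "(\<Sum>\<sigma> | \<sigma> permutes set js. prod_list (map (\<lambda>i. v i (\<sigma> i)) js)) = minor (set js) js"
proof -
  have "(\<Sum>\<sigma> | \<sigma> permutes set js. prod_list (map (\<lambda>i. v i (\<sigma> i)) js))
      = (\<Sum>\<sigma> | \<sigma> permutes set js. row_prod js (map \<sigma> js))"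
    by (simp add: map2_map_map[of v "\<lambda>x. x" js, simplified])
  also have "\<dots> = (\<Sum>ks\<in>permutations_of_set (set js). row_prod js ks)"
    by (rule sum.reindex_bij_betw[OF bij_betw_map_permutes[OF assms(1)]])
  also have "\<dots> = (\<Sum>\<sigma> | \<sigma> permutes {..<length js}. row_prod js (permute_list \<sigma> js))"
    by (rule sum.reindex_bij_betw[OF bij_betw_permute_list[OF assms(1)], symmetric])
  also have "\<dots> = (\<Sum>\<sigma> | \<sigma> permutes {..<length js}. row_prod (permute_list (inv_into UNIV \<sigma>) js) js)"
  proof (rule sum.cong[OF refl])
    fix \<sigma> assume "\<sigma> \<in> {\<sigma>. \<sigma> permutes {..<length js}}"
    then have \<sigma>: "\<sigma> permutes {..<length js}" "inv_into UNIV \<sigma> permutes {..<length js}"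
      by (auto intro: permutes_inv)
    have "row_prod (permute_list \<sigma> (permute_list (inv_into UNIV \<sigma>) js)) (permute_list \<sigma> js)
        = row_prod (permute_list (inv_into UNIV \<sigma>) js) js"
      using \<sigma> assms by (intro row_prod_permute) auto
    moreover have "permute_list \<sigma> (permute_list (inv_into UNIV \<sigma>) js) = js"
      using \<sigma> by (simp flip: permute_list_compose add: permutes_inv_o[OF \<sigma>(1)])
    ultimately show "row_prod js (permute_list \<sigma> js) = row_prod (permute_list (inv_into UNIV \<sigma>) js) js"
      by simp
  qed
  also have "\<dots> = (\<Sum>\<sigma> | \<sigma> permutes {..<length js}. row_prod (permute_list \<sigma> js) js)"
  proof (rule sum.reindex_bij_betw)
    show "bij_betw (inv_into UNIV) {\<sigma>. \<sigma> permutes {..<length js}} {\<sigma>. \<sigma> permutes {..<length js}}"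
      by (rule bij_betw_byWitness[where f' = "inv_into UNIV"]) (auto simp: permutes_inv_inv intro: permutes_inv)
  qed
  also have "\<dots> = minor (set js) js"
    unfolding minor_def by (rule sum.reindex_bij_betw[OF bij_betw_permute_list[OF assms(1)]])
  finally show ?thesis .
qed

lemma minor_full:
  assumes "distinct js"
  shows "minor (set js) js = (\<Sum>\<sigma> | \<sigma> permutes set js. prod_list (map (\<lambda>i. v (\<sigma> i) i) js))"
proof -
  have "minor (set js) js = (\<Sum>\<sigma> | \<sigma> permutes set js. row_prod (map \<sigma> js) js)"
    unfolding minor_def by (rule sum.reindex_bij_betw[OF bij_betw_map_permutes[OF assms], symmetric])
  then show ?thesis by (simp add: map2_map_map[of v _ js "\<lambda>x. x", simplified])
qed

end

lemma set_upt_Suc: "set [1..<m+1] = {1..m}" by auto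

context anticommutative_SO
begin

lemma minor_one: "minor {1..M} [1..<M+1] = 1"
  using det_rows_eq_cols[of "[1..<M+1]"] det_row by (simp only: set_upt_Suc distinct_upt order_refl simp_thms)

lemma transpose: "anticommutative_SO M (\<lambda>i j. v j i)"
proof
  show "(\<Sum>\<sigma> | \<sigma> permutes {1..M}. prod_list (map (\<lambda>i. v (\<sigma> i) i) [1..<M+1])) = 1"
    using minor_full[of "[1..<M+1]"] minor_one by (simp only: set_upt_Suc distinct_upt simp_thms)
qed (simp_all only: finite_index row_orth col_orth selfadj, (rule anti_row anti_col comm; assumption?)+)

end

section \<open>From anticommutative matrices to quantum automorphisms\<close>

text \<open>The instance of \<open>column_comb\<close> for the signs \<open>\<tau>\<^sub>i(\<alpha>)\<close>; it is available for every matrix \<open>v\<close>.\<close>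

definition tau_image :: "nat \<Rightarrow> (nat \<Rightarrow> nat \<Rightarrow> 'a::complex_star_algebra) \<Rightarrow> nat set \<Rightarrow> nat \<Rightarrow> 'a" where
  "tau_image n v \<alpha> j = (\<Sum>i\<in>{1..n+1}. tau_gen n \<alpha> i *\<^sub>C v i j)"

text \<open>The entry in row \<open>\<alpha>\<close> and column \<open>\<beta>\<close> is the image of the indicator function
\<open>\<delta>\<^sub>\<beta> = \<Prod>j. (1 + \<tau>\<^sub>j(\<beta>) \<tau>\<^sub>j) / 2\<close>, evaluated at \<open>\<alpha>\<close>.  The product is over \<open>j \<le> n\<close>, as \<open>\<tau>\<^sub>1, \<dots>, \<tau>\<^sub>n\<close> separate
the vertices.\<close>

definition cube_matrix :: "nat \<Rightarrow> (nat \<Rightarrow> nat \<Rightarrow> 'a::complex_star_algebra) \<Rightarrow> nat set \<Rightarrow> nat set \<Rightarrow> 'a" where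
  "cube_matrix n v \<alpha> \<beta> = joint_proj (tau_gen n \<beta>) (tau_image n v \<alpha>) [1..<n+1]"

text \<open>Expanding the product of the identities \<open>(1 + x j) / 2 + (1 - x j) / 2 = 1\<close>.\<close>

lemma sum_sign_projections:
  "(\<Sum>\<beta>\<in>Pow {1..m}. joint_proj (\<lambda>j. if j \<in> \<beta> then -1 else 1) x [1..<m+1]) = (1::'a::complex_star_algebra)"
proof (induct m)
  case 0
  show ?case by (simp add: joint_proj_def)
next
  case (Suc m)
  let ?P = "\<lambda>\<beta> js. joint_proj (\<lambda>j. if j \<in> \<beta> then -1 else 1) x js"
  have list: "[1..<Suc m + 1] = [1..<m+1] @ [Suc m]" by simp
  have split: "?P \<beta> [1..<Suc m + 1] = ?P \<beta> [1..<m+1] * ((1/2) *\<^sub>C (1 + (if Suc m \<in> \<beta> then -1 else 1) *\<^sub>C x (Suc m)))" for \<beta>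
    unfolding list joint_proj_def by simp
  have ins: "?P (insert (Suc m) \<beta>) [1..<m+1] = ?P \<beta> [1..<m+1]" for \<beta>
    unfolding joint_proj_def by (rule arg_cong[of _ _ prod_list]) auto
  have Pow: "Pow {1..Suc m} = Pow {1..m} \<union> insert (Suc m) ` Pow {1..m}"
    by (simp add: atLeastAtMostSuc_conv Pow_insert)
  have "(\<Sum>\<beta>\<in>Pow {1..Suc m}. ?P \<beta> [1..<Suc m + 1])
      = (\<Sum>\<beta>\<in>Pow {1..m}. ?P \<beta> [1..<Suc m + 1]) + (\<Sum>\<beta>\<in>insert (Suc m) ` Pow {1..m}. ?P \<beta> [1..<Suc m + 1])"
    unfolding Pow by (rule sum.union_disjoint) auto
  also have "(\<Sum>\<beta>\<in>insert (Suc m) ` Pow {1..m}. ?P \<beta> [1..<Suc m + 1])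
      = (\<Sum>\<beta>\<in>Pow {1..m}. ?P (insert (Suc m) \<beta>) [1..<Suc m + 1])"
  proof (rule sum.reindex[unfolded o_def])
    show "inj_on (insert (Suc m)) (Pow {1..m})" 
    proof (rule inj_onI)
      fix \<beta> \<beta>' assume "\<beta> \<in> Pow {1..m}" "\<beta>' \<in> Pow {1..m}"
        and eq: "insert (Suc m) \<beta> = insert (Suc m) \<beta>'"
      then have "Suc m \<notin> \<beta>" "Suc m \<notin> \<beta>'" by auto
      then show "\<beta> = \<beta>'" using eq by (simp add: insert_ident)
    qed
  qed
  also have "(\<Sum>\<beta>\<in>Pow {1..m}. ?P \<beta> [1..<Suc m + 1]) + \<dots>
      = (\<Sum>\<beta>\<in>Pow {1..m}. ?P \<beta> [1..<m+1])"
    unfolding sum.distrib[symmetric]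
  proof (rule sum.cong[OF refl])
    fix \<beta> assume "\<beta> \<in> Pow {1..m}"
    then have "Suc m \<notin> \<beta>" by auto
    then have "?P \<beta> [1..<Suc m + 1] + ?P (insert (Suc m) \<beta>) [1..<Suc m + 1]
        = ?P \<beta> [1..<m+1] * ((1/2) *\<^sub>C (1 + x (Suc m)) + (1/2) *\<^sub>C (1 - x (Suc m)))"
      by (simp only: split ins distrib_left) simp
    also have "(1/2) *\<^sub>C (1 + x (Suc m)) + (1/2) *\<^sub>C (1 - x (Suc m)) = (1/2 + 1/2) *\<^sub>C 1"
      by (simp only: scaleC_add_left flip: scaleC_add_right) (simp add: scaleC_add_right)
    finally show "?P \<beta> [1..<Suc m + 1] + ?P (insert (Suc m) \<beta>) [1..<Suc m + 1] = ?P \<beta> [1..<m+1]"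
      by simp
  qed
  finally show ?case using Suc by simp
qed

lemma prod_list_eigen:
  assumes "\<And>j. j \<in> set js \<Longrightarrow> x j * z = t j *\<^sub>C (z::'a::complex_star_algebra)"
  shows "prod_list (map x js) * z = prod_list (map t js) *\<^sub>C z"
  using assms by (induct js) (simp_all add: mult.assoc mult.commute)

locale cube_SO = anticommutative_SO "n + 1" v for n and v :: "nat \<Rightarrow> nat \<Rightarrow> 'a::complex_star_algebra"
begin

lemma tau_image: "tau_image n v \<alpha> = column_comb (tau_gen n \<alpha>)"
  by (rule ext) (simp only: tau_image_def column_comb_def)

lemmas tau_image_square = column_comb_square[of "tau_gen n \<alpha>" for \<alpha>, OF tau_gen_square, folded tau_image]
lemmas tau_image_commute = column_comb_commute[of "tau_gen n \<alpha>" for \<alpha>, OF tau_gen_square, folded tau_image]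

lemma prod_tau_image:
  assumes \<alpha>: "\<alpha> \<in> Z2_vectors n" and J: "J \<subseteq> {1..n+1}"
  shows "prod_list (map (tau_image n v \<alpha>) (sorted_list_of_set J))
    = (\<Sum>I\<in>k_subsets (n+1) (card J). tau (tau_exponent n I) \<alpha> *\<^sub>C minor I (sorted_list_of_set J))"
proof -
  have fin: "finite J" using J by (rule finite_subset) simp
  have "prod_list (map (column_comb (tau_gen n \<alpha>)) (sorted_list_of_set J))
      = (\<Sum>I | I \<subseteq> {1..n+1} \<and> card I = length (sorted_list_of_set J).
          prod (tau_gen n \<alpha>) I *\<^sub>C minor I (sorted_list_of_set J))"
    by (rule prod_column_comb_minor) (use J fin in \<open>simp_all add: tau_gen_square\<close>)
  also have "\<dots> = (\<Sum>I\<in>k_subsets (n+1) (card J). tau (tau_exponent n I) \<alpha> *\<^sub>C minor I (sorted_list_of_set J))"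
    unfolding k_subsets_def using prod_tau_gen[OF _ \<alpha>] by (intro sum.cong) auto
  finally show ?thesis unfolding tau_image .
qed

lemma sorted_list_of_upto: "sorted_list_of_set {1..m} = [1..<m+1]"
  by (metis One_nat_def Suc_eq_plus1 atLeastLessThanSuc_atLeastAtMost sorted_list_of_set_range)

lemma prod_tau_image_full:
  assumes \<alpha>: "\<alpha> \<in> Z2_vectors n"
  shows "prod_list (map (tau_image n v \<alpha>) [1..<n+1]) * tau_image n v \<alpha> (n+1) = 1"
proof -
  have K: "k_subsets (n+1) (n+1) = {{1..n+1}}"
  proof -
    have "I = {1..n+1}" if "I \<subseteq> {1..n+1}" "card I = n+1" for I
      using that by (intro card_subset_eq) auto
    then show ?thesis by (auto simp: k_subsets_def)
  qed
  have "prod_list (map (tau_image n v \<alpha>) [1..<n+1+1]) = 1"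
  proof -
    have e: "tau_exponent n {1..n+1} = {}" by (auto simp: tau_exponent_def)
    have c: "card {1..n+1} = n+1" by simp
    show ?thesis
      using prod_tau_image[OF \<alpha> order_refl] unfolding c K sorted_list_of_upto
      by (simp add: e minor_one tau_def del: upt_Suc One_nat_def)
  qed
  then show ?thesis by simp
qed

lemma tau_image_last:
  assumes \<alpha>: "\<alpha> \<in> Z2_vectors n"
  shows "prod_list (map (tau_image n v \<alpha>) [1..<n+1]) = tau_image n v \<alpha> (n+1)"
proof -
  have "prod_list (map (tau_image n v \<alpha>) [1..<n+1]) * (tau_image n v \<alpha> (n+1) * tau_image n v \<alpha> (n+1))
      = tau_image n v \<alpha> (n+1)"
    using prod_tau_image_full[OF \<alpha>] by (simp flip: mult.assoc)
  then show ?thesis using tau_image_square[of "n+1" \<alpha>] by simp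
qed

text \<open>The determinant condition makes the image of \<open>\<tau>\<^sub>n\<^sub>+\<^sub>1\<close> the product of the images of \<open>\<tau>\<^sub>1, \<dots>, \<tau>\<^sub>n\<close>, so
the eigenvalue equations for \<open>j \<le> n\<close> imply the one for \<open>n + 1\<close>.\<close>

lemma tau_image_last_eigen:
  assumes \<alpha>: "\<alpha> \<in> Z2_vectors n" and \<beta>: "\<beta> \<in> Z2_vectors n"
    and z: "\<And>j. j \<in> {1..n} \<Longrightarrow> tau_image n v \<alpha> j * z = tau_gen n \<beta> j *\<^sub>C z"
  shows "tau_image n v \<alpha> (n+1) * z = tau_gen n \<beta> (n+1) *\<^sub>C z"
proof -
  have "prod_list (map (tau_gen n \<beta>) [1..<n+1]) = prod (tau_gen n \<beta>) {1..n}"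
    using prod.distinct_set_conv_list[of "[1..<n+1]" "tau_gen n \<beta>"] by (simp only: distinct_upt set_upt_Suc)
  also have "\<dots> = tau_gen n \<beta> (n+1)"
  proof -
    have "{1..n} - {n+1} = {1..n}" by auto
    then show ?thesis using prod_tau_gen[OF _ \<beta>, of "{1..n}"]
      by (simp add: tau_gen_def tau_exponent_def atLeastAtMostSuc_conv subset_insertI)
  qed
  finally have t: "prod_list (map (tau_gen n \<beta>) [1..<n+1]) = tau_gen n \<beta> (n+1)" .
  show ?thesis unfolding tau_image_last[OF \<alpha>, symmetric] t[symmetric]
    by (rule prod_list_eigen) (use z in auto)
qed

lemma cube_matrix_eigen:
  assumes \<alpha>: "\<alpha> \<in> Z2_vectors n" and \<beta>: "\<beta> \<in> Z2_vectors n" and j: "j \<in> {1..n+1}"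
  shows "tau_image n v \<alpha> j * cube_matrix n v \<alpha> \<beta> = tau_gen n \<beta> j *\<^sub>C cube_matrix n v \<alpha> \<beta>"
proof -
  have *: "tau_image n v \<alpha> j * cube_matrix n v \<alpha> \<beta> = tau_gen n \<beta> j *\<^sub>C cube_matrix n v \<alpha> \<beta>"
    if "j \<in> {1..n}" for j
    unfolding cube_matrix_def by (rule joint_proj_eigen)
      (use that tau_image_square tau_image_commute in \<open>auto simp: tau_gen_square\<close>)
  show ?thesis
  proof (cases "j = n + 1")
    case True
    then show ?thesis using tau_image_last_eigen[OF \<alpha> \<beta> *] by simp
  next
    case False
    then show ?thesis using * j by simp
  qed
qed

lemma cube_matrix_absorb:
  assumes "\<And>j. j \<in> {1..n} \<Longrightarrow> tau_image n v \<alpha> j * z = tau_gen n \<beta> j *\<^sub>C z"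
  shows "cube_matrix n v \<alpha> \<beta> * z = z"
  unfolding cube_matrix_def by (rule joint_proj_absorb) (use assms in \<open>auto simp: tau_gen_square\<close>)

lemma cube_matrix_annihilate:
  assumes "\<beta> \<in> Z2_vectors n" "\<beta>' \<in> Z2_vectors n" "\<beta> \<noteq> \<beta>'"
    and "\<And>j. j \<in> {1..n} \<Longrightarrow> tau_image n v \<alpha> j * z = tau_gen n \<beta>' j *\<^sub>C z"
  shows "cube_matrix n v \<alpha> \<beta> * z = 0"
proof -
  obtain j where j: "j \<in> {1..n}" "tau {j} \<beta> * tau {j} \<beta>' = -1"
    using tau_separates assms(1-3) by blast
  show ?thesis unfolding cube_matrix_def
    by (rule joint_proj_annihilate[where t' = "tau_gen n \<beta>'" and j = j]) (use j assms tau_gen_le in auto)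
qed

lemma cube_matrix_star: "star (cube_matrix n v \<alpha> \<beta>) = cube_matrix n v \<alpha> \<beta>"
  unfolding cube_matrix_def
proof (rule star_joint_proj)
  show "star (tau_image n v \<alpha> j) = tau_image n v \<alpha> j" if "j \<in> set [1..<n+1]" for j
    unfolding tau_image_def star_sum by (rule sum.cong) (use that selfadj in \<open>auto simp: star_scaleC\<close>)
  show "tau_image n v \<alpha> j * tau_image n v \<alpha> k = tau_image n v \<alpha> k * tau_image n v \<alpha> j"
    if "j \<in> set [1..<n+1]" "k \<in> set [1..<n+1]" for j k
    using that by (intro tau_image_commute) auto
qed simp

lemma cube_matrix_row_sum: "(\<Sum>\<beta>\<in>Z2_vectors n. cube_matrix n v \<alpha> \<beta>) = 1"
proof -
  have "cube_matrix n v \<alpha> \<beta> = joint_proj (\<lambda>j. if j \<in> \<beta> then -1 else 1) (tau_image n v \<alpha>) [1..<n+1]" for \<beta>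
    unfolding cube_matrix_def joint_proj_def
    by (rule arg_cong[of _ _ prod_list], rule map_cong[OF refl]) (auto simp: tau_gen_le[of _ n \<beta>] tau_def)
  then show ?thesis using sum_sign_projections[where m = n and x = "tau_image n v \<alpha>"]
    by (simp only: Z2_vectors_def)
qed

text \<open>With \<open>u\<close> for the entry of \<open>cube_matrix\<close>, the eigenvalue equations \<open>x\<^sub>j(\<alpha>) u = \<tau>\<^sub>j(\<beta>) u\<close> and the
orthonormality of the rows of \<open>v\<close> give
\<open>\<Sum>j. \<tau>\<^sub>j(\<beta>) v i j u = \<Sum>j. v i j x\<^sub>j(\<alpha>) u = \<Sum>k. \<tau>\<^sub>k(\<alpha>) (\<Sum>j. v i j v k j) u = \<tau>\<^sub>i(\<alpha>) u\<close>.
These are the eigenvalue equations for the transpose of \<open>v\<close>, with \<open>\<alpha>\<close> and \<open>\<beta>\<close> exchanged.\<close>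

lemma tau_image_transpose_eigen:
  assumes \<alpha>: "\<alpha> \<in> Z2_vectors n" and \<beta>: "\<beta> \<in> Z2_vectors n" and i: "i \<in> {1..n+1}"
  shows "tau_image n (\<lambda>i j. v j i) \<beta> i * cube_matrix n v \<alpha> \<beta> = tau_gen n \<alpha> i *\<^sub>C cube_matrix n v \<alpha> \<beta>"
proof -
  let ?N = "{1..n+1}" and ?U = "cube_matrix n v \<alpha> \<beta>"
  have "tau_image n (\<lambda>i j. v j i) \<beta> i * ?U = (\<Sum>j\<in>?N. v i j * (tau_gen n \<beta> j *\<^sub>C ?U))"
    by (simp only: tau_image_def sum_distrib_right mult_scaleC_left mult_scaleC_right)
  also have "\<dots> = (\<Sum>j\<in>?N. v i j * (tau_image n v \<alpha> j * ?U))"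
    by (rule sum.cong) (simp_all only: cube_matrix_eigen[OF \<alpha> \<beta>])
  also have "\<dots> = (\<Sum>j\<in>?N. \<Sum>k\<in>?N. tau_gen n \<alpha> k *\<^sub>C (v i j * v k j * ?U))"
    by (simp only: tau_image_def sum_distrib_left sum_distrib_right mult.assoc mult_scaleC_left mult_scaleC_right)
  also have "\<dots> = (\<Sum>k\<in>?N. \<Sum>j\<in>?N. tau_gen n \<alpha> k *\<^sub>C (v i j * v k j * ?U))"
    by (rule sum.swap)
  also have "\<dots> = (\<Sum>k\<in>?N. tau_gen n \<alpha> k *\<^sub>C ((\<Sum>j\<in>?N. v i j * v k j) * ?U))"
    by (simp only: scaleC_sum_right sum_distrib_right)
  also have "\<dots> = (\<Sum>k\<in>?N. if k = i then tau_gen n \<alpha> k *\<^sub>C ?U else 0)"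
    by (rule sum.cong) (use i row_orth in auto)
  also have "\<dots> = tau_gen n \<alpha> i *\<^sub>C ?U" using i by (simp del: One_nat_def)
  finally show ?thesis .
qed

lemma transpose_cube_SO: "cube_SO n (\<lambda>i j. v j i)"
  unfolding cube_SO_def by (rule transpose)

text \<open>By \<open>tau_image_transpose_eigen\<close> each of the two self-adjoint elements absorbs the other from the left, so they
are equal.  Thus every relation between the entries of a row of \<open>cube_matrix\<close> also holds for
the entries of a column.\<close>

lemma cube_matrix_transpose:
  assumes \<alpha>: "\<alpha> \<in> Z2_vectors n" and \<beta>: "\<beta> \<in> Z2_vectors n"
  shows "cube_matrix n (\<lambda>i j. v j i) \<beta> \<alpha> = cube_matrix n v \<alpha> \<beta>"
proof -
  interpret t: cube_SO n "\<lambda>i j. v j i" by (rule transpose_cube_SO)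
  let ?U = "cube_matrix n v \<alpha> \<beta>" and ?W = "cube_matrix n (\<lambda>i j. v j i) \<beta> \<alpha>"
  have "?W * ?U = ?U" by (rule t.cube_matrix_absorb) (use tau_image_transpose_eigen[OF \<alpha> \<beta>] in auto)
  moreover have "?U * ?W = ?W" by (rule cube_matrix_absorb) (use t.tau_image_transpose_eigen[OF \<beta> \<alpha>] in auto)
  moreover have "star (?W * ?U) = ?U * ?W" by (simp add: star_mult cube_matrix_star t.cube_matrix_star)
  ultimately show ?thesis using cube_matrix_star by metis
qed

text \<open>The spectral decomposition of the commuting involutions \<open>x\<^sub>j(\<alpha>)\<close>.\<close>

lemma prod_tau_image_cube_matrix:
  assumes \<alpha>: "\<alpha> \<in> Z2_vectors n" and J: "J \<subseteq> {1..n+1}"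
  shows "prod_list (map (tau_image n v \<alpha>) (sorted_list_of_set J))
    = (\<Sum>\<beta>\<in>Z2_vectors n. tau (tau_exponent n J) \<beta> *\<^sub>C cube_matrix n v \<alpha> \<beta>)"
proof -
  have fin: "finite J" using J by (rule finite_subset) simp
  let ?X = "prod_list (map (tau_image n v \<alpha>) (sorted_list_of_set J))"
  have "?X = ?X * (\<Sum>\<beta>\<in>Z2_vectors n. cube_matrix n v \<alpha> \<beta>)" by (simp add: cube_matrix_row_sum)
  also have "\<dots> = (\<Sum>\<beta>\<in>Z2_vectors n. ?X * cube_matrix n v \<alpha> \<beta>)" by (simp add: sum_distrib_left)
  also have "\<dots> = (\<Sum>\<beta>\<in>Z2_vectors n. tau (tau_exponent n J) \<beta> *\<^sub>C cube_matrix n v \<alpha> \<beta>)"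
  proof (rule sum.cong[OF refl])
    fix \<beta> assume \<beta>: "\<beta> \<in> Z2_vectors n"
    have "?X * cube_matrix n v \<alpha> \<beta> = prod_list (map (tau_gen n \<beta>) (sorted_list_of_set J)) *\<^sub>C cube_matrix n v \<alpha> \<beta>"
      by (rule prod_list_eigen) (use cube_matrix_eigen[OF \<alpha> \<beta>] J fin in auto)
    also have "prod_list (map (tau_gen n \<beta>) (sorted_list_of_set J)) = prod (tau_gen n \<beta>) J"
      using fin by (simp flip: prod.distinct_set_conv_list)
    also have "\<dots> = tau (tau_exponent n J) \<beta>" by (rule prod_tau_gen[OF J \<beta>])
    finally show "?X * cube_matrix n v \<alpha> \<beta> = tau (tau_exponent n J) \<beta> *\<^sub>C cube_matrix n v \<alpha> \<beta>" .
  qed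
  finally show ?thesis .
qed

text \<open>The expansion of the image of \<open>\<tau>\<^sub>J\<close> involves only functions \<open>\<tau>\<^sub>I\<close> with \<open>card I = card J\<close>, and these
belong to one eigenvalue of the adjacency matrix.\<close>

lemma adj_prod_tau_image:
  assumes \<alpha>: "\<alpha> \<in> Z2_vectors n" and J: "J \<subseteq> {1..n+1}"
  shows "(\<Sum>\<gamma>\<in>Z2_vectors n. adj_coeff n \<alpha> \<gamma> *\<^sub>C prod_list (map (tau_image n v \<gamma>) (sorted_list_of_set J)))
    = eigval n (card J) *\<^sub>C prod_list (map (tau_image n v \<alpha>) (sorted_list_of_set J))"
proof -
  let ?K = "k_subsets (n+1) (card J)" and ?m = "\<lambda>I. minor I (sorted_list_of_set J)"
  have "(\<Sum>\<gamma>\<in>Z2_vectors n. adj_coeff n \<alpha> \<gamma> *\<^sub>C prod_list (map (tau_image n v \<gamma>) (sorted_list_of_set J)))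
      = (\<Sum>\<gamma>\<in>Z2_vectors n. \<Sum>I\<in>?K. (adj_coeff n \<alpha> \<gamma> * tau (tau_exponent n I) \<gamma>) *\<^sub>C ?m I)"
    by (rule sum.cong) (simp_all add: prod_tau_image[OF _ J] scaleC_sum_right)
  also have "\<dots> = (\<Sum>I\<in>?K. \<Sum>\<gamma>\<in>Z2_vectors n. (adj_coeff n \<alpha> \<gamma> * tau (tau_exponent n I) \<gamma>) *\<^sub>C ?m I)"
    by (rule sum.swap)
  also have "\<dots> = (\<Sum>I\<in>?K. eigval n (card J) *\<^sub>C tau (tau_exponent n I) \<alpha> *\<^sub>C ?m I)"
  proof (rule sum.cong[OF refl])
    fix I assume "I \<in> ?K"
    then have I: "I \<subseteq> {1..n+1}" "card I = card J" by (auto simp: k_subsets_def)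
    have "(\<Sum>\<gamma>\<in>Z2_vectors n. adj_coeff n \<alpha> \<gamma> * tau (tau_exponent n I) \<gamma>) = eigval n (card J) * tau (tau_exponent n I) \<alpha>"
      using adj_tau[OF \<alpha> tau_exponent_Z2[OF I(1)]] eigval_tau_exponent[OF I(1)] I(2) by simp
    then show "(\<Sum>\<gamma>\<in>Z2_vectors n. (adj_coeff n \<alpha> \<gamma> * tau (tau_exponent n I) \<gamma>) *\<^sub>C ?m I)
      = eigval n (card J) *\<^sub>C tau (tau_exponent n I) \<alpha> *\<^sub>C ?m I"
      by (simp flip: scaleC_sum_left)
  qed
  also have "\<dots> = eigval n (card J) *\<^sub>C prod_list (map (tau_image n v \<alpha>) (sorted_list_of_set J))"
    by (simp only: prod_tau_image[OF \<alpha> J] scaleC_sum_right)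
  finally show ?thesis .
qed

text \<open>Both sides have the same Fourier coefficients with respect to \<open>\<beta>\<close>: on the left
\<open>adj_prod_tau_image\<close> yields the eigenvalue at \<open>\<tau>\<^sub>\<mu>\<close>, on the right the symmetry of the adjacency matrix
does.\<close>

lemma cube_matrix_intertwine:
  assumes \<alpha>: "\<alpha> \<in> Z2_vectors n" and \<beta>: "\<beta> \<in> Z2_vectors n"
  shows "(\<Sum>\<gamma>\<in>Z2_vectors n. adj_coeff n \<alpha> \<gamma> *\<^sub>C cube_matrix n v \<gamma> \<beta>)
    = (\<Sum>\<gamma>\<in>Z2_vectors n. adj_coeff n \<gamma> \<beta> *\<^sub>C cube_matrix n v \<alpha> \<gamma>)"
proof (rule fourier_injective[OF _ \<beta>])
  fix \<mu> assume \<mu>: "\<mu> \<in> Z2_vectors n"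
  then have sub: "\<mu> \<subseteq> {1..n+1}" and e: "tau_exponent n \<mu> = \<mu>"
    by (auto simp: Z2_vectors_def tau_exponent_def)
  let ?Z = "Z2_vectors n" and ?U = "cube_matrix n v"
  have "(\<Sum>\<beta>\<in>?Z. tau \<mu> \<beta> *\<^sub>C (\<Sum>\<gamma>\<in>?Z. adj_coeff n \<alpha> \<gamma> *\<^sub>C ?U \<gamma> \<beta>))
      = (\<Sum>\<beta>\<in>?Z. \<Sum>\<gamma>\<in>?Z. adj_coeff n \<alpha> \<gamma> *\<^sub>C tau \<mu> \<beta> *\<^sub>C ?U \<gamma> \<beta>)"
    by (simp add: scaleC_sum_right mult.commute)
  also have "\<dots> = (\<Sum>\<gamma>\<in>?Z. adj_coeff n \<alpha> \<gamma> *\<^sub>C (\<Sum>\<beta>\<in>?Z. tau \<mu> \<beta> *\<^sub>C ?U \<gamma> \<beta>))"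
    unfolding scaleC_sum_right by (rule sum.swap)
  also have "\<dots> = (\<Sum>\<gamma>\<in>?Z. adj_coeff n \<alpha> \<gamma> *\<^sub>C prod_list (map (tau_image n v \<gamma>) (sorted_list_of_set \<mu>)))"
    by (rule sum.cong) (simp_all add: prod_tau_image_cube_matrix[OF _ sub] e)
  also have "\<dots> = eigval n (card \<mu>) *\<^sub>C (\<Sum>\<gamma>\<in>?Z. tau \<mu> \<gamma> *\<^sub>C ?U \<alpha> \<gamma>)"
    by (simp add: adj_prod_tau_image[OF \<alpha> sub] prod_tau_image_cube_matrix[OF \<alpha> sub] e)
  also have "\<dots> = (\<Sum>\<gamma>\<in>?Z. (\<Sum>\<beta>\<in>?Z. adj_coeff n \<gamma> \<beta> * tau \<mu> \<beta>) *\<^sub>C ?U \<alpha> \<gamma>)"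
    by (simp add: adj_tau[OF _ \<mu>] scaleC_sum_right)
  also have "\<dots> = (\<Sum>\<beta>\<in>?Z. \<Sum>\<gamma>\<in>?Z. (adj_coeff n \<gamma> \<beta> * tau \<mu> \<beta>) *\<^sub>C ?U \<alpha> \<gamma>)"
    unfolding scaleC_sum_left by (rule sum.swap)
  also have "\<dots> = (\<Sum>\<beta>\<in>?Z. tau \<mu> \<beta> *\<^sub>C (\<Sum>\<gamma>\<in>?Z. adj_coeff n \<gamma> \<beta> *\<^sub>C ?U \<alpha> \<gamma>))"
    by (simp add: scaleC_sum_right mult.commute)
  finally show "(\<Sum>\<beta>\<in>?Z. tau \<mu> \<beta> *\<^sub>C (\<Sum>\<gamma>\<in>?Z. adj_coeff n \<alpha> \<gamma> *\<^sub>C ?U \<gamma> \<beta>))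
      = (\<Sum>\<beta>\<in>?Z. tau \<mu> \<beta> *\<^sub>C (\<Sum>\<gamma>\<in>?Z. adj_coeff n \<gamma> \<beta> *\<^sub>C ?U \<alpha> \<gamma>))" .
qed

theorem cube_matrix_quantum_automorphism: "cube_quantum_automorphism n (cube_matrix n v)"
proof
  interpret t: cube_SO n "\<lambda>i j. v j i" by (rule transpose_cube_SO)
  fix \<alpha> \<beta> \<gamma> assume \<alpha>: "\<alpha> \<in> Z2_vectors n" and \<beta>: "\<beta> \<in> Z2_vectors n"
  show "cube_matrix n v \<alpha> \<beta> * cube_matrix n v \<alpha> \<beta> = cube_matrix n v \<alpha> \<beta>"
    by (rule cube_matrix_absorb) (simp add: cube_matrix_eigen[OF \<alpha> \<beta>])
  assume \<gamma>: "\<gamma> \<in> Z2_vectors n" and ne: "\<beta> \<noteq> \<gamma>"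
  show "cube_matrix n v \<alpha> \<beta> * cube_matrix n v \<alpha> \<gamma> = 0"
    by (rule cube_matrix_annihilate[OF \<beta> \<gamma> ne]) (simp add: cube_matrix_eigen[OF \<alpha> \<gamma>])
  show "cube_matrix n v \<beta> \<alpha> * cube_matrix n v \<gamma> \<alpha> = 0"
    using t.cube_matrix_annihilate[OF \<beta> \<gamma> ne, of \<alpha> "cube_matrix n v \<gamma> \<alpha>"] t.cube_matrix_eigen[OF \<alpha> \<gamma>]
    by (simp add: cube_matrix_transpose[OF \<beta> \<alpha>] cube_matrix_transpose[OF \<gamma> \<alpha>])
next
  interpret t: cube_SO n "\<lambda>i j. v j i" by (rule transpose_cube_SO)
  fix \<beta> assume "\<beta> \<in> Z2_vectors n"
  then show "(\<Sum>\<alpha>\<in>Z2_vectors n. cube_matrix n v \<alpha> \<beta>) = 1"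
    using t.cube_matrix_row_sum[of \<beta>] by (simp add: cube_matrix_transpose)
qed (simp_all add: cube_matrix_star cube_matrix_row_sum cube_matrix_intertwine)

end

section \<open>From quantum automorphisms to anticommutative matrices\<close>

definition fourier_matrix :: "nat \<Rightarrow> (nat set \<Rightarrow> nat set \<Rightarrow> 'a::complex_star_algebra) \<Rightarrow> nat set \<Rightarrow> nat set \<Rightarrow> 'a" where
  "fourier_matrix n u \<mu> \<nu> =
     (\<Sum>\<alpha>\<in>Z2_vectors n. \<Sum>\<beta>\<in>Z2_vectors n. (fourier_inv n \<mu> \<alpha> * fourier \<beta> \<nu>) *\<^sub>C u \<alpha> \<beta>)"

definition degree_one_block :: "nat \<Rightarrow> (nat set \<Rightarrow> nat set \<Rightarrow> 'a::complex_star_algebra) \<Rightarrow> nat \<Rightarrow> nat \<Rightarrow> 'a" where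
  "degree_one_block n u i j = fourier_matrix n u (tau_exponent n {i}) (tau_exponent n {j})"

text \<open>The value at \<open>\<alpha>\<close> of the image of the function \<open>f\<close> under \<open>\<delta>\<^sub>\<beta> \<mapsto> \<Sum>\<alpha>. \<delta>\<^sub>\<alpha> \<otimes> u \<alpha> \<beta>\<close>.\<close>

definition coaction :: "nat \<Rightarrow> (nat set \<Rightarrow> nat set \<Rightarrow> 'a::complex_star_algebra) \<Rightarrow> nat set \<Rightarrow> (nat set \<Rightarrow> complex) \<Rightarrow> 'a" where
  "coaction n u \<alpha> f = (\<Sum>\<beta>\<in>Z2_vectors n. f \<beta> *\<^sub>C u \<alpha> \<beta>)"

lemma fourier_matrix_coaction:
  "fourier_matrix n u \<mu> \<nu> = (\<Sum>\<alpha>\<in>Z2_vectors n. (tau \<mu> \<alpha> / 2 ^ n) *\<^sub>C coaction n u \<alpha> (tau \<nu>))"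
  by (simp add: fourier_matrix_def coaction_def fourier_inv_def fourier_def scaleC_sum_right)

lemma fourier_matrix_swap:
  "fourier_matrix n (\<lambda>\<alpha> \<beta>. u \<beta> \<alpha>) \<mu> \<nu> = fourier_matrix n u \<nu> \<mu>"
  unfolding fourier_matrix_def
  by (subst sum.swap) (simp add: fourier_inv_def fourier_def mult.commute)

lemma coaction_fourier:
  assumes \<alpha>: "\<alpha> \<in> Z2_vectors n"
  shows "coaction n u \<alpha> (tau \<nu>) = (\<Sum>\<mu>\<in>Z2_vectors n. tau \<mu> \<alpha> *\<^sub>C fourier_matrix n u \<mu> \<nu>)"
proof -
  let ?Z = "Z2_vectors n" and ?r = "\<lambda>\<alpha>. coaction n u \<alpha> (tau \<nu>)"
  have "(\<Sum>\<mu>\<in>?Z. tau \<mu> \<alpha> *\<^sub>C fourier_matrix n u \<mu> \<nu>)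
      = (\<Sum>\<mu>\<in>?Z. \<Sum>\<gamma>\<in>?Z. (tau \<mu> \<alpha> * (tau \<mu> \<gamma> / 2 ^ n)) *\<^sub>C ?r \<gamma>)"
    by (simp only: fourier_matrix_coaction scaleC_sum_right scaleC_scaleC)
  also have "\<dots> = (\<Sum>\<gamma>\<in>?Z. \<Sum>\<mu>\<in>?Z. (tau \<mu> \<alpha> * (tau \<mu> \<gamma> / 2 ^ n)) *\<^sub>C ?r \<gamma>)"
    by (rule sum.swap)
  also have "\<dots> = (\<Sum>\<gamma>\<in>?Z. if \<gamma> = \<alpha> then ?r \<gamma> else 0)"
  proof (rule sum.cong[OF refl])
    fix \<gamma> assume \<gamma>: "\<gamma> \<in> ?Z"
    have "(\<Sum>\<mu>\<in>?Z. tau \<mu> \<alpha> * (tau \<mu> \<gamma> / 2 ^ n)) = (\<Sum>\<mu>\<in>?Z. tau \<alpha> \<mu> * tau \<gamma> \<mu>) / 2 ^ n"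
      by (simp add: sum_divide_distrib tau_def Int_commute)
    also have "\<dots> = (if \<gamma> = \<alpha> then 1 else 0)" using tau_orth[OF \<alpha> \<gamma>] by auto
    finally have "(\<Sum>\<mu>\<in>?Z. tau \<mu> \<alpha> * (tau \<mu> \<gamma> / 2 ^ n)) = (if \<gamma> = \<alpha> then 1 else 0)" .
    then show "(\<Sum>\<mu>\<in>?Z. (tau \<mu> \<alpha> * (tau \<mu> \<gamma> / 2 ^ n)) *\<^sub>C ?r \<gamma>) = (if \<gamma> = \<alpha> then ?r \<gamma> else 0)"
      by (simp flip: scaleC_sum_left)
  qed
  also have "\<dots> = ?r \<alpha>" using \<alpha> by simp
  finally show ?thesis by simp
qed

lemma fourier_matrix_mult:
  "fourier_matrix n (\<lambda>\<alpha> \<beta>. \<Sum>\<gamma>\<in>Z2_vectors n. p \<alpha> \<gamma> * q \<gamma> \<beta>) \<mu> \<nu>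
    = (\<Sum>\<kappa>\<in>Z2_vectors n. fourier_matrix n p \<mu> \<kappa> * fourier_matrix n q \<kappa> \<nu>)"
proof -
  let ?Z = "Z2_vectors n"
  have r: "coaction n (\<lambda>\<alpha> \<beta>. \<Sum>\<gamma>\<in>?Z. p \<alpha> \<gamma> * q \<gamma> \<beta>) \<alpha> (tau \<nu>)
      = (\<Sum>\<kappa>\<in>?Z. coaction n p \<alpha> (tau \<kappa>) * fourier_matrix n q \<kappa> \<nu>)" for \<alpha>
  proof -
    have "coaction n (\<lambda>\<alpha> \<beta>. \<Sum>\<gamma>\<in>?Z. p \<alpha> \<gamma> * q \<gamma> \<beta>) \<alpha> (tau \<nu>)
        = (\<Sum>\<beta>\<in>?Z. \<Sum>\<gamma>\<in>?Z. p \<alpha> \<gamma> * (tau \<nu> \<beta> *\<^sub>C q \<gamma> \<beta>))"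
      by (simp add: coaction_def scaleC_sum_right)
    also have "\<dots> = (\<Sum>\<gamma>\<in>?Z. p \<alpha> \<gamma> * coaction n q \<gamma> (tau \<nu>))"
      by (subst sum.swap) (simp add: coaction_def sum_distrib_left)
    also have "\<dots> = (\<Sum>\<gamma>\<in>?Z. \<Sum>\<kappa>\<in>?Z. (tau \<kappa> \<gamma> *\<^sub>C p \<alpha> \<gamma>) * fourier_matrix n q \<kappa> \<nu>)"
      by (rule sum.cong) (simp_all add: coaction_fourier sum_distrib_left)
    also have "\<dots> = (\<Sum>\<kappa>\<in>?Z. coaction n p \<alpha> (tau \<kappa>) * fourier_matrix n q \<kappa> \<nu>)"
      by (subst sum.swap) (simp only: coaction_def sum_distrib_right)
    finally show ?thesis .
  qed
  have "fourier_matrix n (\<lambda>\<alpha> \<beta>. \<Sum>\<gamma>\<in>?Z. p \<alpha> \<gamma> * q \<gamma> \<beta>) \<mu> \<nu>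
      = (\<Sum>\<alpha>\<in>?Z. \<Sum>\<kappa>\<in>?Z. ((tau \<mu> \<alpha> / 2 ^ n) *\<^sub>C coaction n p \<alpha> (tau \<kappa>)) * fourier_matrix n q \<kappa> \<nu>)"
    unfolding fourier_matrix_coaction[of n "\<lambda>\<alpha> \<beta>. \<Sum>\<gamma>\<in>?Z. p \<alpha> \<gamma> * q \<gamma> \<beta>"] r
    by (simp only: scaleC_sum_right mult_scaleC_left)
  also have "\<dots> = (\<Sum>\<kappa>\<in>?Z. fourier_matrix n p \<mu> \<kappa> * fourier_matrix n q \<kappa> \<nu>)"
    by (subst sum.swap) (simp only: fourier_matrix_coaction[of n p] sum_distrib_right)
  finally show ?thesis .
qed

lemma tau_exponent_single_inj:
  assumes "n \<ge> 2"
  shows "inj_on (\<lambda>i. tau_exponent n {i}) {1..n+1}"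
proof (rule inj_onI, rule ccontr)
  fix i k assume ik: "i \<in> {1..n+1}" "k \<in> {1..n+1}" "tau_exponent n {i} = tau_exponent n {k}" "i \<noteq> k"
  then have "{k} = {1..n+1} - {i}" using tau_exponent_eq_iff[of "{i}" n "{k}"] by auto
  then have "card {k} = card ({1..n+1} - {i})" by (rule arg_cong)
  then show False using ik(1) assms by (subst (asm) card_Diff_subset) auto
qed

lemma degree_one_image:
  assumes "n \<ge> 1"
  shows "(\<lambda>i. tau_exponent n {i}) ` {1..n+1} = {\<mu> \<in> Z2_vectors n. card \<mu> = 1 \<or> card \<mu> = n}"
proof -
  have "k_subsets (n+1) 1 = (\<lambda>i. {i}) ` {1..n+1}"
    by (auto simp: k_subsets_def card_1_singleton_iff)
  then show ?thesis using tau_exponent_image[of 1 n] assms by (simp add: image_image)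
qed

text \<open>The characters \<open>\<tau>\<^sub>p \<tau>\<^sub>q\<close> and \<open>\<tau>\<^sub>i \<tau>\<^sub>k\<close> are equal or orthogonal.  Besides \<open>{i, k} = {p, q}\<close> they are equal if
the two pairs are complementary in \<open>{1..n+1}\<close>, which is the obstruction for \<open>n = 3\<close>; likewise
\<open>\<tau>\<^sub>p \<tau>\<^sub>q = 1\<close> would require \<open>n = 1\<close>.\<close>

lemma sum_tau_gen4:
  assumes n: "n \<ge> 2" "n \<noteq> 3" and idx: "i \<in> {1..n+1}" "k \<in> {1..n+1}" "p \<in> {1..n+1}" "q \<in> {1..n+1}"
    and pq: "p \<noteq> q"
  shows "(\<Sum>\<alpha>\<in>Z2_vectors n. tau_gen n \<alpha> p * tau_gen n \<alpha> q * (tau_gen n \<alpha> i * tau_gen n \<alpha> k))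
    = (if {i, k} = {p, q} then 2 ^ n else 0)"
proof -
  have pair: "tau_gen n \<alpha> i * tau_gen n \<alpha> k = tau (tau_exponent n (if i = k then {} else {i, k})) \<alpha>"
    if "i \<in> {1..n+1}" "k \<in> {1..n+1}" "\<alpha> \<in> Z2_vectors n" for i k \<alpha>
  proof (cases "i = k")
    case True
    then show ?thesis by (simp add: tau_gen_square tau_exponent_def tau_def)
  next
    case False
    then show ?thesis using prod_tau_gen[of "{i, k}" n \<alpha>] that by simp
  qed
  let ?I = "if i = k then {} else {i, k}"
  have sub: "?I \<subseteq> {1..n+1}" "{p, q} \<subseteq> {1..n+1}" using idx by auto
  have "(\<Sum>\<alpha>\<in>Z2_vectors n. tau_gen n \<alpha> p * tau_gen n \<alpha> q * (tau_gen n \<alpha> i * tau_gen n \<alpha> k))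
      = (\<Sum>\<alpha>\<in>Z2_vectors n. tau (tau_exponent n {p, q}) \<alpha> * tau (tau_exponent n ?I) \<alpha>)"
    by (rule sum.cong[OF refl]) (simp only: pair[OF idx(3,4)] pair[OF idx(1,2)] pq if_False)
  also have "\<dots> = (if tau_exponent n {p, q} = tau_exponent n ?I then 2 ^ n else 0)"
    using sub by (intro tau_orth tau_exponent_Z2)
  also have "tau_exponent n {p, q} = tau_exponent n ?I \<longleftrightarrow> {i, k} = {p, q}"
  proof -
    \<comment> \<open>The complement of the pair has \<open>n - 1\<close> elements, which is neither 0 nor 2.\<close>
    have "?I \<noteq> {1..n+1} - {p, q}"
    proof
      assume "?I = {1..n+1} - {p, q}"
      then have "card ?I = card ({1..n+1} - {p, q})" by (rule arg_cong)
      also have "\<dots> = n - 1" using sub pq by (subst card_Diff_subset) auto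
      finally show False using n by (auto split: if_splits)
    qed
    then have "tau_exponent n {p, q} = tau_exponent n ?I \<longleftrightarrow> ?I = {p, q}"
      using tau_exponent_eq_iff[OF sub(2,1)] by blast
    also have "\<dots> \<longleftrightarrow> {i, k} = {p, q}" using pq by auto
    finally show ?thesis .
  qed
  finally show ?thesis .
qed

lemma sum_tau_gen2:
  assumes n: "n \<ge> 2" and idx: "i \<in> {1..n+1}" "k \<in> {1..n+1}"
  shows "(\<Sum>\<alpha>\<in>Z2_vectors n. tau_gen n \<alpha> i * tau_gen n \<alpha> k) = (if i = k then 2 ^ n else 0)"
proof -
  have "(\<Sum>\<alpha>\<in>Z2_vectors n. tau_gen n \<alpha> i * tau_gen n \<alpha> k)
      = (if tau_exponent n {i} = tau_exponent n {k} then 2 ^ n else 0)"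
    unfolding tau_gen_def using idx by (intro tau_orth tau_exponent_Z2) auto
  then show ?thesis using inj_on_eq_iff[OF tau_exponent_single_inj[OF n] idx] by simp
qed

text \<open>The constant coefficient of the image of \<open>\<tau>\<^sub>j \<tau>\<^sub>l\<close>.\<close>

lemma sum_tau_image_mult:
  assumes n: "n \<ge> 2"
  shows "(\<Sum>\<alpha>\<in>Z2_vectors n. tau_image n v \<alpha> j * tau_image n v \<alpha> l) = 2 ^ n *\<^sub>C (\<Sum>i\<in>{1..n+1}. v i j * v i l)"
proof -
  let ?N = "{1..n+1}"
  have "(\<Sum>\<alpha>\<in>Z2_vectors n. tau_image n v \<alpha> j * tau_image n v \<alpha> l)
      = (\<Sum>\<alpha>\<in>Z2_vectors n. \<Sum>i\<in>?N. \<Sum>k\<in>?N. (tau_gen n \<alpha> i * tau_gen n \<alpha> k) *\<^sub>C (v i j * v k l))"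
    by (simp only: tau_image_def sum_product mult_scaleC_left mult_scaleC_right scaleC_scaleC)
      (simp only: mult.commute)
  also have "\<dots> = (\<Sum>i\<in>?N. \<Sum>\<alpha>\<in>Z2_vectors n. \<Sum>k\<in>?N. (tau_gen n \<alpha> i * tau_gen n \<alpha> k) *\<^sub>C (v i j * v k l))"
    by (rule sum.swap)
  also have "\<dots> = (\<Sum>i\<in>?N. \<Sum>k\<in>?N. \<Sum>\<alpha>\<in>Z2_vectors n. (tau_gen n \<alpha> i * tau_gen n \<alpha> k) *\<^sub>C (v i j * v k l))"
    by (intro sum.cong refl sum.swap)
  also have "\<dots> = (\<Sum>i\<in>?N. \<Sum>k\<in>?N. if k = i then 2 ^ n *\<^sub>C (v i j * v k l) else 0)"
    by (intro sum.cong refl) (simp only: scaleC_sum_left[symmetric] sum_tau_gen2[OF n], simp)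
  also have "\<dots> = 2 ^ n *\<^sub>C (\<Sum>i\<in>?N. v i j * v i l)"
    by (simp add: scaleC_sum_right del: sum.cl_ivl_Suc)
  finally show ?thesis .
qed

text \<open>The coefficient of \<open>\<tau>\<^sub>p \<tau>\<^sub>q\<close> in the image of \<open>\<tau>\<^sub>j \<tau>\<^sub>l\<close>.\<close>

lemma sum_tau_image_mult_pair:
  assumes n: "n \<ge> 2" "n \<noteq> 3" and pq: "p \<in> {1..n+1}" "q \<in> {1..n+1}" "p \<noteq> q"
  shows "(\<Sum>\<alpha>\<in>Z2_vectors n. (tau_gen n \<alpha> p * tau_gen n \<alpha> q) *\<^sub>C (tau_image n v \<alpha> j * tau_image n v \<alpha> l))
    = 2 ^ n *\<^sub>C (v p j * v q l + v q j * v p l)"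
proof -
  let ?N = "{1..n+1}"
  have "(\<Sum>\<alpha>\<in>Z2_vectors n. (tau_gen n \<alpha> p * tau_gen n \<alpha> q) *\<^sub>C (tau_image n v \<alpha> j * tau_image n v \<alpha> l))
      = (\<Sum>\<alpha>\<in>Z2_vectors n. \<Sum>i\<in>?N. \<Sum>k\<in>?N.
          (tau_gen n \<alpha> p * tau_gen n \<alpha> q * (tau_gen n \<alpha> i * tau_gen n \<alpha> k)) *\<^sub>C (v i j * v k l))"
    by (simp only: tau_image_def sum_product mult_scaleC_left mult_scaleC_right scaleC_scaleC scaleC_sum_right)
      (simp only: mult.commute mult.left_commute)
  also have "\<dots> = (\<Sum>i\<in>?N. \<Sum>\<alpha>\<in>Z2_vectors n. \<Sum>k\<in>?N.
          (tau_gen n \<alpha> p * tau_gen n \<alpha> q * (tau_gen n \<alpha> i * tau_gen n \<alpha> k)) *\<^sub>C (v i j * v k l))"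
    by (rule sum.swap)
  also have "\<dots> = (\<Sum>i\<in>?N. \<Sum>k\<in>?N. \<Sum>\<alpha>\<in>Z2_vectors n.
          (tau_gen n \<alpha> p * tau_gen n \<alpha> q * (tau_gen n \<alpha> i * tau_gen n \<alpha> k)) *\<^sub>C (v i j * v k l))"
    by (intro sum.cong refl sum.swap)
  also have "\<dots> = (\<Sum>i\<in>?N. \<Sum>k\<in>?N. if {i, k} = {p, q} then 2 ^ n *\<^sub>C (v i j * v k l) else 0)"
    by (intro sum.cong refl) (simp only: scaleC_sum_left[symmetric] sum_tau_gen4[OF n _ _ pq], simp)
  also have "\<dots> = (\<Sum>i\<in>?N. (if i = p then 2 ^ n *\<^sub>C (v i j * v q l) else 0)
      + (if i = q then 2 ^ n *\<^sub>C (v i j * v p l) else 0))"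
  proof (rule sum.cong[OF refl])
    fix i
    have "(\<Sum>k\<in>?N. if {i, k} = {p, q} then 2 ^ n *\<^sub>C (v i j * v k l) else 0)
      = (\<Sum>k\<in>?N. (if k = q then if i = p then 2 ^ n *\<^sub>C (v i j * v k l) else 0 else 0)
          + (if k = p then if i = q then 2 ^ n *\<^sub>C (v i j * v k l) else 0 else 0))"
      by (rule sum.cong) (use pq(3) in \<open>auto simp: doubleton_eq_iff\<close>)
    then show "(\<Sum>k\<in>?N. if {i, k} = {p, q} then 2 ^ n *\<^sub>C (v i j * v k l) else 0)
      = (if i = p then 2 ^ n *\<^sub>C (v i j * v q l) else 0) + (if i = q then 2 ^ n *\<^sub>C (v i j * v p l) else 0)"
      using pq(1,2) by (simp add: sum.distrib del: sum.cl_ivl_Suc)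
  qed
  also have "\<dots> = 2 ^ n *\<^sub>C (v p j * v q l + v q j * v p l)"
    using pq(1,2) by (simp add: sum.distrib scaleC_add_right del: sum.cl_ivl_Suc)
  finally show ?thesis .
qed

context cube_quantum_automorphism
begin

lemma transpose: "cube_quantum_automorphism n (\<lambda>\<alpha> \<beta>. u \<beta> \<alpha>)"
proof
  fix \<alpha> \<beta> assume ab: "\<alpha> \<in> Z2_vectors n" "\<beta> \<in> Z2_vectors n"
  show "(\<Sum>\<gamma>\<in>Z2_vectors n. adj_coeff n \<alpha> \<gamma> *\<^sub>C u \<beta> \<gamma>) = (\<Sum>\<gamma>\<in>Z2_vectors n. adj_coeff n \<gamma> \<beta> *\<^sub>C u \<gamma> \<alpha>)"
    using intertwine[OF ab(2,1)] by (simp only: adj_coeff_commute)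
qed (auto intro: idem selfadj row_disj col_disj row_sum col_sum)

lemma coaction_absorb:
  assumes "\<alpha> \<in> Z2_vectors n" "\<beta> \<in> Z2_vectors n"
  shows "coaction n u \<alpha> f * u \<alpha> \<beta> = f \<beta> *\<^sub>C u \<alpha> \<beta>"
proof -
  have "coaction n u \<alpha> f * u \<alpha> \<beta> = (\<Sum>\<gamma>\<in>Z2_vectors n. f \<gamma> *\<^sub>C (u \<alpha> \<gamma> * u \<alpha> \<beta>))"
    by (simp add: coaction_def sum_distrib_right)
  also have "\<dots> = (\<Sum>\<gamma>\<in>Z2_vectors n. if \<gamma> = \<beta> then f \<gamma> *\<^sub>C u \<alpha> \<beta> else 0)"
    by (rule sum.cong) (use assms idem row_disj in auto)
  finally show ?thesis using assms by simp
qed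

lemma coaction_mult:
  assumes "\<alpha> \<in> Z2_vectors n"
  shows "coaction n u \<alpha> f * coaction n u \<alpha> g = coaction n u \<alpha> (\<lambda>\<beta>. f \<beta> * g \<beta>)"
proof -
  have "coaction n u \<alpha> f * coaction n u \<alpha> g = (\<Sum>\<beta>\<in>Z2_vectors n. g \<beta> *\<^sub>C (coaction n u \<alpha> f * u \<alpha> \<beta>))"
    by (simp add: coaction_def[of n u \<alpha> g] sum_distrib_left)
  also have "\<dots> = coaction n u \<alpha> (\<lambda>\<beta>. f \<beta> * g \<beta>)"
    unfolding coaction_def[of n u \<alpha> "\<lambda>\<beta>. f \<beta> * g \<beta>"]
    by (rule sum.cong) (simp_all add: coaction_absorb assms mult.commute)
  finally show ?thesis .
qed

lemma coaction_one: "\<alpha> \<in> Z2_vectors n \<Longrightarrow> coaction n u \<alpha> (\<lambda>_. 1) = 1"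
  by (simp add: coaction_def row_sum)

lemma coaction_prod_list:
  assumes "\<alpha> \<in> Z2_vectors n"
  shows "prod_list (map (\<lambda>j. coaction n u \<alpha> (f j)) js) = coaction n u \<alpha> (\<lambda>\<beta>. prod_list (map (\<lambda>j. f j \<beta>) js))"
  by (induct js) (simp_all add: coaction_one coaction_mult assms)

lemma sum_coaction: "(\<Sum>\<alpha>\<in>Z2_vectors n. coaction n u \<alpha> f) = (\<Sum>\<beta>\<in>Z2_vectors n. f \<beta>) *\<^sub>C 1"
proof -
  have "(\<Sum>\<alpha>\<in>Z2_vectors n. coaction n u \<alpha> f) = (\<Sum>\<beta>\<in>Z2_vectors n. f \<beta> *\<^sub>C (\<Sum>\<alpha>\<in>Z2_vectors n. u \<alpha> \<beta>))"
    unfolding coaction_def by (subst sum.swap) (simp only: scaleC_sum_right)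
  also have "\<dots> = (\<Sum>\<beta>\<in>Z2_vectors n. f \<beta> *\<^sub>C 1)"
    by (rule sum.cong) (simp_all only: col_sum)
  finally show ?thesis by (simp only: scaleC_sum_left)
qed

text \<open>Moving the adjacency matrix from one side of \<open>u\<close> to the other multiplies the entry once by the eigenvalue at
\<open>\<mu>\<close> and once by the one at \<open>\<nu>\<close>.\<close>

lemma fourier_matrix_block:
  assumes \<mu>: "\<mu> \<in> Z2_vectors n" and \<nu>: "\<nu> \<in> Z2_vectors n"
    and ne: "eigval n (card \<mu>) \<noteq> eigval n (card \<nu>)"
  shows "fourier_matrix n u \<mu> \<nu> = 0"
proof -
  let ?Z = "Z2_vectors n"
  define S where "S = (\<Sum>\<alpha>\<in>?Z. \<Sum>\<beta>\<in>?Z. (tau \<mu> \<alpha> * tau \<nu> \<beta>) *\<^sub>C u \<alpha> \<beta>)"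
  have "(\<Sum>\<alpha>\<in>?Z. \<Sum>\<beta>\<in>?Z. (tau \<mu> \<alpha> * tau \<nu> \<beta>) *\<^sub>C (\<Sum>\<gamma>\<in>?Z. adj_coeff n \<alpha> \<gamma> *\<^sub>C u \<gamma> \<beta>))
      = (\<Sum>\<beta>\<in>?Z. \<Sum>\<alpha>\<in>?Z. \<Sum>\<gamma>\<in>?Z. (tau \<nu> \<beta> * (adj_coeff n \<gamma> \<alpha> * tau \<mu> \<alpha>)) *\<^sub>C u \<gamma> \<beta>)"
    by (subst sum.swap) (simp add: scaleC_sum_right adj_coeff_commute mult.commute mult.left_commute)
  also have "\<dots> = (\<Sum>\<beta>\<in>?Z. \<Sum>\<gamma>\<in>?Z. \<Sum>\<alpha>\<in>?Z. (tau \<nu> \<beta> * (adj_coeff n \<gamma> \<alpha> * tau \<mu> \<alpha>)) *\<^sub>C u \<gamma> \<beta>)"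
    by (intro sum.cong refl sum.swap)
  also have "\<dots> = (\<Sum>\<beta>\<in>?Z. \<Sum>\<gamma>\<in>?Z. (tau \<nu> \<beta> * (eigval n (card \<mu>) * tau \<mu> \<gamma>)) *\<^sub>C u \<gamma> \<beta>)"
    by (intro sum.cong refl) (simp only: scaleC_sum_left[symmetric] sum_distrib_left[symmetric] adj_tau[OF _ \<mu>])
  also have "\<dots> = eigval n (card \<mu>) *\<^sub>C S"
    unfolding S_def by (subst sum.swap) (simp add: scaleC_sum_right mult.commute mult.left_commute)
  finally have 1: "(\<Sum>\<alpha>\<in>?Z. \<Sum>\<beta>\<in>?Z. (tau \<mu> \<alpha> * tau \<nu> \<beta>) *\<^sub>C (\<Sum>\<gamma>\<in>?Z. adj_coeff n \<alpha> \<gamma> *\<^sub>C u \<gamma> \<beta>))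
      = eigval n (card \<mu>) *\<^sub>C S" .
  have "(\<Sum>\<alpha>\<in>?Z. \<Sum>\<beta>\<in>?Z. (tau \<mu> \<alpha> * tau \<nu> \<beta>) *\<^sub>C (\<Sum>\<gamma>\<in>?Z. adj_coeff n \<gamma> \<beta> *\<^sub>C u \<alpha> \<gamma>))
      = (\<Sum>\<alpha>\<in>?Z. \<Sum>\<beta>\<in>?Z. \<Sum>\<gamma>\<in>?Z. (tau \<mu> \<alpha> * (adj_coeff n \<gamma> \<beta> * tau \<nu> \<beta>)) *\<^sub>C u \<alpha> \<gamma>)"
    by (simp add: scaleC_sum_right mult.commute mult.left_commute)
  also have "\<dots> = (\<Sum>\<alpha>\<in>?Z. \<Sum>\<gamma>\<in>?Z. \<Sum>\<beta>\<in>?Z. (tau \<mu> \<alpha> * (adj_coeff n \<gamma> \<beta> * tau \<nu> \<beta>)) *\<^sub>C u \<alpha> \<gamma>)"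
    by (intro sum.cong refl sum.swap)
  also have "\<dots> = (\<Sum>\<alpha>\<in>?Z. \<Sum>\<gamma>\<in>?Z. (tau \<mu> \<alpha> * (eigval n (card \<nu>) * tau \<nu> \<gamma>)) *\<^sub>C u \<alpha> \<gamma>)"
    by (intro sum.cong refl) (simp only: scaleC_sum_left[symmetric] sum_distrib_left[symmetric] adj_tau[OF _ \<nu>])
  also have "\<dots> = eigval n (card \<nu>) *\<^sub>C S"
    unfolding S_def by (simp add: scaleC_sum_right mult.commute mult.left_commute)
  finally have 2: "(\<Sum>\<alpha>\<in>?Z. \<Sum>\<beta>\<in>?Z. (tau \<mu> \<alpha> * tau \<nu> \<beta>) *\<^sub>C (\<Sum>\<gamma>\<in>?Z. adj_coeff n \<gamma> \<beta> *\<^sub>C u \<alpha> \<gamma>))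
      = eigval n (card \<nu>) *\<^sub>C S" .
  have "(\<Sum>\<alpha>\<in>?Z. \<Sum>\<beta>\<in>?Z. (tau \<mu> \<alpha> * tau \<nu> \<beta>) *\<^sub>C (\<Sum>\<gamma>\<in>?Z. adj_coeff n \<alpha> \<gamma> *\<^sub>C u \<gamma> \<beta>))
     = (\<Sum>\<alpha>\<in>?Z. \<Sum>\<beta>\<in>?Z. (tau \<mu> \<alpha> * tau \<nu> \<beta>) *\<^sub>C (\<Sum>\<gamma>\<in>?Z. adj_coeff n \<gamma> \<beta> *\<^sub>C u \<alpha> \<gamma>))"
    by (intro sum.cong refl) (simp only: intertwine)
  then have "(eigval n (card \<mu>) - eigval n (card \<nu>)) *\<^sub>C S = 0"
    using 1 2 by (simp add: complex_vec.scale_left_diff_distrib)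
  then have "S = 0" using ne by simp
  moreover have "fourier_matrix n u \<mu> \<nu> = (1 / 2 ^ n) *\<^sub>C S"
    by (simp add: fourier_matrix_def S_def scaleC_sum_right fourier_inv_def fourier_def)
  ultimately show ?thesis by simp
qed

lemma sum_degree_one:
  fixes f :: "nat set \<Rightarrow> 'a"
  assumes n: "n \<ge> 2"
    and f: "\<And>\<mu>. \<mu> \<in> Z2_vectors n \<Longrightarrow> eigval n (card \<mu>) \<noteq> eigval n 1 \<Longrightarrow> f \<mu> = 0"
  shows "(\<Sum>\<mu>\<in>Z2_vectors n. f \<mu>) = (\<Sum>i\<in>{1..n+1}. f (tau_exponent n {i}))"
proof -
  have "(\<Sum>\<mu>\<in>Z2_vectors n. f \<mu>) = (\<Sum>\<mu>\<in>(\<lambda>i. tau_exponent n {i}) ` {1..n+1}. f \<mu>)"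
  proof (rule sum.mono_neutral_right)
    show "(\<lambda>i. tau_exponent n {i}) ` {1..n+1} \<subseteq> Z2_vectors n"
      using n by (subst degree_one_image) auto
    show "\<forall>\<mu>\<in>Z2_vectors n - (\<lambda>i. tau_exponent n {i}) ` {1..n+1}. f \<mu> = 0"
    proof
      fix \<mu> assume "\<mu> \<in> Z2_vectors n - (\<lambda>i. tau_exponent n {i}) ` {1..n+1}"
      then have \<mu>: "\<mu> \<in> Z2_vectors n" "card \<mu> \<noteq> 1" "card \<mu> \<noteq> n"
        using degree_one_image[of n] n by auto
      then have "card \<mu> \<le> card {1..n}" by (intro card_mono) (auto simp: Z2_vectors_def)
      then have "eigval n (card \<mu>) \<noteq> eigval n 1" using eigval_eq_iff[of "card \<mu>" n 1] \<mu> by auto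
      then show "f \<mu> = 0" by (rule f[OF \<mu>(1)])
    qed
  qed simp
  also have "\<dots> = (\<Sum>i\<in>{1..n+1}. f (tau_exponent n {i}))"
    by (rule sum.reindex[OF tau_exponent_single_inj[OF n], unfolded o_def])
  finally show ?thesis .
qed

lemma eigval_single: "i \<in> {1..n+1} \<Longrightarrow> eigval n (card (tau_exponent n {i})) = eigval n 1"
  using eigval_tau_exponent[of "{i}" n] by simp

text \<open>The image of \<open>\<tau>\<^sub>j\<close> stays in the eigenspace spanned by \<open>\<tau>\<^sub>1, \<dots>, \<tau>\<^sub>n\<^sub>+\<^sub>1\<close>.\<close>

lemma tau_image_block:
  assumes n: "n \<ge> 2" and \<alpha>: "\<alpha> \<in> Z2_vectors n" and j: "j \<in> {1..n+1}"
  shows "tau_image n (degree_one_block n u) \<alpha> j = coaction n u \<alpha> (\<lambda>\<beta>. tau_gen n \<beta> j)"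
proof -
  have e: "tau_exponent n {j} \<in> Z2_vectors n" using j by (intro tau_exponent_Z2) auto
  have "coaction n u \<alpha> (\<lambda>\<beta>. tau_gen n \<beta> j)
      = (\<Sum>\<mu>\<in>Z2_vectors n. tau \<mu> \<alpha> *\<^sub>C fourier_matrix n u \<mu> (tau_exponent n {j}))"
    unfolding tau_gen_def by (rule coaction_fourier[OF \<alpha>])
  also have "\<dots> = (\<Sum>i\<in>{1..n+1}. tau (tau_exponent n {i}) \<alpha> *\<^sub>C fourier_matrix n u (tau_exponent n {i}) (tau_exponent n {j}))"
    by (rule sum_degree_one[OF n]) (simp add: fourier_matrix_block e eigval_single[OF j])
  finally show ?thesis by (simp only: tau_image_def degree_one_block_def tau_gen_def)
qed

text \<open>The three parts are the constant coefficient of \<open>x\<^sub>j x\<^sub>l\<close> and the coefficients of \<open>\<tau>\<^sub>p \<tau>\<^sub>q\<close> in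
\<open>x\<^sub>j\<^sup>2 = 1\<close> and in \<open>x\<^sub>j x\<^sub>l = x\<^sub>l x\<^sub>j\<close>.\<close>

lemma block_col_relations:
  assumes n: "n \<ge> 2" "n \<noteq> 3" and j: "j \<in> {1..n+1}" and l: "l \<in> {1..n+1}"
  defines "v \<equiv> degree_one_block n u"
  shows "(\<Sum>i\<in>{1..n+1}. v i j * v i l) = (if j = l then 1 else 0)"
    and "p \<in> {1..n+1} \<Longrightarrow> q \<in> {1..n+1} \<Longrightarrow> p \<noteq> q \<Longrightarrow> v p j * v q j = - (v q j * v p j)"
    and "p \<in> {1..n+1} \<Longrightarrow> q \<in> {1..n+1} \<Longrightarrow> p \<noteq> q \<Longrightarrow>
      v p j * v q l + v q j * v p l = v p l * v q j + v q l * v p j"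
proof -
  have x: "tau_image n v \<alpha> j * tau_image n v \<alpha> l = coaction n u \<alpha> (\<lambda>\<beta>. tau_gen n \<beta> j * tau_gen n \<beta> l)"
    if "\<alpha> \<in> Z2_vectors n" "j \<in> {1..n+1}" "l \<in> {1..n+1}" for j l \<alpha>
    using that by (simp only: v_def tau_image_block[OF n(1)] coaction_mult)
  have "2 ^ n *\<^sub>C (\<Sum>i\<in>{1..n+1}. v i j * v i l) = (\<Sum>\<alpha>\<in>Z2_vectors n. coaction n u \<alpha> (\<lambda>\<beta>. tau_gen n \<beta> j * tau_gen n \<beta> l))"
    unfolding sum_tau_image_mult[OF n(1), symmetric] using j l by (intro sum.cong refl x)
  also have "\<dots> = 2 ^ n *\<^sub>C (if j = l then 1 else 0)"
    unfolding sum_coaction sum_tau_gen2[OF n(1) j l] by simp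
  finally show "(\<Sum>i\<in>{1..n+1}. v i j * v i l) = (if j = l then 1 else 0)"
    by (simp only: complex_vec.scale_left_imp_eq[of "2 ^ n"] complex_vec.scale_cancel_left) simp
  assume pq: "p \<in> {1..n+1}" "q \<in> {1..n+1}" "p \<noteq> q"
  have "2 ^ n *\<^sub>C (v p j * v q j + v q j * v p j)
      = (\<Sum>\<alpha>\<in>Z2_vectors n. (tau_gen n \<alpha> p * tau_gen n \<alpha> q) *\<^sub>C 1)"
    unfolding sum_tau_image_mult_pair[OF n pq, symmetric]
    by (intro sum.cong refl) (simp only: x[OF _ j j] tau_gen_square coaction_one)
  also have "\<dots> = 0" unfolding scaleC_sum_left[symmetric] sum_tau_gen2[OF n(1) pq(1,2)] using pq(3) by simp
  finally show "v p j * v q j = - (v q j * v p j)" by (simp add: eq_neg_iff_add_eq_0)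
  have "2 ^ n *\<^sub>C (v p j * v q l + v q j * v p l) = 2 ^ n *\<^sub>C (v p l * v q j + v q l * v p j)"
    unfolding sum_tau_image_mult_pair[OF n pq, symmetric]
    by (intro sum.cong refl) (simp only: x j l, simp only: mult.commute)
  then show "v p j * v q l + v q j * v p l = v p l * v q j + v q l * v p j" by simp
qed

lemma block_swap: "degree_one_block n (\<lambda>\<alpha> \<beta>. u \<beta> \<alpha>) i j = degree_one_block n u j i"
  unfolding degree_one_block_def by (rule fourier_matrix_swap)

text \<open>The last part of \<open>block_col_relations\<close> says \<open>[v i j, v k l] + [v k j, v i l] = 0\<close>.  Applied to the
transpose of \<open>u\<close> it says \<open>[v i j, v k l] = [v k j, v i l]\<close>.  Hence both commutators vanish.\<close>

lemma block_anticommutative: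
  assumes n: "n \<ge> 2" "n \<noteq> 3"
  shows "anticommutative_matrix {1..n+1} (degree_one_block n u)"
proof
  interpret t: cube_quantum_automorphism n "\<lambda>\<alpha> \<beta>. u \<beta> \<alpha>" by (rule transpose)
  let ?v = "degree_one_block n u"
  note col = block_col_relations[OF n] and row = t.block_col_relations[OF n, unfolded block_swap]
  show "finite {1..n+1}" by simp
  show "(\<Sum>i\<in>{1..n+1}. ?v i j * ?v i l) = (if j = l then 1 else 0)"
    if "j \<in> {1..n+1}" "l \<in> {1..n+1}" for j l
    using that by (rule col(1))
  show "?v i j * ?v k j = - (?v k j * ?v i j)"
    if "i \<in> {1..n+1}" "k \<in> {1..n+1}" "j \<in> {1..n+1}" "i \<noteq> k" for i j k
    using that by (intro col(2)[of j j])
  show "?v i j * ?v i l = - (?v i l * ?v i j)"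
    if "i \<in> {1..n+1}" "j \<in> {1..n+1}" "l \<in> {1..n+1}" "j \<noteq> l" for i j l
    using that by (intro row(2)[of i i])
  show "?v i j * ?v k l = ?v k l * ?v i j"
    if h: "i \<in> {1..n+1}" "k \<in> {1..n+1}" "j \<in> {1..n+1}" "l \<in> {1..n+1}" "i \<noteq> k" "j \<noteq> l" for i j k l
  proof -
    define a where "a = ?v i j * ?v k l - ?v k l * ?v i j"
    define b where "b = ?v k j * ?v i l - ?v i l * ?v k j"
    have "a + b = 0" using col(3)[OF h(3,4,1,2,5)] unfolding a_def b_def by (simp add: algebra_simps)
    moreover have "a - b = 0" using row(3)[OF h(1,2,3,4,6)] unfolding a_def b_def by (simp add: algebra_simps)
    ultimately have "a = - a" by (metis add_eq_0_iff eq_iff_diff_eq_0)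
    then have "a = 0" by (rule antisymmetric_eq_zero)
    then show ?thesis by (simp add: a_def)
  qed
qed

text \<open>The determinant condition is the expansion into minors for the image of \<open>\<tau>\<^sub>1 \<cdots> \<tau>\<^sub>n\<^sub>+\<^sub>1 = 1\<close>, evaluated
at the vertex 0.\<close>

theorem block_SO:
  assumes n: "n \<ge> 2" "n \<noteq> 3"
  shows "cube_SO n (degree_one_block n u)"
  unfolding cube_SO_def
proof -
  interpret t: cube_quantum_automorphism n "\<lambda>\<alpha> \<beta>. u \<beta> \<alpha>" by (rule transpose)
  let ?v = "degree_one_block n u" and ?js = "[1..<(n+1)+1]"
  interpret a: anticommutative_matrix "{1..n+1}" ?v by (rule block_anticommutative[OF n])
  have fullset: "{I. I \<subseteq> {1..n+1} \<and> card I = n+1} = {{1..n+1}}"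
    using card_subset_eq[of "{1..n+1}"] by auto
  have e: "{} \<in> Z2_vectors n" by (simp add: Z2_vectors_def)
  have sgn: "prod (tau_gen n \<beta>) {1..n+1} = 1" if "\<beta> \<in> Z2_vectors n" for \<beta>
  proof -
    have "tau_exponent n {1..n+1} = {}" by (auto simp: tau_exponent_def)
    then show ?thesis using prod_tau_gen[OF order_refl that] by (simp add: tau_def)
  qed
  have sgnl: "prod_list (map (tau_gen n \<beta>) ?js) = 1" if "\<beta> \<in> Z2_vectors n" for \<beta>
    using sgn[OF that] prod.distinct_set_conv_list[of ?js "tau_gen n \<beta>"] by (simp only: distinct_upt set_upt_Suc)
  have "prod_list (map (tau_image n ?v {}) ?js) = prod_list (map (\<lambda>j. coaction n u {} (\<lambda>\<beta>. tau_gen n \<beta> j)) ?js)"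
    by (rule arg_cong[of _ _ prod_list], rule map_cong[OF refl], rule tau_image_block[OF n(1) e]) auto
  also have "\<dots> = coaction n u {} (\<lambda>\<beta>. prod_list (map (tau_gen n \<beta>) ?js))"
    by (rule coaction_prod_list[OF e])
  also have "\<dots> = coaction n u {} (\<lambda>_. 1)"
    unfolding coaction_def by (rule sum.cong[OF refl]) (simp only: sgnl)
  also have "\<dots> = 1" by (rule coaction_one[OF e])
  finally have 1: "prod_list (map (tau_image n ?v {}) ?js) = 1" .
  have "prod_list (map (a.column_comb (tau_gen n {})) ?js)
      = (\<Sum>I | I \<subseteq> {1..n+1} \<and> card I = length ?js. prod (tau_gen n {}) I *\<^sub>C a.minor I ?js)"
    by (rule a.prod_column_comb_minor) (simp_all only: tau_gen_square distinct_upt set_upt_Suc order_refl)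
  also have "\<dots> = a.minor {1..n+1} ?js"
    by (simp only: length_upt diff_add_inverse2 add_diff_cancel_right' fullset sum.insert finite.emptyI empty_iff sum.empty sgn[OF e]
        scaleC_one not_False_eq_True add_0_right)
  finally have prod: "prod_list (map (a.column_comb (tau_gen n {})) ?js) = a.minor {1..n+1} ?js" .
  have cc: "tau_image n ?v {} = a.column_comb (tau_gen n {})"
    by (rule ext) (simp only: tau_image_def a.column_comb_def)
  have "a.minor {1..n+1} ?js = 1"
    using 1 prod unfolding cc by (rule trans[OF sym, rotated])
  then have det: "(\<Sum>\<sigma> | \<sigma> permutes {1..n+1}. prod_list (map (\<lambda>i. ?v i (\<sigma> i)) ?js)) = 1"
    using a.det_rows_eq_cols[of ?js] by (simp only: set_upt_Suc distinct_upt order_refl simp_thms)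
  show "anticommutative_SO (n+1) ?v"
  proof
    show "(\<Sum>j\<in>{1..n+1}. ?v i j * ?v k j) = (if i = k then 1 else 0)"
      if "i \<in> {1..n+1}" "k \<in> {1..n+1}" for i k
      using t.block_col_relations(1)[OF n that] unfolding block_swap .
    show "(\<Sum>\<sigma> | \<sigma> permutes {1..n+1}. prod_list (map (\<lambda>i. ?v i (\<sigma> i)) ?js)) = 1" by (rule det)
    show "star (?v i j) = ?v i j" for i j
      by (simp add: degree_one_block_def fourier_matrix_def star_sum star_scaleC selfadj fourier_inv_def fourier_def
          cong: sum.cong)
  qed
qed

text \<open>The entries of \<open>u\<close> satisfy the eigenvalue equations that characterise the joint projections.\<close>

theorem cube_matrix_block:
  assumes n: "n \<ge> 2" "n \<noteq> 3" and \<alpha>: "\<alpha> \<in> Z2_vectors n" and \<beta>: "\<beta> \<in> Z2_vectors n"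
  shows "cube_matrix n (degree_one_block n u) \<alpha> \<beta> = u \<alpha> \<beta>"
proof -
  let ?v = "degree_one_block n u"
  interpret c: cube_SO n ?v by (rule block_SO[OF n])
  have x: "tau_image n ?v \<alpha> j * u \<alpha> \<gamma> = tau_gen n \<gamma> j *\<^sub>C u \<alpha> \<gamma>" if "j \<in> {1..n}" "\<gamma> \<in> Z2_vectors n" for j \<gamma>
    using that tau_image_block[OF n(1) \<alpha>, of j] coaction_absorb[OF \<alpha> that(2)] by simp
  have "cube_matrix n ?v \<alpha> \<beta> = (\<Sum>\<gamma>\<in>Z2_vectors n. cube_matrix n ?v \<alpha> \<beta> * u \<alpha> \<gamma>)"
    using row_sum[OF \<alpha>] by (simp flip: sum_distrib_left)
  also have "\<dots> = (\<Sum>\<gamma>\<in>Z2_vectors n. if \<gamma> = \<beta> then u \<alpha> \<gamma> else 0)"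
  proof (rule sum.cong[OF refl])
    fix \<gamma> assume \<gamma>: "\<gamma> \<in> Z2_vectors n"
    show "cube_matrix n ?v \<alpha> \<beta> * u \<alpha> \<gamma> = (if \<gamma> = \<beta> then u \<alpha> \<gamma> else 0)"
      using c.cube_matrix_absorb[of \<alpha> "u \<alpha> \<gamma>" \<gamma>] c.cube_matrix_annihilate[OF \<beta> \<gamma>, of \<alpha> "u \<alpha> \<gamma>"] x \<gamma> by auto
  qed
  also have "\<dots> = u \<alpha> \<beta>" using \<beta> by simp
  finally show ?thesis .
qed

text \<open>Block matrices: for \<open>\<kappa>\<close> outside of the eigenspace of the \<open>\<tau>\<^sub>i\<close> the entry of the first factor vanishes.\<close>

lemma block_mult:
  assumes n: "n \<ge> 2" and i: "i \<in> {1..n+1}"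
  shows "degree_one_block n (\<lambda>\<alpha> \<beta>. \<Sum>\<gamma>\<in>Z2_vectors n. u \<alpha> \<gamma> * q \<gamma> \<beta>) i j
    = (\<Sum>k\<in>{1..n+1}. degree_one_block n u i k * degree_one_block n q k j)"
  unfolding degree_one_block_def fourier_matrix_mult
proof (rule sum_degree_one[OF n])
  fix \<mu> assume "\<mu> \<in> Z2_vectors n" "eigval n (card \<mu>) \<noteq> eigval n 1"
  moreover have "tau_exponent n {i} \<in> Z2_vectors n" using i by (intro tau_exponent_Z2) auto
  ultimately have "fourier_matrix n u (tau_exponent n {i}) \<mu> = 0"
    using eigval_single[OF i] by (intro fourier_matrix_block) auto
  then show "fourier_matrix n u (tau_exponent n {i}) \<mu> * fourier_matrix n q \<mu> (tau_exponent n {j}) = 0" by simp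
qed

text \<open>The comultiplication of the quantum automorphism group on the level of matrices, for two commuting
copies of \<open>u\<close>.\<close>

theorem mult_quantum_automorphism:
  assumes "cube_quantum_automorphism n q"
    and c: "\<And>\<alpha> \<beta> \<gamma> \<delta>. \<alpha> \<in> Z2_vectors n \<Longrightarrow> \<beta> \<in> Z2_vectors n \<Longrightarrow> \<gamma> \<in> Z2_vectors n \<Longrightarrow> \<delta> \<in> Z2_vectors n \<Longrightarrow>
      u \<alpha> \<beta> * q \<gamma> \<delta> = q \<gamma> \<delta> * u \<alpha> \<beta>"
  shows "cube_quantum_automorphism n (\<lambda>\<alpha> \<beta>. \<Sum>\<gamma>\<in>Z2_vectors n. u \<alpha> \<gamma> * q \<gamma> \<beta>)"
proof -
  interpret q: cube_quantum_automorphism n q by fact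
  let ?Z = "Z2_vectors n" and ?r = "\<lambda>\<alpha> \<beta>. \<Sum>\<gamma>\<in>Z2_vectors n. u \<alpha> \<gamma> * q \<gamma> \<beta>"
  have prod: "?r \<alpha> \<beta> * ?r \<alpha>' \<beta>' = (\<Sum>\<gamma>\<in>?Z. \<Sum>\<delta>\<in>?Z. (u \<alpha> \<gamma> * u \<alpha>' \<delta>) * (q \<gamma> \<beta> * q \<delta> \<beta>'))"
    if "\<alpha> \<in> ?Z" "\<beta> \<in> ?Z" "\<alpha>' \<in> ?Z" "\<beta>' \<in> ?Z" for \<alpha> \<beta> \<alpha>' \<beta>'
    unfolding sum_product
  proof (intro sum.cong refl)
    fix \<gamma> \<delta> assume "\<gamma> \<in> ?Z" "\<delta> \<in> ?Z"
    then have "u \<alpha>' \<delta> * q \<gamma> \<beta> = q \<gamma> \<beta> * u \<alpha>' \<delta>" using that by (intro c)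
    then show "u \<alpha> \<gamma> * q \<gamma> \<beta> * (u \<alpha>' \<delta> * q \<delta> \<beta>') = u \<alpha> \<gamma> * u \<alpha>' \<delta> * (q \<gamma> \<beta> * q \<delta> \<beta>')"
      by (metis mult.assoc)
  qed
  show ?thesis
  proof
    fix \<alpha> \<beta> assume ab: "\<alpha> \<in> ?Z" "\<beta> \<in> ?Z"
    have "?r \<alpha> \<beta> * ?r \<alpha> \<beta> = (\<Sum>\<gamma>\<in>?Z. \<Sum>\<delta>\<in>?Z. if \<delta> = \<gamma> then u \<alpha> \<gamma> * q \<gamma> \<beta> else 0)"
      unfolding prod[OF ab ab] by (intro sum.cong refl) (use ab idem row_disj q.idem in auto)
    then show "?r \<alpha> \<beta> * ?r \<alpha> \<beta> = ?r \<alpha> \<beta>" by simp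
    show "star (?r \<alpha> \<beta>) = ?r \<alpha> \<beta>"
      unfolding star_sum by (rule sum.cong) (use ab c selfadj q.selfadj in \<open>auto simp: star_mult\<close>)
    show "(\<Sum>\<gamma>\<in>?Z. adj_coeff n \<alpha> \<gamma> *\<^sub>C ?r \<gamma> \<beta>) = (\<Sum>\<gamma>\<in>?Z. adj_coeff n \<gamma> \<beta> *\<^sub>C ?r \<alpha> \<gamma>)"
    proof -
      have "(\<Sum>\<gamma>\<in>?Z. adj_coeff n \<alpha> \<gamma> *\<^sub>C ?r \<gamma> \<beta>) = (\<Sum>\<delta>\<in>?Z. (\<Sum>\<gamma>\<in>?Z. adj_coeff n \<alpha> \<gamma> *\<^sub>C u \<gamma> \<delta>) * q \<delta> \<beta>)"
        unfolding scaleC_sum_right by (subst sum.swap) (simp add: sum_distrib_right)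
      also have "\<dots> = (\<Sum>\<delta>\<in>?Z. (\<Sum>\<gamma>\<in>?Z. adj_coeff n \<gamma> \<delta> *\<^sub>C u \<alpha> \<gamma>) * q \<delta> \<beta>)"
        by (rule sum.cong) (use ab intertwine in auto)
      also have "\<dots> = (\<Sum>\<gamma>\<in>?Z. u \<alpha> \<gamma> * (\<Sum>\<delta>\<in>?Z. adj_coeff n \<gamma> \<delta> *\<^sub>C q \<delta> \<beta>))"
        unfolding sum_distrib_right by (subst sum.swap) (simp add: sum_distrib_left)
      also have "\<dots> = (\<Sum>\<gamma>\<in>?Z. u \<alpha> \<gamma> * (\<Sum>\<delta>\<in>?Z. adj_coeff n \<delta> \<beta> *\<^sub>C q \<gamma> \<delta>))"
        by (rule sum.cong) (use ab q.intertwine in auto)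
      also have "\<dots> = (\<Sum>\<gamma>\<in>?Z. adj_coeff n \<gamma> \<beta> *\<^sub>C ?r \<alpha> \<gamma>)"
        unfolding sum_distrib_left by (subst sum.swap) (simp add: scaleC_sum_right)
      finally show ?thesis .
    qed
    fix \<gamma> assume g: "\<gamma> \<in> ?Z" "\<beta> \<noteq> \<gamma>"
    show "?r \<alpha> \<beta> * ?r \<alpha> \<gamma> = 0"
      unfolding prod[OF ab ab(1) g(1)]
    proof (intro sum.neutral ballI)
      fix x y assume "x \<in> ?Z" "y \<in> ?Z"
      then show "u \<alpha> x * u \<alpha> y * (q x \<beta> * q y \<gamma>) = 0"
        using row_disj[of \<alpha> x y] q.row_disj[of x \<beta> \<gamma>] ab g by (cases "x = y") auto
    qed
    show "?r \<beta> \<alpha> * ?r \<gamma> \<alpha> = 0"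
      unfolding prod[OF ab(2,1) g(1) ab(1)]
    proof (intro sum.neutral ballI)
      fix x y assume "x \<in> ?Z" "y \<in> ?Z"
      then show "u \<beta> x * u \<gamma> y * (q x \<alpha> * q y \<alpha>) = 0"
        using col_disj[of x \<beta> \<gamma>] q.col_disj[of \<alpha> x y] ab g by (cases "x = y") auto
    qed
  next
    fix \<alpha> assume a: "\<alpha> \<in> ?Z"
    show "(\<Sum>\<beta>\<in>?Z. ?r \<alpha> \<beta>) = 1"
      by (subst sum.swap) (simp add: q.row_sum row_sum a flip: sum_distrib_left)
    show "(\<Sum>\<beta>\<in>?Z. ?r \<beta> \<alpha>) = 1"
      by (subst sum.swap) (simp add: q.col_sum col_sum a flip: sum_distrib_right)
  qed simp
qed

end

context cube_SO
begin

text \<open>The coefficient of \<open>\<tau>\<^sub>\<mu>\<close> in the expansion of the image of \<open>\<tau>\<^sub>J\<close> into minors collects all \<open>I\<close> with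
\<open>\<tau>\<^sub>I = \<tau>\<^sub>\<mu>\<close>.\<close>

theorem fourier_cube_matrix:
  assumes \<mu>: "\<mu> \<in> Z2_vectors n" and J: "J \<subseteq> {1..n+1}"
  shows "fourier_matrix n (cube_matrix n v) \<mu> (tau_exponent n J)
    = (\<Sum>I | I \<in> k_subsets (n+1) (card J) \<and> tau_exponent n I = \<mu>. minor I (sorted_list_of_set J))"
proof -
  let ?Z = "Z2_vectors n" and ?K = "k_subsets (n+1) (card J)" and ?m = "\<lambda>I. minor I (sorted_list_of_set J)"
  have finK: "finite ?K" unfolding k_subsets_def by (rule finite_subset[of _ "Pow {1..n+1}"]) auto
  have "fourier_matrix n (cube_matrix n v) \<mu> (tau_exponent n J)
      = (\<Sum>\<alpha>\<in>?Z. (tau \<mu> \<alpha> / 2 ^ n) *\<^sub>C prod_list (map (tau_image n v \<alpha>) (sorted_list_of_set J)))"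
    unfolding fourier_matrix_coaction by (rule sum.cong) (simp_all add: prod_tau_image_cube_matrix[OF _ J] coaction_def)
  also have "\<dots> = (\<Sum>\<alpha>\<in>?Z. \<Sum>I\<in>?K. (tau \<mu> \<alpha> / 2 ^ n * tau (tau_exponent n I) \<alpha>) *\<^sub>C ?m I)"
    by (rule sum.cong) (simp_all only: prod_tau_image[OF _ J] scaleC_sum_right scaleC_scaleC)
  also have "\<dots> = (\<Sum>I\<in>?K. \<Sum>\<alpha>\<in>?Z. (tau \<mu> \<alpha> / 2 ^ n * tau (tau_exponent n I) \<alpha>) *\<^sub>C ?m I)"
    by (rule sum.swap)
  also have "\<dots> = (\<Sum>I\<in>?K. if tau_exponent n I = \<mu> then ?m I else 0)"
  proof (rule sum.cong[OF refl])
    fix I assume "I \<in> ?K"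
    then have I: "I \<subseteq> {1..n+1}" by (auto simp: k_subsets_def)
    have "(\<Sum>\<alpha>\<in>?Z. tau \<mu> \<alpha> / 2 ^ n * tau (tau_exponent n I) \<alpha>) = (if tau_exponent n I = \<mu> then 1 else 0)"
      using tau_orth[OF \<mu> tau_exponent_Z2[OF I]] by (auto simp flip: sum_divide_distrib)
    then show "(\<Sum>\<alpha>\<in>?Z. (tau \<mu> \<alpha> / 2 ^ n * tau (tau_exponent n I) \<alpha>) *\<^sub>C ?m I)
        = (if tau_exponent n I = \<mu> then ?m I else 0)"
      unfolding scaleC_sum_left[symmetric] by simp
  qed
  also have "\<dots> = (\<Sum>I | I \<in> ?K \<and> tau_exponent n I = \<mu>. ?m I)"
    using sum.inter_filter[OF finK, of ?m "\<lambda>I. tau_exponent n I = \<mu>"] by simp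
  finally show ?thesis .
qed

theorem block_cube_matrix:
  assumes n: "n \<ge> 2" and i: "i \<in> {1..n+1}" and j: "j \<in> {1..n+1}"
  shows "degree_one_block n (cube_matrix n v) i j = v i j"
proof -
  have "{I. I \<in> k_subsets (n+1) 1 \<and> tau_exponent n I = tau_exponent n {i}} = {{i}}"
  proof (intro equalityI subsetI)
    fix I assume "I \<in> {I. I \<in> k_subsets (n+1) 1 \<and> tau_exponent n I = tau_exponent n {i}}"
    then obtain k where "I = {k}" "k \<in> {1..n+1}" "tau_exponent n {k} = tau_exponent n {i}"
      by (auto simp: k_subsets_def card_1_singleton_iff)
    then show "I \<in> {{i}}" using inj_onD[OF tau_exponent_single_inj[OF n], of k i] i by simp
  qed (use i in \<open>auto simp: k_subsets_def\<close>)
  moreover have "tau_exponent n {i} \<in> Z2_vectors n" using i by (intro tau_exponent_Z2) auto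
  ultimately show ?thesis
    using fourier_cube_matrix[of "tau_exponent n {i}" "{j}"] j
    by (simp add: degree_one_block_def minor_def)
qed

end

section \<open>Homomorphisms of *-algebras\<close>

lemma star_homI:
  assumes "\<And>x. x \<in> carrier A \<Longrightarrow> h x \<in> carrier B"
    and "\<And>x y. x \<in> carrier A \<Longrightarrow> y \<in> carrier A \<Longrightarrow> h (x \<otimes>\<^bsub>A\<^esub> y) = h x \<otimes>\<^bsub>B\<^esub> h y"
    and "\<And>x y. x \<in> carrier A \<Longrightarrow> y \<in> carrier A \<Longrightarrow> h (x \<oplus>\<^bsub>A\<^esub> y) = h x \<oplus>\<^bsub>B\<^esub> h y"
    and "h \<one>\<^bsub>A\<^esub> = \<one>\<^bsub>B\<^esub>"
    and "\<And>c x. x \<in> carrier A \<Longrightarrow> h (c \<odot>\<^bsub>A\<^esub> x) = c \<odot>\<^bsub>B\<^esub> h x"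
    and "\<And>x. x \<in> carrier A \<Longrightarrow> h (adj A x) = adj B (h x)"
  shows "h \<in> star_hom A B"
  using assms by (simp add: star_hom_def ring_hom_def)

lemma
  assumes "h \<in> star_hom A B"
  shows star_hom_closed: "x \<in> carrier A \<Longrightarrow> h x \<in> carrier B"
    and star_hom_mult: "x \<in> carrier A \<Longrightarrow> y \<in> carrier A \<Longrightarrow> h (x \<otimes>\<^bsub>A\<^esub> y) = h x \<otimes>\<^bsub>B\<^esub> h y"
    and star_hom_add: "x \<in> carrier A \<Longrightarrow> y \<in> carrier A \<Longrightarrow> h (x \<oplus>\<^bsub>A\<^esub> y) = h x \<oplus>\<^bsub>B\<^esub> h y"
    and star_hom_one: "h \<one>\<^bsub>A\<^esub> = \<one>\<^bsub>B\<^esub>"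
    and star_hom_smult: "x \<in> carrier A \<Longrightarrow> h (c \<odot>\<^bsub>A\<^esub> x) = c \<odot>\<^bsub>B\<^esub> h x"
    and star_hom_adj: "x \<in> carrier A \<Longrightarrow> h (adj A x) = adj B (h x)"
  using assms by (auto simp: star_hom_def ring_hom_def)

lemma star_hom_comp:
  assumes "g \<in> star_hom A B" "h \<in> star_hom B C"
  shows "h \<circ> g \<in> star_hom A C"
  by (rule star_homI) (simp_all add: star_hom_closed[OF assms(1)] star_hom_closed[OF assms(2)]
      star_hom_mult[OF assms(1)] star_hom_mult[OF assms(2)] star_hom_add[OF assms(1)] star_hom_add[OF assms(2)]
      star_hom_one[OF assms(1)] star_hom_one[OF assms(2)] star_hom_smult[OF assms(1)] star_hom_smult[OF assms(2)]
      star_hom_adj[OF assms(1)] star_hom_adj[OF assms(2)])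

context star_algebra
begin

lemma smult_zero_left: "x \<in> carrier A \<Longrightarrow> 0 \<odot> x = \<zero>"
proof -
  assume x: "x \<in> carrier A"
  have "0 \<odot> x \<oplus> 0 \<odot> x = 0 \<odot> x" using smult_l_distr[OF x, of 0 0] by simp
  then show ?thesis using x smult_closed by (metis add.l_cancel_one' zero_closed)
qed

lemma smult_zero_right: "c \<odot> \<zero> = \<zero>"
  using smult_r_distr[of \<zero> \<zero> c] smult_closed[of \<zero> c] by (metis add.l_cancel_one' r_zero zero_closed)

lemma smult_minus_one: "x \<in> carrier A \<Longrightarrow> (-1) \<odot> x = \<ominus> x"
proof -
  assume x: "x \<in> carrier A"
  have "(-1) \<odot> x \<oplus> x = \<zero>"
    using smult_l_distr[OF x, of "-1" 1] smult_zero_left[OF x] smult_one[OF x] by simp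
  then show ?thesis using x smult_closed by (metis minus_equality)
qed

lemma adj_one: "adj A \<one> = \<one>"
  using adj_mult[of "adj A \<one>" \<one>] adj_closed[of \<one>] adj_adj[of \<one>] by simp

lemma adj_zero: "adj A \<zero> = \<zero>"
  using adj_add[of \<zero> \<zero>] adj_closed[of \<zero>] by (metis add.l_cancel_one' r_zero zero_closed)

end

lemma star_hom_zero:
  assumes "star_algebra A" "star_algebra B" "h \<in> star_hom A B"
  shows "h \<zero>\<^bsub>A\<^esub> = \<zero>\<^bsub>B\<^esub>"
proof -
  interpret A: star_algebra A by fact
  interpret B: star_algebra B by fact
  have "h (0 \<odot>\<^bsub>A\<^esub> \<zero>\<^bsub>A\<^esub>) = 0 \<odot>\<^bsub>B\<^esub> h \<zero>\<^bsub>A\<^esub>" by (rule star_hom_smult[OF assms(3)]) simp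
  then show ?thesis using star_hom_closed[OF assms(3) A.zero_closed]
    by (simp add: A.smult_zero_right B.smult_zero_left)
qed

lemma star_hom_a_minus:
  assumes "star_algebra A" "star_algebra B" "h \<in> star_hom A B" "x \<in> carrier A" "y \<in> carrier A"
  shows "h (x \<ominus>\<^bsub>A\<^esub> y) = h x \<ominus>\<^bsub>B\<^esub> h y"
proof -
  interpret A: star_algebra A by fact
  interpret B: star_algebra B by fact
  have "h (x \<oplus>\<^bsub>A\<^esub> (-1) \<odot>\<^bsub>A\<^esub> y) = h x \<oplus>\<^bsub>B\<^esub> (-1) \<odot>\<^bsub>B\<^esub> h y"
    using assms by (simp add: star_hom_add[OF assms(3)] star_hom_smult[OF assms(3)] A.smult_closed)
  then show ?thesis using assms star_hom_closed[OF assms(3)]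
    by (simp add: A.smult_minus_one B.smult_minus_one A.minus_eq B.minus_eq)
qed

lemma star_hom_finsum:
  assumes "star_algebra A" "star_algebra B" "h \<in> star_hom A B" "finite S" "\<And>i. i \<in> S \<Longrightarrow> f i \<in> carrier A"
  shows "h (\<Oplus>\<^bsub>A\<^esub>i\<in>S. f i) = (\<Oplus>\<^bsub>B\<^esub>i\<in>S. h (f i))"
proof -
  interpret A: star_algebra A by fact
  interpret B: star_algebra B by fact
  show ?thesis using assms(4,5)
  proof (induct S)
    case empty
    then show ?case by (simp add: star_hom_zero[OF assms(1-3)])
  next
    case (insert i S)
    then have f: "f \<in> S \<rightarrow> carrier A" "f i \<in> carrier A" by auto
    then have "(\<lambda>i. h (f i)) \<in> S \<rightarrow> carrier B" "h (f i) \<in> carrier B"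
      using star_hom_closed[OF assms(3)] by auto
    then show ?case using insert f
      by (simp add: star_hom_add[OF assms(3)])
  qed
qed

lemma star_generated_closed:
  assumes "star_algebra A" "S \<subseteq> carrier A" "x \<in> star_generated A S"
  shows "x \<in> carrier A"
proof -
  interpret star_algebra A by fact
  show ?thesis using assms(3)
    by induct (use assms(2) in \<open>auto intro: smult_closed adj_closed\<close>)
qed

lemma star_hom_eq_on_generated:
  assumes "star_algebra A" "S \<subseteq> carrier A" "g \<in> star_hom A B" "h \<in> star_hom A B"
    and "\<And>x. x \<in> S \<Longrightarrow> g x = h x" "x \<in> star_generated A S"
  shows "g x = h x"
  using assms(6)
proof induct
  case (add x y)
  then show ?case using star_generated_closed[OF assms(1,2)]
    by (simp add: star_hom_add[OF assms(3)] star_hom_add[OF assms(4)])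
next
  case (mult x y)
  then show ?case using star_generated_closed[OF assms(1,2)]
    by (simp add: star_hom_mult[OF assms(3)] star_hom_mult[OF assms(4)])
next
  case (smult x c)
  then show ?case using star_generated_closed[OF assms(1,2)]
    by (simp add: star_hom_smult[OF assms(3)] star_hom_smult[OF assms(4)])
next
  case (adj x)
  then show ?case using star_generated_closed[OF assms(1,2)]
    by (simp add: star_hom_adj[OF assms(3)] star_hom_adj[OF assms(4)])
qed (simp_all add: assms(5) star_hom_one[OF assms(3)] star_hom_one[OF assms(4)])

lemma star_generated_image:
  assumes "star_algebra A" "S \<subseteq> carrier A" "h \<in> star_hom A B" "x \<in> star_generated A S"
  shows "h x \<in> star_generated B (h ` S)"
  using assms(4)
proof induct
  case (add x y)
  then show ?case using star_generated_closed[OF assms(1,2)]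
    by (simp add: star_hom_add[OF assms(3)] star_generated.add)
next
  case (mult x y)
  then show ?case using star_generated_closed[OF assms(1,2)]
    by (simp add: star_hom_mult[OF assms(3)] star_generated.mult)
next
  case (smult x c)
  then show ?case using star_generated_closed[OF assms(1,2)]
    by (simp add: star_hom_smult[OF assms(3)] star_generated.smult)
next
  case (adj x)
  then show ?case using star_generated_closed[OF assms(1,2)]
    by (simp add: star_hom_adj[OF assms(3)] star_generated.adj)
qed (auto simp: star_hom_one[OF assms(3)] intro: star_generated.intros)

section \<open>The product of all *-algebras on a type\<close>

text \<open>An instance of \<open>complex_star_algebra\<close> that has every *-algebra on \<open>'a\<close> as a factor.  An identity between elements
of the product holds in each factor, so the results about matrices apply to all *-algebras,
although their carriers are not types.\<close>

typedef 'a star_prod = "(\<Pi>\<^sub>E A\<in>Collect (star_algebra :: 'a star_alg \<Rightarrow> bool). carrier A)"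
  morphisms component Abs_star_prod
proof -
  have "(\<lambda>A\<in>Collect star_algebra. \<zero>\<^bsub>A\<^esub>) \<in> (\<Pi>\<^sub>E A\<in>Collect (star_algebra :: 'a star_alg \<Rightarrow> bool). carrier A)"
    by (auto intro: abelian_monoid.zero_closed simp: star_algebra_def ring_def abelian_group_def)
  then show ?thesis by blast
qed

definition star_tuple :: "('a star_alg \<Rightarrow> 'a) \<Rightarrow> 'a star_prod" where
  "star_tuple f = Abs_star_prod (restrict f (Collect star_algebra))"

lemma component_closed [simp]: "star_algebra A \<Longrightarrow> component x A \<in> carrier A"
  using component[of x] by auto

lemma component_star_tuple:
  assumes "\<And>B. star_algebra B \<Longrightarrow> f B \<in> carrier B" "star_algebra A"
  shows "component (star_tuple f) A = f A"
  using assms by (simp add: star_tuple_def Abs_star_prod_inverse)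

lemma star_prod_eqI:
  assumes "\<And>A. star_algebra A \<Longrightarrow> component x A = component y A"
  shows "x = y"
proof -
  have "component x = component y"
    using component[of x] component[of y] assms by (intro PiE_ext) auto
  then show ?thesis by (simp add: component_inject)
qed

instantiation star_prod :: (type) complex_star_algebra
begin

definition "0 = star_tuple (\<lambda>A. \<zero>\<^bsub>A\<^esub>)"
definition "1 = star_tuple (\<lambda>A. \<one>\<^bsub>A\<^esub>)"
definition "x + y = star_tuple (\<lambda>A. component x A \<oplus>\<^bsub>A\<^esub> component y A)"
definition "- x = star_tuple (\<lambda>A. \<ominus>\<^bsub>A\<^esub> component x A)"
definition "x - y = star_tuple (\<lambda>A. component x A \<ominus>\<^bsub>A\<^esub> component y A)"
definition "x * y = star_tuple (\<lambda>A. component x A \<otimes>\<^bsub>A\<^esub> component y A)"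
definition "c *\<^sub>C x = star_tuple (\<lambda>A. c \<odot>\<^bsub>A\<^esub> component x A)"
definition "star x = star_tuple (\<lambda>A. adj A (component x A))"

lemma component_zero: "star_algebra A \<Longrightarrow> component 0 A = \<zero>\<^bsub>A\<^esub>"
  unfolding zero_star_prod_def
  by (rule component_star_tuple) (auto simp: star_algebra_def ring_def intro: abelian_group.axioms abelian_monoid.zero_closed)

lemma component_one: "star_algebra A \<Longrightarrow> component 1 A = \<one>\<^bsub>A\<^esub>"
  unfolding one_star_prod_def
  by (rule component_star_tuple) (auto simp: star_algebra_def ring_def intro: monoid.one_closed)

lemma component_plus: "star_algebra A \<Longrightarrow> component (x + y) A = component x A \<oplus>\<^bsub>A\<^esub> component y A"
  unfolding plus_star_prod_def
  by (rule component_star_tuple) (auto simp: star_algebra_def ring_def abelian_group_def intro: abelian_monoid.a_closed)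

lemma component_uminus: "star_algebra A \<Longrightarrow> component (- x) A = \<ominus>\<^bsub>A\<^esub> component x A"
  unfolding uminus_star_prod_def
  by (rule component_star_tuple) (auto simp: star_algebra_def ring_def intro: abelian_group.a_inv_closed)

lemma component_minus: "star_algebra A \<Longrightarrow> component (x - y) A = component x A \<ominus>\<^bsub>A\<^esub> component y A"
  unfolding minus_star_prod_def
  by (rule component_star_tuple) (auto simp: star_algebra_def ring_def intro: abelian_group.minus_closed)

lemma component_times: "star_algebra A \<Longrightarrow> component (x * y) A = component x A \<otimes>\<^bsub>A\<^esub> component y A"
  unfolding times_star_prod_def
  by (rule component_star_tuple) (auto simp: star_algebra_def ring_def intro: monoid.m_closed)

lemma component_scaleC: "star_algebra A \<Longrightarrow> component (c *\<^sub>C x) A = c \<odot>\<^bsub>A\<^esub> component x A"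
  unfolding scaleC_star_prod_def
  by (rule component_star_tuple) (auto intro: star_algebra.smult_closed)

lemma component_star: "star_algebra A \<Longrightarrow> component (star x) A = adj A (component x A)"
  unfolding star_star_prod_def
  by (rule component_star_tuple) (auto intro: star_algebra.adj_closed)

lemmas component_simps = component_zero component_one component_plus component_uminus
  component_minus component_times component_scaleC component_star

instance
proof
  fix x y z :: "'a star_prod" and c d :: complex
  have R: "ring A" if "star_algebra A" for A :: "'a star_alg" using that by (simp add: star_algebra_def)
  show "x + y + z = x + (y + z)"
    by (rule star_prod_eqI) (simp add: component_simps R ring.ring_simprules)
  show "x + y = y + x"
    by (rule star_prod_eqI) (simp add: component_simps R ring.ring_simprules)
  show "0 + x = x"
    by (rule star_prod_eqI) (simp add: component_simps R ring.ring_simprules)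
  show "- x + x = 0"
    by (rule star_prod_eqI) (simp add: component_simps R ring.ring_simprules)
  show "x - y = x + - y"
    by (rule star_prod_eqI) (simp add: component_simps R ring.ring_simprules)
  show "x * y * z = x * (y * z)"
    by (rule star_prod_eqI) (simp add: component_simps R ring.ring_simprules)
  show "(x + y) * z = x * z + y * z"
    by (rule star_prod_eqI) (simp add: component_simps R ring.ring_simprules)
  show "x * (y + z) = x * y + x * z"
    by (rule star_prod_eqI) (simp add: component_simps R ring.ring_simprules)
  show "1 * x = x" "x * 1 = x"
    by (rule star_prod_eqI, simp add: component_simps R ring.is_monoid monoid.l_one monoid.r_one)+
  show "c *\<^sub>C (x + y) = c *\<^sub>C x + c *\<^sub>C y"
    by (rule star_prod_eqI) (simp add: component_simps star_algebra.smult_r_distr)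
  show "(c + d) *\<^sub>C x = c *\<^sub>C x + d *\<^sub>C x"
    by (rule star_prod_eqI) (simp add: component_simps star_algebra.smult_l_distr)
  show "c *\<^sub>C d *\<^sub>C x = (c * d) *\<^sub>C x"
    by (rule star_prod_eqI) (simp add: component_simps star_algebra.smult_smult)
  show "1 *\<^sub>C x = x"
    by (rule star_prod_eqI) (simp add: component_simps star_algebra.smult_one)
  show "c *\<^sub>C x * y = c *\<^sub>C (x * y)"
    by (rule star_prod_eqI) (simp add: component_simps star_algebra.smult_mult_left)
  show "x * c *\<^sub>C y = c *\<^sub>C (x * y)"
    by (rule star_prod_eqI) (simp add: component_simps star_algebra.smult_mult_right)
  show "star (x + y) = star x + star y"
    by (rule star_prod_eqI) (simp add: component_simps star_algebra.adj_add)
  show "star (x * y) = star y * star x"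
    by (rule star_prod_eqI) (simp add: component_simps star_algebra.adj_mult)
  show "star (star x) = x"
    by (rule star_prod_eqI) (simp add: component_simps star_algebra.adj_adj)
  show "star (c *\<^sub>C x) = cnj c *\<^sub>C star x"
    by (rule star_prod_eqI) (simp add: component_simps star_algebra.adj_smult)
qed

end

lemma component_sum:
  assumes "star_algebra A" "finite S"
  shows "component (\<Sum>i\<in>S. f i) A = (\<Oplus>\<^bsub>A\<^esub>i\<in>S. component (f i) A)"
proof -
  interpret star_algebra A by fact
  show ?thesis using assms(2)
    by (induct S) (simp_all add: component_simps assms(1) Pi_def)
qed

lemma component_prod_list:
  "star_algebra A \<Longrightarrow> component (prod_list xs) A = ordered_prod A (map (\<lambda>x. component x A) xs)"
  by (induct xs) (simp_all add: ordered_prod_def component_simps)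

text \<open>Elements of a single algebra \<open>A\<close> are lifted to the product by a choice of the other components.\<close>

definition with_component :: "'a star_alg \<Rightarrow> 'a \<Rightarrow> 'a star_prod \<Rightarrow> 'a star_prod" where
  "with_component A a x = star_tuple (\<lambda>B. if B = A then a else component x B)"

lemma component_with_component:
  assumes "star_algebra B" "a \<in> carrier A"
  shows "component (with_component A a x) B = (if B = A then a else component x B)"
  unfolding with_component_def by (rule component_star_tuple) (use assms in auto)

text \<open>Homomorphisms of *-algebras from a carrier set to a type.  Followed by a component of \<open>star_prod\<close> they are
homomorphisms between *-algebras with carrier sets.\<close>

definition class_hom :: "('a, 'x) star_alg_scheme \<Rightarrow> ('a \<Rightarrow> 't::complex_star_algebra) \<Rightarrow> bool" where
  "class_hom A h \<longleftrightarrow> h \<one>\<^bsub>A\<^esub> = 1 \<and> (\<forall>x\<in>carrier A. \<forall>y\<in>carrier A. h (x \<oplus>\<^bsub>A\<^esub> y) = h x + h y \<and> h (x \<otimes>\<^bsub>A\<^esub> y) = h x * h y) \<and>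
     (\<forall>x\<in>carrier A. (\<forall>c. h (c \<odot>\<^bsub>A\<^esub> x) = c *\<^sub>C h x) \<and> h (adj A x) = star (h x))"

lemma class_hom_component:
  assumes "class_hom A h" "star_algebra B"
  shows "(\<lambda>x. component (h x) B) \<in> star_hom A B"
  by (rule star_homI) (use assms in \<open>simp_all add: class_hom_def component_simps\<close>)

lemma
  assumes "class_hom A h"
  shows class_hom_one: "h \<one>\<^bsub>A\<^esub> = 1"
    and class_hom_add: "x \<in> carrier A \<Longrightarrow> y \<in> carrier A \<Longrightarrow> h (x \<oplus>\<^bsub>A\<^esub> y) = h x + h y"
    and class_hom_mult: "x \<in> carrier A \<Longrightarrow> y \<in> carrier A \<Longrightarrow> h (x \<otimes>\<^bsub>A\<^esub> y) = h x * h y"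
    and class_hom_smult: "x \<in> carrier A \<Longrightarrow> h (c \<odot>\<^bsub>A\<^esub> x) = c *\<^sub>C h x"
    and class_hom_adj: "x \<in> carrier A \<Longrightarrow> h (adj A x) = star (h x)"
  using assms by (auto simp: class_hom_def)

lemma class_hom_zero:
  assumes "star_algebra A" "class_hom A h" shows "h \<zero>\<^bsub>A\<^esub> = 0"
proof -
  interpret star_algebra A by fact
  show ?thesis using class_hom_smult[OF assms(2), of "\<zero>\<^bsub>A\<^esub>" 0] by (simp add: smult_zero_right)
qed

lemma class_hom_uminus:
  assumes "star_algebra A" "class_hom A h" "x \<in> carrier A" shows "h (\<ominus>\<^bsub>A\<^esub> x) = - h x"
proof -
  interpret star_algebra A by fact
  show ?thesis using class_hom_smult[OF assms(2,3), of "-1"] assms(3) by (simp add: smult_minus_one)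
qed

lemma class_hom_finsum:
  assumes "star_algebra A" "class_hom A h" "finite S" "\<And>i. i \<in> S \<Longrightarrow> f i \<in> carrier A"
  shows "h (\<Oplus>\<^bsub>A\<^esub>i\<in>S. f i) = (\<Sum>i\<in>S. h (f i))"
proof -
  interpret star_algebra A by fact
  show ?thesis using assms(3,4)
    by (induct S) (simp_all add: class_hom_zero[OF assms(1,2)] class_hom_add[OF assms(2)] Pi_def)
qed

lemma class_hom_ordered_prod:
  assumes "star_algebra A" "class_hom A h" "set xs \<subseteq> carrier A"
  shows "ordered_prod A xs \<in> carrier A \<and> h (ordered_prod A xs) = prod_list (map h xs)"
proof -
  interpret star_algebra A by fact
  show ?thesis using assms(3)
    by (induct xs) (auto simp: ordered_prod_def class_hom_one[OF assms(2)] class_hom_mult[OF assms(2)])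
qed

section \<open>Monoid algebras\<close>

instantiation complex :: complex_star_algebra
begin
definition "scaleC_complex (c :: complex) (x :: complex) = c * x"
definition "star_complex (x :: complex) = cnj x"
instance by standard (simp_all add: scaleC_complex_def star_complex_def algebra_simps)
end

text \<open>With values in \<open>complex\<close> this is the pairing of \<open>f\<close> with the function \<open>\<phi>\<close>.  The laws of a monoid algebra are checked below after
pairing with all \<open>\<phi>\<close>, where the convolution product becomes an iterated sum.\<close>

definition linear_extension :: "('m \<Rightarrow> 't::complex_star_algebra) \<Rightarrow> ('m \<Rightarrow> complex) \<Rightarrow> 't" where
  "linear_extension \<phi> f = (\<Sum>x | f x \<noteq> 0. f x *\<^sub>C \<phi> x)"

lemma linear_extension_superset:
  assumes "finite X" "{x. f x \<noteq> 0} \<subseteq> X"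
  shows "linear_extension \<phi> f = (\<Sum>x\<in>X. f x *\<^sub>C \<phi> x)"
  unfolding linear_extension_def by (rule sum.mono_neutral_left) (use assms in auto)

lemma linear_extension_cong:
  assumes "\<And>x. f x \<noteq> 0 \<Longrightarrow> \<phi> x = \<psi> x"
  shows "linear_extension \<phi> f = linear_extension \<psi> f"
  unfolding linear_extension_def by (rule sum.cong) (use assms in auto)

lemma linear_extension_add:
  assumes "finite {x. f x \<noteq> 0}" "finite {x. g x \<noteq> 0}"
  shows "linear_extension \<phi> (\<lambda>z. f z + g z) = linear_extension \<phi> f + linear_extension \<phi> g"
proof -
  let ?X = "{x. f x \<noteq> 0} \<union> {x. g x \<noteq> 0}"
  have X: "finite ?X" using assms by simp
  have "linear_extension \<phi> f = (\<Sum>x\<in>?X. f x *\<^sub>C \<phi> x)"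
    "linear_extension \<phi> g = (\<Sum>x\<in>?X. g x *\<^sub>C \<phi> x)"
    "linear_extension \<phi> (\<lambda>z. f z + g z) = (\<Sum>x\<in>?X. (f x + g x) *\<^sub>C \<phi> x)"
    by (rule linear_extension_superset[OF X]; auto)+
  then show ?thesis by (simp add: scaleC_add_left sum.distrib)
qed

lemma linear_extension_scale:
  assumes "finite {x. f x \<noteq> 0}"
  shows "linear_extension \<phi> (\<lambda>z. c * f z) = c *\<^sub>C linear_extension \<phi> f"
proof -
  have "linear_extension \<phi> (\<lambda>z. c * f z) = (\<Sum>x | f x \<noteq> 0. (c * f x) *\<^sub>C \<phi> x)"
    by (rule linear_extension_superset[OF assms]) auto
  then show ?thesis by (simp add: linear_extension_def scaleC_sum_right)
qed

lemma linear_extension_delta [simp]: "linear_extension \<phi> (delta x) = \<phi> x"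
proof -
  have "{y. delta x y \<noteq> 0} = {x}" by (auto simp: delta_def)
  then show ?thesis by (simp add: linear_extension_def delta_def)
qed

lemma linear_extension_point:
  assumes "finite {x. f x \<noteq> 0}"
  shows "linear_extension (\<lambda>x. if x = z then 1 else 0 :: complex) f = f z"
proof -
  have "linear_extension (\<lambda>x. if x = z then 1 else 0 :: complex) f
      = (\<Sum>x\<in>insert z {x. f x \<noteq> 0}. f x *\<^sub>C (if x = z then 1 else 0))"
    by (rule linear_extension_superset) (use assms in auto)
  also have "\<dots> = (\<Sum>x\<in>insert z {x. f x \<noteq> 0}. if x = z then f x else 0)"
    by (rule sum.cong) (auto simp: scaleC_complex_def)
  also have "\<dots> = f z" using assms by simp
  finally show ?thesis .
qed

lemma linear_extension_image:
  assumes "finite P" "\<And>z. f z = (\<Sum>p\<in>P. if h p = z then c p else 0)"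
  shows "{z. f z \<noteq> 0} \<subseteq> h ` P" "linear_extension \<phi> f = (\<Sum>p\<in>P. c p *\<^sub>C \<phi> (h p))"
proof -
  show sub: "{z. f z \<noteq> 0} \<subseteq> h ` P"
  proof
    fix z assume z: "z \<in> {z. f z \<noteq> 0}"
    show "z \<in> h ` P"
    proof (rule ccontr)
      assume "z \<notin> h ` P"
      then have "f z = 0" unfolding assms(2) by (intro sum.neutral) auto
      then show False using z by simp
    qed
  qed
  have "linear_extension \<phi> f = (\<Sum>z\<in>h ` P. f z *\<^sub>C \<phi> z)"
    by (rule linear_extension_superset) (use assms(1) sub in auto)
  also have "\<dots> = (\<Sum>z\<in>h ` P. \<Sum>p\<in>P. if h p = z then c p *\<^sub>C \<phi> z else 0)"
  proof (rule sum.cong[OF refl])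
    fix z
    have "f z *\<^sub>C \<phi> z = (\<Sum>p\<in>P. (if h p = z then c p else 0) *\<^sub>C \<phi> z)"
      by (simp only: assms(2) scaleC_sum_left)
    also have "\<dots> = (\<Sum>p\<in>P. if h p = z then c p *\<^sub>C \<phi> z else 0)"
      by (rule sum.cong) auto
    finally show "f z *\<^sub>C \<phi> z = (\<Sum>p\<in>P. if h p = z then c p *\<^sub>C \<phi> z else 0)" .
  qed
  also have "\<dots> = (\<Sum>p\<in>P. \<Sum>z\<in>h ` P. if h p = z then c p *\<^sub>C \<phi> z else 0)"
    by (rule sum.swap)
  also have "\<dots> = (\<Sum>p\<in>P. c p *\<^sub>C \<phi> (h p))"
    by (rule sum.cong) (use assms(1) in auto)
  finally show "linear_extension \<phi> f = (\<Sum>p\<in>P. c p *\<^sub>C \<phi> (h p))" .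
qed

lemma lin_ext_point:
  assumes "finite {x. f x \<noteq> 0}"
  shows "lin_ext h f z = (\<Sum>x | f x \<noteq> 0. if h x = z then f x else 0)"
  unfolding lin_ext_def by (simp add: sum.inter_filter[OF assms, symmetric] conj_commute)

lemmas lin_ext_support = linear_extension_image(1)[OF _ lin_ext_point]

lemma linear_extension_lin_ext:
  assumes "finite {x. f x \<noteq> 0}"
  shows "linear_extension \<phi> (lin_ext h f) = linear_extension (\<lambda>x. \<phi> (h x)) f"
  using linear_extension_image(2)[OF assms lin_ext_point[OF assms], of \<phi> h]
  by (simp only: linear_extension_def[of "\<lambda>x. \<phi> (h x)"])

locale star_monoid = monoid M for M (structure) +
  fixes s :: "'a \<Rightarrow> 'a"
  assumes s_closed: "x \<in> carrier M \<Longrightarrow> s x \<in> carrier M"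
    and s_s: "x \<in> carrier M \<Longrightarrow> s (s x) = x"
    and s_mult: "x \<in> carrier M \<Longrightarrow> y \<in> carrier M \<Longrightarrow> s (x \<otimes> y) = s y \<otimes> s x"
begin

abbreviation "MA \<equiv> monoid_algebra M s"

lemma MA_carrier: "f \<in> carrier MA \<longleftrightarrow> finite {x. f x \<noteq> 0} \<and> {x. f x \<noteq> 0} \<subseteq> carrier M"
  by (simp add: monoid_algebra_def)

lemma MA_fin: "f \<in> carrier MA \<Longrightarrow> finite {x. f x \<noteq> 0}"
  by (simp add: MA_carrier)

lemma MA_supp: "f \<in> carrier MA \<Longrightarrow> f x \<noteq> 0 \<Longrightarrow> x \<in> carrier M"
  by (auto simp: MA_carrier)

lemma MA_simps: "\<one>\<^bsub>MA\<^esub> = delta \<one>" "\<zero>\<^bsub>MA\<^esub> = (\<lambda>z. 0)" "f \<oplus>\<^bsub>MA\<^esub> g = (\<lambda>z. f z + g z)"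
  "c \<odot>\<^bsub>MA\<^esub> f = (\<lambda>z. c * f z)" "adj MA f = lin_ext s (\<lambda>x. cnj (f x))"
  by (simp_all add: monoid_algebra_def)

lemma delta_closed: "x \<in> carrier M \<Longrightarrow> delta x \<in> carrier MA"
  by (auto simp: MA_carrier delta_def)

lemma MA_eqI:
  assumes "f \<in> carrier MA" "g \<in> carrier MA"
    and "\<And>\<phi> :: 'a \<Rightarrow> complex. linear_extension \<phi> f = linear_extension \<phi> g"
  shows "f = g"
  using linear_extension_point[OF MA_fin[OF assms(1)]] linear_extension_point[OF MA_fin[OF assms(2)]]
    assms(3) by (metis ext)

lemma MA_mult_point:
  assumes "f \<in> carrier MA" "g \<in> carrier MA"
  shows "(f \<otimes>\<^bsub>MA\<^esub> g) z = (\<Sum>p\<in>{x. f x \<noteq> 0} \<times> {y. g y \<noteq> 0}.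
    if (case p of (x, y) \<Rightarrow> x \<otimes> y) = z then (case p of (x, y) \<Rightarrow> f x * g y) else 0)"
proof -
  have "{(x, y). f x \<noteq> 0 \<and> g y \<noteq> 0 \<and> x \<otimes> y = z}
      = {p \<in> {x. f x \<noteq> 0} \<times> {y. g y \<noteq> 0}. (case p of (x, y) \<Rightarrow> x \<otimes> y) = z}" by auto
  moreover have "finite ({x. f x \<noteq> 0} \<times> {y. g y \<noteq> 0})" using assms MA_fin by blast
  ultimately show ?thesis
    by (simp only: monoid_algebra_def partial_object.select_convs monoid.select_convs sum.inter_filter)
qed

lemma MA_mult_closed:
  assumes "f \<in> carrier MA" "g \<in> carrier MA"
  shows "f \<otimes>\<^bsub>MA\<^esub> g \<in> carrier MA"
proof -
  have fin: "finite ({x. f x \<noteq> 0} \<times> {y. g y \<noteq> 0})" using assms MA_fin by blast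
  have "{z. (f \<otimes>\<^bsub>MA\<^esub> g) z \<noteq> 0} \<subseteq> (\<lambda>(x, y). x \<otimes> y) ` ({x. f x \<noteq> 0} \<times> {y. g y \<noteq> 0})"
    using linear_extension_image(1)[OF fin MA_mult_point[OF assms]] .
  moreover have "(\<lambda>(x, y). x \<otimes> y) ` ({x. f x \<noteq> 0} \<times> {y. g y \<noteq> 0}) \<subseteq> carrier M"
    using assms MA_supp by auto
  ultimately show ?thesis unfolding MA_carrier using fin by (meson finite_imageI finite_subset subset_trans)
qed

lemma linear_extension_mult:
  assumes "f \<in> carrier MA" "g \<in> carrier MA"
  shows "linear_extension \<phi> (f \<otimes>\<^bsub>MA\<^esub> g) = (\<Sum>x | f x \<noteq> 0. \<Sum>y | g y \<noteq> 0. (f x * g y) *\<^sub>C \<phi> (x \<otimes> y))"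
proof -
  have fin: "finite ({x. f x \<noteq> 0} \<times> {y. g y \<noteq> 0})" using assms MA_fin by blast
  show ?thesis unfolding linear_extension_image(2)[OF fin MA_mult_point[OF assms]] sum.cartesian_product
    by (simp add: case_prod_unfold)
qed

lemma linear_extension_mult':
  assumes "f \<in> carrier MA" "g \<in> carrier MA"
  shows "linear_extension \<phi> (f \<otimes>\<^bsub>MA\<^esub> g) = linear_extension (\<lambda>x. linear_extension (\<lambda>y. \<phi> (x \<otimes> y)) g) f"
  unfolding linear_extension_mult[OF assms]
  by (simp only: linear_extension_def[of _ f] linear_extension_def[of _ g] scaleC_sum_right scaleC_scaleC)

lemma MA_adj_closed:
  assumes "f \<in> carrier MA" shows "adj MA f \<in> carrier MA"
proof -
  have fin: "finite {x. cnj (f x) \<noteq> 0}" using MA_fin[OF assms] by simp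
  have "{z. adj MA f z \<noteq> 0} \<subseteq> s ` {x. cnj (f x) \<noteq> 0}"
    unfolding MA_simps by (rule lin_ext_support[OF fin fin])
  moreover have "s ` {x. cnj (f x) \<noteq> 0} \<subseteq> carrier M"
    using MA_supp[OF assms] s_closed by auto
  ultimately show ?thesis unfolding MA_carrier using fin by (meson finite_imageI finite_subset subset_trans)
qed

lemma linear_extension_adj:
  assumes "f \<in> carrier MA"
  shows "linear_extension \<phi> (adj MA f) = (\<Sum>x | f x \<noteq> 0. cnj (f x) *\<^sub>C \<phi> (s x))"
  using linear_extension_lin_ext[of "\<lambda>x. cnj (f x)" \<phi> s] MA_fin[OF assms]
  by (simp add: MA_simps linear_extension_def)

lemma MA_add_closed:
  assumes "f \<in> carrier MA" "g \<in> carrier MA" shows "f \<oplus>\<^bsub>MA\<^esub> g \<in> carrier MA"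
proof -
  have "{x. f x + g x \<noteq> 0} \<subseteq> {x. f x \<noteq> 0} \<union> {x. g x \<noteq> 0}" by auto
  then show ?thesis using assms unfolding MA_carrier MA_simps
    by (meson Un_least finite_Un finite_subset subset_trans)
qed

lemma MA_smult_closed:
  assumes "f \<in> carrier MA" shows "c \<odot>\<^bsub>MA\<^esub> f \<in> carrier MA"
proof -
  have "{x. c * f x \<noteq> 0} \<subseteq> {x. f x \<noteq> 0}" by auto
  then show ?thesis using assms unfolding MA_carrier MA_simps
    by (meson finite_subset subset_trans)
qed

lemma MA_abelian: "abelian_group MA"
proof (rule abelian_groupI)
  fix f assume f: "f \<in> carrier MA"
  show "\<exists>g\<in>carrier MA. g \<oplus>\<^bsub>MA\<^esub> f = \<zero>\<^bsub>MA\<^esub>"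
    by (rule bexI[of _ "(-1) \<odot>\<^bsub>MA\<^esub> f"]) (rule MA_smult_closed[OF f] | simp add: MA_simps)+
qed ((rule MA_add_closed; assumption) | simp add: MA_simps MA_carrier algebra_simps)+

lemma linear_extension_MA_add:
  "f \<in> carrier MA \<Longrightarrow> g \<in> carrier MA \<Longrightarrow>
    linear_extension \<phi> (f \<oplus>\<^bsub>MA\<^esub> g) = linear_extension \<phi> f + linear_extension \<phi> g"
  by (simp add: MA_simps linear_extension_add MA_fin)

lemma linear_extension_MA_smult:
  "f \<in> carrier MA \<Longrightarrow> linear_extension \<phi> (c \<odot>\<^bsub>MA\<^esub> f) = c *\<^sub>C linear_extension \<phi> f"
  by (simp add: MA_simps linear_extension_scale MA_fin)

lemma linear_extension_fun_add:
  "linear_extension (\<lambda>x. \<phi> x + \<psi> x) f = linear_extension \<phi> f + linear_extension \<psi> f"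
  by (simp add: linear_extension_def scaleC_add_right sum.distrib)

lemma linear_extension_fun_scale:
  "linear_extension (\<lambda>x. c *\<^sub>C \<phi> x) f = c *\<^sub>C linear_extension \<phi> f"
  by (simp add: linear_extension_def scaleC_sum_right mult.commute)

lemma MA_ring: "ring MA"
proof (rule ringI[OF MA_abelian])
  show "monoid MA"
  proof (rule monoidI)
    fix f g h assume c: "f \<in> carrier MA" "g \<in> carrier MA" "h \<in> carrier MA"
    show "f \<otimes>\<^bsub>MA\<^esub> g \<in> carrier MA" by (rule MA_mult_closed[OF c(1,2)])
    show "f \<otimes>\<^bsub>MA\<^esub> g \<otimes>\<^bsub>MA\<^esub> h = f \<otimes>\<^bsub>MA\<^esub> (g \<otimes>\<^bsub>MA\<^esub> h)"
    proof (rule MA_eqI)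
      fix \<phi> :: "'a \<Rightarrow> complex"
      have "linear_extension \<phi> (f \<otimes>\<^bsub>MA\<^esub> g \<otimes>\<^bsub>MA\<^esub> h) =
          linear_extension (\<lambda>x. linear_extension (\<lambda>y. linear_extension (\<lambda>t. \<phi> (x \<otimes> y \<otimes> t)) h) g) f"
        using c by (simp add: linear_extension_mult' MA_mult_closed)
      also have "\<dots> = linear_extension (\<lambda>x. linear_extension (\<lambda>y. linear_extension (\<lambda>t. \<phi> (x \<otimes> (y \<otimes> t))) h) g) f"
        using MA_supp[OF c(1)] MA_supp[OF c(2)] MA_supp[OF c(3)]
        by (intro linear_extension_cong) (simp add: m_assoc)
      also have "\<dots> = linear_extension \<phi> (f \<otimes>\<^bsub>MA\<^esub> (g \<otimes>\<^bsub>MA\<^esub> h))"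
        using c by (simp add: linear_extension_mult' MA_mult_closed)
      finally show "linear_extension \<phi> (f \<otimes>\<^bsub>MA\<^esub> g \<otimes>\<^bsub>MA\<^esub> h) = linear_extension \<phi> (f \<otimes>\<^bsub>MA\<^esub> (g \<otimes>\<^bsub>MA\<^esub> h))" .
    qed (use c in \<open>simp_all add: MA_mult_closed\<close>)
  next
    show "\<one>\<^bsub>MA\<^esub> \<in> carrier MA" by (simp add: MA_simps delta_closed)
    fix f assume f: "f \<in> carrier MA"
    have o: "delta \<one> \<in> carrier MA" by (simp add: delta_closed)
    show "\<one>\<^bsub>MA\<^esub> \<otimes>\<^bsub>MA\<^esub> f = f" unfolding MA_simps
    proof (rule MA_eqI)
      fix \<phi> :: "'a \<Rightarrow> complex"
      show "linear_extension \<phi> (delta \<one> \<otimes>\<^bsub>MA\<^esub> f) = linear_extension \<phi> f"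
        unfolding linear_extension_mult'[OF o f]
        using MA_supp[OF f] by (simp, intro linear_extension_cong) simp
    qed (use f o in \<open>simp_all add: MA_mult_closed\<close>)
    show "f \<otimes>\<^bsub>MA\<^esub> \<one>\<^bsub>MA\<^esub> = f" unfolding MA_simps
    proof (rule MA_eqI)
      fix \<phi> :: "'a \<Rightarrow> complex"
      show "linear_extension \<phi> (f \<otimes>\<^bsub>MA\<^esub> delta \<one>) = linear_extension \<phi> f"
        unfolding linear_extension_mult'[OF f o]
        using MA_supp[OF f] by (simp, intro linear_extension_cong) simp
    qed (use f o in \<open>simp_all add: MA_mult_closed\<close>)
  qed
next
  fix f g h assume c: "f \<in> carrier MA" "g \<in> carrier MA" "h \<in> carrier MA"
  show "(f \<oplus>\<^bsub>MA\<^esub> g) \<otimes>\<^bsub>MA\<^esub> h = f \<otimes>\<^bsub>MA\<^esub> h \<oplus>\<^bsub>MA\<^esub> g \<otimes>\<^bsub>MA\<^esub> h"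
    by (rule MA_eqI) (use c in \<open>simp_all add: MA_mult_closed MA_add_closed linear_extension_mult' linear_extension_MA_add\<close>)
  show "h \<otimes>\<^bsub>MA\<^esub> (f \<oplus>\<^bsub>MA\<^esub> g) = h \<otimes>\<^bsub>MA\<^esub> f \<oplus>\<^bsub>MA\<^esub> h \<otimes>\<^bsub>MA\<^esub> g"
    by (rule MA_eqI) (use c in \<open>simp_all add: MA_mult_closed MA_add_closed linear_extension_mult' linear_extension_MA_add
          linear_extension_fun_add\<close>)
qed

theorem MA_star_algebra: "star_algebra MA"
proof (rule star_algebra.intro[OF MA_ring], unfold_locales)
  fix f g c d assume f: "f \<in> carrier MA"
  show "c \<odot>\<^bsub>MA\<^esub> f \<in> carrier MA" by (rule MA_smult_closed[OF f])
  show "(c + d) \<odot>\<^bsub>MA\<^esub> f = c \<odot>\<^bsub>MA\<^esub> f \<oplus>\<^bsub>MA\<^esub> d \<odot>\<^bsub>MA\<^esub> f" by (simp add: MA_simps algebra_simps)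
  show "(c * d) \<odot>\<^bsub>MA\<^esub> f = c \<odot>\<^bsub>MA\<^esub> (d \<odot>\<^bsub>MA\<^esub> f)" by (simp add: MA_simps algebra_simps)
  show "1 \<odot>\<^bsub>MA\<^esub> f = f" by (simp add: MA_simps)
  show "adj MA f \<in> carrier MA" by (rule MA_adj_closed[OF f])
  have adj2: "linear_extension \<phi> (adj MA h) = cnj (linear_extension (\<lambda>x. cnj (\<phi> (s x))) h)"
    if "h \<in> carrier MA" for \<phi> :: "'a \<Rightarrow> complex" and h
    unfolding linear_extension_adj[OF that] by (simp add: linear_extension_def scaleC_complex_def)
  show "adj MA (adj MA f) = f"
  proof (rule MA_eqI)
    fix \<phi> :: "'a \<Rightarrow> complex"
    have "linear_extension \<phi> (adj MA (adj MA f)) = linear_extension (\<lambda>x. \<phi> (s (s x))) f"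
      using f by (simp add: adj2 MA_adj_closed)
    also have "\<dots> = linear_extension \<phi> f"
      using MA_supp[OF f] by (intro linear_extension_cong) (simp add: s_s)
    finally show "linear_extension \<phi> (adj MA (adj MA f)) = linear_extension \<phi> f" .
  qed (use f in \<open>simp_all add: MA_adj_closed\<close>)
  show "adj MA (c \<odot>\<^bsub>MA\<^esub> f) = cnj c \<odot>\<^bsub>MA\<^esub> adj MA f"
    by (rule MA_eqI) (use f in \<open>simp_all add: MA_adj_closed MA_smult_closed adj2 linear_extension_MA_smult scaleC_complex_def\<close>)
  assume g: "g \<in> carrier MA"
  show "c \<odot>\<^bsub>MA\<^esub> (f \<oplus>\<^bsub>MA\<^esub> g) = c \<odot>\<^bsub>MA\<^esub> f \<oplus>\<^bsub>MA\<^esub> c \<odot>\<^bsub>MA\<^esub> g" by (simp add: MA_simps algebra_simps)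
  show "c \<odot>\<^bsub>MA\<^esub> f \<otimes>\<^bsub>MA\<^esub> g = c \<odot>\<^bsub>MA\<^esub> (f \<otimes>\<^bsub>MA\<^esub> g)"
    by (rule MA_eqI) (use f g in \<open>simp_all add: MA_mult_closed MA_smult_closed linear_extension_mult' linear_extension_MA_smult\<close>)
  show "f \<otimes>\<^bsub>MA\<^esub> (c \<odot>\<^bsub>MA\<^esub> g) = c \<odot>\<^bsub>MA\<^esub> (f \<otimes>\<^bsub>MA\<^esub> g)"
    by (rule MA_eqI) (use f g in \<open>simp_all add: MA_mult_closed MA_smult_closed linear_extension_mult' linear_extension_MA_smult
          linear_extension_fun_scale\<close>)
  show "adj MA (f \<oplus>\<^bsub>MA\<^esub> g) = adj MA f \<oplus>\<^bsub>MA\<^esub> adj MA g"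
    by (rule MA_eqI) (use f g in \<open>simp_all add: MA_adj_closed MA_add_closed adj2 linear_extension_MA_add\<close>)
  show "adj MA (f \<otimes>\<^bsub>MA\<^esub> g) = adj MA g \<otimes>\<^bsub>MA\<^esub> adj MA f"
  proof (rule MA_eqI)
    fix \<phi> :: "'a \<Rightarrow> complex"
    have "linear_extension \<phi> (adj MA (f \<otimes>\<^bsub>MA\<^esub> g))
        = (\<Sum>x | f x \<noteq> 0. \<Sum>y | g y \<noteq> 0. cnj (f x) * cnj (g y) * \<phi> (s (x \<otimes> y)))"
      using f g by (simp add: adj2 MA_mult_closed linear_extension_mult scaleC_complex_def)
    also have "\<dots> = (\<Sum>y | g y \<noteq> 0. \<Sum>x | f x \<noteq> 0. cnj (f x) * cnj (g y) * \<phi> (s (x \<otimes> y)))"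
      by (rule sum.swap)
    also have "\<dots> = (\<Sum>y | g y \<noteq> 0. \<Sum>x | f x \<noteq> 0. cnj (g y) * (cnj (f x) * \<phi> (s y \<otimes> s x)))"
      using MA_supp[OF f] MA_supp[OF g] by (intro sum.cong refl) (simp add: s_mult)
    also have "\<dots> = linear_extension \<phi> (adj MA g \<otimes>\<^bsub>MA\<^esub> adj MA f)"
      using f g by (simp add: linear_extension_mult' linear_extension_adj MA_adj_closed scaleC_complex_def sum_distrib_left)
    finally show "linear_extension \<phi> (adj MA (f \<otimes>\<^bsub>MA\<^esub> g)) = linear_extension \<phi> (adj MA g \<otimes>\<^bsub>MA\<^esub> adj MA f)" .
  qed (use f g in \<open>simp_all add: MA_mult_closed MA_adj_closed\<close>)
qed

theorem linear_extension_class_hom: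
  fixes \<phi> :: "'a \<Rightarrow> 't::complex_star_algebra"
  assumes "\<phi> \<one> = 1" "\<And>x y. x \<in> carrier M \<Longrightarrow> y \<in> carrier M \<Longrightarrow> \<phi> (x \<otimes> y) = \<phi> x * \<phi> y"
    and "\<And>x. x \<in> carrier M \<Longrightarrow> \<phi> (s x) = star (\<phi> x)"
  shows "class_hom MA (linear_extension \<phi>)"
  unfolding class_hom_def
proof (intro conjI ballI allI)
  show "linear_extension \<phi> \<one>\<^bsub>MA\<^esub> = 1" by (simp add: MA_simps assms(1))
  fix f assume f: "f \<in> carrier MA"
  show "linear_extension \<phi> (c \<odot>\<^bsub>MA\<^esub> f) = c *\<^sub>C linear_extension \<phi> f" for c
    by (rule linear_extension_MA_smult[OF f])
  show "linear_extension \<phi> (adj MA f) = star (linear_extension \<phi> f)"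
    unfolding linear_extension_adj[OF f] linear_extension_def[of _ f] star_sum
    using MA_supp[OF f] by (intro sum.cong) (auto simp: star_scaleC assms(3))
  fix g assume g: "g \<in> carrier MA"
  show "linear_extension \<phi> (f \<oplus>\<^bsub>MA\<^esub> g) = linear_extension \<phi> f + linear_extension \<phi> g"
    by (rule linear_extension_MA_add[OF f g])
  show "linear_extension \<phi> (f \<otimes>\<^bsub>MA\<^esub> g) = linear_extension \<phi> f * linear_extension \<phi> g"
    unfolding linear_extension_mult[OF f g] linear_extension_def[of _ f] linear_extension_def[of _ g] sum_product
    using MA_supp[OF f] MA_supp[OF g] by (intro sum.cong refl) (auto simp: assms(2) mult.commute)
qed

lemma finsum_MA_point:
  assumes "finite S" "\<And>i. i \<in> S \<Longrightarrow> g i \<in> carrier MA"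
  shows "(\<Oplus>\<^bsub>MA\<^esub>i\<in>S. g i) z = (\<Sum>i\<in>S. g i z)"
proof -
  interpret MA: star_algebra MA by (rule MA_star_algebra)
  show ?thesis using assms by (induct S) (simp_all add: Pi_def MA_simps)
qed

lemma MA_expand:
  assumes "f \<in> carrier MA"
  shows "f = (\<Oplus>\<^bsub>MA\<^esub>x\<in>{x. f x \<noteq> 0}. f x \<odot>\<^bsub>MA\<^esub> delta x)"
proof
  fix z
  have "(\<Oplus>\<^bsub>MA\<^esub>x\<in>{x. f x \<noteq> 0}. f x \<odot>\<^bsub>MA\<^esub> delta x) z = (\<Sum>x | f x \<noteq> 0. (f x \<odot>\<^bsub>MA\<^esub> delta x) z)"
    by (rule finsum_MA_point) (use assms in \<open>auto simp: MA_fin intro!: MA_smult_closed delta_closed MA_supp\<close>)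
  also have "\<dots> = (\<Sum>x | f x \<noteq> 0. if x = z then f x else 0)"
    by (rule sum.cong) (auto simp: MA_simps delta_def)
  also have "\<dots> = f z" using MA_fin[OF assms] by simp
  finally show "f z = (\<Oplus>\<^bsub>MA\<^esub>x\<in>{x. f x \<noteq> 0}. f x \<odot>\<^bsub>MA\<^esub> delta x) z" by simp
qed

lemma delta_mult:
  assumes "x \<in> carrier M" "y \<in> carrier M"
  shows "delta x \<otimes>\<^bsub>MA\<^esub> delta y = delta (x \<otimes> y)"
  by (rule MA_eqI) (use assms in \<open>simp_all add: MA_mult_closed delta_closed linear_extension_mult'\<close>)

lemma adj_delta:
  assumes "x \<in> carrier M"
  shows "adj MA (delta x) = delta (s x)"
proof (rule MA_eqI)
  have "{y. delta x y \<noteq> 0} = {x}" by (auto simp: delta_def)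
  then show "linear_extension \<phi> (adj MA (delta x)) = linear_extension \<phi> (delta (s x))" for \<phi> :: "'a \<Rightarrow> complex"
    using assms by (simp add: linear_extension_adj delta_closed) (simp add: delta_def)
qed (use assms in \<open>simp_all add: MA_adj_closed delta_closed s_closed\<close>)

end

section \<open>Quotients by *-ideals\<close>

lemma ring_cong_record:
  assumes "ring R" "carrier S = carrier R" "mult S = mult R" "one S = one R" "zero S = zero R" "add S = add R"
  shows "ring S"
proof -
  interpret R: ring R by fact
  show ?thesis
  proof (rule ringI)
    show "abelian_group S"
    proof (rule abelian_groupI)
      fix x assume "x \<in> carrier S"
      then show "\<exists>y\<in>carrier S. y \<oplus>\<^bsub>S\<^esub> x = \<zero>\<^bsub>S\<^esub>"
        by (intro bexI[of _ "\<ominus>\<^bsub>R\<^esub> x"]) (simp_all add: assms R.l_neg)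
    qed (simp_all add: assms R.a_ac)
    show "monoid S" by (rule monoidI) (simp_all add: assms R.m_assoc)
  qed (simp_all add: assms R.l_distr R.r_distr)
qed

context star_algebra
begin

lemma kernel_ideal:
  assumes "star_algebra B" "h \<in> star_hom A B"
  shows "ideal {x \<in> carrier A. h x = \<zero>\<^bsub>B\<^esub>} A"
proof -
  interpret B: star_algebra B by fact
  note h = star_hom_zero[OF star_algebra_axioms assms] star_hom_add[OF assms(2)] star_hom_mult[OF assms(2)]
    star_hom_closed[OF assms(2)]
  show ?thesis
  proof (rule idealI[OF ring_axioms])
    show "subgroup {x \<in> carrier A. h x = \<zero>\<^bsub>B\<^esub>} (add_monoid A)"
    proof (rule add.subgroupI)
      show "{x \<in> carrier A. h x = \<zero>\<^bsub>B\<^esub>} \<noteq> {}" using h(1) by auto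
      fix a assume "a \<in> {x \<in> carrier A. h x = \<zero>\<^bsub>B\<^esub>}"
      then show "\<ominus> a \<in> {x \<in> carrier A. h x = \<zero>\<^bsub>B\<^esub>}"
        using star_hom_smult[OF assms(2), of a "-1"] by (simp add: smult_minus_one B.smult_zero_right)
    qed (auto simp: h)
  qed (auto simp: h)
qed

text \<open>The kernel of \<open>h\<close> is an ideal.\<close>

lemma genideal_vanish:
  assumes "star_algebra B" "h \<in> star_hom A B" "S \<subseteq> carrier A" "\<And>x. x \<in> S \<Longrightarrow> h x = \<zero>\<^bsub>B\<^esub>" "x \<in> Idl S"
  shows "h x = \<zero>\<^bsub>B\<^esub>"
  using genideal_minimal[OF kernel_ideal[OF assms(1,2)], of S] assms(3-5) by auto

text \<open>The elements whose adjoint lies in the ideal form an ideal, too.\<close>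

lemma genideal_adj_closed:
  assumes S: "S \<subseteq> carrier A" "adj A ` S \<subseteq> S" and x: "x \<in> Idl S"
  shows "adj A x \<in> Idl S"
proof -
  interpret I: ideal "Idl S" A by (rule genideal_ideal[OF S(1)])
  have "ideal {x \<in> carrier A. adj A x \<in> Idl S} A"
  proof (rule idealI[OF ring_axioms])
    show "subgroup {x \<in> carrier A. adj A x \<in> Idl S} (add_monoid A)"
    proof (rule add.subgroupI)
      show "{x \<in> carrier A. adj A x \<in> Idl S} \<noteq> {}" using adj_zero I.zero_closed by auto
      fix a assume "a \<in> {x \<in> carrier A. adj A x \<in> Idl S}"
      then have a: "a \<in> carrier A" "adj A a \<in> Idl S" by auto
      have "adj A (\<ominus> a) = \<ominus> adj A a"
        using adj_smult[OF a(1), of "-1"] a adj_closed by (simp add: smult_minus_one)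
      then show "\<ominus> a \<in> {x \<in> carrier A. adj A x \<in> Idl S}"
        using a I.a_inv_closed by simp
    qed (auto simp: adj_add)
  qed (auto simp: adj_mult adj_closed I.I_l_closed I.I_r_closed)
  moreover have "S \<subseteq> {x \<in> carrier A. adj A x \<in> Idl S}"
    using S genideal_self[OF S(1)] by auto
  ultimately show ?thesis using genideal_minimal x by blast
qed

end

locale star_ideal = star_algebra A + ideal I A for A (structure) and I +
  assumes I_adj: "x \<in> I \<Longrightarrow> adj A x \<in> I"
begin

abbreviation "Q \<equiv> quot_star_alg A I"

lemma I_smult: "x \<in> I \<Longrightarrow> c \<odot> x \<in> I"
  using I_l_closed[of x "c \<odot> \<one>"] smult_mult_left[of \<one> x c] a_subset smult_closed[of \<one> c] by auto

lemma Q_carrier: "carrier Q = (+>) I ` carrier A"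
  by (auto simp: quot_star_alg_def FactRing_def A_RCOSETS_def')

lemma Q_one: "\<one>\<^bsub>Q\<^esub> = I +> \<one>"
  by (simp add: quot_star_alg_def FactRing_def)

lemma Q_add: "x \<in> carrier A \<Longrightarrow> y \<in> carrier A \<Longrightarrow> (I +> x) \<oplus>\<^bsub>Q\<^esub> (I +> y) = I +> (x \<oplus> y)"
  by (simp add: quot_star_alg_def FactRing_def a_rcos_sum)

lemma Q_mult: "x \<in> carrier A \<Longrightarrow> y \<in> carrier A \<Longrightarrow> (I +> x) \<otimes>\<^bsub>Q\<^esub> (I +> y) = I +> (x \<otimes> y)"
  by (simp add: quot_star_alg_def FactRing_def rcoset_mult_add)

lemma Q_smult:
  assumes x: "x \<in> carrier A"
  shows "c \<odot>\<^bsub>Q\<^esub> (I +> x) = I +> (c \<odot> x)"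
proof -
  have i: "i \<in> carrier A" if "i \<in> I" for i using that a_subset by auto
  have "set_add A I ((\<odot>) c ` (I +> x)) = I +> (c \<odot> x)"
  proof (intro equalityI subsetI)
    fix z assume "z \<in> set_add A I ((\<odot>) c ` (I +> x))"
    then obtain h k where hk: "h \<in> I" "k \<in> I" "z = h \<oplus> c \<odot> (k \<oplus> x)"
      by (auto simp: set_add_def' a_r_coset_def')
    then have "z = (h \<oplus> c \<odot> k) \<oplus> c \<odot> x"
      using x i by (simp add: smult_r_distr smult_closed a_assoc)
    moreover have "h \<oplus> c \<odot> k \<in> I" using hk I_smult by simp
    ultimately show "z \<in> I +> (c \<odot> x)" by (auto simp: a_r_coset_def')
  next
    fix z assume "z \<in> I +> (c \<odot> x)"
    then obtain h where h: "h \<in> I" "z = h \<oplus> c \<odot> x" by (auto simp: a_r_coset_def')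
    moreover have "x \<in> I +> x" using a_rcos_self[OF x] .
    ultimately show "z \<in> set_add A I ((\<odot>) c ` (I +> x))" by (auto simp: set_add_def')
  qed
  then show ?thesis by (simp add: quot_star_alg_def)
qed

lemma Q_adj:
  assumes x: "x \<in> carrier A"
  shows "adj Q (I +> x) = I +> adj A x"
proof -
  have i: "i \<in> carrier A" if "i \<in> I" for i using that a_subset by auto
  have "adj A ` (I +> x) = I +> adj A x"
  proof (intro equalityI subsetI)
    fix z assume "z \<in> adj A ` (I +> x)"
    then obtain h where h: "h \<in> I" "z = adj A (h \<oplus> x)" by (auto simp: a_r_coset_def')
    then have "z = adj A h \<oplus> adj A x" using x i by (simp add: adj_add)
    then show "z \<in> I +> adj A x" using I_adj[OF h(1)] by (auto simp: a_r_coset_def')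
  next
    fix z assume "z \<in> I +> adj A x"
    then obtain h where h: "h \<in> I" "z = h \<oplus> adj A x" by (auto simp: a_r_coset_def')
    then have "z = adj A (adj A h \<oplus> x)" using x i by (simp add: adj_add adj_closed adj_adj)
    moreover have "adj A h \<oplus> x \<in> I +> x" using I_adj[OF h(1)] by (auto simp: a_r_coset_def')
    ultimately show "z \<in> adj A ` (I +> x)" by blast
  qed
  then show ?thesis by (simp add: quot_star_alg_def)
qed

lemma Q_ring: "ring Q"
  by (rule ring_cong_record[OF quotient_is_ring]) (simp_all add: quot_star_alg_def)

theorem Q_star_algebra: "star_algebra Q"
proof (rule star_algebra.intro[OF Q_ring], unfold_locales)
  fix X Y c d assume "X \<in> carrier Q"
  then obtain x where x: "x \<in> carrier A" "X = I +> x" by (auto simp: Q_carrier)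
  note s = x(1) smult_closed adj_closed Q_smult Q_adj Q_add Q_mult
  show "c \<odot>\<^bsub>Q\<^esub> X \<in> carrier Q" "adj Q X \<in> carrier Q" unfolding x(2) by (auto simp: s Q_carrier)
  show "(c + d) \<odot>\<^bsub>Q\<^esub> X = c \<odot>\<^bsub>Q\<^esub> X \<oplus>\<^bsub>Q\<^esub> d \<odot>\<^bsub>Q\<^esub> X" unfolding x(2) by (simp add: s smult_l_distr)
  show "(c * d) \<odot>\<^bsub>Q\<^esub> X = c \<odot>\<^bsub>Q\<^esub> (d \<odot>\<^bsub>Q\<^esub> X)" unfolding x(2) by (simp add: s smult_smult)
  show "1 \<odot>\<^bsub>Q\<^esub> X = X" unfolding x(2) by (simp add: s smult_one)
  show "adj Q (adj Q X) = X" unfolding x(2) by (simp add: s adj_adj)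
  show "adj Q (c \<odot>\<^bsub>Q\<^esub> X) = cnj c \<odot>\<^bsub>Q\<^esub> adj Q X" unfolding x(2) by (simp add: s adj_smult)
  assume "Y \<in> carrier Q"
  then obtain y where y: "y \<in> carrier A" "Y = I +> y" by (auto simp: Q_carrier)
  show "c \<odot>\<^bsub>Q\<^esub> (X \<oplus>\<^bsub>Q\<^esub> Y) = c \<odot>\<^bsub>Q\<^esub> X \<oplus>\<^bsub>Q\<^esub> c \<odot>\<^bsub>Q\<^esub> Y" unfolding x(2) y(2) by (simp add: s y smult_r_distr)
  show "c \<odot>\<^bsub>Q\<^esub> X \<otimes>\<^bsub>Q\<^esub> Y = c \<odot>\<^bsub>Q\<^esub> (X \<otimes>\<^bsub>Q\<^esub> Y)" unfolding x(2) y(2) by (simp add: s y smult_mult_left)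
  show "X \<otimes>\<^bsub>Q\<^esub> (c \<odot>\<^bsub>Q\<^esub> Y) = c \<odot>\<^bsub>Q\<^esub> (X \<otimes>\<^bsub>Q\<^esub> Y)" unfolding x(2) y(2) by (simp add: s y smult_mult_right)
  show "adj Q (X \<oplus>\<^bsub>Q\<^esub> Y) = adj Q X \<oplus>\<^bsub>Q\<^esub> adj Q Y" unfolding x(2) y(2) by (simp add: s y adj_add)
  show "adj Q (X \<otimes>\<^bsub>Q\<^esub> Y) = adj Q Y \<otimes>\<^bsub>Q\<^esub> adj Q X" unfolding x(2) y(2) by (simp add: s y adj_mult)
qed

lemma projection_star_hom: "(+>) I \<in> star_hom A Q"
  by (rule star_homI) (auto simp: Q_carrier Q_mult Q_add Q_one Q_smult Q_adj)

theorem factor_star_hom: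
  assumes B: "star_algebra B" and h: "h \<in> star_hom A B" and I0: "\<And>x. x \<in> I \<Longrightarrow> h x = \<zero>\<^bsub>B\<^esub>"
  shows "(\<lambda>X. the_elem (h ` X)) \<in> star_hom Q B"
    and "x \<in> carrier A \<Longrightarrow> the_elem (h ` (I +> x)) = h x"
proof -
  interpret B: star_algebra B by fact
  have e: "the_elem (h ` (I +> x)) = h x" if x: "x \<in> carrier A" for x
  proof -
    have "h y = h x" if y: "y \<in> I +> x" for y
    proof -
      obtain i where i: "i \<in> I" "y = i \<oplus> x" using y by (auto simp: a_r_coset_def')
      then have "i \<in> carrier A" using a_subset by auto
      then show ?thesis using x i I0[OF i(1)] star_hom_closed[OF h x] by (simp add: star_hom_add[OF h])
    qed
    moreover have "x \<in> I +> x" using a_rcos_self[OF x] .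
    ultimately have "h ` (I +> x) = {h x}" by blast
    then show ?thesis by simp
  qed
  then show "x \<in> carrier A \<Longrightarrow> the_elem (h ` (I +> x)) = h x" .
  show "(\<lambda>X. the_elem (h ` X)) \<in> star_hom Q B"
    by (rule star_homI)
      (auto simp: Q_carrier Q_mult Q_add Q_one Q_smult Q_adj e star_hom_closed[OF h] star_hom_mult[OF h]
        star_hom_add[OF h] star_hom_one[OF h] star_hom_smult[OF h] star_hom_adj[OF h] smult_closed adj_closed)
qed

end

section \<open>Universal *-algebras\<close>

text \<open>The letter \<open>(x, True)\<close> stands for the adjoint of the generator \<open>x\<close>; the involution of words therefore reverses
them and flips the flags.\<close>

definition word_monoid :: "'g set \<Rightarrow> ('g \<times> bool) list monoid" where
  "word_monoid X = \<lparr>carrier = lists (X \<times> UNIV), mult = (@), one = []\<rparr>"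

lemma word_star_monoid: "star_monoid (word_monoid X) (\<lambda>w. rev (map (apsnd Not) w))"
proof (intro star_monoid.intro star_monoid_axioms.intro)
  show "monoid (word_monoid X)" by (rule monoidI) (auto simp: word_monoid_def)
next
  fix w assume "w \<in> carrier (word_monoid X)"
  then show "rev (map (apsnd Not) w) \<in> carrier (word_monoid X)" by (fastforce simp: word_monoid_def)
  show "rev (map (apsnd Not) (rev (map (apsnd Not) w))) = w"
    by (induct w) (auto simp: rev_map)
qed (simp add: word_monoid_def)

lemma free_star_alg_eq: "free_star_alg X = monoid_algebra (word_monoid X) (\<lambda>w. rev (map (apsnd Not) w))"
  by (simp add: free_star_alg_def word_monoid_def)

definition free_eval :: "('g \<Rightarrow> 't::complex_star_algebra) \<Rightarrow> (('g \<times> bool) list \<Rightarrow> complex) \<Rightarrow> 't" where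
  "free_eval b = linear_extension (\<lambda>w. prod_list (map (\<lambda>(x, t). if t then star (b x) else b x) w))"

context
  fixes X :: "'g set"
begin

interpretation W: star_monoid "word_monoid X" "\<lambda>w. rev (map (apsnd Not) w)"
  by (rule word_star_monoid)

lemma free_star_algebra: "star_algebra (free_star_alg X)"
  unfolding free_star_alg_eq by (rule W.MA_star_algebra)

lemma free_gen_closed: "x \<in> X \<Longrightarrow> free_gen x \<in> carrier (free_star_alg X)"
  unfolding free_star_alg_eq free_gen_def by (rule W.delta_closed) (simp add: word_monoid_def)

lemma free_generated:
  assumes "f \<in> carrier (free_star_alg X)"
  shows "f \<in> star_generated (free_star_alg X) (free_gen ` X)"
proof -
  let ?F = "free_star_alg X" and ?G = "star_generated (free_star_alg X) (free_gen ` X)"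
  interpret F: star_algebra ?F by (rule free_star_algebra)
  have one: "\<one>\<^bsub>?F\<^esub> \<in> ?G" by (rule star_generated.one)
  have word: "delta w \<in> ?G" if "w \<in> lists (X \<times> UNIV)" for w
    using that
  proof (induct w)
    case Nil
    have "\<one>\<^bsub>?F\<^esub> = delta []" unfolding free_star_alg_eq W.MA_simps by (simp add: word_monoid_def)
    then show ?case using one by simp
  next
    case (Cons l w)
    then obtain x t where l: "l = (x, t)" "x \<in> X" by auto
    have "free_gen x \<in> ?G" using l by (auto intro: star_generated.base)
    moreover have "delta [(x, True)] = adj ?F (free_gen x)"
      unfolding free_star_alg_eq free_gen_def using l by (subst W.adj_delta) (auto simp: word_monoid_def)
    ultimately have "delta [l] \<in> ?G"
      using l by (cases t) (auto simp: free_gen_def intro: star_generated.adj)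
    moreover have "delta (l # w) = delta [l] \<otimes>\<^bsub>?F\<^esub> delta w"
      unfolding free_star_alg_eq using Cons by (subst W.delta_mult) (auto simp: word_monoid_def)
    ultimately show ?case using Cons by (auto intro: star_generated.mult)
  qed
  have supp: "w \<in> lists (X \<times> UNIV)" if "f w \<noteq> 0" for w
    using W.MA_supp[of f w] assms that by (simp add: free_star_alg_eq word_monoid_def)
  have z: "\<zero>\<^bsub>?F\<^esub> \<in> ?G"
    using star_generated.smult[OF one, of 0] by (simp add: F.smult_zero_left)
  have "(\<Oplus>\<^bsub>?F\<^esub>x\<in>S. f x \<odot>\<^bsub>?F\<^esub> delta x) \<in> ?G" if "finite S" "S \<subseteq> lists (X \<times> UNIV)" for S
    using that
  proof (induct S)
    case (insert w S)
    have c: "f w \<odot>\<^bsub>?F\<^esub> delta w \<in> carrier ?F" if "w \<in> lists (X \<times> UNIV)" for w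
      unfolding free_star_alg_eq using that by (intro W.MA_smult_closed W.delta_closed) (simp add: word_monoid_def)
    have "(\<Oplus>\<^bsub>?F\<^esub>x\<in>insert w S. f x \<odot>\<^bsub>?F\<^esub> delta x) = f w \<odot>\<^bsub>?F\<^esub> delta w \<oplus>\<^bsub>?F\<^esub> (\<Oplus>\<^bsub>?F\<^esub>x\<in>S. f x \<odot>\<^bsub>?F\<^esub> delta x)"
      using insert c by (intro F.finsum_insert) auto
    then show ?case using insert word by (auto intro: star_generated.intros)
  qed (simp add: z)
  moreover have "finite {w. f w \<noteq> 0}" "{w. f w \<noteq> 0} \<subseteq> lists (X \<times> UNIV)"
    using assms supp W.MA_fin[of f] by (auto simp: free_star_alg_eq)
  ultimately have mem: "(\<Oplus>\<^bsub>?F\<^esub>x\<in>{x. f x \<noteq> 0}. f x \<odot>\<^bsub>?F\<^esub> delta x) \<in> ?G" by blast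
  have "(\<Oplus>\<^bsub>?F\<^esub>x\<in>{x. f x \<noteq> 0}. f x \<odot>\<^bsub>?F\<^esub> delta x) = f"
    using W.MA_expand[of f] assms by (simp only: free_star_alg_eq)
  from subst[OF this, of "\<lambda>g. g \<in> ?G", OF mem] show ?thesis .
qed

lemma free_eval_class_hom: "class_hom (free_star_alg X) (free_eval b)"
  unfolding free_star_alg_eq free_eval_def
proof (rule W.linear_extension_class_hom)
  fix w
  have "map (\<lambda>(x, t). if t then star (b x) else b x) (map (apsnd Not) w)
      = map star (map (\<lambda>(x, t). if t then star (b x) else b x) w)"
    by (induct w) auto
  then show "prod_list (map (\<lambda>(x, t). if t then star (b x) else b x) (rev (map (apsnd Not) w)))
      = star (prod_list (map (\<lambda>(x, t). if t then star (b x) else b x) w))"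
    by (simp add: star_prod_list rev_map[symmetric] del: map_map)
qed (simp_all add: word_monoid_def)

lemma free_eval_gen: "free_eval b (free_gen x) = b x"
  by (simp add: free_eval_def free_gen_def)

lemma free_star_hom_eq:
  assumes "g \<in> star_hom (free_star_alg X) B" "h \<in> star_hom (free_star_alg X) B"
    and "\<And>x. x \<in> X \<Longrightarrow> g (free_gen x) = h (free_gen x)" "f \<in> carrier (free_star_alg X)"
  shows "g f = h f"
  by (rule star_hom_eq_on_generated[OF free_star_algebra _ assms(1,2) _ free_generated[OF assms(4)]])
    (use assms(3) free_gen_closed in auto)

end

locale presentation =
  fixes X :: "'g set" and E :: "((('g \<times> bool) list \<Rightarrow> complex) \<times> (('g \<times> bool) list \<Rightarrow> complex)) set"
  assumes E_closed: "(p, q) \<in> E \<Longrightarrow> p \<in> carrier (free_star_alg X) \<and> q \<in> carrier (free_star_alg X)"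
begin

abbreviation "F \<equiv> free_star_alg X"
abbreviation "U \<equiv> universal_star_alg X E"
abbreviation "gen \<equiv> universal_gen X E"

definition "relators = {p \<ominus>\<^bsub>F\<^esub> q | p q. (p, q) \<in> E}"

sublocale F: star_algebra F by (rule free_star_algebra)

lemma relators_closed: "relators \<union> adj F ` relators \<subseteq> carrier F"
  using E_closed by (auto simp: relators_def intro!: F.adj_closed F.minus_closed)

lemma relation_ideal_eq: "relation_ideal X E = Idl\<^bsub>F\<^esub> (relators \<union> adj F ` relators)"
  by (simp add: relation_ideal_def relators_def Let_def)

sublocale I: star_ideal F "relation_ideal X E"
proof (intro star_ideal.intro star_ideal_axioms.intro)
  show "star_algebra F" by (rule free_star_algebra)
  show "ideal (relation_ideal X E) F" unfolding relation_ideal_eq by (rule F.genideal_ideal[OF relators_closed])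
  have "adj F ` (relators \<union> adj F ` relators) \<subseteq> relators \<union> adj F ` relators"
    using relators_closed by (auto simp: F.adj_adj)
  then show "adj F x \<in> relation_ideal X E" if "x \<in> relation_ideal X E" for x
    using that unfolding relation_ideal_eq by (intro F.genideal_adj_closed[OF relators_closed])
qed

lemma U_star_algebra: "star_algebra U"
  unfolding universal_star_alg_def by (rule I.Q_star_algebra)

definition proj :: "(('g \<times> bool) list \<Rightarrow> complex) \<Rightarrow> (('g \<times> bool) list \<Rightarrow> complex) set" where
  "proj f = relation_ideal X E +>\<^bsub>F\<^esub> f"

lemma proj_star_hom: "proj \<in> star_hom F U"
  unfolding universal_star_alg_def proj_def[abs_def] by (rule I.projection_star_hom)

lemma proj_gen: "proj (free_gen x) = gen x"
  by (simp add: proj_def universal_gen_def)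

lemma proj_eq: "(p, q) \<in> E \<Longrightarrow> proj p = proj q"
proof -
  assume pq: "(p, q) \<in> E"
  have "p \<ominus>\<^bsub>F\<^esub> q \<in> relation_ideal X E"
    unfolding relation_ideal_eq using pq F.genideal_self[OF relators_closed] by (auto simp: relators_def)
  then show ?thesis unfolding proj_def
    using F.quotient_eq_iff_same_a_r_cos[OF I.ideal_axioms] E_closed[OF pq] by blast
qed

lemma gen_closed: "x \<in> X \<Longrightarrow> gen x \<in> carrier U"
  using star_hom_closed[OF proj_star_hom free_gen_closed] by (simp add: proj_gen)

lemma U_generated: "carrier U = star_generated U (gen ` X)"
proof (intro equalityI subsetI)
  fix y assume "y \<in> carrier U"
  then obtain f where f: "f \<in> carrier F" "y = proj f"
    unfolding universal_star_alg_def I.Q_carrier by (auto simp: proj_def)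
  have "proj f \<in> star_generated U (proj ` free_gen ` X)"
    by (rule star_generated_image[OF free_star_algebra _ proj_star_hom free_generated[OF f(1)]])
      (auto intro: free_gen_closed)
  then show "y \<in> star_generated U (gen ` X)" using f by (simp add: image_image proj_gen)
next
  fix y assume "y \<in> star_generated U (gen ` X)"
  then show "y \<in> carrier U"
    by (rule star_generated_closed[OF U_star_algebra, rotated]) (auto intro: gen_closed)
qed

lemma U_hom_eq:
  assumes "g \<in> star_hom U B" "h \<in> star_hom U B" "\<And>x. x \<in> X \<Longrightarrow> g (gen x) = h (gen x)" "y \<in> carrier U"
  shows "g y = h y"
  by (rule star_hom_eq_on_generated[OF U_star_algebra _ assms(1,2), of "gen ` X"])
    (use assms(3,4) gen_closed U_generated in auto)

definition satisfies :: "('g \<Rightarrow> 't::complex_star_algebra) \<Rightarrow> bool" where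
  "satisfies b \<longleftrightarrow> (\<forall>(p, q)\<in>E. free_eval b p = free_eval b q)"

text \<open>Evaluation at \<open>b\<close> followed by the component \<open>B\<close> vanishes on the relators, hence on the ideal generated by them and
their adjoints.\<close>

theorem universal_property:
  assumes b: "satisfies b" and B: "star_algebra B"
  shows "\<exists>h\<in>star_hom U B. \<forall>x\<in>X. h (gen x) = component (b x) B"
proof -
  interpret B: star_algebra B by fact
  let ?e = "\<lambda>f. component (free_eval b f) B"
  have e: "?e \<in> star_hom F B" by (rule class_hom_component[OF free_eval_class_hom B])
  have r: "?e x = \<zero>\<^bsub>B\<^esub>" if x: "x \<in> relators" for x
  proof -
    obtain p q where pq: "(p, q) \<in> E" "x = p \<ominus>\<^bsub>F\<^esub> q" using x by (auto simp: relators_def)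
    then have "?e x = ?e p \<ominus>\<^bsub>B\<^esub> ?e q"
      using E_closed[OF pq(1)] star_hom_a_minus[OF free_star_algebra B e] by simp
    also have "?e p = ?e q" using b pq(1) by (auto simp: satisfies_def)
    finally show ?thesis using B by (simp add: B.minus_eq B.r_neg)
  qed
  have "?e x = \<zero>\<^bsub>B\<^esub>" if "x \<in> relators \<union> adj F ` relators" for x
    using that r relators_closed by (auto simp: star_hom_adj[OF e] B.adj_zero)
  then have "?e x = \<zero>\<^bsub>B\<^esub>" if "x \<in> relation_ideal X E" for x
    using F.genideal_vanish[OF B e relators_closed] that unfolding relation_ideal_eq by blast
  note fac = I.factor_star_hom[OF B e this, folded universal_star_alg_def]
  define h where "h = (\<lambda>Y. the_elem (?e ` Y))"
  have "h \<in> star_hom U B" unfolding h_def by (rule fac(1))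
  moreover have "h (gen x) = component (b x) B" if "x \<in> X" for x
    unfolding h_def universal_gen_def
    by (subst fac(2)) (simp_all add: free_gen_closed free_eval_gen that)
  ultimately show ?thesis by blast
qed

text \<open>A converse of the universal property: the images of the generators under a homomorphism to \<open>B\<close> are the component \<open>B\<close> of
elements of the product of all algebras that satisfy the relations.  The remaining
components are taken from an arbitrary solution \<open>b0\<close>.\<close>

theorem lift_hom:
  fixes b0 :: "'g \<Rightarrow> 'b star_prod" and B :: "'b star_alg"
  assumes b0: "satisfies b0" and B: "star_algebra B" and h: "h \<in> star_hom U B"
  defines "b \<equiv> \<lambda>x. with_component B (h (gen x)) (b0 x)"
  shows "satisfies b" and "x \<in> X \<Longrightarrow> component (b x) B = h (gen x)"
    and "x \<in> X \<Longrightarrow> star_algebra C \<Longrightarrow> C \<noteq> B \<Longrightarrow> component (b x) C = component (b0 x) C"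
proof -
  have hc: "h (gen x) \<in> carrier B" if "x \<in> X" for x using star_hom_closed[OF h gen_closed[OF that]] .
  show 1: "component (b x) B = h (gen x)" if "x \<in> X" for x
    using component_with_component[OF B hc[OF that]] by (simp add: b_def)
  show 2: "component (b x) C = component (b0 x) C" if "x \<in> X" "star_algebra C" "C \<noteq> B" for x C
    using component_with_component[OF that(2) hc[OF that(1)]] that by (simp add: b_def)
  have hp: "h \<circ> proj \<in> star_hom F B" by (rule star_hom_comp[OF proj_star_hom h])
  show "satisfies b" unfolding satisfies_def
  proof (intro ballI, clarify)
    fix p q assume pq: "(p, q) \<in> E"
    note c = E_closed[OF pq]
    show "free_eval b p = free_eval b q"
    proof (rule star_prod_eqI)
      fix C :: "'b star_alg" assume C: "star_algebra C"
      have eb: "(\<lambda>f. component (free_eval b' f) C) \<in> star_hom F C" for b' :: "'g \<Rightarrow> 'b star_prod"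
        by (rule class_hom_component[OF free_eval_class_hom C])
      show "component (free_eval b p) C = component (free_eval b q) C"
      proof (cases "C = B")
        case True
        have "component (free_eval b f) B = (h \<circ> proj) f" if "f \<in> carrier F" for f
          by (rule free_star_hom_eq[OF eb[unfolded True] hp _ that]) (simp add: free_eval_gen 1 proj_gen)
        then show ?thesis unfolding True using c proj_eq[OF pq] by simp
      next
        case False
        have "component (free_eval b f) C = component (free_eval b0 f) C" if "f \<in> carrier F" for f
          by (rule free_star_hom_eq[OF eb eb _ that]) (simp add: free_eval_gen 2 C False)
        then show ?thesis using c b0 pq by (auto simp: satisfies_def)
      qed
    qed
  qed
qed

end

section \<open>Tensor products\<close>

lemma (in star_algebra) adj_a_minus:
  assumes "x \<in> carrier A" "y \<in> carrier A"
  shows "adj A (x \<ominus> y) = adj A x \<ominus> adj A y"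
proof -
  have "adj A (\<ominus> y) = \<ominus> adj A y"
    using assms(2) adj_smult[of y "-1"] by (simp add: smult_minus_one adj_closed)
  then show ?thesis using assms by (simp add: minus_eq adj_add adj_closed)
qed

locale tensor_pair = A: star_algebra A + B: star_algebra B
  for A :: "'a star_alg" and B :: "'b star_alg"
begin

abbreviation "P \<equiv> A \<times>\<times> B"

sublocale P: star_monoid P "map_prod (adj A) (adj B)"
proof (intro star_monoid.intro star_monoid_axioms.intro)
  show "monoid P" by (rule DirProd_monoid) (rule A.is_monoid B.is_monoid)+
qed (auto simp: A.adj_closed B.adj_closed A.adj_adj B.adj_adj A.adj_mult B.adj_mult)

abbreviation "T0 \<equiv> tensor_pre A B"
abbreviation "T \<equiv> tensor_alg A B"
abbreviation "tens \<equiv> elem_tensor A B"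

sublocale T0: star_algebra T0
  unfolding tensor_pre_def by (rule P.MA_star_algebra)

lemma delta_closed: "a \<in> carrier A \<Longrightarrow> b \<in> carrier B \<Longrightarrow> delta (a, b) \<in> carrier T0"
  unfolding tensor_pre_def by (rule P.delta_closed) simp

lemma delta_mult:
  assumes "a \<in> carrier A" "b \<in> carrier B" "c \<in> carrier A" "d \<in> carrier B"
  shows "delta (a, b) \<otimes>\<^bsub>T0\<^esub> delta (c, d) = delta (a \<otimes>\<^bsub>A\<^esub> c, b \<otimes>\<^bsub>B\<^esub> d)"
  unfolding tensor_pre_def using assms by (subst P.delta_mult) auto

lemma adj_delta:
  assumes "a \<in> carrier A" "b \<in> carrier B"
  shows "adj T0 (delta (a, b)) = delta (adj A a, adj B b)"
  unfolding tensor_pre_def using assms by (subst P.adj_delta) auto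

lemma T0_one: "\<one>\<^bsub>T0\<^esub> = delta (\<one>\<^bsub>A\<^esub>, \<one>\<^bsub>B\<^esub>)"
  unfolding tensor_pre_def P.MA_simps by simp

definition "relators =
  {delta (a \<oplus>\<^bsub>A\<^esub> a', b) \<ominus>\<^bsub>T0\<^esub> (delta (a, b) \<oplus>\<^bsub>T0\<^esub> delta (a', b)) | a a' b.
         a \<in> carrier A \<and> a' \<in> carrier A \<and> b \<in> carrier B}
    \<union> {delta (a, b \<oplus>\<^bsub>B\<^esub> b') \<ominus>\<^bsub>T0\<^esub> (delta (a, b) \<oplus>\<^bsub>T0\<^esub> delta (a, b')) | a b b'.
         a \<in> carrier A \<and> b \<in> carrier B \<and> b' \<in> carrier B}
    \<union> {delta (c \<odot>\<^bsub>A\<^esub> a, b) \<ominus>\<^bsub>T0\<^esub> c \<odot>\<^bsub>T0\<^esub> delta (a, b) | c a b.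
         a \<in> carrier A \<and> b \<in> carrier B}
    \<union> {delta (a, c \<odot>\<^bsub>B\<^esub> b) \<ominus>\<^bsub>T0\<^esub> c \<odot>\<^bsub>T0\<^esub> delta (a, b) | c a b.
         a \<in> carrier A \<and> b \<in> carrier B}"

lemma tensor_ideal_eq: "tensor_ideal A B = Idl\<^bsub>T0\<^esub> relators"
  by (simp only: tensor_ideal_def relators_def Let_def)

lemmas closed = delta_closed A.smult_closed B.smult_closed A.a_closed B.a_closed T0.smult_closed T0.a_closed
  T0.minus_closed A.adj_closed B.adj_closed A.m_closed B.m_closed T0.m_closed T0.adj_closed

lemma relators_closed: "relators \<subseteq> carrier T0"
  unfolding relators_def by (auto intro!: closed)

lemma relators_adj: "adj T0 ` relators \<subseteq> relators"
proof (rule image_subsetI)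
  fix x assume "x \<in> relators"
  then consider
    a a' b where "x = delta (a \<oplus>\<^bsub>A\<^esub> a', b) \<ominus>\<^bsub>T0\<^esub> (delta (a, b) \<oplus>\<^bsub>T0\<^esub> delta (a', b))"
      "a \<in> carrier A" "a' \<in> carrier A" "b \<in> carrier B"
  | a b b' where "x = delta (a, b \<oplus>\<^bsub>B\<^esub> b') \<ominus>\<^bsub>T0\<^esub> (delta (a, b) \<oplus>\<^bsub>T0\<^esub> delta (a, b'))"
      "a \<in> carrier A" "b \<in> carrier B" "b' \<in> carrier B"
  | c a b where "x = delta (c \<odot>\<^bsub>A\<^esub> a, b) \<ominus>\<^bsub>T0\<^esub> c \<odot>\<^bsub>T0\<^esub> delta (a, b)"
      "a \<in> carrier A" "b \<in> carrier B"
  | c a b where "x = delta (a, c \<odot>\<^bsub>B\<^esub> b) \<ominus>\<^bsub>T0\<^esub> c \<odot>\<^bsub>T0\<^esub> delta (a, b)"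
      "a \<in> carrier A" "b \<in> carrier B"
    unfolding relators_def by blast
  then show "adj T0 x \<in> relators"
  proof cases
    case (1 a a' b)
    then have "adj T0 x = delta (adj A a \<oplus>\<^bsub>A\<^esub> adj A a', adj B b)
        \<ominus>\<^bsub>T0\<^esub> (delta (adj A a, adj B b) \<oplus>\<^bsub>T0\<^esub> delta (adj A a', adj B b))"
      by (simp add: T0.adj_a_minus T0.adj_add adj_delta A.adj_add closed)
    then show ?thesis unfolding relators_def using 1 by (blast intro: closed)
  next
    case (2 a b b')
    then have "adj T0 x = delta (adj A a, adj B b \<oplus>\<^bsub>B\<^esub> adj B b')
        \<ominus>\<^bsub>T0\<^esub> (delta (adj A a, adj B b) \<oplus>\<^bsub>T0\<^esub> delta (adj A a, adj B b'))"
      by (simp add: T0.adj_a_minus T0.adj_add adj_delta B.adj_add closed)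
    then show ?thesis unfolding relators_def using 2 by (blast intro: closed)
  next
    case (3 c a b)
    then have "adj T0 x = delta (cnj c \<odot>\<^bsub>A\<^esub> adj A a, adj B b)
        \<ominus>\<^bsub>T0\<^esub> cnj c \<odot>\<^bsub>T0\<^esub> delta (adj A a, adj B b)"
      by (simp add: T0.adj_a_minus T0.adj_smult adj_delta A.adj_smult closed)
    then show ?thesis unfolding relators_def using 3 by (blast intro: closed)
  next
    case (4 c a b)
    then have "adj T0 x = delta (adj A a, cnj c \<odot>\<^bsub>B\<^esub> adj B b)
        \<ominus>\<^bsub>T0\<^esub> cnj c \<odot>\<^bsub>T0\<^esub> delta (adj A a, adj B b)"
      by (simp add: T0.adj_a_minus T0.adj_smult adj_delta B.adj_smult closed)
    then show ?thesis unfolding relators_def using 4 by (blast intro: closed)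
  qed
qed

sublocale I: star_ideal T0 "tensor_ideal A B"
proof (intro star_ideal.intro star_ideal_axioms.intro)
  show "star_algebra T0" by (rule T0.star_algebra_axioms)
  show "ideal (tensor_ideal A B) T0" unfolding tensor_ideal_eq by (rule T0.genideal_ideal[OF relators_closed])
  show "adj T0 x \<in> tensor_ideal A B" if "x \<in> tensor_ideal A B" for x
    using that unfolding tensor_ideal_eq by (rule T0.genideal_adj_closed[OF relators_closed relators_adj])
qed

sublocale T: star_algebra T
  unfolding tensor_alg_def by (rule I.Q_star_algebra)

text \<open>The bilinearity relators identify the corresponding classes in the quotient.\<close>

lemma relator_eq:
  assumes "x \<ominus>\<^bsub>T0\<^esub> y \<in> relators" "x \<in> carrier T0" "y \<in> carrier T0"
  shows "tensor_ideal A B +>\<^bsub>T0\<^esub> x = tensor_ideal A B +>\<^bsub>T0\<^esub> y"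
proof -
  have "x \<ominus>\<^bsub>T0\<^esub> y \<in> tensor_ideal A B"
    unfolding tensor_ideal_eq using assms(1) T0.genideal_self[OF relators_closed] by blast
  then show ?thesis using T0.quotient_eq_iff_same_a_r_cos[OF I.ideal_axioms assms(2,3)] by blast
qed

lemma tens_closed: "a \<in> carrier A \<Longrightarrow> b \<in> carrier B \<Longrightarrow> tens a b \<in> carrier T"
  unfolding elem_tensor_def tensor_alg_def I.Q_carrier by (auto intro: delta_closed)

lemma tens_add_left:
  assumes "a \<in> carrier A" "a' \<in> carrier A" "b \<in> carrier B"
  shows "tens (a \<oplus>\<^bsub>A\<^esub> a') b = tens a b \<oplus>\<^bsub>T\<^esub> tens a' b"
proof -
  have "delta (a \<oplus>\<^bsub>A\<^esub> a', b) \<ominus>\<^bsub>T0\<^esub> (delta (a, b) \<oplus>\<^bsub>T0\<^esub> delta (a', b)) \<in> relators"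
    unfolding relators_def using assms by blast
  then show ?thesis unfolding elem_tensor_def tensor_alg_def
    using assms by (subst relator_eq) (simp_all add: closed I.Q_add)
qed

lemma tens_add_right:
  assumes "a \<in> carrier A" "b \<in> carrier B" "b' \<in> carrier B"
  shows "tens a (b \<oplus>\<^bsub>B\<^esub> b') = tens a b \<oplus>\<^bsub>T\<^esub> tens a b'"
proof -
  have "delta (a, b \<oplus>\<^bsub>B\<^esub> b') \<ominus>\<^bsub>T0\<^esub> (delta (a, b) \<oplus>\<^bsub>T0\<^esub> delta (a, b')) \<in> relators"
    unfolding relators_def using assms by blast
  then show ?thesis unfolding elem_tensor_def tensor_alg_def
    using assms by (subst relator_eq) (simp_all add: closed I.Q_add)
qed

lemma tens_smult_left:
  assumes "a \<in> carrier A" "b \<in> carrier B"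
  shows "tens (c \<odot>\<^bsub>A\<^esub> a) b = c \<odot>\<^bsub>T\<^esub> tens a b"
proof -
  have "delta (c \<odot>\<^bsub>A\<^esub> a, b) \<ominus>\<^bsub>T0\<^esub> c \<odot>\<^bsub>T0\<^esub> delta (a, b) \<in> relators"
    unfolding relators_def using assms by blast
  then show ?thesis unfolding elem_tensor_def tensor_alg_def
    using assms by (subst relator_eq) (simp_all add: closed I.Q_smult)
qed

lemma tens_smult_right:
  assumes "a \<in> carrier A" "b \<in> carrier B"
  shows "tens a (c \<odot>\<^bsub>B\<^esub> b) = c \<odot>\<^bsub>T\<^esub> tens a b"
proof -
  have "delta (a, c \<odot>\<^bsub>B\<^esub> b) \<ominus>\<^bsub>T0\<^esub> c \<odot>\<^bsub>T0\<^esub> delta (a, b) \<in> relators"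
    unfolding relators_def using assms by blast
  then show ?thesis unfolding elem_tensor_def tensor_alg_def
    using assms by (subst relator_eq) (simp_all add: closed I.Q_smult)
qed

lemma tens_mult:
  assumes "a \<in> carrier A" "b \<in> carrier B" "c \<in> carrier A" "d \<in> carrier B"
  shows "tens a b \<otimes>\<^bsub>T\<^esub> tens c d = tens (a \<otimes>\<^bsub>A\<^esub> c) (b \<otimes>\<^bsub>B\<^esub> d)"
  unfolding elem_tensor_def tensor_alg_def using assms
  by (subst I.Q_mult) (simp_all add: closed delta_mult)

lemma tens_one: "\<one>\<^bsub>T\<^esub> = tens \<one>\<^bsub>A\<^esub> \<one>\<^bsub>B\<^esub>"
  unfolding elem_tensor_def tensor_alg_def I.Q_one T0_one ..

lemma tens_adj:
  assumes "a \<in> carrier A" "b \<in> carrier B"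
  shows "adj T (tens a b) = tens (adj A a) (adj B b)"
  unfolding elem_tensor_def tensor_alg_def using assms
  by (subst I.Q_adj) (simp_all add: closed adj_delta)

lemma left_star_hom: "(\<lambda>a. tens a \<one>\<^bsub>B\<^esub>) \<in> star_hom A T"
  by (rule star_homI) (simp_all add: tens_closed tens_mult tens_add_left tens_one tens_smult_left tens_adj B.adj_one)

lemma right_star_hom: "(\<lambda>b. tens \<one>\<^bsub>A\<^esub> b) \<in> star_hom B T"
  by (rule star_homI) (simp_all add: tens_closed tens_mult tens_add_right tens_one tens_smult_right tens_adj A.adj_one)

lemma tens_split:
  assumes "a \<in> carrier A" "b \<in> carrier B"
  shows "tens a b = tens a \<one>\<^bsub>B\<^esub> \<otimes>\<^bsub>T\<^esub> tens \<one>\<^bsub>A\<^esub> b"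
    and "tens a b = tens \<one>\<^bsub>A\<^esub> b \<otimes>\<^bsub>T\<^esub> tens a \<one>\<^bsub>B\<^esub>"
  using assms by (simp_all add: tens_mult)

end

lemma star_hom_cong:
  assumes "g \<in> star_hom A B" "star_algebra A" "\<And>x. x \<in> carrier A \<Longrightarrow> g x = h x"
  shows "h \<in> star_hom A B"
proof -
  interpret A: star_algebra A by fact
  note e = assms(3)[symmetric]
  show ?thesis
    by (rule star_homI) (simp_all add: e A.smult_closed A.adj_closed star_hom_closed[OF assms(1)] star_hom_mult[OF assms(1)]
        star_hom_add[OF assms(1)] star_hom_one[OF assms(1)] star_hom_smult[OF assms(1)] star_hom_adj[OF assms(1)])
qed

text \<open>The map \<open>(c, d) \<mapsto> \<phi> c \<otimes> \<psi> d\<close> is multiplicative and compatible with the involutions, so its linear extension is a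
homomorphism; it vanishes on the bilinearity relators because pure tensors are bilinear.\<close>

theorem tensor_map_star_hom:
  fixes A :: "'a star_alg" and B :: "'b star_alg" and C :: "'c star_alg" and D :: "'d star_alg"
  assumes "star_algebra A" "star_algebra B" "star_algebra C" "star_algebra D"
    and \<phi>: "\<phi> \<in> star_hom C A" and \<psi>: "\<psi> \<in> star_hom D B"
  shows "tensor_map A B \<phi> \<psi> \<in> star_hom (tensor_alg C D) (tensor_alg A B)"
    and "c \<in> carrier C \<Longrightarrow> d \<in> carrier D \<Longrightarrow>
      tensor_map A B \<phi> \<psi> (elem_tensor C D c d) = elem_tensor A B (\<phi> c) (\<psi> d)"
proof -
  interpret t: tensor_pair A B using assms by (simp add: tensor_pair_def)
  interpret s: tensor_pair C D using assms by (simp add: tensor_pair_def)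
  let ?m = "map_prod \<phi> \<psi>"
  define h where "h = (\<lambda>f. tensor_ideal A B +>\<^bsub>t.T0\<^esub> lin_ext ?m f)"
  \<comment> \<open>The constant 1 is multiplicative, so it may serve as the other components.\<close>
  define m where "m = (\<lambda>x. with_component t.T (elem_tensor A B (\<phi> (fst x)) (\<psi> (snd x))) 1)"
  have mc: "elem_tensor A B (\<phi> (fst x)) (\<psi> (snd x)) \<in> carrier t.T" if "x \<in> carrier s.P" for x
    using that star_hom_closed[OF \<phi>] star_hom_closed[OF \<psi>] by (auto intro: t.tens_closed)
  have cm: "component (m x) X = (if X = t.T then elem_tensor A B (\<phi> (fst x)) (\<psi> (snd x)) else \<one>\<^bsub>X\<^esub>)"
    if "x \<in> carrier s.P" "star_algebra X" for x X
    unfolding m_def using component_with_component[OF that(2) mc[OF that(1)], of 1] that(2)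
    by (simp add: component_one)
  have tc: "class_hom s.T0 (linear_extension m)"
    unfolding tensor_pre_def
  proof (rule s.P.linear_extension_class_hom)
    show "m \<one>\<^bsub>s.P\<^esub> = 1"
      by (rule star_prod_eqI) (simp add: cm component_one star_hom_one[OF \<phi>] star_hom_one[OF \<psi>] t.tens_one)
  next
    fix x y assume xy: "x \<in> carrier s.P" "y \<in> carrier s.P"
    then have c: "fst x \<in> carrier C" "snd x \<in> carrier D" "fst y \<in> carrier C" "snd y \<in> carrier D" by auto
    have xy': "x \<otimes>\<^bsub>s.P\<^esub> y = (fst x \<otimes>\<^bsub>C\<^esub> fst y, snd x \<otimes>\<^bsub>D\<^esub> snd y)" by (cases x; cases y) simp
    show "m (x \<otimes>\<^bsub>s.P\<^esub> y) = m x * m y"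
    proof (rule star_prod_eqI)
      fix X :: "('a \<times> 'b \<Rightarrow> complex) set star_alg" assume X: "star_algebra X"
      then interpret X: star_algebra X .
      have "x \<otimes>\<^bsub>s.P\<^esub> y \<in> carrier s.P" using xy by (rule s.P.m_closed)
      then show "component (m (x \<otimes>\<^bsub>s.P\<^esub> y)) X = component (m x * m y) X"
        using xy c by (simp add: cm X component_times) (simp add: xy' star_hom_mult[OF \<phi>] star_hom_mult[OF \<psi>]
            t.tens_mult star_hom_closed[OF \<phi>] star_hom_closed[OF \<psi>])
    qed
  next
    fix x assume x: "x \<in> carrier s.P"
    then have c: "fst x \<in> carrier C" "snd x \<in> carrier D" by auto
    show "m (map_prod (adj C) (adj D) x) = star (m x)"
    proof (rule star_prod_eqI)
      fix X :: "('a \<times> 'b \<Rightarrow> complex) set star_alg" assume X: "star_algebra X"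
      then interpret X: star_algebra X .
      have "map_prod (adj C) (adj D) x \<in> carrier s.P" using x by (rule s.P.s_closed)
      then show "component (m (map_prod (adj C) (adj D) x)) X = component (star (m x)) X"
        using x c by (simp add: cm X component_star X.adj_one star_hom_adj[OF \<phi>] star_hom_adj[OF \<psi>]
            t.tens_adj star_hom_closed[OF \<phi>] star_hom_closed[OF \<psi>])
    qed
  qed
  have hd: "component (linear_extension m (delta x)) t.T = h (delta x)" if "x \<in> carrier s.P" for x
  proof -
    have "{y. delta x y \<noteq> 0} = {x}" by (auto simp: delta_def)
    then have "lin_ext ?m (delta x) = delta (?m x)"
      by (auto simp: fun_eq_iff lin_ext_point) (auto simp: delta_def)
    then show ?thesis using that
      by (cases x) (simp add: cm t.T.star_algebra_axioms h_def elem_tensor_def)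
  qed
  \<comment> \<open>This identifies \<open>h\<close> with a component of a homomorphism.\<close>
  have comp: "component (linear_extension m f) t.T = h f" if f: "f \<in> carrier s.T0" for f
  proof -
    have fin: "finite {x. f x \<noteq> 0}" using s.P.MA_fin[of f] f by (simp add: tensor_pre_def)
    have sup: "x \<in> carrier s.P" if "f x \<noteq> 0" for x using s.P.MA_supp[of f x] f that by (simp add: tensor_pre_def)
    have mx: "?m x \<in> carrier t.P" if "f x \<noteq> 0" for x
      using sup[OF that] star_hom_closed[OF \<phi>] star_hom_closed[OF \<psi>] by (cases x) auto
    have pr: "(+>\<^bsub>t.T0\<^esub>) (tensor_ideal A B) \<in> star_hom t.T0 t.T"
      unfolding tensor_alg_def by (rule t.I.projection_star_hom)
    have "lin_ext ?m f = (\<Oplus>\<^bsub>t.T0\<^esub>x\<in>{x. f x \<noteq> 0}. f x \<odot>\<^bsub>t.T0\<^esub> delta (?m x))"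
    proof
      fix z
      have "(\<Oplus>\<^bsub>t.T0\<^esub>x\<in>{x. f x \<noteq> 0}. f x \<odot>\<^bsub>t.T0\<^esub> delta (?m x)) z
          = (\<Sum>x | f x \<noteq> 0. (f x \<odot>\<^bsub>t.T0\<^esub> delta (?m x)) z)"
        unfolding tensor_pre_def using fin mx
        by (intro t.P.finsum_MA_point) (auto intro!: t.P.MA_smult_closed t.P.delta_closed)
      also have "\<dots> = lin_ext ?m f z"
        unfolding lin_ext_point[OF fin] by (rule sum.cong) (auto simp: tensor_pre_def t.P.MA_simps delta_def)
      finally show "lin_ext ?m f z = (\<Oplus>\<^bsub>t.T0\<^esub>x\<in>{x. f x \<noteq> 0}. f x \<odot>\<^bsub>t.T0\<^esub> delta (?m x)) z" by simp
    qed
    then have "h f = tensor_ideal A B +>\<^bsub>t.T0\<^esub> (\<Oplus>\<^bsub>t.T0\<^esub>x\<in>{x. f x \<noteq> 0}. f x \<odot>\<^bsub>t.T0\<^esub> delta (?m x))"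
      by (simp add: h_def)
    also have "\<dots> = (\<Oplus>\<^bsub>t.T\<^esub>x\<in>{x. f x \<noteq> 0}. tensor_ideal A B +>\<^bsub>t.T0\<^esub> (f x \<odot>\<^bsub>t.T0\<^esub> delta (?m x)))"
      by (rule star_hom_finsum[OF t.T0.star_algebra_axioms t.T.star_algebra_axioms pr fin])
        (use mx in \<open>force intro: t.T0.smult_closed t.delta_closed\<close>)
    also have "\<dots> = (\<Oplus>\<^bsub>t.T\<^esub>x\<in>{x. f x \<noteq> 0}. component (f x *\<^sub>C m x) t.T)"
    proof (rule t.T.finsum_cong')
      fix x assume "x \<in> {x. f x \<noteq> 0}"
      then have x: "x \<in> carrier s.P" "?m x \<in> carrier t.P" using sup mx by auto
      have "delta (?m x) \<in> carrier t.T0" using x(2) by (cases x) (auto intro: t.delta_closed)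
      then show "tensor_ideal A B +>\<^bsub>t.T0\<^esub> (f x \<odot>\<^bsub>t.T0\<^esub> delta (?m x)) = component (f x *\<^sub>C m x) t.T"
        using star_hom_smult[OF pr, of "delta (?m x)" "f x"]
        by (cases x) (use x in \<open>simp add: component_scaleC t.T.star_algebra_axioms cm elem_tensor_def\<close>)
    qed (auto simp: t.T.star_algebra_axioms)
    also have "\<dots> = component (linear_extension m f) t.T"
      unfolding linear_extension_def by (rule component_sum[symmetric]) (rule t.T.star_algebra_axioms fin)+
    finally show ?thesis by simp
  qed
  have hom': "(\<lambda>f. component (linear_extension m f) t.T) \<in> star_hom s.T0 t.T"
    by (rule class_hom_component[OF tc t.T.star_algebra_axioms])
  have hom: "h \<in> star_hom s.T0 t.T"
    by (rule star_hom_cong[OF hom' s.T0.star_algebra_axioms comp])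
  have he: "h (delta (c, d)) = elem_tensor A B (\<phi> c) (\<psi> d)" if "c \<in> carrier C" "d \<in> carrier D" for c d
    using hd[of "(c, d)"] that by (simp add: cm t.T.star_algebra_axioms)
  have "h x = \<zero>\<^bsub>t.T\<^esub>" if "x \<in> s.relators" for x
  proof -
    note c = star_hom_closed[OF \<phi>] star_hom_closed[OF \<psi>]
    note sm = star_hom_a_minus[OF s.T0.star_algebra_axioms t.T.star_algebra_axioms hom]
      star_hom_add[OF hom] star_hom_smult[OF hom] he s.closed c
      star_hom_add[OF \<phi>] star_hom_add[OF \<psi>] star_hom_smult[OF \<phi>] star_hom_smult[OF \<psi>]
      t.tens_add_left t.tens_add_right t.tens_smult_left t.tens_smult_right t.tens_closed
      t.T.minus_eq t.T.r_neg t.T.smult_closed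
    show ?thesis using that unfolding s.relators_def
      by (elim UnE CollectE exE conjE) (simp_all add: sm)
  qed
  then have "h x = \<zero>\<^bsub>t.T\<^esub>" if "x \<in> tensor_ideal C D" for x
    using s.T0.genideal_vanish[OF t.T.star_algebra_axioms hom s.relators_closed] that
    unfolding s.tensor_ideal_eq by blast
  note fac = s.I.factor_star_hom[OF t.T.star_algebra_axioms hom this, folded tensor_alg_def]
  have tm: "tensor_map A B \<phi> \<psi> = (\<lambda>X. the_elem (h ` X))"
    by (simp add: fun_eq_iff tensor_map_def h_def)
  show "tensor_map A B \<phi> \<psi> \<in> star_hom s.T t.T" unfolding tm by (rule fac(1))
  show "tensor_map A B \<phi> \<psi> (elem_tensor C D c d) = elem_tensor A B (\<phi> c) (\<psi> d)"
    if "c \<in> carrier C" "d \<in> carrier D"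
    unfolding tm elem_tensor_def[of C D] using that
    by (subst fac(2)) (auto simp: he intro: s.delta_closed)
qed

section \<open>The defining relations of the two quantum groups\<close>

lemma free_eval_rules:
  fixes b :: "'g \<Rightarrow> 't::complex_star_algebra"
  shows "free_eval b \<one>\<^bsub>free_star_alg X\<^esub> = 1"
    and "free_eval b \<zero>\<^bsub>free_star_alg X\<^esub> = 0"
    and "p \<in> carrier (free_star_alg X) \<Longrightarrow> q \<in> carrier (free_star_alg X) \<Longrightarrow>
      free_eval b (p \<otimes>\<^bsub>free_star_alg X\<^esub> q) = free_eval b p * free_eval b q"
    and "p \<in> carrier (free_star_alg X) \<Longrightarrow> free_eval b (c \<odot>\<^bsub>free_star_alg X\<^esub> p) = c *\<^sub>C free_eval b p"
    and "p \<in> carrier (free_star_alg X) \<Longrightarrow> free_eval b (adj (free_star_alg X) p) = star (free_eval b p)"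
    and "p \<in> carrier (free_star_alg X) \<Longrightarrow> free_eval b (\<ominus>\<^bsub>free_star_alg X\<^esub> p) = - free_eval b p"
    and "finite S \<Longrightarrow> (\<And>i. i \<in> S \<Longrightarrow> f i \<in> carrier (free_star_alg X)) \<Longrightarrow>
      free_eval b (\<Oplus>\<^bsub>free_star_alg X\<^esub>i\<in>S. f i) = (\<Sum>i\<in>S. free_eval b (f i))"
    and "set xs \<subseteq> carrier (free_star_alg X) \<Longrightarrow>
      free_eval b (ordered_prod (free_star_alg X) xs) = prod_list (map (free_eval b) xs)"
  by (simp_all add: class_hom_one[OF free_eval_class_hom] class_hom_zero[OF free_star_algebra free_eval_class_hom]
      class_hom_mult[OF free_eval_class_hom] class_hom_smult[OF free_eval_class_hom] class_hom_adj[OF free_eval_class_hom]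
      class_hom_uminus[OF free_star_algebra free_eval_class_hom] class_hom_finsum[OF free_star_algebra free_eval_class_hom]
      class_hom_ordered_prod[OF free_star_algebra free_eval_class_hom])

lemma free_finsum_closed:
  "(\<And>i. i \<in> S \<Longrightarrow> f i \<in> carrier (free_star_alg X)) \<Longrightarrow> (\<Oplus>\<^bsub>free_star_alg X\<^esub>i\<in>S. f i) \<in> carrier (free_star_alg X)"
  by (rule abelian_monoid.finsum_closed)
    (use free_star_algebra[of X] in \<open>auto simp: star_algebra_def ring_def abelian_group_def\<close>)

lemma free_closed:
  "\<one>\<^bsub>free_star_alg X\<^esub> \<in> carrier (free_star_alg X)"
  "\<zero>\<^bsub>free_star_alg X\<^esub> \<in> carrier (free_star_alg X)"
  "p \<in> carrier (free_star_alg X) \<Longrightarrow> q \<in> carrier (free_star_alg X) \<Longrightarrow> p \<otimes>\<^bsub>free_star_alg X\<^esub> q \<in> carrier (free_star_alg X)"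
  "p \<in> carrier (free_star_alg X) \<Longrightarrow> c \<odot>\<^bsub>free_star_alg X\<^esub> p \<in> carrier (free_star_alg X)"
  "p \<in> carrier (free_star_alg X) \<Longrightarrow> adj (free_star_alg X) p \<in> carrier (free_star_alg X)"
  "p \<in> carrier (free_star_alg X) \<Longrightarrow> \<ominus>\<^bsub>free_star_alg X\<^esub> p \<in> carrier (free_star_alg X)"
  "set xs \<subseteq> carrier (free_star_alg X) \<Longrightarrow> ordered_prod (free_star_alg X) xs \<in> carrier (free_star_alg X)"
proof -
  interpret F: star_algebra "free_star_alg X" by (rule free_star_algebra)
  show "\<one>\<^bsub>free_star_alg X\<^esub> \<in> carrier (free_star_alg X)"
    "\<zero>\<^bsub>free_star_alg X\<^esub> \<in> carrier (free_star_alg X)" by auto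
  show "p \<in> carrier (free_star_alg X) \<Longrightarrow> q \<in> carrier (free_star_alg X) \<Longrightarrow> p \<otimes>\<^bsub>free_star_alg X\<^esub> q \<in> carrier (free_star_alg X)"
    "p \<in> carrier (free_star_alg X) \<Longrightarrow> c \<odot>\<^bsub>free_star_alg X\<^esub> p \<in> carrier (free_star_alg X)"
    "p \<in> carrier (free_star_alg X) \<Longrightarrow> adj (free_star_alg X) p \<in> carrier (free_star_alg X)"
    "p \<in> carrier (free_star_alg X) \<Longrightarrow> \<ominus>\<^bsub>free_star_alg X\<^esub> p \<in> carrier (free_star_alg X)"
    by (auto intro: F.smult_closed F.adj_closed)
  show "set xs \<subseteq> carrier (free_star_alg X) \<Longrightarrow> ordered_prod (free_star_alg X) xs \<in> carrier (free_star_alg X)"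
    using class_hom_ordered_prod[OF free_star_algebra free_eval_class_hom, of xs X "\<lambda>_. 0 :: complex"] by simp
qed

lemma so_presentation: "presentation ({1..M} \<times> {1..M}) (so_minus_relations M)"
proof
  fix p q assume "(p, q) \<in> so_minus_relations M"
  moreover have perm: "1 \<le> \<sigma> i \<and> \<sigma> i \<le> M" if "\<sigma> permutes {1..M}" "1 \<le> i" "i \<le> M" for \<sigma> i
    using permutes_in_image[OF that(1), of i] that(2,3) by simp
  ultimately show "p \<in> carrier (free_star_alg ({1..M} \<times> {1..M})) \<and> q \<in> carrier (free_star_alg ({1..M} \<times> {1..M}))"
    unfolding so_minus_relations_def Let_def
    by (elim UnE CollectE exE conjE insertE)
      (auto intro!: free_finsum_closed free_closed free_gen_closed
        simp: perm set_upt_Suc simp del: One_nat_def upt_Suc set_upt)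
qed

lemma ev_gen: "free_eval b (free_gen (i, j)) = b (i, j)"
  by (rule free_eval_gen)

text \<open>Evaluation at \<open>b\<close> translates each pair of the presentation into one of the axioms of the locale.  Through this
equivalence the universal property applies to matrices of the locale.\<close>

lemma so_satisfies:
  fixes b :: "nat \<times> nat \<Rightarrow> 't::complex_star_algebra"
  shows "presentation.satisfies (so_minus_relations M) b \<longleftrightarrow> anticommutative_SO M (\<lambda>i j. b (i, j))"
proof -
  interpret presentation "{1..M} \<times> {1..M}" "so_minus_relations M" by (rule so_presentation)
  let ?N = "{1..M}"
  have g: "free_gen (i, j) \<in> carrier F" if "i \<in> ?N" "j \<in> ?N" for i j
    using that by (intro free_gen_closed) auto
  note ev = free_eval_rules(1-6) free_closed g ev_gen
  have e_row: "free_eval b (\<Oplus>\<^bsub>F\<^esub>k\<in>?N. free_gen (i, k) \<otimes>\<^bsub>F\<^esub> free_gen (j, k)) = (\<Sum>k\<in>?N. b (i, k) * b (j, k))"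
    if "i \<in> ?N" "j \<in> ?N" for i j
    by (subst free_eval_rules(7)) (use that in \<open>auto simp only: ev finite_atLeastAtMost intro!: sum.cong\<close>)
  have e_col: "free_eval b (\<Oplus>\<^bsub>F\<^esub>k\<in>?N. free_gen (k, i) \<otimes>\<^bsub>F\<^esub> free_gen (k, j)) = (\<Sum>k\<in>?N. b (k, i) * b (k, j))"
    if "i \<in> ?N" "j \<in> ?N" for i j
    by (subst free_eval_rules(7)) (use that in \<open>auto simp only: ev finite_atLeastAtMost intro!: sum.cong\<close>)
  have e_if: "free_eval b (if i = j then \<one>\<^bsub>F\<^esub> else \<zero>\<^bsub>F\<^esub>) = (if i = j then 1 else 0)" for i j :: nat
    by (simp add: ev)
  have e_det: "free_eval b (\<Oplus>\<^bsub>F\<^esub>\<sigma>\<in>{\<sigma>. \<sigma> permutes ?N}. ordered_prod F (map (\<lambda>i. free_gen (i, \<sigma> i)) [1..<M+1]))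
      = (\<Sum>\<sigma> | \<sigma> permutes ?N. prod_list (map (\<lambda>i. b (i, \<sigma> i)) [1..<M+1]))"
  proof -
    have c: "set (map (\<lambda>i. free_gen (i, \<sigma> i)) [1..<M+1]) \<subseteq> carrier F" if "\<sigma> permutes ?N" for \<sigma>
      using permutes_in_image[OF that] by (auto simp del: One_nat_def intro!: g)
    show ?thesis
      by (subst free_eval_rules(7))
        (use c in \<open>auto simp: finite_permutations free_closed free_eval_rules(8) ev_gen o_def
            simp del: upt_Suc set_map intro!: sum.cong\<close>)
  qed
  show ?thesis
  proof
    assume sat: "satisfies b"
    then have s: "free_eval b p = free_eval b q" if "(p, q) \<in> so_minus_relations M" for p q
      using that by (auto simp: satisfies_def)
    show "anticommutative_SO M (\<lambda>i j. b (i, j))"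
    proof
      show "finite ?N" by simp
      show "(\<Sum>i\<in>?N. b (i, j) * b (i, l)) = (if j = l then 1 else 0)" if "j \<in> ?N" "l \<in> ?N" for j l
        unfolding e_col[OF that, symmetric] e_if[symmetric]
        by (rule s) (use that in \<open>unfold so_minus_relations_def Let_def, blast\<close>)
      show "(\<Sum>k\<in>?N. b (i, k) * b (j, k)) = (if i = j then 1 else 0)" if "i \<in> ?N" "j \<in> ?N" for i j
        unfolding e_row[OF that, symmetric] e_if[symmetric]
        by (rule s) (use that in \<open>unfold so_minus_relations_def Let_def, blast\<close>)
      show "b (i, j) * b (k, j) = - (b (k, j) * b (i, j))"
        if "i \<in> ?N" "k \<in> ?N" "j \<in> ?N" "i \<noteq> k" for i k j
      proof -
        have "free_eval b (free_gen (i, j) \<otimes>\<^bsub>F\<^esub> free_gen (k, j)) = free_eval b (\<ominus>\<^bsub>F\<^esub> (free_gen (k, j) \<otimes>\<^bsub>F\<^esub> free_gen (i, j)))"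
          by (rule s) (use that in \<open>unfold so_minus_relations_def Let_def, blast\<close>)
        then show ?thesis using that by (simp only: ev)
      qed
      show "b (i, j) * b (i, l) = - (b (i, l) * b (i, j))"
        if "i \<in> ?N" "j \<in> ?N" "l \<in> ?N" "j \<noteq> l" for i j l
      proof -
        have "free_eval b (free_gen (i, j) \<otimes>\<^bsub>F\<^esub> free_gen (i, l)) = free_eval b (\<ominus>\<^bsub>F\<^esub> (free_gen (i, l) \<otimes>\<^bsub>F\<^esub> free_gen (i, j)))"
          by (rule s) (use that in \<open>unfold so_minus_relations_def Let_def, blast\<close>)
        then show ?thesis using that by (simp only: ev)
      qed
      show "b (i, j) * b (k, l) = b (k, l) * b (i, j)"
        if "i \<in> ?N" "k \<in> ?N" "j \<in> ?N" "l \<in> ?N" "i \<noteq> k" "j \<noteq> l" for i k j l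
      proof -
        have "free_eval b (free_gen (i, j) \<otimes>\<^bsub>F\<^esub> free_gen (k, l)) = free_eval b (free_gen (k, l) \<otimes>\<^bsub>F\<^esub> free_gen (i, j))"
          by (rule s) (use that in \<open>unfold so_minus_relations_def Let_def, blast\<close>)
        then show ?thesis using that by (simp only: ev)
      qed
      show "star (b (i, j)) = b (i, j)" if "i \<in> ?N" "j \<in> ?N" for i j
      proof -
        have "free_eval b (free_gen (i, j)) = free_eval b (adj F (free_gen (i, j)))"
          by (rule s) (use that in \<open>unfold so_minus_relations_def Let_def, blast\<close>)
        then show ?thesis using that by (simp only: ev)
      qed
      have "(\<Sum>\<sigma> | \<sigma> permutes ?N. prod_list (map (\<lambda>i. b (i, \<sigma> i)) [1..<M+1])) = free_eval b \<one>\<^bsub>F\<^esub>"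
        unfolding e_det[symmetric]
        by (rule s) (unfold so_minus_relations_def Let_def, blast)
      then show "(\<Sum>\<sigma> | \<sigma> permutes ?N. prod_list (map (\<lambda>i. b (i, \<sigma> i)) [1..<M+1])) = 1"
        by (simp only: ev)
    qed
  next
    assume "anticommutative_SO M (\<lambda>i j. b (i, j))"
    then interpret v: anticommutative_SO M "\<lambda>i j. b (i, j)" .
    show "satisfies b"
      unfolding satisfies_def
    proof (intro ballI, clarify)
      fix p q assume "(p, q) \<in> so_minus_relations M"
      then show "free_eval b p = free_eval b q"
        unfolding so_minus_relations_def Let_def
      proof (elim UnE CollectE exE conjE insertE emptyE, unfold prod.inject)
        fix i j assume h: "p = free_gen (i, j) \<and> q = adj F (free_gen (i, j))" "i \<in> ?N" "j \<in> ?N"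
        then show ?thesis by (simp only: ev v.selfadj)
      next
        fix i j assume h: "p = (\<Oplus>\<^bsub>F\<^esub>k\<in>?N. free_gen (i, k) \<otimes>\<^bsub>F\<^esub> free_gen (j, k)) \<and> q = (if i = j then \<one>\<^bsub>F\<^esub> else \<zero>\<^bsub>F\<^esub>)"
          "i \<in> ?N" "j \<in> ?N"
        then show ?thesis by (simp only: e_row e_if v.row_orth)
      next
        fix i j assume h: "p = (\<Oplus>\<^bsub>F\<^esub>k\<in>?N. free_gen (k, i) \<otimes>\<^bsub>F\<^esub> free_gen (k, j)) \<and> q = (if i = j then \<one>\<^bsub>F\<^esub> else \<zero>\<^bsub>F\<^esub>)"
          "i \<in> ?N" "j \<in> ?N"
        then show ?thesis by (simp only: e_col e_if v.col_orth)
      next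
        fix i j k assume h: "p = free_gen (i, k) \<otimes>\<^bsub>F\<^esub> free_gen (j, k) \<and> q = \<ominus>\<^bsub>F\<^esub> (free_gen (j, k) \<otimes>\<^bsub>F\<^esub> free_gen (i, k))"
          "i \<in> ?N" "j \<in> ?N" "k \<in> ?N" "i \<noteq> j"
        then show ?thesis using v.anti_col[OF h(2,3,4,5)] by (simp only: ev)
      next
        fix i j k assume h: "p = free_gen (k, i) \<otimes>\<^bsub>F\<^esub> free_gen (k, j) \<and> q = \<ominus>\<^bsub>F\<^esub> (free_gen (k, j) \<otimes>\<^bsub>F\<^esub> free_gen (k, i))"
          "i \<in> ?N" "j \<in> ?N" "k \<in> ?N" "i \<noteq> j"
        then show ?thesis using v.anti_row[OF h(4,2,3,5)] by (simp only: ev)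
      next
        fix i j k l assume h: "p = free_gen (i, k) \<otimes>\<^bsub>F\<^esub> free_gen (j, l) \<and> q = free_gen (j, l) \<otimes>\<^bsub>F\<^esub> free_gen (i, k)"
          "i \<in> ?N" "j \<in> ?N" "k \<in> ?N" "l \<in> ?N" "i \<noteq> j" "k \<noteq> l"
        then show ?thesis using v.comm[OF h(2-7)] by (simp only: ev)
      next
        assume h: "p = (\<Oplus>\<^bsub>F\<^esub>\<sigma>\<in>{\<sigma>. \<sigma> permutes ?N}. ordered_prod F (map (\<lambda>i. free_gen (i, \<sigma> i)) [1..<M+1])) \<and> q = \<one>\<^bsub>F\<^esub>"
        then show ?thesis by (simp only: e_det v.det_row ev)
      qed
    qed
  qed
qed

lemma qaut_presentation:
  assumes "finite V"
  shows "presentation (V \<times> V) (qaut_relations V E)"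
proof
  fix p q assume "(p, q) \<in> qaut_relations V E"
  then show "p \<in> carrier (free_star_alg (V \<times> V)) \<and> q \<in> carrier (free_star_alg (V \<times> V))"
    unfolding qaut_relations_def Let_def
    by (elim UnE CollectE exE conjE)
      (auto simp del: mult_cancel_left1 intro!: free_finsum_closed free_closed free_gen_closed)
qed

lemma cube_satisfies:
  fixes b :: "nat set \<times> nat set \<Rightarrow> 't::complex_star_algebra" and n :: nat
  defines "V \<equiv> Z2_vectors n" and "E \<equiv> halved_cube_adj n"
  shows "presentation.satisfies (qaut_relations V E) b \<longleftrightarrow> cube_quantum_automorphism n (\<lambda>\<alpha> \<beta>. b (\<alpha>, \<beta>))"
proof -
  have fin: "finite V" by (simp add: V_def)
  interpret presentation "V \<times> V" "qaut_relations V E" by (rule qaut_presentation[OF fin])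
  have g: "free_gen (i, j) \<in> carrier F" if "i \<in> V" "j \<in> V" for i j
    using that by (intro free_gen_closed) auto
  note ev = free_eval_rules(1-6) free_closed g ev_gen
  have e_row: "free_eval b (\<Oplus>\<^bsub>F\<^esub>k\<in>V. free_gen (i, k)) = (\<Sum>k\<in>V. b (i, k))" if "i \<in> V" for i
    by (subst free_eval_rules(7)) (use that fin g in \<open>auto simp only: ev_gen\<close>)
  have e_col: "free_eval b (\<Oplus>\<^bsub>F\<^esub>k\<in>V. free_gen (k, j)) = (\<Sum>k\<in>V. b (k, j))" if "j \<in> V" for j
    by (subst free_eval_rules(7)) (use that fin g in \<open>auto simp only: ev_gen\<close>)
  have e_left: "free_eval b (\<Oplus>\<^bsub>F\<^esub>k\<in>V. (if E i k then 1 else 0) \<odot>\<^bsub>F\<^esub> free_gen (k, j)) = (\<Sum>k\<in>V. adj_coeff n i k *\<^sub>C b (k, j))"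
    if "i \<in> V" "j \<in> V" for i j
    by (subst free_eval_rules(7)) (use that fin in \<open>auto simp only: ev adj_coeff_def E_def intro!: sum.cong\<close>)
  have e_right: "free_eval b (\<Oplus>\<^bsub>F\<^esub>k\<in>V. (if E k j then 1 else 0) \<odot>\<^bsub>F\<^esub> free_gen (i, k)) = (\<Sum>k\<in>V. adj_coeff n k j *\<^sub>C b (i, k))"
    if "i \<in> V" "j \<in> V" for i j
    by (subst free_eval_rules(7)) (use that fin in \<open>auto simp only: ev adj_coeff_def E_def intro!: sum.cong\<close>)
  show ?thesis
  proof
    assume sat: "satisfies b"
    then have s: "free_eval b p = free_eval b q" if "(p, q) \<in> qaut_relations V E" for p q
      using that by (auto simp: satisfies_def)
    show "cube_quantum_automorphism n (\<lambda>\<alpha> \<beta>. b (\<alpha>, \<beta>))"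
    proof (unfold_locales, fold V_def)
      show "finite V" by (rule fin)
      show "b (i, j) * b (i, j) = b (i, j)" if "i \<in> V" "j \<in> V" for i j
      proof -
        have "free_eval b (free_gen (i, j) \<otimes>\<^bsub>F\<^esub> free_gen (i, j)) = free_eval b (free_gen (i, j))"
          by (rule s) (use that in \<open>unfold qaut_relations_def Let_def, blast\<close>)
        then show ?thesis using that by (simp only: ev)
      qed
      show "star (b (i, j)) = b (i, j)" if "i \<in> V" "j \<in> V" for i j
      proof -
        have "free_eval b (adj F (free_gen (i, j))) = free_eval b (free_gen (i, j))"
          by (rule s) (use that in \<open>unfold qaut_relations_def Let_def, blast\<close>)
        then show ?thesis using that by (simp only: ev)
      qed
      show "b (i, j) * b (i, k) = 0" if "i \<in> V" "j \<in> V" "k \<in> V" "j \<noteq> k" for i j k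
      proof -
        have "free_eval b (free_gen (i, j) \<otimes>\<^bsub>F\<^esub> free_gen (i, k)) = free_eval b \<zero>\<^bsub>F\<^esub>"
          by (rule s) (use that in \<open>unfold qaut_relations_def Let_def, blast\<close>)
        then show ?thesis using that by (simp only: ev)
      qed
      show "b (j, i) * b (k, i) = 0" if "i \<in> V" "j \<in> V" "k \<in> V" "j \<noteq> k" for i j k
      proof -
        have "free_eval b (free_gen (j, i) \<otimes>\<^bsub>F\<^esub> free_gen (k, i)) = free_eval b \<zero>\<^bsub>F\<^esub>"
          by (rule s) (use that in \<open>unfold qaut_relations_def Let_def, blast\<close>)
        then show ?thesis using that by (simp only: ev)
      qed
      show "(\<Sum>k\<in>V. b (i, k)) = 1" if "i \<in> V" for i
      proof -
        have "(\<Sum>k\<in>V. b (i, k)) = free_eval b \<one>\<^bsub>F\<^esub>" unfolding e_row[OF that, symmetric]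
          by (rule s) (use that in \<open>unfold qaut_relations_def Let_def, blast\<close>)
        then show ?thesis by (simp only: ev)
      qed
      show "(\<Sum>k\<in>V. b (k, j)) = 1" if "j \<in> V" for j
      proof -
        have "(\<Sum>k\<in>V. b (k, j)) = free_eval b \<one>\<^bsub>F\<^esub>" unfolding e_col[OF that, symmetric]
          by (rule s) (use that in \<open>unfold qaut_relations_def Let_def, blast\<close>)
        then show ?thesis by (simp only: ev)
      qed
      show "(\<Sum>k\<in>V. adj_coeff n i k *\<^sub>C b (k, j)) = (\<Sum>k\<in>V. adj_coeff n k j *\<^sub>C b (i, k))"
        if "i \<in> V" "j \<in> V" for i j
        unfolding e_left[OF that, symmetric] e_right[OF that, symmetric]
        by (rule s) (use that in \<open>unfold qaut_relations_def Let_def, blast\<close>)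
    qed
  next
    assume "cube_quantum_automorphism n (\<lambda>\<alpha> \<beta>. b (\<alpha>, \<beta>))"
    then interpret u: cube_quantum_automorphism n "\<lambda>\<alpha> \<beta>. b (\<alpha>, \<beta>)" .
    note u = u.idem u.selfadj u.row_disj u.col_disj u.row_sum u.col_sum u.intertwine
    note u' = u[folded V_def]
    show "satisfies b"
      unfolding satisfies_def
    proof (intro ballI, clarify)
      fix p q assume "(p, q) \<in> qaut_relations V E"
      then show "free_eval b p = free_eval b q"
        unfolding qaut_relations_def Let_def
        by (elim UnE CollectE exE conjE; unfold prod.inject; elim conjE; hypsubst)
          (simp_all only: ev e_row e_col e_left e_right u' not_False_eq_True)
    qed
  qed
qed

text \<open>The identity matrix satisfies the relations over every algebra; it supplies the components left open in
\<open>lift_hom\<close>.\<close>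

lemma identity_SO: "anticommutative_SO M (\<lambda>i j. if i = j then 1 else (0::'t::complex_star_algebra))"
proof
  let ?d = "\<lambda>i j. if i = j then 1 else (0::'t)"
  show "(\<Sum>i\<in>{1..M}. ?d i j * ?d i l) = (if j = l then 1 else 0)" if "j \<in> {1..M}" for j l
  proof -
    have "(\<Sum>i\<in>{1..M}. ?d i j * ?d i l) = (\<Sum>i\<in>{1..M}. if i = j then ?d j l else 0)" by (rule sum.cong) auto
    then show ?thesis using that by simp
  qed
  show "(\<Sum>j\<in>{1..M}. ?d i j * ?d k j) = (if i = k then 1 else 0)" if "i \<in> {1..M}" for i k
  proof -
    have "(\<Sum>j\<in>{1..M}. ?d i j * ?d k j) = (\<Sum>j\<in>{1..M}. if j = i then ?d k i else 0)" by (rule sum.cong) auto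
    then show ?thesis using that by auto
  qed
  have z: "prod_list (map (\<lambda>i. ?d i (\<sigma> i)) [1..<M+1]) = (if \<sigma> = id then 1 else 0)" if "\<sigma> permutes {1..M}" for \<sigma>
  proof (cases "\<sigma> = id")
    case True
    have "prod_list (map (\<lambda>i. 1) js) = (1::'t)" for js :: "nat list" by (induct js) auto
    then show ?thesis using True by simp
  next
    case False
    then obtain i where i: "\<sigma> i \<noteq> i" by (auto simp: fun_eq_iff)
    then have "i \<in> {1..M}" using that unfolding permutes_def by blast
    then have "i \<in> set [1..<M+1]" by (simp only: set_upt_Suc)
    moreover have "prod_list (map (\<lambda>i. ?d i (\<sigma> i)) js) = 0" if "i \<in> set js" for js
      using that i by (induct js) auto
    ultimately have "prod_list (map (\<lambda>i. ?d i (\<sigma> i)) [1..<M+1]) = 0" by blast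
    then show ?thesis using False by (simp only: if_False)
  qed
  have "(\<Sum>\<sigma> | \<sigma> permutes {1..M}. prod_list (map (\<lambda>i. ?d i (\<sigma> i)) [1..<M+1]))
      = (\<Sum>\<sigma> | \<sigma> permutes {1..M}. if \<sigma> = id then 1 else 0)"
    by (rule sum.cong) (use z in auto)
  also have "\<dots> = 1" by (simp add: finite_permutations permutes_id)
  finally show "(\<Sum>\<sigma> | \<sigma> permutes {1..M}. prod_list (map (\<lambda>i. ?d i (\<sigma> i)) [1..<M+1])) = 1" .
qed auto

lemma identity_cube: "cube_quantum_automorphism n (\<lambda>\<alpha> \<beta>. if \<alpha> = \<beta> then 1 else (0::'t::complex_star_algebra))"
proof
  let ?d = "\<lambda>i j. if i = j then 1 else (0::'t)"
  fix \<alpha> \<beta> assume ab: "\<alpha> \<in> Z2_vectors n" "\<beta> \<in> Z2_vectors n"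
  have "(\<Sum>\<gamma>\<in>Z2_vectors n. adj_coeff n \<alpha> \<gamma> *\<^sub>C ?d \<gamma> \<beta>) = (\<Sum>\<gamma>\<in>Z2_vectors n. if \<gamma> = \<beta> then adj_coeff n \<alpha> \<beta> *\<^sub>C 1 else 0)"
    by (rule sum.cong) auto
  also have "\<dots> = (\<Sum>\<gamma>\<in>Z2_vectors n. if \<gamma> = \<alpha> then adj_coeff n \<alpha> \<beta> *\<^sub>C 1 else 0)" using ab by simp
  also have "\<dots> = (\<Sum>\<gamma>\<in>Z2_vectors n. adj_coeff n \<gamma> \<beta> *\<^sub>C ?d \<alpha> \<gamma>)"
    by (rule sum.cong) auto
  finally show "(\<Sum>\<gamma>\<in>Z2_vectors n. adj_coeff n \<alpha> \<gamma> *\<^sub>C ?d \<gamma> \<beta>) = (\<Sum>\<gamma>\<in>Z2_vectors n. adj_coeff n \<gamma> \<beta> *\<^sub>C ?d \<alpha> \<gamma>)" .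
qed auto

section \<open>The isomorphism of quantum groups\<close>

text \<open>The components of \<open>x\<close> and \<open>y\<close> are related by \<open>h\<close>.  This passes to sums and products, hence to
\<open>fourier_matrix\<close> and \<open>cube_matrix\<close>: these constructions commute with homomorphisms.\<close>

definition corresponds :: "'a star_alg \<Rightarrow> 'b star_alg \<Rightarrow> ('a \<Rightarrow> 'b) \<Rightarrow> 'a star_prod \<Rightarrow> 'b star_prod \<Rightarrow> bool" where
  "corresponds A B h x y \<longleftrightarrow> component y B = h (component x A)"

context
  fixes A :: "'a star_alg" and B :: "'b star_alg" and h
  assumes A: "star_algebra A" and B: "star_algebra B" and h: "h \<in> star_hom A B"
begin

lemma corresponds_one: "corresponds A B h 1 1"
  by (simp add: corresponds_def component_one A B star_hom_one[OF h])

lemma corresponds_plus: "corresponds A B h x y \<Longrightarrow> corresponds A B h x' y' \<Longrightarrow> corresponds A B h (x + x') (y + y')"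
  by (simp add: corresponds_def component_plus A B star_hom_add[OF h])

lemma corresponds_times: "corresponds A B h x y \<Longrightarrow> corresponds A B h x' y' \<Longrightarrow> corresponds A B h (x * x') (y * y')"
  by (simp add: corresponds_def component_times A B star_hom_mult[OF h])

lemma corresponds_scaleC: "corresponds A B h x y \<Longrightarrow> corresponds A B h (c *\<^sub>C x) (c *\<^sub>C y)"
  by (simp add: corresponds_def component_scaleC A B star_hom_smult[OF h])

lemma corresponds_sum:
  assumes "\<And>i. i \<in> S \<Longrightarrow> corresponds A B h (f i) (g i)"
  shows "corresponds A B h (\<Sum>i\<in>S. f i) (\<Sum>i\<in>S. g i)"
proof -
  have "corresponds A B h 0 0"
    by (simp add: corresponds_def component_zero A B star_hom_zero[OF A B h])
  then show ?thesis using assms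
    by (induct S rule: infinite_finite_induct) (auto intro: corresponds_plus)
qed

lemma corresponds_prod_list:
  assumes "\<And>i. i \<in> set is \<Longrightarrow> corresponds A B h (f i) (g i)"
  shows "corresponds A B h (prod_list (map f is)) (prod_list (map g is))"
  using assms by (induct "is") (auto intro: corresponds_one corresponds_times)

lemma corresponds_fourier:
  assumes "\<And>\<alpha> \<beta>. \<alpha> \<in> Z2_vectors n \<Longrightarrow> \<beta> \<in> Z2_vectors n \<Longrightarrow> corresponds A B h (u \<alpha> \<beta>) (w \<alpha> \<beta>)"
  shows "corresponds A B h (fourier_matrix n u \<mu> \<nu>) (fourier_matrix n w \<mu> \<nu>)"
  unfolding fourier_matrix_def by (intro corresponds_sum corresponds_scaleC assms)

lemma corresponds_cube_matrix:
  assumes "\<And>i j. i \<in> {1..n+1} \<Longrightarrow> j \<in> {1..n+1} \<Longrightarrow> corresponds A B h (v i j) (w i j)"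
  shows "corresponds A B h (cube_matrix n v \<alpha> \<beta>) (cube_matrix n w \<alpha> \<beta>)"
  unfolding cube_matrix_def joint_proj_def tau_image_def
  by (intro corresponds_prod_list corresponds_scaleC corresponds_plus corresponds_one corresponds_sum assms) auto

end

lemma fourier_transform_component:
  assumes A: "star_algebra A"
    and u: "\<And>\<alpha> \<beta>. \<alpha> \<in> Z2_vectors n \<Longrightarrow> \<beta> \<in> Z2_vectors n \<Longrightarrow> component (w \<alpha> \<beta>) A = u \<alpha> \<beta>"
  shows "fourier_transform n A u \<mu> \<nu> = component (fourier_matrix n w \<mu> \<nu>) A"
proof -
  interpret A: star_algebra A by fact
  let ?c = "\<lambda>\<alpha> \<beta>. fourier_inv n \<mu> \<alpha> * fourier \<beta> \<nu>"
  have inner: "(\<Oplus>\<^bsub>A\<^esub>\<beta>\<in>Z2_vectors n. ?c \<alpha> \<beta> \<odot>\<^bsub>A\<^esub> u \<alpha> \<beta>)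
      = component (\<Sum>\<beta>\<in>Z2_vectors n. ?c \<alpha> \<beta> *\<^sub>C w \<alpha> \<beta>) A" if "\<alpha> \<in> Z2_vectors n" for \<alpha>
    unfolding component_sum[OF A finite_Z2]
    by (rule A.finsum_cong') (use that A in \<open>auto simp: component_scaleC u simp flip: u intro!: A.smult_closed\<close>)
  show ?thesis
    unfolding fourier_transform_def fourier_matrix_def component_sum[OF A finite_Z2]
    by (rule A.finsum_cong') (use inner A in \<open>auto simp flip: component_sum\<close>)
qed

text \<open>A matrix that is already unitary is conjugated by the identity matrix.\<close>

lemma similar_to_unitary_component:
  assumes A: "star_algebra A" and fin: "finite N"
    and w: "\<And>i j. i \<in> N \<Longrightarrow> j \<in> N \<Longrightarrow> component (W i j) A = w i j"
    and 1: "\<And>i j. i \<in> N \<Longrightarrow> j \<in> N \<Longrightarrow> (\<Sum>k\<in>N. W i k * star (W j k)) = (if i = j then 1 else 0)"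
    and 2: "\<And>i j. i \<in> N \<Longrightarrow> j \<in> N \<Longrightarrow> (\<Sum>k\<in>N. star (W k i) * W k j) = (if i = j then 1 else 0)"
  shows "similar_to_unitary A N w"
proof -
  interpret A: star_algebra A by fact
  let ?T = "\<lambda>i k. if i = k then 1 else 0 :: complex"
  have wc: "w i j \<in> carrier A" if "i \<in> N" "j \<in> N" for i j using w[OF that] A by (metis component_closed)
  have id: "(\<Oplus>\<^bsub>A\<^esub>k\<in>N. \<Oplus>\<^bsub>A\<^esub>l\<in>N. (?T i k * ?T l j) \<odot>\<^bsub>A\<^esub> w k l) = w i j" if ij: "i \<in> N" "j \<in> N" for i j
  proof -
    have inner: "(\<Oplus>\<^bsub>A\<^esub>l\<in>N. (?T i k * ?T l j) \<odot>\<^bsub>A\<^esub> w k l) = component (\<Sum>l\<in>N. (?T i k * ?T l j) *\<^sub>C W k l) A"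
      if "k \<in> N" for k
      unfolding component_sum[OF A fin]
      by (rule A.finsum_cong') (use that A w wc in \<open>auto simp: component_scaleC intro: A.smult_closed\<close>)
    have "(\<Oplus>\<^bsub>A\<^esub>k\<in>N. \<Oplus>\<^bsub>A\<^esub>l\<in>N. (?T i k * ?T l j) \<odot>\<^bsub>A\<^esub> w k l)
        = component (\<Sum>k\<in>N. \<Sum>l\<in>N. (?T i k * ?T l j) *\<^sub>C W k l) A"
      unfolding component_sum[OF A fin, of "\<lambda>k. \<Sum>l\<in>N. (?T i k * ?T l j) *\<^sub>C W k l"]
      by (rule A.finsum_cong') (use inner A in auto)
    also have "(\<Sum>k\<in>N. \<Sum>l\<in>N. (?T i k * ?T l j) *\<^sub>C W k l) = (\<Sum>k\<in>N. if k = i then W k j else 0)"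
    proof (rule sum.cong[OF refl])
      fix k
      have "(\<Sum>l\<in>N. (?T i k * ?T l j) *\<^sub>C W k l) = (\<Sum>l\<in>N. if l = j then (if k = i then W k j else 0) else 0)"
        by (rule sum.cong) auto
      then show "(\<Sum>l\<in>N. (?T i k * ?T l j) *\<^sub>C W k l) = (if k = i then W k j else 0)"
        using ij fin by simp
    qed
    also have "\<dots> = W i j" using ij fin by simp
    finally show ?thesis using w[OF ij] by simp
  qed
  have row: "(\<Oplus>\<^bsub>A\<^esub>k\<in>N. w i k \<otimes>\<^bsub>A\<^esub> adj A (w j k)) = (if i = j then \<one>\<^bsub>A\<^esub> else \<zero>\<^bsub>A\<^esub>)" if ij: "i \<in> N" "j \<in> N" for i j
  proof -
    have "(\<Oplus>\<^bsub>A\<^esub>k\<in>N. w i k \<otimes>\<^bsub>A\<^esub> adj A (w j k)) = component (\<Sum>k\<in>N. W i k * star (W j k)) A"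
      unfolding component_sum[OF A fin]
      by (rule A.finsum_cong') (use ij A w wc in \<open>auto simp: component_times component_star intro!: A.m_closed A.adj_closed\<close>)
    then show ?thesis using 1[OF ij] A by (simp add: component_one component_zero)
  qed
  have col: "(\<Oplus>\<^bsub>A\<^esub>k\<in>N. adj A (w k i) \<otimes>\<^bsub>A\<^esub> w k j) = (if i = j then \<one>\<^bsub>A\<^esub> else \<zero>\<^bsub>A\<^esub>)" if ij: "i \<in> N" "j \<in> N" for i j
  proof -
    have "(\<Oplus>\<^bsub>A\<^esub>k\<in>N. adj A (w k i) \<otimes>\<^bsub>A\<^esub> w k j) = component (\<Sum>k\<in>N. star (W k i) * W k j) A"
      unfolding component_sum[OF A fin]
      by (rule A.finsum_cong') (use ij A w wc in \<open>auto simp: component_times component_star intro!: A.m_closed A.adj_closed\<close>)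
    then show ?thesis using 2[OF ij] A by (simp add: component_one component_zero)
  qed
  have T: "(\<Sum>k\<in>N. ?T i k * ?T k j) = (if i = j then 1 else 0)" if "i \<in> N" for i j
  proof -
    have "(\<Sum>k\<in>N. ?T i k * ?T k j) = (\<Sum>k\<in>N. if k = i then ?T i j else 0)" by (rule sum.cong) auto
    then show ?thesis using that fin by simp
  qed
  have closed1: "(\<lambda>k. w i k \<otimes>\<^bsub>A\<^esub> adj A (w j k)) \<in> N \<rightarrow> carrier A"
    "(\<lambda>k. adj A (w k i) \<otimes>\<^bsub>A\<^esub> w k j) \<in> N \<rightarrow> carrier A" if "i \<in> N" "j \<in> N" for i j
    using that by (auto intro!: A.m_closed A.adj_closed wc)
  show ?thesis
    unfolding similar_to_unitary_def unitary_matrix_def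
  proof (rule exI[of _ ?T], rule exI[of _ ?T], intro conjI ballI)
    fix i j assume ij: "i \<in> N" "j \<in> N"
    show "(\<Sum>k\<in>N. ?T i k * ?T k j) = (if i = j then 1 else 0)" by (rule T[OF ij(1)])
    show "(\<Sum>k\<in>N. ?T i k * ?T k j) = (if i = j then 1 else 0)" by (rule T[OF ij(1)])
    let ?w = "\<lambda>i j. \<Oplus>\<^bsub>A\<^esub>k\<in>N. \<Oplus>\<^bsub>A\<^esub>l\<in>N. (?T i k * ?T l j) \<odot>\<^bsub>A\<^esub> w k l"
    show "(\<Oplus>\<^bsub>A\<^esub>k\<in>N. ?w i k \<otimes>\<^bsub>A\<^esub> adj A (?w j k)) = (if i = j then \<one>\<^bsub>A\<^esub> else \<zero>\<^bsub>A\<^esub>)"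
      unfolding row[OF ij, symmetric]
      by (rule A.finsum_cong'[OF refl closed1(1)[OF ij]]) (simp only: id ij)
    show "(\<Oplus>\<^bsub>A\<^esub>k\<in>N. adj A (?w k i) \<otimes>\<^bsub>A\<^esub> ?w k j) = (if i = j then \<one>\<^bsub>A\<^esub> else \<zero>\<^bsub>A\<^esub>)"
      unfolding col[OF ij, symmetric]
      by (rule A.finsum_cong'[OF refl closed1(2)[OF ij]]) (simp only: id ij)
  qed
qed

lemma (in anticommutative_SO) SO_unitary:
  assumes "i \<in> {1..M}" "j \<in> {1..M}"
  shows "(\<Sum>k\<in>{1..M}. v i k * star (v j k)) = (if i = j then 1 else 0)"
    and "(\<Sum>k\<in>{1..M}. star (v k i) * v k j) = (if i = j then 1 else 0)"
proof -
  have "(\<Sum>k\<in>{1..M}. v i k * star (v j k)) = (\<Sum>k\<in>{1..M}. v i k * v j k)"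
    by (rule sum.cong) (use assms selfadj in auto)
  then show "(\<Sum>k\<in>{1..M}. v i k * star (v j k)) = (if i = j then 1 else 0)" using row_orth assms by simp
  have "(\<Sum>k\<in>{1..M}. star (v k i) * v k j) = (\<Sum>k\<in>{1..M}. v k i * v k j)"
    by (rule sum.cong) (use assms selfadj in auto)
  then show "(\<Sum>k\<in>{1..M}. star (v k i) * v k j) = (if i = j then 1 else 0)" using col_orth assms by simp
qed

lemma (in quantum_permutation) permutation_unitary:
  assumes "i \<in> V" "j \<in> V"
  shows "(\<Sum>k\<in>V. u i k * star (u j k)) = (if i = j then 1 else 0)"
    and "(\<Sum>k\<in>V. star (u k i) * u k j) = (if i = j then 1 else 0)"
proof -
  have "(\<Sum>k\<in>V. u i k * star (u j k)) = (\<Sum>k\<in>V. if i = j then u i k else 0)"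
    by (rule sum.cong) (use assms selfadj idem col_disj in auto)
  then show "(\<Sum>k\<in>V. u i k * star (u j k)) = (if i = j then 1 else 0)" using row_sum assms by simp
  have "(\<Sum>k\<in>V. star (u k i) * u k j) = (\<Sum>k\<in>V. if i = j then u k j else 0)"
    by (rule sum.cong) (use assms selfadj idem row_disj in auto)
  then show "(\<Sum>k\<in>V. star (u k i) * u k j) = (if i = j then 1 else 0)" using col_sum assms by simp
qed

text \<open>The orderings of \<open>I\<close> are the rearrangements of its increasing enumeration.\<close>

lemma (in anticommutative_matrix) minor_eq_ext_power:
  assumes "finite I" "length js = card I"
  shows "minor I js = (\<Sum>\<sigma> | \<sigma> permutes {..<card I}.
    prod_list (map (\<lambda>a. v (sorted_list_of_set I ! \<sigma> a) (js ! a)) [0..<card I]))"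
proof -
  let ?is = "sorted_list_of_set I"
  have "minor I js = (\<Sum>is\<in>permutations_of_set (set ?is). row_prod is js)"
    using assms by (simp add: minor_def)
  also have "\<dots> = (\<Sum>\<sigma> | \<sigma> permutes {..<length ?is}. row_prod (permute_list \<sigma> ?is) js)"
    by (rule sum.reindex_bij_betw[OF bij_betw_permute_list, symmetric]) simp
  also have "\<dots> = (\<Sum>\<sigma> | \<sigma> permutes {..<card I}. prod_list (map (\<lambda>a. v (?is ! \<sigma> a) (js ! a)) [0..<card I]))"
  proof (rule sum.cong)
    fix \<sigma>
    have "map2 v (permute_list \<sigma> ?is) js = map (\<lambda>a. v (?is ! \<sigma> a) (js ! a)) [0..<card I]"
      using assms by (intro nth_equalityI) (auto simp: permute_list_def)
    then show "row_prod (permute_list \<sigma> ?is) js = prod_list (map (\<lambda>a. v (?is ! \<sigma> a) (js ! a)) [0..<card I])"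
      by simp
  qed (use assms in simp)
  finally show ?thesis .
qed

locale halved_cube_iso =
  fixes n :: nat
  assumes n: "n \<ge> 2" "n \<noteq> 3"
begin

definition "qH = so_minus (n + 1)"

abbreviation "Z \<equiv> Z2_vectors n"
abbreviation "N \<equiv> {1..n+1}"
abbreviation "qG \<equiv> qaut_halved_cube n"
abbreviation "A \<equiv> func_alg qG"
abbreviation "H \<equiv> func_alg qH"
abbreviation "u \<equiv> fund qG"
abbreviation "v \<equiv> fund qH"

sublocale G: presentation "Z \<times> Z" "qaut_relations Z (halved_cube_adj n)"
  by (rule qaut_presentation) simp

sublocale S: presentation "N \<times> N" "so_minus_relations (n + 1)"
  by (rule so_presentation)

lemma A_eq: "A = G.U" and u_eq: "u \<alpha> \<beta> = G.gen (\<alpha>, \<beta>)" and indexG: "index qG = Z"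
  by (simp_all add: qaut_halved_cube_def qaut_def)

lemma H_eq: "H = S.U" and v_eq: "v i j = S.gen (i, j)" and indexH: "index qH = N"
  by (simp_all add: qH_def so_minus_def)

lemma A_star: "star_algebra A" unfolding A_eq by (rule G.U_star_algebra)
lemma H_star: "star_algebra H" unfolding H_eq by (rule S.U_star_algebra)

lemma u_closed: "\<alpha> \<in> Z \<Longrightarrow> \<beta> \<in> Z \<Longrightarrow> u \<alpha> \<beta> \<in> carrier A"
  unfolding A_eq u_eq by (rule G.gen_closed) simp

lemma v_closed: "i \<in> N \<Longrightarrow> j \<in> N \<Longrightarrow> v i j \<in> carrier H"
  unfolding H_eq v_eq by (rule S.gen_closed) simp

lemma A_hom_eq:
  assumes "g \<in> star_hom A B" "h \<in> star_hom A B" "\<And>\<alpha> \<beta>. \<alpha> \<in> Z \<Longrightarrow> \<beta> \<in> Z \<Longrightarrow> g (u \<alpha> \<beta>) = h (u \<alpha> \<beta>)" "x \<in> carrier A"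
  shows "g x = h x"
  using assms unfolding A_eq u_eq by (intro G.U_hom_eq[of g B h x]) auto

lemma H_hom_eq:
  assumes "g \<in> star_hom H B" "h \<in> star_hom H B" "\<And>i j. i \<in> N \<Longrightarrow> j \<in> N \<Longrightarrow> g (v i j) = h (v i j)" "x \<in> carrier H"
  shows "g x = h x"
  using assms unfolding H_eq v_eq by (intro S.U_hom_eq[of g B h x]) auto

lemma cube_hom:
  assumes "cube_quantum_automorphism n w" "star_algebra B"
  shows "\<exists>h\<in>star_hom A B. \<forall>\<alpha>\<in>Z. \<forall>\<beta>\<in>Z. h (u \<alpha> \<beta>) = component (w \<alpha> \<beta>) B"
proof -
  have "G.satisfies (\<lambda>(\<alpha>, \<beta>). w \<alpha> \<beta>)" using assms(1) by (simp add: cube_satisfies)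
  then obtain h where h: "h \<in> star_hom G.U B" "\<forall>x\<in>Z \<times> Z. h (G.gen x) = component (case x of (\<alpha>, \<beta>) \<Rightarrow> w \<alpha> \<beta>) B"
    using G.universal_property[OF _ assms(2)] by blast
  have "h (G.gen (\<alpha>, \<beta>)) = component (w \<alpha> \<beta>) B" if "\<alpha> \<in> Z" "\<beta> \<in> Z" for \<alpha> \<beta>
    using bspec[OF h(2), of "(\<alpha>, \<beta>)"] that by simp
  then show ?thesis unfolding A_eq u_eq using h(1) by blast
qed

lemma SO_hom:
  assumes "anticommutative_SO (n + 1) w" "star_algebra B"
  shows "\<exists>h\<in>star_hom H B. \<forall>i\<in>N. \<forall>j\<in>N. h (v i j) = component (w i j) B"
proof -
  have "S.satisfies (\<lambda>(i, j). w i j)" using assms(1) by (simp only: so_satisfies prod.case)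
  then obtain h where h: "h \<in> star_hom S.U B" "\<forall>x\<in>N \<times> N. h (S.gen x) = component (case x of (i, j) \<Rightarrow> w i j) B"
    using S.universal_property[OF _ assms(2)] by blast
  have "h (S.gen (i, j)) = component (w i j) B" if "i \<in> N" "j \<in> N" for i j
    using bspec[OF h(2), of "(i, j)"] that by simp
  then show ?thesis unfolding H_eq v_eq using h(1) by blast
qed

text \<open>The fundamental matrix \<open>u\<close>, mapped to \<open>B\<close> by \<open>h\<close> and extended by the identity matrix to the product of all algebras.\<close>

definition cube_lift :: "'b star_alg \<Rightarrow> (_ \<Rightarrow> 'b) \<Rightarrow> nat set \<Rightarrow> nat set \<Rightarrow> 'b star_prod" where
  "cube_lift B h \<alpha> \<beta> = with_component B (h (u \<alpha> \<beta>)) (if \<alpha> = \<beta> then 1 else 0)"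

lemma cube_lift:
  assumes B: "star_algebra B" and h: "h \<in> star_hom A B"
  shows "cube_quantum_automorphism n (cube_lift B h)"
    and "\<alpha> \<in> Z \<Longrightarrow> \<beta> \<in> Z \<Longrightarrow> component (cube_lift B h \<alpha> \<beta>) B = h (u \<alpha> \<beta>)"
    and "\<alpha> \<in> Z \<Longrightarrow> \<beta> \<in> Z \<Longrightarrow> star_algebra C \<Longrightarrow> C \<noteq> B \<Longrightarrow>
      component (cube_lift B h \<alpha> \<beta>) C = component (if \<alpha> = \<beta> then 1 else 0) C"
proof -
  have b0: "G.satisfies (\<lambda>x. if fst x = snd x then 1 else (0 :: 'b star_prod))"
    using identity_cube by (simp add: cube_satisfies)
  note l = G.lift_hom[OF b0 B h[unfolded A_eq]]
  show "cube_quantum_automorphism n (cube_lift B h)"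
    using l(1) unfolding cube_satisfies cube_lift_def u_eq fst_conv snd_conv .
  show "\<alpha> \<in> Z \<Longrightarrow> \<beta> \<in> Z \<Longrightarrow> component (cube_lift B h \<alpha> \<beta>) B = h (u \<alpha> \<beta>)"
    using l(2)[of "(\<alpha>, \<beta>)"] unfolding cube_lift_def u_eq by simp
  show "\<alpha> \<in> Z \<Longrightarrow> \<beta> \<in> Z \<Longrightarrow> star_algebra C \<Longrightarrow> C \<noteq> B \<Longrightarrow>
      component (cube_lift B h \<alpha> \<beta>) C = component (if \<alpha> = \<beta> then 1 else 0) C"
    using l(3)[of "(\<alpha>, \<beta>)" C] unfolding cube_lift_def u_eq by simp
qed

text \<open>The fundamental matrix of \<open>SO\<^sub>n\<^sub>+\<^sub>1\<^sup>-\<^sup>1\<close>, extended by the identity matrix to the product of all algebras.\<close>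

definition "V0 i j = with_component H (v i j) (if i = j then 1 else 0)"

lemma id_star_hom: "id \<in> star_hom B B"
  by (rule star_homI) auto

lemma V0:
  shows "cube_SO n V0" and "i \<in> N \<Longrightarrow> j \<in> N \<Longrightarrow> component (V0 i j) H = v i j"
proof -
  have b0: "S.satisfies (\<lambda>x. if fst x = snd x then 1 else (0 :: _ star_prod))"
    using identity_SO[of "n + 1"] by (simp only: so_satisfies fst_conv snd_conv)
  note l = S.lift_hom[OF b0 H_star[unfolded H_eq] id_star_hom]
  show "cube_SO n V0"
    using l(1) unfolding so_satisfies cube_SO_def V0_def[abs_def] H_eq v_eq fst_conv snd_conv id_apply .
  show "i \<in> N \<Longrightarrow> j \<in> N \<Longrightarrow> component (V0 i j) H = v i j"
    using l(2)[of "(i, j)"] unfolding V0_def H_eq v_eq by simp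
qed

definition "U0 = cube_lift A id"

lemma U0:
  shows "cube_quantum_automorphism n U0" and "\<alpha> \<in> Z \<Longrightarrow> \<beta> \<in> Z \<Longrightarrow> component (U0 \<alpha> \<beta>) A = u \<alpha> \<beta>"
  using cube_lift[OF A_star id_star_hom] by (simp_all add: U0_def)

definition "\<phi> = (SOME h. h \<in> star_hom A H \<and> (\<forall>\<alpha>\<in>Z. \<forall>\<beta>\<in>Z. h (u \<alpha> \<beta>) = component (cube_matrix n V0 \<alpha> \<beta>) H))"
definition "\<psi> = (SOME h. h \<in> star_hom H A \<and> (\<forall>i\<in>N. \<forall>j\<in>N. h (v i j) = component (degree_one_block n U0 i j) A))"

lemma \<phi>: "\<phi> \<in> star_hom A H" "\<alpha> \<in> Z \<Longrightarrow> \<beta> \<in> Z \<Longrightarrow> \<phi> (u \<alpha> \<beta>) = component (cube_matrix n V0 \<alpha> \<beta>) H"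
proof -
  have "\<exists>h. h \<in> star_hom A H \<and> (\<forall>\<alpha>\<in>Z. \<forall>\<beta>\<in>Z. h (u \<alpha> \<beta>) = component (cube_matrix n V0 \<alpha> \<beta>) H)"
    using cube_hom[OF cube_SO.cube_matrix_quantum_automorphism[OF V0(1)] H_star] by blast
  from someI_ex[OF this, folded \<phi>_def]
  show "\<phi> \<in> star_hom A H" "\<alpha> \<in> Z \<Longrightarrow> \<beta> \<in> Z \<Longrightarrow> \<phi> (u \<alpha> \<beta>) = component (cube_matrix n V0 \<alpha> \<beta>) H" by auto
qed

lemma \<psi>: "\<psi> \<in> star_hom H A" "i \<in> N \<Longrightarrow> j \<in> N \<Longrightarrow> \<psi> (v i j) = component (degree_one_block n U0 i j) A"
proof -
  have "anticommutative_SO (n + 1) (degree_one_block n U0)"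
    using cube_quantum_automorphism.block_SO[OF U0(1) n] by (simp add: cube_SO_def)
  then have "\<exists>h. h \<in> star_hom H A \<and> (\<forall>i\<in>N. \<forall>j\<in>N. h (v i j) = component (degree_one_block n U0 i j) A)"
    using SO_hom[OF _ A_star] by blast
  from someI_ex[OF this, folded \<psi>_def]
  show "\<psi> \<in> star_hom H A" "i \<in> N \<Longrightarrow> j \<in> N \<Longrightarrow> \<psi> (v i j) = component (degree_one_block n U0 i j) A" by auto
qed

lemma \<phi>_fourier:
  "\<phi> (component (fourier_matrix n U0 \<mu> \<nu>) A) = component (fourier_matrix n (cube_matrix n V0) \<mu> \<nu>) H"
  using corresponds_fourier[OF A_star H_star \<phi>(1), of n U0 "cube_matrix n V0" \<mu> \<nu>]
  by (simp add: corresponds_def U0(2) \<phi>(2))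

text \<open>Both compositions fix the generators, by \<open>block_cube_matrix\<close> and \<open>cube_matrix_block\<close>.\<close>

lemma \<phi>_\<psi>: "x \<in> carrier H \<Longrightarrow> \<phi> (\<psi> x) = x"
proof -
  assume x: "x \<in> carrier H"
  have "(\<phi> \<circ> \<psi>) x = id x"
  proof (rule H_hom_eq[OF star_hom_comp[OF \<psi>(1) \<phi>(1)] id_star_hom _ x])
    fix i j assume ij: "i \<in> N" "j \<in> N"
    show "(\<phi> \<circ> \<psi>) (v i j) = id (v i j)"
      using \<phi>_fourier[of "tau_exponent n {i}" "tau_exponent n {j}"] cube_SO.block_cube_matrix[OF V0(1) n(1) ij]
      by (simp only: o_apply id_apply \<psi>(2)[OF ij] degree_one_block_def V0(2)[OF ij])
  qed
  then show ?thesis by simp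
qed

lemma \<psi>_\<phi>: "x \<in> carrier A \<Longrightarrow> \<psi> (\<phi> x) = x"
proof -
  assume x: "x \<in> carrier A"
  have "(\<psi> \<circ> \<phi>) x = id x"
  proof (rule A_hom_eq[OF star_hom_comp[OF \<phi>(1) \<psi>(1)] id_star_hom _ x])
    fix \<alpha> \<beta> assume ab: "\<alpha> \<in> Z" "\<beta> \<in> Z"
    have "corresponds H A \<psi> (cube_matrix n V0 \<alpha> \<beta>) (cube_matrix n (degree_one_block n U0) \<alpha> \<beta>)"
      by (rule corresponds_cube_matrix[OF H_star A_star \<psi>(1)]) (simp only: corresponds_def \<psi>(2) V0(2))
    then have "\<psi> (\<phi> (u \<alpha> \<beta>)) = component (U0 \<alpha> \<beta>) A"
      unfolding corresponds_def \<phi>(2)[OF ab] cube_quantum_automorphism.cube_matrix_block[OF U0(1) n ab] ..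
    then show "(\<psi> \<circ> \<phi>) (u \<alpha> \<beta>) = id (u \<alpha> \<beta>)"
      by (simp only: o_apply id_apply U0(2)[OF ab])
  qed
  then show ?thesis by simp
qed

lemma \<phi>_iso: "\<phi> \<in> star_iso A H"
  unfolding star_iso_def
proof (intro CollectI conjI \<phi>(1))
  show "bij_betw \<phi> (carrier A) (carrier H)"
    by (rule bij_betw_byWitness[where f' = \<psi>])
      (auto simp: \<phi>_\<psi> \<psi>_\<phi> star_hom_closed[OF \<phi>(1)] star_hom_closed[OF \<psi>(1)])
qed

text \<open>The matrices \<open>f(u) \<otimes> 1\<close> and \<open>1 \<otimes> f(u)\<close> over \<open>B \<otimes> B\<close> have commuting entries, so their product is again a quantum
automorphism; its entries are the elements prescribed by a comultiplication.\<close>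

lemma commuting_copies:
  fixes B :: "'b star_alg"
  assumes B: "star_algebra B" and f: "f \<in> star_hom A B"
  defines "T \<equiv> tensor_alg B B"
  defines "P \<equiv> cube_lift T (\<lambda>x. elem_tensor B B (f x) \<one>\<^bsub>B\<^esub>)"
    and "Q \<equiv> cube_lift T (\<lambda>x. elem_tensor B B \<one>\<^bsub>B\<^esub> (f x))"
  shows "cube_quantum_automorphism n P" and "cube_quantum_automorphism n Q"
    and "cube_quantum_automorphism n (\<lambda>\<alpha> \<beta>. \<Sum>\<gamma>\<in>Z. P \<alpha> \<gamma> * Q \<gamma> \<beta>)"
    and "\<alpha> \<in> Z \<Longrightarrow> \<beta> \<in> Z \<Longrightarrow> component (P \<alpha> \<beta>) T = elem_tensor B B (f (u \<alpha> \<beta>)) \<one>\<^bsub>B\<^esub>"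
    and "\<alpha> \<in> Z \<Longrightarrow> \<beta> \<in> Z \<Longrightarrow> component (Q \<alpha> \<beta>) T = elem_tensor B B \<one>\<^bsub>B\<^esub> (f (u \<alpha> \<beta>))"
    and "\<alpha> \<in> Z \<Longrightarrow> \<beta> \<in> Z \<Longrightarrow> component (\<Sum>\<gamma>\<in>Z. P \<alpha> \<gamma> * Q \<gamma> \<beta>) T
      = (\<Oplus>\<^bsub>T\<^esub>\<gamma>\<in>Z. elem_tensor B B (f (u \<alpha> \<gamma>)) (f (u \<gamma> \<beta>)))"
proof -
  interpret t: tensor_pair B B using B by (simp add: tensor_pair_def)
  have T: "star_algebra T" unfolding T_def by (rule t.T.star_algebra_axioms)
  have p: "(\<lambda>x. elem_tensor B B (f x) \<one>\<^bsub>B\<^esub>) \<in> star_hom A T"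
    using star_hom_comp[OF f t.left_star_hom] by (simp add: o_def T_def)
  have q: "(\<lambda>x. elem_tensor B B \<one>\<^bsub>B\<^esub> (f x)) \<in> star_hom A T"
    using star_hom_comp[OF f t.right_star_hom] by (simp add: o_def T_def)
  have fu: "f (u \<alpha> \<beta>) \<in> carrier B" if "\<alpha> \<in> Z" "\<beta> \<in> Z" for \<alpha> \<beta>
    using star_hom_closed[OF f u_closed[OF that]] .
  show P: "cube_quantum_automorphism n P" unfolding P_def by (rule cube_lift(1)[OF T p])
  show Q: "cube_quantum_automorphism n Q" unfolding Q_def by (rule cube_lift(1)[OF T q])
  have cP: "component (P \<alpha> \<beta>) T = elem_tensor B B (f (u \<alpha> \<beta>)) \<one>\<^bsub>B\<^esub>" if "\<alpha> \<in> Z" "\<beta> \<in> Z" for \<alpha> \<beta>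
    unfolding P_def by (rule cube_lift(2)[OF T p that])
  have cQ: "component (Q \<alpha> \<beta>) T = elem_tensor B B \<one>\<^bsub>B\<^esub> (f (u \<alpha> \<beta>))" if "\<alpha> \<in> Z" "\<beta> \<in> Z" for \<alpha> \<beta>
    unfolding Q_def by (rule cube_lift(2)[OF T q that])
  show "\<alpha> \<in> Z \<Longrightarrow> \<beta> \<in> Z \<Longrightarrow> component (P \<alpha> \<beta>) T = elem_tensor B B (f (u \<alpha> \<beta>)) \<one>\<^bsub>B\<^esub>" by (rule cP)
  show "\<alpha> \<in> Z \<Longrightarrow> \<beta> \<in> Z \<Longrightarrow> component (Q \<alpha> \<beta>) T = elem_tensor B B \<one>\<^bsub>B\<^esub> (f (u \<alpha> \<beta>))" by (rule cQ)
  have pq: "component (P \<alpha> \<beta> * Q \<gamma> \<delta>) T = elem_tensor B B (f (u \<alpha> \<beta>)) (f (u \<gamma> \<delta>))"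
    "component (Q \<gamma> \<delta> * P \<alpha> \<beta>) T = elem_tensor B B (f (u \<alpha> \<beta>)) (f (u \<gamma> \<delta>))"
    if "\<alpha> \<in> Z" "\<beta> \<in> Z" "\<gamma> \<in> Z" "\<delta> \<in> Z" for \<alpha> \<beta> \<gamma> \<delta>
    using t.tens_split[OF fu[OF that(1,2)] fu[OF that(3,4)]]
    by (simp_all add: component_times[OF T] cP cQ that T_def[symmetric])
  have comm: "P \<alpha> \<beta> * Q \<gamma> \<delta> = Q \<gamma> \<delta> * P \<alpha> \<beta>" if h: "\<alpha> \<in> Z" "\<beta> \<in> Z" "\<gamma> \<in> Z" "\<delta> \<in> Z" for \<alpha> \<beta> \<gamma> \<delta>
  proof (rule star_prod_eqI)
    fix C :: "('b \<times> 'b \<Rightarrow> complex) set star_alg" assume C: "star_algebra C"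
    then interpret C: star_algebra C .
    show "component (P \<alpha> \<beta> * Q \<gamma> \<delta>) C = component (Q \<gamma> \<delta> * P \<alpha> \<beta>) C"
    proof (cases "C = T")
      case True
      then show ?thesis using pq[OF h] by simp
    next
      case False
      have "component (P \<alpha> \<beta>) C = component (if \<alpha> = \<beta> then 1 else 0) C"
        unfolding P_def by (rule cube_lift(3)[OF T p h(1,2) C False])
      then show ?thesis by (simp add: component_times[OF C] component_one[OF C] component_zero[OF C] C)
    qed
  qed
  show "cube_quantum_automorphism n (\<lambda>\<alpha> \<beta>. \<Sum>\<gamma>\<in>Z. P \<alpha> \<gamma> * Q \<gamma> \<beta>)"
    by (rule cube_quantum_automorphism.mult_quantum_automorphism[OF P Q comm])
  interpret T: star_algebra T by (rule T)
  assume ab: "\<alpha> \<in> Z" "\<beta> \<in> Z"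
  show "component (\<Sum>\<gamma>\<in>Z. P \<alpha> \<gamma> * Q \<gamma> \<beta>) T = (\<Oplus>\<^bsub>T\<^esub>\<gamma>\<in>Z. elem_tensor B B (f (u \<alpha> \<gamma>)) (f (u \<gamma> \<beta>)))"
    unfolding component_sum[OF T finite_Z2]
    by (rule T.finsum_cong') (use pq ab fu t.tens_closed in \<open>auto simp: T_def[symmetric]\<close>)
qed

text \<open>The homomorphism \<open>u \<alpha> \<beta> \<mapsto> \<Sum>\<gamma>. f(u \<alpha> \<gamma>) \<otimes> f(u \<gamma> \<beta>)\<close>.  By \<open>block_mult\<close> it has the same form on the elements
\<open>\<psi>(v i j)\<close>, which are the entries of the block of degree one.  For \<open>f = id\<close> it is the comultiplication of the quantum
automorphism group; for \<open>f = \<phi>\<close>, composed with \<open>\<psi>\<close>, that of \<open>SO\<^sub>n\<^sub>+\<^sub>1\<^sup>-\<^sup>1\<close>.\<close>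

lemma diagonal_hom:
  fixes B :: "'b star_alg"
  assumes B: "star_algebra B" and f: "f \<in> star_hom A B"
  shows "\<exists>\<Theta>\<in>star_hom A (tensor_alg B B). (\<forall>\<alpha>\<in>Z. \<forall>\<beta>\<in>Z.
    \<Theta> (u \<alpha> \<beta>) = (\<Oplus>\<^bsub>tensor_alg B B\<^esub>\<gamma>\<in>Z. elem_tensor B B (f (u \<alpha> \<gamma>)) (f (u \<gamma> \<beta>)))) \<and>
    (\<forall>i\<in>N. \<forall>j\<in>N. \<Theta> (\<psi> (v i j)) = (\<Oplus>\<^bsub>tensor_alg B B\<^esub>k\<in>N. elem_tensor B B (f (\<psi> (v i k))) (f (\<psi> (v k j)))))"
proof -
  interpret t: tensor_pair B B using B by (simp add: tensor_pair_def)
  let ?T = "tensor_alg B B"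
  have T: "star_algebra ?T" by (rule t.T.star_algebra_axioms)
  define P where "P = cube_lift ?T (\<lambda>x. elem_tensor B B (f x) \<one>\<^bsub>B\<^esub>)"
  define Q where "Q = cube_lift ?T (\<lambda>x. elem_tensor B B \<one>\<^bsub>B\<^esub> (f x))"
  note m = commuting_copies[OF B f, folded P_def Q_def]
  let ?R = "\<lambda>\<alpha> \<beta>. \<Sum>\<gamma>\<in>Z. P \<alpha> \<gamma> * Q \<gamma> \<beta>"
  obtain \<Theta> where \<Theta>: "\<Theta> \<in> star_hom A ?T" "\<And>\<alpha> \<beta>. \<alpha> \<in> Z \<Longrightarrow> \<beta> \<in> Z \<Longrightarrow> \<Theta> (u \<alpha> \<beta>) = component (?R \<alpha> \<beta>) ?T"
    using cube_hom[OF m(3) T] by blast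
  have p: "(\<lambda>x. elem_tensor B B (f x) \<one>\<^bsub>B\<^esub>) \<in> star_hom A ?T"
    using star_hom_comp[OF f t.left_star_hom] by (simp add: o_def)
  have q: "(\<lambda>x. elem_tensor B B \<one>\<^bsub>B\<^esub> (f x)) \<in> star_hom A ?T"
    using star_hom_comp[OF f t.right_star_hom] by (simp add: o_def)
  have block: "component (degree_one_block n w i j) ?T = g (\<psi> (v i j))"
    if "g \<in> star_hom A ?T" "\<And>\<alpha> \<beta>. \<alpha> \<in> Z \<Longrightarrow> \<beta> \<in> Z \<Longrightarrow> component (w \<alpha> \<beta>) ?T = g (u \<alpha> \<beta>)" "i \<in> N" "j \<in> N" for w g i j
    using corresponds_fourier[OF A_star T that(1), of n U0 w] that(2-4) U0(2)
    by (simp add: corresponds_def degree_one_block_def \<psi>(2))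
  have "\<Theta> (\<psi> (v i j)) = (\<Oplus>\<^bsub>?T\<^esub>k\<in>N. elem_tensor B B (f (\<psi> (v i k))) (f (\<psi> (v k j))))"
    if ij: "i \<in> N" "j \<in> N" for i j
  proof -
    have c: "f (\<psi> (v i k)) \<in> carrier B" if "i \<in> N" "k \<in> N" for i k
      using star_hom_closed[OF f star_hom_closed[OF \<psi>(1) v_closed[OF that]]] .
    have "\<Theta> (\<psi> (v i j)) = component (degree_one_block n ?R i j) ?T"
      by (rule block[OF \<Theta>(1) _ ij, symmetric]) (simp add: \<Theta>(2))
    also have "degree_one_block n ?R i j = (\<Sum>k\<in>N. degree_one_block n P i k * degree_one_block n Q k j)"
      by (rule cube_quantum_automorphism.block_mult[OF m(1) n(1) ij(1)])
    also have "component \<dots> ?T = (\<Oplus>\<^bsub>?T\<^esub>k\<in>N. component (degree_one_block n P i k * degree_one_block n Q k j) ?T)"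
      by (rule component_sum[OF T]) simp
    also have "\<dots> = (\<Oplus>\<^bsub>?T\<^esub>k\<in>N. elem_tensor B B (f (\<psi> (v i k))) (f (\<psi> (v k j))))"
    proof (rule t.T.finsum_cong'[OF refl])
      fix k assume k: "k \<in> N"
      have "component (degree_one_block n P i k) ?T = elem_tensor B B (f (\<psi> (v i k))) \<one>\<^bsub>B\<^esub>"
        by (rule block[OF p m(4) ij(1) k])
      moreover have "component (degree_one_block n Q k j) ?T = elem_tensor B B \<one>\<^bsub>B\<^esub> (f (\<psi> (v k j)))"
        by (rule block[OF q m(5) k ij(2)])
      ultimately show "component (degree_one_block n P i k * degree_one_block n Q k j) ?T
          = elem_tensor B B (f (\<psi> (v i k))) (f (\<psi> (v k j)))"
        using t.tens_split(1)[OF c[OF ij(1) k] c[OF k ij(2)]] by (simp add: component_times[OF T])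
    qed (use c ij t.tens_closed in auto)
    finally show ?thesis .
  qed
  then show ?thesis using \<Theta> m(6) by (intro bexI[OF _ \<Theta>(1)]) auto
qed

lemma comult_A: "\<exists>\<Delta>. is_comult qG \<Delta>"
proof -
  obtain \<Theta> where "\<Theta> \<in> star_hom A (tensor_alg A A)"
    "\<And>\<alpha> \<beta>. \<alpha> \<in> Z \<Longrightarrow> \<beta> \<in> Z \<Longrightarrow> \<Theta> (u \<alpha> \<beta>) = (\<Oplus>\<^bsub>tensor_alg A A\<^esub>\<gamma>\<in>Z. elem_tensor A A (id (u \<alpha> \<gamma>)) (id (u \<gamma> \<beta>)))"
    using diagonal_hom[OF A_star id_star_hom] by blast
  then have "is_comult qG \<Theta>" unfolding is_comult_def Let_def indexG by simp
  then show ?thesis by blast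
qed

lemma comult_H:
  shows "\<exists>\<Theta>. \<Theta> \<in> star_hom A (tensor_alg H H) \<and> (\<forall>\<alpha>\<in>Z. \<forall>\<beta>\<in>Z.
    \<Theta> (u \<alpha> \<beta>) = (\<Oplus>\<^bsub>tensor_alg H H\<^esub>\<gamma>\<in>Z. elem_tensor H H (\<phi> (u \<alpha> \<gamma>)) (\<phi> (u \<gamma> \<beta>)))) \<and> is_comult qH (\<Theta> \<circ> \<psi>)"
proof -
  interpret t: tensor_pair H H using H_star by (simp add: tensor_pair_def)
  obtain \<Theta> where \<Theta>: "\<Theta> \<in> star_hom A (tensor_alg H H)"
    "\<forall>\<alpha>\<in>Z. \<forall>\<beta>\<in>Z. \<Theta> (u \<alpha> \<beta>) = (\<Oplus>\<^bsub>tensor_alg H H\<^esub>\<gamma>\<in>Z. elem_tensor H H (\<phi> (u \<alpha> \<gamma>)) (\<phi> (u \<gamma> \<beta>)))"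
    "\<And>i j. i \<in> N \<Longrightarrow> j \<in> N \<Longrightarrow> \<Theta> (\<psi> (v i j)) = (\<Oplus>\<^bsub>tensor_alg H H\<^esub>k\<in>N. elem_tensor H H (\<phi> (\<psi> (v i k))) (\<phi> (\<psi> (v k j))))"
    using diagonal_hom[OF H_star \<phi>(1)] by blast
  have "is_comult qH (\<Theta> \<circ> \<psi>)"
    unfolding is_comult_def Let_def indexH
  proof (intro conjI ballI)
    show "\<Theta> \<circ> \<psi> \<in> star_hom H (tensor_alg H H)" by (rule star_hom_comp[OF \<psi>(1) \<Theta>(1)])
    fix i j assume ij: "i \<in> N" "j \<in> N"
    have "(\<Oplus>\<^bsub>tensor_alg H H\<^esub>k\<in>N. elem_tensor H H (\<phi> (\<psi> (v i k))) (\<phi> (\<psi> (v k j))))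
        = (\<Oplus>\<^bsub>tensor_alg H H\<^esub>k\<in>N. elem_tensor H H (v i k) (v k j))"
      by (rule t.T.finsum_cong'[OF refl]) (use ij v_closed \<phi>_\<psi> t.tens_closed in auto)
    then show "(\<Theta> \<circ> \<psi>) (v i j) = (\<Oplus>\<^bsub>tensor_alg H H\<^esub>k\<in>N. elem_tensor H H (v i k) (v k j))"
      using \<Theta>(3)[OF ij] by simp
  qed
  then show ?thesis using \<Theta>(1,2) by blast
qed

lemma qG_cmqg: "compact_matrix_quantum_group qG"
proof (rule compact_matrix_quantum_group.intro)
  show "star_algebra A" by (rule A_star)
  show "finite (index qG)" by (simp add: indexG)
  show "u i j \<in> carrier A" if "i \<in> index qG" "j \<in> index qG" for i j
    using that u_closed by (simp add: indexG)
  have "{u i j | i j. i \<in> index qG \<and> j \<in> index qG} = G.gen ` (Z \<times> Z)" by (auto simp: indexG u_eq)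
  then show "carrier A = star_generated A {u i j | i j. i \<in> index qG \<and> j \<in> index qG}"
    using G.U_generated by (simp add: A_eq)
  interpret U0: cube_quantum_automorphism n U0 by (rule U0(1))
  interpret U0t: cube_quantum_automorphism n "\<lambda>\<alpha> \<beta>. U0 \<beta> \<alpha>" by (rule U0.transpose)
  show "similar_to_unitary A (index qG) u" unfolding indexG
    by (rule similar_to_unitary_component[OF A_star finite_Z2 U0(2) U0.permutation_unitary])
  show "similar_to_unitary A (index qG) (\<lambda>i j. u j i)" unfolding indexG
    by (rule similar_to_unitary_component[OF A_star finite_Z2 _ U0t.permutation_unitary]) (simp add: U0(2))
  show "\<exists>\<Delta>. is_comult qG \<Delta>" by (rule comult_A)
qed

lemma qH_cmqg: "compact_matrix_quantum_group qH"
proof (rule compact_matrix_quantum_group.intro)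
  show "star_algebra H" by (rule H_star)
  show "finite (index qH)" by (simp add: indexH)
  show "v i j \<in> carrier H" if "i \<in> index qH" "j \<in> index qH" for i j
    using that v_closed by (simp only: indexH)
  have "{v i j | i j. i \<in> index qH \<and> j \<in> index qH} = S.gen ` (N \<times> N)"
    unfolding indexH v_eq by blast
  then show "carrier H = star_generated H {v i j | i j. i \<in> index qH \<and> j \<in> index qH}"
    using S.U_generated by (simp only: H_eq)
  interpret V0: anticommutative_SO "n + 1" V0 using V0(1) by (simp add: cube_SO_def)
  interpret V0t: anticommutative_SO "n + 1" "\<lambda>i j. V0 j i" by (rule V0.transpose)
  show "similar_to_unitary H (index qH) v" unfolding indexH
    by (rule similar_to_unitary_component[OF H_star _ V0(2) V0.SO_unitary]) simp_all
  show "similar_to_unitary H (index qH) (\<lambda>i j. v j i)" unfolding indexH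
    by (rule similar_to_unitary_component[OF H_star _ V0(2) V0t.SO_unitary]) simp_all
  show "\<exists>\<Delta>. is_comult qH \<Delta>" using comult_H by blast
qed

lemma is_comult_unique:
  assumes "is_comult qH \<Delta>" "is_comult qH \<Delta>'" "x \<in> carrier H"
  shows "\<Delta> x = \<Delta>' x"
proof (rule H_hom_eq[OF _ _ _ assms(3)])
  show "\<Delta> \<in> star_hom H (tensor_alg H H)" "\<Delta>' \<in> star_hom H (tensor_alg H H)"
    using assms by (simp_all only: is_comult_def Let_def)
  show "\<Delta> (v i j) = \<Delta>' (v i j)" if "i \<in> N" "j \<in> N" for i j
    using assms(1,2) that by (simp only: is_comult_def Let_def indexH)
qed

text \<open>Comultiplications are determined by their values on the generators, so any two choices of them
may be compared with the homomorphism of \<open>diagonal_hom\<close> for \<open>f = \<phi>\<close>.\<close>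

theorem \<phi>_quantum_group_iso: "quantum_group_iso qG qH \<phi>"
  unfolding quantum_group_iso_def
proof (intro conjI qG_cmqg qH_cmqg \<phi>_iso ballI)
  fix x assume x: "x \<in> carrier A"
  interpret tA: tensor_pair A A using A_star by (simp add: tensor_pair_def)
  interpret tH: tensor_pair H H using H_star by (simp add: tensor_pair_def)
  note tm = tensor_map_star_hom[OF H_star H_star A_star A_star \<phi>(1) \<phi>(1)]
  have cA: "is_comult qG (comult qG)" unfolding comult_def by (rule someI_ex[OF comult_A])
  obtain \<Theta> where \<Theta>: "\<Theta> \<in> star_hom A (tensor_alg H H)"
    "\<And>\<alpha> \<beta>. \<alpha> \<in> Z \<Longrightarrow> \<beta> \<in> Z \<Longrightarrow> \<Theta> (u \<alpha> \<beta>) = (\<Oplus>\<^bsub>tensor_alg H H\<^esub>\<gamma>\<in>Z. elem_tensor H H (\<phi> (u \<alpha> \<gamma>)) (\<phi> (u \<gamma> \<beta>)))"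
    "is_comult qH (\<Theta> \<circ> \<psi>)"
    using comult_H by blast
  have cH: "is_comult qH (comult qH)" unfolding comult_def by (rule someI[of "is_comult qH", OF \<Theta>(3)])
  have cA1: "comult qG \<in> star_hom A (tensor_alg A A)" using cA by (simp add: is_comult_def Let_def)
  have "(tensor_map H H \<phi> \<phi> \<circ> comult qG) x = \<Theta> x"
  proof (rule A_hom_eq[OF star_hom_comp[OF cA1 tm(1)] \<Theta>(1) _ x])
    fix \<alpha> \<beta> assume ab: "\<alpha> \<in> Z" "\<beta> \<in> Z"
    have "(tensor_map H H \<phi> \<phi> \<circ> comult qG) (u \<alpha> \<beta>)
        = tensor_map H H \<phi> \<phi> (\<Oplus>\<^bsub>tensor_alg A A\<^esub>\<gamma>\<in>Z. elem_tensor A A (u \<alpha> \<gamma>) (u \<gamma> \<beta>))"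
      using cA ab by (simp add: is_comult_def Let_def indexG)
    also have "\<dots> = (\<Oplus>\<^bsub>tensor_alg H H\<^esub>\<gamma>\<in>Z. tensor_map H H \<phi> \<phi> (elem_tensor A A (u \<alpha> \<gamma>) (u \<gamma> \<beta>)))"
      by (rule star_hom_finsum[OF tA.T.star_algebra_axioms tH.T.star_algebra_axioms tm(1) finite_Z2])
        (use ab u_closed tA.tens_closed in auto)
    also have "\<dots> = (\<Oplus>\<^bsub>tensor_alg H H\<^esub>\<gamma>\<in>Z. elem_tensor H H (\<phi> (u \<alpha> \<gamma>)) (\<phi> (u \<gamma> \<beta>)))"
      by (rule tH.T.finsum_cong'[OF refl])
        (use ab u_closed star_hom_closed[OF \<phi>(1)] tm(2) tH.tens_closed in auto)
    finally show "(tensor_map H H \<phi> \<phi> \<circ> comult qG) (u \<alpha> \<beta>) = \<Theta> (u \<alpha> \<beta>)" using \<Theta>(2)[OF ab] by simp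
  qed
  also have "\<Theta> x = comult qH (\<phi> x)"
    using is_comult_unique[OF \<Theta>(3) cH star_hom_closed[OF \<phi>(1) x]] by (simp add: \<psi>_\<phi>[OF x])
  finally show "tensor_map H H \<phi> \<phi> (comult qG x) = comult qH (\<phi> x)" by simp
qed

text \<open>By \<open>fourier_cube_matrix\<close> the coefficients are minors, and these are the entries of the exterior power.\<close>

theorem \<phi>_block_eq:
  "block_eq n H i (\<lambda>\<mu> \<nu>. \<phi> (fourier_transform n A u \<mu> \<nu>)) (anticomm_ext_power H v i)"
  unfolding block_eq_def
proof (intro ballI)
  fix J \<mu> assume J: "J \<in> k_subsets (n+1) i" and \<mu>: "\<mu> \<in> Z"
  interpret H: star_algebra H by (rule H_star)
  interpret V0: cube_SO n V0 by (rule V0(1))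
  have J': "J \<subseteq> N" "card J = i" "finite J" using J by (auto simp: k_subsets_def intro: finite_subset)
  have fin: "finite (k_subsets (n+1) i)"
    unfolding k_subsets_def by (rule finite_subset[of _ "Pow {1..n+1}"]) auto
  let ?K = "{I \<in> k_subsets (n+1) i. tau_exponent n I = \<mu>}"
  have minor: "component (V0.minor I (sorted_list_of_set J)) H = anticomm_ext_power H v i I J" if I: "I \<in> ?K" for I
  proof -
    have I': "I \<subseteq> N" "card I = i" "finite I" using I by (auto simp: k_subsets_def intro: finite_subset)
    let ?s = "sorted_list_of_set I" and ?t = "sorted_list_of_set J"
    have fp: "finite {\<sigma>. \<sigma> permutes {..<i}}" by (simp add: finite_permutations)
    have idx: "component (V0 (?s ! \<sigma> a) (?t ! a)) H = v (?s ! \<sigma> a) (?t ! a)" if "\<sigma> permutes {..<i}" "a < i" for \<sigma> a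
    proof (rule V0(2))
      have "\<sigma> a < i" using permutes_in_image[OF that(1), of a] that(2) by simp
      then have "?s ! \<sigma> a \<in> set ?s" by (intro nth_mem) (simp add: I')
      then show "?s ! \<sigma> a \<in> N" using I' by auto
      have "?t ! a \<in> set ?t" using that(2) by (intro nth_mem) (simp add: J')
      then show "?t ! a \<in> N" using J' by auto
    qed
    have "V0.minor I ?t = (\<Sum>\<sigma> | \<sigma> permutes {..<i}. prod_list (map (\<lambda>a. V0 (?s ! \<sigma> a) (?t ! a)) [0..<i]))"
      using V0.minor_eq_ext_power[of I ?t] I' J' by simp
    then have "component (V0.minor I ?t) H = (\<Oplus>\<^bsub>H\<^esub>\<sigma>\<in>{\<sigma>. \<sigma> permutes {..<i}}.
        component (prod_list (map (\<lambda>a. V0 (?s ! \<sigma> a) (?t ! a)) [0..<i])) H)"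
      using component_sum[OF H_star fp] by simp
    also have "\<dots> = anticomm_ext_power H v i I J"
      unfolding anticomm_ext_power_def
    proof (rule H.finsum_cong'[OF refl])
      have *: "component (prod_list (map (\<lambda>a. V0 (?s ! \<sigma> a) (?t ! a)) [0..<i])) H
          = ordered_prod H (map (\<lambda>a. v (?s ! \<sigma> a) (?t ! a)) [0..<i])" if "\<sigma> permutes {..<i}" for \<sigma>
        unfolding component_prod_list[OF H_star] map_map o_def
        by (rule arg_cong[of _ _ "ordered_prod H"], rule map_cong[OF refl]) (use idx that in auto)
      then show "component (prod_list (map (\<lambda>a. V0 (?s ! \<sigma> a) (?t ! a)) [0..<i])) H
          = ordered_prod H (map (\<lambda>a. v (?s ! \<sigma> a) (?t ! a)) [0..<i])" if "\<sigma> \<in> {\<sigma>. \<sigma> permutes {..<i}}" for \<sigma>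
        using that by simp
      show "(\<lambda>\<sigma>. ordered_prod H (map (\<lambda>a. v (?s ! \<sigma> a) (?t ! a)) [0..<i])) \<in> {\<sigma>. \<sigma> permutes {..<i}} \<rightarrow> carrier H"
        using * component_closed[OF H_star] by (metis (no_types, lifting) Pi_I mem_Collect_eq)
    qed
    finally show ?thesis .
  qed
  have "\<phi> (fourier_transform n A u \<mu> (tau_exponent n J))
      = component (fourier_matrix n (cube_matrix n V0) \<mu> (tau_exponent n J)) H"
  proof -
    have "fourier_transform n A u \<mu> (tau_exponent n J) = component (fourier_matrix n U0 \<mu> (tau_exponent n J)) A"
      by (rule fourier_transform_component[OF A_star U0(2)])
    then show ?thesis by (simp only: \<phi>_fourier)
  qed
  also have "fourier_matrix n (cube_matrix n V0) \<mu> (tau_exponent n J) = (\<Sum>I\<in>?K. V0.minor I (sorted_list_of_set J))"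
    using V0.fourier_cube_matrix[OF \<mu> J'(1)] by (simp only: J'(2))
  also have "component \<dots> H = (\<Oplus>\<^bsub>H\<^esub>I\<in>?K. component (V0.minor I (sorted_list_of_set J)) H)"
    by (rule component_sum[OF H_star]) (use fin in simp)
  also have "\<dots> = (\<Oplus>\<^bsub>H\<^esub>I\<in>?K. anticomm_ext_power H v i I J)"
    by (rule H.finsum_cong'[OF refl]) (use minor component_closed[OF H_star] in \<open>auto simp flip: minor\<close>)
  finally show "\<phi> (fourier_transform n A u \<mu> (tau_exponent n J)) = (\<Oplus>\<^bsub>H\<^esub>I\<in>?K. anticomm_ext_power H v i I J)" .
qed

end

theorem theorem4p1:
  fixes n :: nat
  assumes "n \<in> {1..} - {1, 3}"
  shows "\<exists>\<phi>. quantum_group_iso (qaut_halved_cube n) (so_minus (n + 1)) \<phi> \<and>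
    (\<forall>i \<in> {0..(n + 1) div 2}.
       block_eq n (func_alg (so_minus (n + 1))) i
         (\<lambda>\<mu> \<nu>. \<phi> (fourier_transform n (func_alg (qaut_halved_cube n)) (fund (qaut_halved_cube n)) \<mu> \<nu>))
         (anticomm_ext_power (func_alg (so_minus (n + 1))) (fund (so_minus (n + 1))) i))"
proof -
  interpret halved_cube_iso n by standard (use assms in auto)
  show ?thesis using \<phi>_quantum_group_iso \<phi>_block_eq unfolding qH_def by blast
qed

end
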